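(* Let $V$ be a compact connected algebraic submanifold of $\mathbb{R}^n$. Then there is a constant $C(V)$ such that for every integer $k\ge 0$ and every real polynomial $p\in\mathcal{P}_{k,n}(\mathbb{R})$ with $p|_V\not\equiv 0$, the function $(\log|p|)|_V$ belongs to $\mathrm{BMO}(V)$ and its BMO-norm satisfies $|\log|p||_V|_*\le C(V)\,k$.
   Context: $\mathcal{P}_{k,n}(\mathbb{R})$ is the space of real polynomials in $n$ variables of degree at most $k$. $V$ is endowed with the metric induced from the Euclidean metric of $\mathbb{R}^n$ and with the measure $\lambda_V$ induced from Lebesgue measure of $\mathbb{R}^n$. For $f\in L_1(V,d\lambda_V)$ the BMO-norm is $$|f|_*:=\sup_B\frac{1}{\lambda_V(B)}\int_B|f-f_B|\,d\lambda_V,\qquad f_B:=\frac{1}{\lambda_V(B)}\int_B f\,d\lambda_V,$$ the supremum being over all metric balls $B\subset V$ for the induced metric; $\mathrm{BMO}(V)$ consists of those $f$ with $|f|_*<\infty$. *)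

theory Defs
  imports "HOL-Analysis.Analysis"
begin

definition poly_fun :: "nat \<Rightarrow> (real^'n \<Rightarrow> real) \<Rightarrow> bool" where
  "poly_fun k p \<longleftrightarrow> (\<exists>(A :: ('n \<Rightarrow> nat) set) (c :: ('n \<Rightarrow> nat) \<Rightarrow> real).
      finite A \<and> (\<forall>\<alpha>\<in>A. (\<Sum>i\<in>UNIV. \<alpha> i) \<le> k) \<and>
      p = (\<lambda>x. \<Sum>\<alpha>\<in>A. c \<alpha> * (\<Prod>i\<in>UNIV. (x $ i) ^ (\<alpha> i))))"

definition is_polynomial :: "(real^'n \<Rightarrow> real) \<Rightarrow> bool" where
  "is_polynomial p \<longleftrightarrow> (\<exists>k. poly_fun k p)"

definition algebraic_set :: "(real^'n) set \<Rightarrow> bool" where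
  "algebraic_set V \<longleftrightarrow> (\<exists>Q. finite Q \<and> (\<forall>q\<in>Q. is_polynomial q) \<and>
      V = {x. \<forall>q\<in>Q. q x = 0})"

fun smooth_dirs :: "'a::real_normed_vector list \<Rightarrow> 'a set \<Rightarrow> ('a \<Rightarrow> 'b::real_normed_vector) \<Rightarrow> bool" where
  "smooth_dirs [] U f \<longleftrightarrow> continuous_on U f"
| "smooth_dirs (v # vs) U f \<longleftrightarrow> f differentiable_on U \<and>
      smooth_dirs vs U (\<lambda>x. frechet_derivative f (at x) v)"

definition C_inf_on :: "'a::real_normed_vector set \<Rightarrow> ('a \<Rightarrow> 'b::real_normed_vector) \<Rightarrow> bool" where
  "C_inf_on U f \<longleftrightarrow> open U \<and> (\<forall>vs. smooth_dirs vs U f)"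

definition smooth_submanifold :: "nat \<Rightarrow> (real^'n) set \<Rightarrow> bool" where
  "smooth_submanifold d V \<longleftrightarrow> (\<forall>x\<in>V. \<exists>U W (\<phi> :: real^'n \<Rightarrow> real^'n) \<psi> L.
      x \<in> U \<and> open U \<and> open W \<and> C_inf_on U \<phi> \<and> C_inf_on W \<psi> \<and>
      \<phi> ` U = W \<and> (\<forall>y\<in>U. \<psi> (\<phi> y) = y) \<and> (\<forall>z\<in>W. \<phi> (\<psi> z) = z) \<and>
      subspace L \<and> dim L = d \<and> \<phi> ` (U \<inter> V) = W \<inter> L)"

definition algebraic_submanifold :: "nat \<Rightarrow> (real^'n) set \<Rightarrow> bool" where
  "algebraic_submanifold d V \<longleftrightarrow> algebraic_set V \<and> smooth_submanifold d V"

text \<open>The measure induced on a d-dimensional submanifold by Lebesgue measure (Riemannian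
  volume) is the normalised d-dimensional Hausdorff measure.\<close>
definition hausdorff_pre :: "nat \<Rightarrow> real \<Rightarrow> 'a::metric_space set \<Rightarrow> ennreal" where
  "hausdorff_pre d \<delta> A = (INF S \<in> {S :: nat \<Rightarrow> 'a set. A \<subseteq> (\<Union>i. S i) \<and>
        (\<forall>i. bounded (S i) \<and> diameter (S i) \<le> \<delta>)}.
      (\<Sum>i. (if S i = {} then 0 else ennreal (unit_ball_vol (real d) * (diameter (S i) / 2) ^ d))))"

definition hausdorff_outer :: "nat \<Rightarrow> 'a::metric_space set \<Rightarrow> ennreal" where
  "hausdorff_outer d A = (SUP \<delta> \<in> {0<..}. hausdorff_pre d \<delta> A)"

definition hausdorff_measure :: "nat \<Rightarrow> 'a::metric_space measure" where
  "hausdorff_measure d = measure_of UNIV (sets borel) (hausdorff_outer d)"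

definition submanifold_measure :: "nat \<Rightarrow> 'a::metric_space set \<Rightarrow> 'a measure" where
  "submanifold_measure d V = restrict_space (hausdorff_measure d) V"

definition ball_in :: "'a::metric_space set \<Rightarrow> 'a \<Rightarrow> real \<Rightarrow> 'a set" where
  "ball_in V x r = {y \<in> V. dist x y < r}"

definition balls_in :: "'a::metric_space set \<Rightarrow> 'a set set" where
  "balls_in V = {ball_in V x r | x r. x \<in> V \<and> r > 0}"

definition mean_on :: "'a measure \<Rightarrow> 'a set \<Rightarrow> ('a \<Rightarrow> real) \<Rightarrow> real" where
  "mean_on M B f = (LINT y:B|M. f y) / measure M B"

definition mean_osc :: "'a measure \<Rightarrow> 'a set \<Rightarrow> ('a \<Rightarrow> real) \<Rightarrow> real" where
  "mean_osc M B f = (LINT y:B|M. \<bar>f y - mean_on M B f\<bar>) / measure M B"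

definition in_BMO :: "'a::metric_space measure \<Rightarrow> 'a set \<Rightarrow> ('a \<Rightarrow> real) \<Rightarrow> bool" where
  "in_BMO M V f \<longleftrightarrow> integrable M f \<and> bdd_above ((\<lambda>B. mean_osc M B f) ` balls_in V)"

definition bmo_norm :: "'a::metric_space measure \<Rightarrow> 'a set \<Rightarrow> ('a \<Rightarrow> real) \<Rightarrow> real" where
  "bmo_norm M V f = (SUP B \<in> balls_in V. mean_osc M B f)"

end

theory Submission
 imports Defs "HOL-Complex_Analysis.Complex_Analysis" "HOL-Computational_Algebra.Fundamental_Theorem_Algebra"
begin

text \<open>Near each of its points \<open>V\<close> is a graph over \<open>d\<close> of the coordinates. A polynomial \<open>p\<close> of degree \<open>k\<close>
 satisfies on \<open>V\<close> an equation whose degree in \<open>p\<close> does not depend on \<open>p\<close> and whose coefficients are polynomials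
 of degree \<open>O(k)\<close> in these coordinates. The graph functions are smooth and algebraic, hence analytic, and along
 short segments they extend holomorphically to a disc of fixed size. So \<open>p\<close> becomes, on a segment, a holomorphic
 algebraic function of one variable; away from the centre it varies by a factor \<open>exp(O(k))\<close> on suitable circles, and
 the mean of \<open>ln |p|\<close> along the segment is at most \<open>O(k)\<close> below its value at the end point. Averaging over the
 segments that start at a maximum of \<open>|p|\<close> bounds the mean of \<open>max ln |p| - ln |p|\<close> over small balls by \<open>O(k)\<close>.
 A chain of overlapping balls, finite and independent of \<open>p\<close>, gives the same bound on all of \<open>V\<close>; such a
 one-sided bound controls the mean oscillation.\<close>

text \<open>Algebraicity and smoothness enter separately: the defining polynomials need not have
  independent gradients along \<open>V\<close>, so neither the algebraic dimension nor the
  algebraicity of the charts can be read off from a Jacobian. Dimension is replaced by measure: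
  \<open>V\<close> projects to a Lebesgue null set in any \<open>d + 1\<close> coordinates, and
  minima of a sum of squares over points off this projection yield a polynomial that vanishes on it.
  Analyticity is recovered from Taylor expansions of all orders together with an algebraic equation
  that may be singular. All constants must be uniform in \<open>p\<close>. Hence the relations for
  \<open>p\<close> come from counting monomials, which fixes the degree in \<open>p\<close> and
  makes the degree of the coefficients linear in \<open>k\<close>, and estimates of these
  coefficients use nothing but their degrees. As constants are free, Hausdorff measures are compared
  through Lipschitz maps only. The one-sided quantity \<open>max ln |p| - ln |p|\<close> is kept
  throughout because it survives averaging over rays, transport between overlapping balls, and the
  zeros of \<open>p\<close>.\<close>

no_notation fps_nth (infixl "$" 75)

section \<open>Polynomial functions of several real variables\<close>

definition mon :: "('n::finite \<Rightarrow> nat) \<Rightarrow> real^'n \<Rightarrow> real" where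
 "mon \<alpha> x = (\<Prod>i\<in>UNIV. (x $ i) ^ \<alpha> i)"

definition mons :: "'n::finite set \<Rightarrow> nat \<Rightarrow> ('n \<Rightarrow> nat) set" where
 "mons I k = {\<alpha>. (\<forall>i. i \<notin> I \<longrightarrow> \<alpha> i = 0) \<and> (\<Sum>i\<in>UNIV. \<alpha> i) \<le> k}"

text \<open>\<open>I\<close> lists the coordinates that may occur; elimination of variables is
  expressed by shrinking it. Summing over the fixed index set \<open>mons I k\<close> makes addition
  coefficientwise.\<close>

definition pfun :: "'n::finite set \<Rightarrow> nat \<Rightarrow> (real^'n \<Rightarrow> real) \<Rightarrow> bool" where
 "pfun I k p \<longleftrightarrow> (\<exists>c. p = (\<lambda>x. \<Sum>\<alpha>\<in>mons I k. c \<alpha> * mon \<alpha> x))"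

lemma finite_mons [simp]: "finite (mons I k)"
proof -
 have "\<alpha> i \<le> k" if "\<alpha> \<in> mons I k" for \<alpha> i
 proof -
  have "\<alpha> i \<le> (\<Sum>i\<in>UNIV. \<alpha> i)" by (rule member_le_sum) auto
  thus ?thesis using that by (auto simp: mons_def)
 qed
 hence "mons I k \<subseteq> (UNIV \<rightarrow>\<^sub>E {..k})" by (auto simp: PiE_def)
 thus ?thesis by (rule finite_subset) (auto intro: finite_PiE)
qed

lemma mons_mono: "I \<subseteq> I' \<Longrightarrow> k \<le> k' \<Longrightarrow> mons I k \<subseteq> mons I' k'"
 by (auto simp: mons_def)

lemma mons_add: "\<alpha> \<in> mons I k \<Longrightarrow> \<beta> \<in> mons I l \<Longrightarrow> (\<lambda>i. \<alpha> i + \<beta> i) \<in> mons I (k + l)"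
 by (auto simp: mons_def sum.distrib)

lemma mon_mult: "mon \<alpha> x * mon \<beta> x = mon (\<lambda>i. \<alpha> i + \<beta> i) x"
 by (simp add: mon_def power_add prod.distrib)

lemma mon_zero [simp]: "mon (\<lambda>_. 0) x = 1"
 by (simp add: mon_def)

lemma mon_split: "mon \<alpha> x = (x $ i) ^ \<alpha> i * mon (\<alpha>(i := 0)) x"
proof -
 have "mon \<alpha> x = (x $ i) ^ \<alpha> i * (\<Prod>j\<in>UNIV - {i}. (x $ j) ^ \<alpha> j)"
  unfolding mon_def by (rule prod.remove) auto
 moreover have "mon (\<alpha>(i := 0)) x = (\<Prod>j\<in>UNIV - {i}. (x $ j) ^ \<alpha> j)"
  unfolding mon_def by (subst prod.remove[of _ i]) auto
 ultimately show ?thesis by simp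
qed

lemma mon_scale: "mon \<alpha> (s *\<^sub>R x) = s ^ (\<Sum>i\<in>UNIV. \<alpha> i) * mon \<alpha> x"
 by (simp add: mon_def power_mult_distrib prod.distrib power_sum)

lemma pfun_mono: assumes "pfun I k p" "I \<subseteq> I'" "k \<le> k'" shows "pfun I' k' p"
proof -
 obtain c where c: "p = (\<lambda>x. \<Sum>\<alpha>\<in>mons I k. c \<alpha> * mon \<alpha> x)" using assms by (auto simp: pfun_def)
 have "p = (\<lambda>x. \<Sum>\<alpha>\<in>mons I' k'. (if \<alpha> \<in> mons I k then c \<alpha> else 0) * mon \<alpha> x)"
  unfolding c using mons_mono[OF assms(2,3)]
  by (intro ext sum.mono_neutral_cong_left) auto
 thus ?thesis unfolding pfun_def by (rule exI[of _ "\<lambda>\<alpha>. if \<alpha> \<in> mons I k then c \<alpha> else 0"])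
qed

lemma pfun_mon: "\<alpha> \<in> mons I k \<Longrightarrow> pfun I k (\<lambda>x. c * mon \<alpha> x)"
 unfolding pfun_def
 by (rule exI[of _ "\<lambda>\<beta>. if \<beta> = \<alpha> then c else 0"]) (auto simp: if_distrib[of "\<lambda>u. u * _"] cong: if_cong)

lemma pfun_const [simp]: "pfun I k (\<lambda>x. c)"
 using pfun_mon[of "\<lambda>_. 0" I k c] by (simp add: mons_def)

lemma pfun_add: assumes "pfun I k p" "pfun I k q" shows "pfun I k (\<lambda>x. p x + q x)"
proof -
 obtain c d where "p = (\<lambda>x. \<Sum>\<alpha>\<in>mons I k. c \<alpha> * mon \<alpha> x)" "q = (\<lambda>x. \<Sum>\<alpha>\<in>mons I k. d \<alpha> * mon \<alpha> x)"
  using assms by (auto simp: pfun_def)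
 hence "(\<lambda>x. p x + q x) = (\<lambda>x. \<Sum>\<alpha>\<in>mons I k. (c \<alpha> + d \<alpha>) * mon \<alpha> x)"
  by (simp add: sum.distrib algebra_simps)
 thus ?thesis unfolding pfun_def by (intro exI[of _ "\<lambda>\<alpha>. c \<alpha> + d \<alpha>"])
qed

lemma pfun_cmult: assumes "pfun I k p" shows "pfun I k (\<lambda>x. b * p x)"
proof -
 obtain c where "p = (\<lambda>x. \<Sum>\<alpha>\<in>mons I k. c \<alpha> * mon \<alpha> x)"
  using assms by (auto simp: pfun_def)
 hence "(\<lambda>x. b * p x) = (\<lambda>x. \<Sum>\<alpha>\<in>mons I k. (b * c \<alpha>) * mon \<alpha> x)"
  by (simp add: sum_distrib_left algebra_simps)
 thus ?thesis unfolding pfun_def by (intro exI[of _ "\<lambda>\<alpha>. b * c \<alpha>"])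
qed

lemma pfun_uminus: "pfun I k p \<Longrightarrow> pfun I k (\<lambda>x. - p x)"
 using pfun_cmult[of I k p "-1"] by simp

lemma pfun_diff: "pfun I k p \<Longrightarrow> pfun I k q \<Longrightarrow> pfun I k (\<lambda>x. p x - q x)"
 using pfun_add[of I k p "\<lambda>x. - q x"] pfun_uminus by force

lemma pfun_sum: "(\<And>a. a \<in> A \<Longrightarrow> pfun I k (f a)) \<Longrightarrow> pfun I k (\<lambda>x. \<Sum>a\<in>A. f a x)"
 by (induction A rule: infinite_finite_induct) (auto intro: pfun_add)

lemma pfun_mult: assumes "pfun I k p" "pfun I l q" shows "pfun I (k + l) (\<lambda>x. p x * q x)"
proof -
 obtain c d where "p = (\<lambda>x. \<Sum>\<alpha>\<in>mons I k. c \<alpha> * mon \<alpha> x)" "q = (\<lambda>x. \<Sum>\<alpha>\<in>mons I l. d \<alpha> * mon \<alpha> x)"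
  using assms by (auto simp: pfun_def)
 hence "(\<lambda>x. p x * q x) = (\<lambda>x. \<Sum>\<alpha>\<in>mons I k. \<Sum>\<beta>\<in>mons I l. (c \<alpha> * d \<beta>) * mon (\<lambda>i. \<alpha> i + \<beta> i) x)"
  by (simp add: sum_product mon_mult[symmetric] algebra_simps)
 thus ?thesis by (auto intro!: pfun_sum pfun_mon mons_add)
qed

lemma pfun_power: "pfun I k p \<Longrightarrow> pfun I (m * k) (\<lambda>x. p x ^ m)"
proof (induction m)
 case (Suc m)
 thus ?case using pfun_mult[of I k p "m * k" "\<lambda>x. p x ^ m"] by simp
qed simp

lemma pfun_prod: assumes "\<And>a. a \<in> A \<Longrightarrow> pfun I (k a) (f a)" "finite A"
 shows "pfun I (\<Sum>a\<in>A. k a) (\<lambda>x. \<Prod>a\<in>A. f a x)"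
 using assms(2,1)
proof (induction A)
 case (insert a A)
 have "pfun I (k a + (\<Sum>a\<in>A. k a)) (\<lambda>x. f a x * (\<Prod>a\<in>A. f a x))"
  using insert by (intro pfun_mult) auto
 thus ?case using insert by simp
qed simp

lemma pfun_var: "i \<in> I \<Longrightarrow> pfun I 1 (\<lambda>x. x $ i)"
proof -
 assume "i \<in> I"
 have "mon (\<lambda>j. if j = i then 1 else 0) x = x $ i" for x :: "real^'a"
 proof -
  have "mon (\<lambda>j. if j = i then 1 else 0) x = (\<Prod>j\<in>UNIV. if j = i then x $ j else 1)"
   unfolding mon_def by (rule prod.cong) auto
  thus ?thesis by simp
 qed
 moreover have "(\<lambda>j. if j = i then 1 else 0) \<in> mons I 1" using \<open>i \<in> I\<close> by (auto simp: mons_def)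
 ultimately show ?thesis using pfun_mon[of "\<lambda>j. if j = i then 1 else 0" I 1 1] by simp
qed

lemma pfun_comp:
 assumes "pfun I k p" "\<And>i. i \<in> I \<Longrightarrow> pfun I' g (\<lambda>x. G x $ i)"
 shows "pfun I' (k * g) (\<lambda>x. p (G x))"
proof -
 obtain c where c: "p = (\<lambda>x. \<Sum>\<alpha>\<in>mons I k. c \<alpha> * mon \<alpha> x)"
  using assms by (auto simp: pfun_def)
 have "pfun I' (k * g) (\<lambda>x. c \<alpha> * mon \<alpha> (G x))" if "\<alpha> \<in> mons I k" for \<alpha>
 proof -
  have "pfun I' (\<Sum>i\<in>UNIV. \<alpha> i * g) (\<lambda>x. \<Prod>i\<in>UNIV. (G x $ i) ^ \<alpha> i)"
  proof (rule pfun_prod)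
   fix i show "pfun I' (\<alpha> i * g) (\<lambda>x. (G x $ i) ^ \<alpha> i)"
    using assms(2)[of i] that by (cases "i \<in> I") (auto intro: pfun_power simp: mons_def)
  qed auto
  moreover have "(\<Sum>i\<in>UNIV. \<alpha> i * g) \<le> k * g"
   using that by (simp add: sum_distrib_right[symmetric] mons_def)
  ultimately show ?thesis unfolding mon_def by (intro pfun_cmult) (blast intro: pfun_mono)
 qed
 thus ?thesis unfolding c by (rule pfun_sum)
qed

lemma pfun_cong: "pfun I k p \<Longrightarrow> (\<And>i. i \<in> I \<Longrightarrow> x $ i = y $ i) \<Longrightarrow> p x = p y"
proof -
 assume "pfun I k p" and xy: "\<And>i. i \<in> I \<Longrightarrow> x $ i = y $ i"
 then obtain c where c: "p = (\<lambda>x. \<Sum>\<alpha>\<in>mons I k. c \<alpha> * mon \<alpha> x)" by (auto simp: pfun_def)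
 have "mon \<alpha> x = mon \<alpha> y" if "\<alpha> \<in> mons I k" for \<alpha>
  unfolding mon_def
 proof (intro prod.cong refl)
  fix i show "x $ i ^ \<alpha> i = y $ i ^ \<alpha> i"
   using that xy[of i] by (cases "i \<in> I") (auto simp: mons_def)
 qed
 thus "p x = p y" by (simp add: c)
qed

lemma poly_fun_pfun: "poly_fun k p \<longleftrightarrow> pfun UNIV k p"
proof
 assume "poly_fun k p"
 then obtain A :: "('a \<Rightarrow> nat) set" and c where A: "finite A" "\<forall>\<alpha>\<in>A. (\<Sum>i\<in>UNIV. \<alpha> i) \<le> k"
  "p = (\<lambda>x. \<Sum>\<alpha>\<in>A. c \<alpha> * (\<Prod>i\<in>UNIV. (x $ i) ^ (\<alpha> i)))" unfolding poly_fun_def by blast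
 show "pfun UNIV k p" unfolding A(3) mon_def[symmetric] using A
  by (intro pfun_sum pfun_mon) (auto simp: mons_def)
next
 assume "pfun UNIV k p"
 then obtain c where c: "p = (\<lambda>x. \<Sum>\<alpha>\<in>mons UNIV k. c \<alpha> * mon \<alpha> x)" by (auto simp: pfun_def)
 show "poly_fun k p" unfolding poly_fun_def
  by (rule exI[of _ "mons UNIV k"], rule exI[of _ c]) (auto simp: c mon_def, auto simp: mons_def)
qed

lemma pfun_continuous: "pfun I k p \<Longrightarrow> continuous_on S p"
 by (auto simp: pfun_def mon_def intro!: continuous_intros)

lemma pfun_borel [measurable (raw)]: "pfun I k p \<Longrightarrow> p \<in> borel_measurable borel"
 by (intro borel_measurable_continuous_onI pfun_continuous)

text \<open>Induction over the variables that may occur: grouping by the exponent of one variable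
  gives a univariate polynomial that vanishes identically, so each group vanishes and involves one
  variable less.\<close>

lemma monomials_independent:
 assumes "finite A" "\<And>x. (\<Sum>\<alpha>\<in>A. c \<alpha> * mon \<alpha> x) = 0" "\<alpha> \<in> A"
 shows "c \<alpha> = 0"
proof -
 have "\<forall>A c \<alpha>. finite A \<longrightarrow> (\<forall>\<alpha>\<in>A. \<forall>i. i \<notin> I \<longrightarrow> \<alpha> i = 0) \<longrightarrow> (\<forall>x. (\<Sum>\<alpha>\<in>A. c \<alpha> * mon \<alpha> x) = 0)
   \<longrightarrow> \<alpha> \<in> A \<longrightarrow> c \<alpha> = 0" if "finite I" for I :: "'a set"
  using that
 proof (induction I)
  case empty
  show ?case
  proof (intro allI impI)
   fix A :: "('a \<Rightarrow> nat) set" and c \<alpha>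
   assume *: "finite A" "\<forall>\<alpha>\<in>A. \<forall>i. i \<notin> {} \<longrightarrow> \<alpha> i = 0" "\<forall>x. (\<Sum>\<alpha>\<in>A. c \<alpha> * mon \<alpha> x) = 0" "\<alpha> \<in> A"
   have "\<beta> = (\<lambda>_. 0)" if "\<beta> \<in> A" for \<beta> using *(2) that by auto
   hence "A = {\<lambda>_. 0}" "\<alpha> = (\<lambda>_. 0)" using *(4) by blast+
   with *(3) show "c \<alpha> = 0" by simp
  qed
 next
  case (insert i I)
  show ?case
  proof (intro allI impI)
   fix A :: "('a \<Rightarrow> nat) set" and c \<alpha>
   assume *: "finite A" "\<forall>\<alpha>\<in>A. \<forall>j. j \<notin> insert i I \<longrightarrow> \<alpha> j = 0" "\<forall>x. (\<Sum>\<alpha>\<in>A. c \<alpha> * mon \<alpha> x) = 0" "\<alpha> \<in> A"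
   define A' where "A' j = {\<alpha>\<in>A. \<alpha> i = j}" for j
   define n where "n = Max ((\<lambda>\<alpha>. \<alpha> i) ` A)"
   have le: "\<beta> i \<le> n" if "\<beta> \<in> A" for \<beta> unfolding n_def using that * by auto
   have coef: "(\<Sum>\<beta>\<in>A' j. c \<beta> * mon (\<beta>(i := 0)) x) = 0" for j x
   proof (cases "j \<le> n")
    case True
    have "(\<Sum>j\<le>n. (\<Sum>\<beta>\<in>A' j. c \<beta> * mon (\<beta>(i := 0)) x) * s ^ j) = 0" for s
    proof -
     define x' where "x' = (\<chi> l. if l = i then s else x $ l)"
     have m: "mon \<beta> x' = s ^ \<beta> i * mon (\<beta>(i := 0)) x" for \<beta>
     proof -
      have "mon (\<beta>(i := 0)) x' = mon (\<beta>(i := 0)) x"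
       unfolding mon_def by (rule prod.cong) (auto simp: x'_def)
      thus ?thesis by (subst mon_split[of _ _ i]) (simp add: x'_def)
     qed
     have "0 = (\<Sum>\<beta>\<in>A. c \<beta> * mon \<beta> x')" using * by simp
     also have "\<dots> = (\<Sum>j\<le>n. \<Sum>\<beta>\<in>A' j. c \<beta> * mon \<beta> x')"
      unfolding A'_def by (rule sum.group[symmetric]) (use * le in auto)
     also have "\<dots> = (\<Sum>j\<le>n. (\<Sum>\<beta>\<in>A' j. c \<beta> * mon (\<beta>(i := 0)) x) * s ^ j)"
      unfolding sum_distrib_right by (intro sum.cong refl) (auto simp: A'_def m algebra_simps)
     finally show ?thesis by simp
    qed
    with True show ?thesis using polyfun_eq_0[of "\<lambda>j. (\<Sum>\<beta>\<in>A' j. c \<beta> * mon (\<beta>(i := 0)) x)" n] by blast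
   next
    case False
    hence "A' j = {}" using le by (auto simp: A'_def)
    thus ?thesis by simp
   qed
   let ?j = "\<alpha> i"
   have inj: "inj_on (\<lambda>\<beta>. \<beta>(i := 0)) (A' ?j)"
   proof (rule inj_onI)
    fix \<beta> \<gamma> assume "\<beta> \<in> A' ?j" "\<gamma> \<in> A' ?j" and e: "\<beta>(i := 0) = \<gamma>(i := 0)"
    hence "\<beta> i = \<gamma> i" by (simp add: A'_def)
    moreover have "\<beta> l = \<gamma> l" if "l \<noteq> i" for l using fun_cong[OF e, of l] that by simp
    ultimately show "\<beta> = \<gamma>" by (metis ext)
   qed
   have "(\<Sum>\<gamma>\<in>(\<lambda>\<beta>. \<beta>(i := 0)) ` A' ?j. c (\<gamma>(i := ?j)) * mon \<gamma> x) = 0" for x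
   proof -
    have "(\<Sum>\<gamma>\<in>(\<lambda>\<beta>. \<beta>(i := 0)) ` A' ?j. c (\<gamma>(i := ?j)) * mon \<gamma> x)
     = (\<Sum>\<beta>\<in>A' ?j. c (\<beta>(i := 0, i := ?j)) * mon (\<beta>(i := 0)) x)"
     by (subst sum.reindex[OF inj]) simp
    also have "\<dots> = (\<Sum>\<beta>\<in>A' ?j. c \<beta> * mon (\<beta>(i := 0)) x)"
     by (rule sum.cong) (auto simp: A'_def fun_upd_idem)
    finally show ?thesis using coef by simp
   qed
   hence z: "\<forall>x. (\<Sum>\<gamma>\<in>(\<lambda>\<beta>. \<beta>(i := 0)) ` A' ?j. c (\<gamma>(i := ?j)) * mon \<gamma> x) = 0" by blast
   have fi: "finite ((\<lambda>\<beta>. \<beta>(i := 0)) ` A' ?j)" using * by (auto simp: A'_def)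
   have su: "\<forall>\<alpha>\<in>(\<lambda>\<beta>. \<beta>(i := 0)) ` A' ?j. \<forall>j. j \<notin> I \<longrightarrow> \<alpha> j = 0" using *(2) by (auto simp: A'_def)
   have me: "\<alpha>(i := 0) \<in> (\<lambda>\<beta>. \<beta>(i := 0)) ` A' ?j" using * by (auto simp: A'_def)
   have "c ((\<alpha>(i := 0))(i := ?j)) = 0"
    by (rule insert.IH[THEN spec, THEN spec, THEN spec, THEN mp, THEN mp, THEN mp, THEN mp, OF fi su z me])
   thus "c \<alpha> = 0" by simp
  qed
 qed
 from this[of UNIV] show ?thesis using assms by auto
qed

lemma pfun_deriv:
 assumes "pfun I k q"
 obtains dq where "pfun I k dq"
  "\<And>x. ((\<lambda>s. q (x + s *\<^sub>R axis i 1)) has_real_derivative dq x) (at 0)"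
proof -
 obtain c where c: "q = (\<lambda>x. \<Sum>\<alpha>\<in>mons I k. c \<alpha> * mon \<alpha> x)" using assms by (auto simp: pfun_def)
 \<comment> \<open>For \<open>\<alpha> i = 0\<close> the truncated exponent is harmless, since the
   factor \<open>real (\<alpha> i)\<close> vanishes.\<close>
 define dq where "dq = (\<lambda>x. \<Sum>\<alpha>\<in>mons I k. (c \<alpha> * real (\<alpha> i)) * mon (\<alpha>(i := \<alpha> i - 1)) x)"
 have "pfun I k dq" unfolding dq_def
 proof (intro pfun_sum pfun_mon)
  fix \<alpha> assume a: "\<alpha> \<in> mons I k"
  have "(\<Sum>j\<in>UNIV. (\<alpha>(i := \<alpha> i - 1)) j) \<le> (\<Sum>j\<in>UNIV. \<alpha> j)" by (rule sum_mono) auto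
  thus "\<alpha>(i := \<alpha> i - 1) \<in> mons I k" using a by (auto simp: mons_def)
 qed
 moreover have "((\<lambda>s. q (x + s *\<^sub>R axis i 1)) has_real_derivative dq x) (at 0)" for x
 proof -
  have m: "mon \<alpha> (x + s *\<^sub>R axis i 1) = (x $ i + s) ^ \<alpha> i * mon (\<alpha>(i := 0)) x" for \<alpha> s
  proof -
   have "mon (\<alpha>(i := 0)) (x + s *\<^sub>R axis i 1) = mon (\<alpha>(i := 0)) x"
    unfolding mon_def by (rule prod.cong) (auto simp: axis_def)
   thus ?thesis by (subst mon_split[of _ _ i]) (simp add: axis_def)
  qed
  have m2: "mon (\<alpha>(i := \<alpha> i - 1)) x = (x $ i) ^ (\<alpha> i - 1) * mon (\<alpha>(i := 0)) x" for \<alpha>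
   by (subst mon_split[of _ _ i]) simp
  show ?thesis unfolding c m dq_def m2
   by (auto intro!: derivative_eq_intros sum.cong)
 qed
 ultimately show ?thesis using that by blast
qed

lemma pfun_line:
 assumes "pfun I k p"
 obtains P :: "real poly" where "degree P \<le> k" "\<And>s. poly P s = p (a + s *\<^sub>R v)"
proof -
 obtain c where c: "p = (\<lambda>x. \<Sum>\<alpha>\<in>mons I k. c \<alpha> * mon \<alpha> x)" using assms by (auto simp: pfun_def)
 define P where "P = (\<Sum>\<alpha>\<in>mons I k. smult (c \<alpha>) (\<Prod>i\<in>UNIV. [:a $ i, v $ i:] ^ \<alpha> i))"
 have "degree P \<le> k" unfolding P_def
 proof (rule degree_sum_le)
  fix \<alpha> assume a: "\<alpha> \<in> mons I k"
  have "degree (smult (c \<alpha>) (\<Prod>i\<in>UNIV. [:a $ i, v $ i:] ^ \<alpha> i)) \<le> degree (\<Prod>i\<in>UNIV. [:a $ i, v $ i:] ^ \<alpha> i)"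
   by (rule degree_smult_le)
  also have "\<dots> \<le> (\<Sum>i\<in>UNIV. degree ([:a $ i, v $ i:] ^ \<alpha> i))"
   using degree_prod_sum_le[of UNIV "\<lambda>i. [:a $ i, v $ i:] ^ \<alpha> i"] by (simp add: o_def)
  also have "\<dots> \<le> (\<Sum>i\<in>UNIV. \<alpha> i)"
  proof (rule sum_mono)
   fix i have "degree ([:a $ i, v $ i:] ^ \<alpha> i) \<le> degree [:a $ i, v $ i:] * \<alpha> i" by (rule degree_power_le)
   also have "\<dots> \<le> 1 * \<alpha> i" by (rule mult_right_mono) auto
   finally show "degree ([:a $ i, v $ i:] ^ \<alpha> i) \<le> \<alpha> i" by simp
  qed
  finally show "degree (smult (c \<alpha>) (\<Prod>i\<in>UNIV. [:a $ i, v $ i:] ^ \<alpha> i)) \<le> k" using a by (auto simp: mons_def)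
 qed auto
 moreover have "poly P s = p (a + s *\<^sub>R v)" for s
  by (simp add: P_def c poly_sum poly_prod mon_def algebra_simps)
 ultimately show ?thesis using that by blast
qed

section \<open>Passage to complex arguments; products of nonzero polynomials\<close>

abbreviation cpoly :: "real poly \<Rightarrow> complex poly" where
 "cpoly \<equiv> map_poly complex_of_real"

lemma poly_cpoly [simp]: "poly (cpoly P) (complex_of_real s) = complex_of_real (poly P s)"
 by (induction P) (auto simp: map_poly_pCons)

lemma degree_cpoly [simp]: "degree (cpoly P) = degree P"
 by (rule degree_map_poly) auto

lemma coeff_cpoly [simp]: "coeff (cpoly P) j = complex_of_real (coeff P j)"
 by (rule coeff_map_poly) auto

lemma cpoly_eq_0 [simp]: "cpoly P = 0 \<longleftrightarrow> P = 0"
 by (metis (no_types, lifting) coeff_cpoly coeff_0 of_real_eq_0_iff poly_eq_iff)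

text \<open>For substituting holomorphic curves into \<open>p\<close>: the same coefficients are
  used at complex points. Holomorphy is stated along curves only, which avoids several complex
  variables.\<close>

lemma pfun_complexify:
 assumes "pfun I k p"
 obtains pc :: "('n::finite \<Rightarrow> complex) \<Rightarrow> complex" where
  "\<And>x::real^'n. pc (\<lambda>i. complex_of_real (x $ i)) = complex_of_real (p x)"
  "\<And>W S. (\<And>i. (\<lambda>s. W s i) holomorphic_on S) \<Longrightarrow> (\<lambda>s. pc (W s)) holomorphic_on S"
proof -
 obtain c where c: "p = (\<lambda>x. \<Sum>\<alpha>\<in>mons I k. c \<alpha> * mon \<alpha> x)" using assms by (auto simp: pfun_def)
 show ?thesis
 proof (rule that[of "\<lambda>z. \<Sum>\<alpha>\<in>mons I k. of_real (c \<alpha>) * (\<Prod>i\<in>UNIV. z i ^ \<alpha> i)"])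
  show "(\<Sum>\<alpha>\<in>mons I k. complex_of_real (c \<alpha>) * (\<Prod>i\<in>UNIV. complex_of_real (x $ i) ^ \<alpha> i)) =
     complex_of_real (p x)" for x by (simp add: c mon_def)
 qed (auto intro!: holomorphic_intros)
qed

text \<open>On the line through the two points both functions restrict to nonzero univariate
  polynomials, and these have finitely many zeros.\<close>

lemma pfun_mult_nonzero:
 assumes "pfun I k p" "pfun J l q" "p x \<noteq> 0" "q y \<noteq> 0"
 obtains z where "p z \<noteq> 0" "q z \<noteq> 0"
proof -
 obtain P :: "real poly" where P: "\<And>s. poly P s = p (x + s *\<^sub>R (y - x))" using pfun_line[OF assms(1)] by metis
 obtain Q :: "real poly" where Q: "\<And>s. poly Q s = q (x + s *\<^sub>R (y - x))" using pfun_line[OF assms(2)] by metis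
 have "poly P 0 \<noteq> 0" "poly Q 1 \<noteq> 0" using assms by (auto simp: P Q)
 hence "P * Q \<noteq> 0" by auto
 hence "finite {s. poly (P * Q) s = 0}" by (rule poly_roots_finite)
 hence "{s. poly (P * Q) s = 0} \<noteq> UNIV" using infinite_UNIV_char_0 by metis
 then obtain s where "poly (P * Q) s \<noteq> 0" by auto
 thus ?thesis using that[of "x + s *\<^sub>R (y - x)"] by (simp add: P Q)
qed

lemma pfun_nonzero_near:
 assumes "pfun I k p" "p y \<noteq> 0" "e > 0"
 obtains z where "dist z x < e" "p z \<noteq> 0"
proof -
 obtain P :: "real poly" where P: "\<And>s. poly P s = p (x + s *\<^sub>R (y - x))" using pfun_line[OF assms(1)] by metis
 have "poly P 1 \<noteq> 0" using assms by (auto simp: P)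
 hence "finite {s. poly P s = 0}" by (intro poly_roots_finite) auto
 \<comment> \<open>The summand 1 keeps the denominator positive when \<open>y = x\<close>.\<close>
 define r where "r = e / (norm (y - x) + 1)"
 have n1: "norm (y - x) + 1 > 0" by (smt (verit) norm_ge_zero)
 hence r: "r > 0" using assms by (simp add: r_def)
 hence "infinite {0<..<r}" by simp
 then obtain s where s: "s \<in> {0<..<r}" "poly P s \<noteq> 0" using \<open>finite {s. poly P s = 0}\<close>
  by (metis (mono_tags, lifting) finite_subset mem_Collect_eq subsetI)
 have "dist (x + s *\<^sub>R (y - x)) x = s * norm (y - x)" using s by (simp add: dist_norm)
 also have "\<dots> \<le> s * (norm (y - x) + 1)" using s by (intro mult_left_mono) auto
 also have "\<dots> < r * (norm (y - x) + 1)" using s n1 by (intro mult_strict_right_mono) auto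
 also have "\<dots> = e" using n1 by (simp add: r_def)
 finally show ?thesis using s P that by auto
qed

section \<open>Algebraic functions of one complex variable\<close>

text \<open>\<open>u - u ln |u|\<close> is a primitive of \<open>- ln |u|\<close>; its boundedness
  is what makes the logarithmic singularity below cheap to integrate.\<close>

lemma abs_minus_ln_bound:
 fixes u :: real assumes "\<bar>u\<bar> \<le> 3/2" shows "\<bar>u - u * ln \<bar>u\<bar>\<bar> \<le> 3"
proof -
 have "\<bar>u * ln \<bar>u\<bar>\<bar> \<le> 3/2"
 proof (cases "\<bar>u\<bar> \<le> 1")
  case True
  show ?thesis
  proof (cases "u = 0")
   case False
   hence u: "\<bar>u\<bar> > 0" by simp
   have "ln (1 / \<bar>u\<bar>) \<le> 1 / \<bar>u\<bar> - 1" using u by (intro ln_le_minus_one) auto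
   hence "- ln \<bar>u\<bar> \<le> 1 / \<bar>u\<bar>" using u by (simp add: ln_div)
   hence "\<bar>u\<bar> * (- ln \<bar>u\<bar>) \<le> \<bar>u\<bar> * (1 / \<bar>u\<bar>)" using u by (intro mult_left_mono) auto
   moreover have "\<bar>u * ln \<bar>u\<bar>\<bar> = \<bar>u\<bar> * (- ln \<bar>u\<bar>)" using True u by (simp add: abs_mult)
   ultimately show ?thesis using u by simp
  qed simp
 next
  case False
  have "ln \<bar>u\<bar> \<le> \<bar>u\<bar> - 1" using False by (intro ln_le_minus_one) auto
  hence "ln \<bar>u\<bar> \<le> 1/2" using assms by simp
  moreover have "ln \<bar>u\<bar> \<ge> 0" using False by simp
  ultimately have "\<bar>u\<bar> * ln \<bar>u\<bar> \<le> 3/2 * (1/2)" using assms by (intro mult_mono) auto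
  thus ?thesis using \<open>ln \<bar>u\<bar> \<ge> 0\<close> by (simp add: abs_mult)
 qed
 thus ?thesis using assms by linarith
qed

text \<open>Here \<open>a\<close> is the modulus of a root and \<open>t\<close> the radius of a
  circle. The singularity at \<open>t = a\<close> is integrable, and the factor \<open>1 + a\<close>
  makes the integral bounded uniformly in \<open>a\<close>; 7 is a convenient bound.\<close>

lemma log_quotient_integral:
 fixes a :: real assumes a: "a \<ge> 0"
 obtains I where "((\<lambda>t. ln ((1 + a) / \<bar>t - a\<bar>)) has_integral I) {1/2..1}" "I \<le> 7"
proof -
 \<comment> \<open>A primitive that stays continuous at \<open>t = a\<close>, so the fundamental
   theorem applies with \<open>a\<close> as an exceptional point.\<close>
 define F where "F t = t * ln (1 + a) + ((t - a) - (t - a) * ln \<bar>t - a\<bar>)" for t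
 have cont: "continuous_on {1/2..1} F"
 proof -
  have "((\<lambda>u::real. u * ln \<bar>u\<bar>) \<longlongrightarrow> 0) (at 0)"
   using lim_1_over_n by (real_asymp)
  hence "isCont (\<lambda>u::real. u * ln \<bar>u\<bar>) 0" by (simp add: isCont_def)
  moreover have "isCont (\<lambda>u::real. u * ln \<bar>u\<bar>) u" if "u \<noteq> 0" for u
   using that by (intro continuous_intros) auto
  ultimately have "isCont (\<lambda>u::real. u * ln \<bar>u\<bar>) u" for u by (cases "u = 0") auto
  hence c: "continuous_on UNIV (\<lambda>u::real. u * ln \<bar>u\<bar>)" by (simp add: continuous_at_imp_continuous_on)
  have "continuous_on {1/2..1} (\<lambda>t. (\<lambda>u::real. u * ln \<bar>u\<bar>) (t - a))"
   by (rule continuous_on_compose2[OF c]) (auto intro!: continuous_intros)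
  thus ?thesis unfolding F_def
   by (intro continuous_on_add[OF _ continuous_on_diff]) (auto intro!: continuous_intros)
 qed
 have der: "(F has_vector_derivative ln ((1 + a) / \<bar>t - a\<bar>)) (at t)" if "t \<in> {1/2..1} - {a}" for t
 proof -
  have ta: "t - a \<noteq> 0" using that by auto
  have d: "((\<lambda>t. ln \<bar>t - a\<bar>) has_real_derivative inverse (t - a)) (at t)"
  proof (cases "t > a")
   case True
   have "((\<lambda>t. ln (t - a)) has_real_derivative inverse (t - a)) (at t)"
    using True by (auto intro!: derivative_eq_intros simp: field_simps)
   moreover have "eventually (\<lambda>t. t > a) (nhds t)" using True by (intro eventually_nhds_in_open[of "{a<..}", simplified]) auto
   hence "eventually (\<lambda>t. ln (t - a) = ln \<bar>t - a\<bar>) (nhds t)" by eventually_elim auto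
   ultimately show ?thesis using DERIV_cong_ev by fastforce
  next
   case False
   have "((\<lambda>t. ln (a - t)) has_real_derivative inverse (t - a)) (at t)"
    using False ta by (auto intro!: derivative_eq_intros simp: field_simps)
   moreover have "eventually (\<lambda>t. t < a) (nhds t)" using False ta by (intro eventually_nhds_in_open[of "{..<a}", simplified]) auto
   hence "eventually (\<lambda>t. ln (a - t) = ln \<bar>t - a\<bar>) (nhds t)" by eventually_elim (auto simp: abs_if)
   ultimately show ?thesis using DERIV_cong_ev by fastforce
  qed
  have "(F has_real_derivative (ln (1 + a) + (1 - (1 * ln \<bar>t - a\<bar> + inverse (t - a) * (t - a))))) (at t)"
   unfolding F_def by (rule derivative_eq_intros d refl)+ simp
  hence "(F has_real_derivative (ln (1 + a) - ln \<bar>t - a\<bar>)) (at t)" using ta by simp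
  moreover have "ln ((1 + a) / \<bar>t - a\<bar>) = ln (1 + a) - ln \<bar>t - a\<bar>"
   using ta a by (simp add: ln_divide_pos)
  ultimately show ?thesis by (simp add: has_real_derivative_iff_has_vector_derivative)
 qed
 have I: "((\<lambda>t. ln ((1 + a) / \<bar>t - a\<bar>)) has_integral (F 1 - F (1/2))) {1/2..1}"
  by (rule fundamental_theorem_of_calculus_strong[of "{a}"]) (use der cont in auto)
 have "F 1 - F (1/2) \<le> 7"
 proof (cases "a \<le> 3/2")
  \<comment> \<open>\<open>F 1 - F (1/2)\<close> is half of \<open>ln (1 + a)\<close>, at most 3/4,
    plus a difference of two terms bounded by 3.\<close>
  case True
  have "ln (1 + a) \<le> a" using a by (simp add: ln_add_one_self_le_self)
  moreover have "\<bar>(1 - a) - (1 - a) * ln \<bar>1 - a\<bar>\<bar> \<le> 3" using True a by (intro abs_minus_ln_bound, unfold abs_le_iff) auto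
  moreover have "\<bar>(1/2 - a) - (1/2 - a) * ln \<bar>1/2 - a\<bar>\<bar> \<le> 3" using True a by (intro abs_minus_ln_bound, unfold abs_le_iff) auto
  ultimately show ?thesis using True unfolding F_def by linarith
 next
  case False
  have "F 1 - F (1/2) \<le> integral {1/2..1} (\<lambda>t::real. 4)"
  proof (rule has_integral_le[OF I])
   show "((\<lambda>t::real. 4) has_integral integral {1/2..1} (\<lambda>t::real. 4::real)) {1/2..1::real}"
    by (intro integrable_integral integrable_const_ivl)
   fix t :: real assume t: "t \<in> {1/2..1}"
   \<comment> \<open>The quotient is largest for \<open>t = 1\<close> and \<open>a\<close> close to
     3/2.\<close>
   have "(1 + a) / \<bar>t - a\<bar> \<le> 5" using t False by (simp add: field_simps abs_if)
   moreover have "(1 + a) / \<bar>t - a\<bar> > 0" using t False by simp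
   ultimately have "ln ((1 + a) / \<bar>t - a\<bar>) \<le> 5 - 1" using ln_le_minus_one by (smt (verit))
   thus "ln ((1 + a) / \<bar>t - a\<bar>) \<le> 4" by simp
  qed
  thus ?thesis by simp
 qed
 with I show ?thesis using that by blast
qed

text \<open>Factor over the roots. A root of modulus \<open>a\<close> contributes at most
  \<open>(1 + a) * max 1 |z|\<close> and, on the circle of radius \<open>t\<close>, at least
  \<open>|t - a|\<close>; for \<open>t \<le> 1\<close> the logarithmic loss between the two is the
  function integrated above. The total loss is controlled by the degree alone, wherever the roots
  lie; \<open>X\<close> collects their moduli.\<close>

lemma poly_circle_bounds:
 fixes \<beta> :: "complex poly"
 assumes "\<beta> \<noteq> 0" "degree \<beta> \<le> K"
 obtains m L X I where "m > 0" "finite X" "(L has_integral I) {1/2..1::real}" "I \<le> 7 * real K"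
  "\<And>t. t \<in> {1/2..1} \<Longrightarrow> L t \<ge> 0"
  "\<And>z. norm (poly \<beta> z) \<le> m * max 1 (norm z) ^ K"
  "\<And>t z. t \<in> {1/2..1} - X \<Longrightarrow> norm z = t \<Longrightarrow> m * exp (- L t) \<le> norm (poly \<beta> z)"
proof -
 let ?n = "degree \<beta>"
 obtain root where root: "smult (lead_coeff \<beta>) (\<Prod>i<?n. [:-root i, 1:]) = \<beta>"
  using complex_poly_decompose' by blast
 have ev: "poly \<beta> z = lead_coeff \<beta> * (\<Prod>i<?n. z - root i)" for z
  by (subst root[symmetric]) (simp add: poly_prod)
 define a where "a i = norm (root i)" for i
 have a0: "a i \<ge> 0" for i by (simp add: a_def)
 define m where "m = norm (lead_coeff \<beta>) * (\<Prod>i<?n. 1 + a i)"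
 define l where "l i t = ln ((1 + a i) / \<bar>t - a i\<bar>)" for i t
 define L where "L t = (\<Sum>i<?n. l i t)" for t
 have "\<exists>I. (l i has_integral I) {1/2..1} \<and> I \<le> 7" for i
  using log_quotient_integral[OF a0[of i]] unfolding l_def by metis
 then obtain J where J: "\<And>i. (l i has_integral J i) {1/2..1}" "\<And>i. J i \<le> 7" by metis
 show ?thesis
 proof (rule that[of m "a ` {..<?n}" L "\<Sum>i<?n. J i"])
  have "1 + a i > 0" for i using a0[of i] by linarith
  thus "m > 0" unfolding m_def using assms by (intro mult_pos_pos prod_pos) auto
  show "finite (a ` {..<?n})" by simp
  show "(L has_integral (\<Sum>i<?n. J i)) {1/2..1}" unfolding L_def using J by (intro has_integral_sum) auto
  have "(\<Sum>i<?n. J i) \<le> (\<Sum>i<?n. 7)" using J by (intro sum_mono) auto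
  also have "\<dots> \<le> 7 * real K" using assms by simp
  finally show "(\<Sum>i<?n. J i) \<le> 7 * real K" .
  show "L t \<ge> 0" if t: "t \<in> {1/2..1}" for t
   unfolding L_def
  proof (intro sum_nonneg)
   fix i
   show "l i t \<ge> 0"
   proof (cases "t = a i")
    case False
    hence "(1 + a i) / \<bar>t - a i\<bar> \<ge> 1" using t a0[of i] by (simp add: field_simps abs_if)
    thus ?thesis unfolding l_def by (rule ln_ge_zero)
   qed (simp add: l_def)
  qed
  show "norm (poly \<beta> z) \<le> m * max 1 (norm z) ^ K" for z
  proof -
   have "norm (\<Prod>i<?n. z - root i) \<le> (\<Prod>i<?n. (1 + a i) * max 1 (norm z))"
    unfolding prod_norm[symmetric]
   proof (intro prod_mono conjI norm_ge_zero)
    fix i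
    have "norm (z - root i) \<le> norm z + a i" unfolding a_def by (rule norm_triangle_ineq4)
    also have "\<dots> \<le> max 1 (norm z) + a i * max 1 (norm z)"
     using mult_left_mono[OF _ a0[of i], of 1 "max 1 (norm z)"] by simp
    finally show "norm (z - root i) \<le> (1 + a i) * max 1 (norm z)" by (simp add: algebra_simps)
   qed
   also have "\<dots> = (\<Prod>i<?n. 1 + a i) * max 1 (norm z) ^ ?n" by (simp add: prod.distrib)
   also have "\<dots> \<le> (\<Prod>i<?n. 1 + a i) * max 1 (norm z) ^ K"
    using assms a0 by (intro mult_left_mono power_increasing prod_nonneg) (auto intro: add_nonneg_nonneg)
   finally show ?thesis unfolding ev m_def norm_mult by (simp add: mult.assoc mult_left_mono)
  qed
  show "m * exp (- L t) \<le> norm (poly \<beta> z)" if t: "t \<in> {1/2..1} - a ` {..<?n}" and z: "norm z = t" for t z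
  proof -
   have "(\<Prod>i<?n. (1 + a i) * exp (- l i t)) \<le> (\<Prod>i<?n. norm (z - root i))"
   proof (intro prod_mono conjI)
    fix i assume i: "i \<in> {..<?n}"
    hence ne: "t \<noteq> a i" using t by auto
    have p: "(1 + a i) > 0" using a0[of i] by linarith
    have "exp (- l i t) = \<bar>t - a i\<bar> / (1 + a i)"
     unfolding l_def exp_minus using ne p by (subst exp_ln) auto
    hence "(1 + a i) * exp (- l i t) = \<bar>t - a i\<bar>" using p by simp
    also have "\<dots> \<le> norm (z - root i)" unfolding z[symmetric] a_def by (rule norm_triangle_ineq3)
    finally show "(1 + a i) * exp (- l i t) \<le> norm (z - root i)" .
    show "0 \<le> (1 + a i) * exp (- l i t)" using p by simp
   qed
   moreover have "(\<Prod>i<?n. (1 + a i) * exp (- l i t)) = (\<Prod>i<?n. 1 + a i) * exp (- L t)"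
   proof -
    have "exp (- L t) = (\<Prod>i<?n. exp (- l i t))"
     unfolding L_def sum_negf[symmetric] by (rule exp_sum) simp
    thus ?thesis by (simp add: prod.distrib)
   qed
   ultimately have "(\<Prod>i<?n. 1 + a i) * exp (- L t) \<le> norm (\<Prod>i<?n. z - root i)"
    by (simp add: prod_norm)
   hence "norm (lead_coeff \<beta>) * ((\<Prod>i<?n. 1 + a i) * exp (- L t)) \<le> norm (lead_coeff \<beta>) * norm (\<Prod>i<?n. z - root i)"
    by (rule mult_left_mono) simp
   thus ?thesis by (simp only: ev m_def norm_mult mult.assoc)
  qed
 qed
qed

text \<open>A Remez type inequality: at a good radius the bound on the segment limits the
  normalising constant \<open>m\<close>, and \<open>m\<close> limits the polynomial
  everywhere.\<close>

lemma poly_bound_from_segment: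
 fixes P :: "complex poly"
 assumes "degree P \<le> K" "\<And>t. t \<in> {1/2..1} \<Longrightarrow> norm (poly P (complex_of_real t)) \<le> M" "M \<ge> 0"
 shows "norm (poly P z) \<le> M * exp (14 * real K + 2) * max 1 (norm z) ^ K"
proof (cases "P = 0")
 case False
 obtain m L X I where *: "m > 0" "finite X" "(L has_integral I) {1/2..1::real}" "I \<le> 7 * real K"
  "\<And>t. t \<in> {1/2..1} \<Longrightarrow> L t \<ge> 0"
  "\<And>z. norm (poly P z) \<le> m * max 1 (norm z) ^ K"
  "\<And>t z. t \<in> {1/2..1} - X \<Longrightarrow> norm z = t \<Longrightarrow> m * exp (- L t) \<le> norm (poly P z)"
  by (rule poly_circle_bounds[OF False assms(1)]) blast
 \<comment> \<open>\<open>14 K + 2\<close> is twice \<open>7 K + 1\<close>: exceeding it on an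
   interval of length 1/2 would make the integral of \<open>L\<close> larger than
   \<open>7 K\<close>.\<close>
 have "\<exists>t\<in>{1/2..1} - X. L t \<le> 14 * real K + 2"
 proof (rule ccontr)
  assume "\<not> ?thesis"
  hence L: "L t \<ge> 14 * real K + 2" if "t \<in> {1/2..1} - X" for t using that by force
  have h1: "((\<lambda>t. if t \<in> X then 14 * real K + 2 else L t) has_integral I) {1/2..1}"
   by (rule has_integral_spike_finite[OF *(2) _ *(3)]) auto
  have h2: "((\<lambda>t. 14 * real K + 2) has_integral (1 - 1/2) *\<^sub>R (14 * real K + 2)) {1/2..1::real}"
   using has_integral_const_real[of "14 * real K + 2" "1/2" 1] by simp
  have "(1 - 1/2) *\<^sub>R (14 * real K + 2) \<le> I"
   by (rule has_integral_le[OF h2 h1]) (use L in auto)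
  thus False using *(4) by simp
 qed
 then obtain t where t: "t \<in> {1/2..1} - X" "L t \<le> 14 * real K + 2" by blast
 have "m * exp (- L t) \<le> M" using *(7)[OF t(1), of "complex_of_real t"] assms(2)[of t] t by auto
 hence "m * exp (- L t) * exp (L t) \<le> M * exp (L t)" by (intro mult_right_mono) auto
 moreover have "m * exp (- L t) * exp (L t) = m" by (simp add: exp_minus)
 ultimately have "m \<le> M * exp (L t)" by simp
 also have "\<dots> \<le> M * exp (14 * real K + 2)" using t assms by (intro mult_left_mono) auto
 finally have "m * max 1 (norm z) ^ K \<le> M * exp (14 * real K + 2) * max 1 (norm z) ^ K"
  by (intro mult_right_mono) auto
 with *(6)[of z] show ?thesis by linarith
qed (use assms in auto)

text \<open>Compares lengths: a connected set of reals contains the whole interval between any two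
  of its points.\<close>

lemma connected_covered_by_intervals:
 fixes S :: "real set"
 assumes "connected S" "finite X" "S \<subseteq> (\<Union>c\<in>X. {c - r..c + r})" "x \<in> S" "y \<in> S" "r \<ge> 0"
 shows "y - x \<le> 2 * r * card X"
proof (cases "x \<le> y")
 case True
 have "{x..y} \<subseteq> (\<Union>c\<in>X. {c - r..c + r})"
  using connected_contains_Icc[OF assms(1,4,5)] assms(3) by blast
 hence "measure lborel {x..y} \<le> measure lborel (\<Union>c\<in>X. {c - r..c + r})"
 proof (rule measure_mono_fmeasurable)
  show "(\<Union>c\<in>X. {c - r..c + r}) \<in> fmeasurable lborel"
   by (rule fmeasurable_compact) (use assms in auto)
 qed auto
 also have "\<dots> \<le> (\<Sum>c\<in>X. measure lborel {c - r..c + r})"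
  by (rule measure_UNION_le) (use assms in auto)
 also have "\<dots> = (\<Sum>c\<in>X. 2 * r)" using assms by (intro sum.cong) auto
 finally show ?thesis using True by (simp add: mult.commute)
next
 case False
 have "0 \<le> 2 * r * card X" using assms by simp
 thus ?thesis using False by linarith
qed

text \<open>At each point of the circle the relation must be balanced by two terms of comparable
  size. As the coefficients are known up to the factor \<open>exp L\<close>, the two indices
  determine \<open>ln |w|\<close> up to \<open>\<Lambda>\<close>, so the values of
  \<open>ln |w|\<close> on the circle lie near finitely many centres. The circle is connected, so
  these values spread by at most the total length of the intervals; the maximum principle then
  brings in the centre of the disc. The alternative \<open>w 0 = 0\<close> excludes the default
  value of the logarithm.\<close>

lemma algebraic_function_osc_on_circle:
 fixes w :: "complex \<Rightarrow> complex" and D :: nat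
 assumes w: "w holomorphic_on ball 0 2" and t: "t \<in> {1/2..1::real}"
  and Ind: "0 \<in> Ind" "Ind \<subseteq> {..D}"
  and m: "\<And>i. i \<in> Ind \<Longrightarrow> m i > (0::real)" and L: "L \<ge> 0"
  and up: "\<And>i z. i \<in> Ind \<Longrightarrow> norm z = t \<Longrightarrow> norm (b i z) \<le> m i"
  and lo: "\<And>i z. i \<in> Ind \<Longrightarrow> norm z = t \<Longrightarrow> m i * exp (- L) \<le> norm (b i z)"
  and rel: "\<And>z. norm z = t \<Longrightarrow> (\<Sum>i\<in>Ind. b i z * w z ^ i) = 0"
  and z1: "norm z1 = t"
 shows "w z1 \<noteq> 0" "ln (norm (w 0)) - ln (norm (w z1)) \<le> 2 * (L + ln (real D + 1)) * (real D + 1)^2 \<or> w 0 = 0"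
proof -
 have fin: "finite Ind" using Ind finite_subset by blast
 define \<Lambda> where "\<Lambda> = L + ln (real D + 1)"
 have \<Lambda>: "\<Lambda> \<ge> 0" unfolding \<Lambda>_def using L by simp
 have bpos: "norm (b i z) > 0" if "i \<in> Ind" "norm z = t" for i z
  using lo[OF that] m[OF that(1)] by (smt (verit) exp_gt_zero mult_pos_pos)
 have wnz: "w z \<noteq> 0" if z: "norm z = t" for z
 proof
  assume "w z = 0"
  have "(\<Sum>i\<in>Ind. b i z * w z ^ i) = (\<Sum>i\<in>Ind. if i = 0 then b 0 z else 0)"
   by (intro sum.cong) (auto simp: \<open>w z = 0\<close>)
  also have "\<dots> = b 0 z" using Ind fin by simp
  finally show False using rel[OF z] bpos[OF Ind(1) z] by simp
 qed
 show "w z1 \<noteq> 0" using wnz z1 by blast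
 \<comment> \<open>The solution \<open>x\<close> of \<open>ln (m i) + i x = ln (m l) + l x\<close>.
   For \<open>i = l\<close> the quotient is the default value 0, which merely adds a centre.\<close>
 define ctr where "ctr = (\<lambda>(i, l). (ln (m l) - ln (m i)) / (real i - real l))"
 define X where "X = ctr ` (Ind \<times> Ind)"
 have finX: "finite X" using fin by (simp add: X_def)
 have "card X \<le> card (Ind \<times> Ind)" unfolding X_def by (rule card_image_le) (use fin in auto)
 also have "\<dots> = card Ind ^ 2" by (simp add: card_cartesian_product power2_eq_square)
 also have "\<dots> \<le> (D + 1)^2" using card_mono[OF _ Ind(2)] by (intro power_mono) auto
 finally have "real (card X) \<le> real ((D + 1)^2)" by linarith
 hence cX: "real (card X) \<le> (real D + 1)^2" by (simp add: add.commute)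
 let ?S = "(\<lambda>z. ln (norm (w z))) ` sphere 0 t"
 have contw: "continuous_on (ball 0 2) w" using w by (rule holomorphic_on_imp_continuous_on)
 have "continuous_on (sphere 0 t) (\<lambda>z. ln (norm (w z)))"
  using wnz t by (intro continuous_intros continuous_on_subset[OF contw]) auto
 hence conn: "connected ?S"
  by (intro connected_continuous_image) (auto intro!: connected_sphere)
 have cov: "?S \<subseteq> (\<Union>c\<in>X. {c - \<Lambda>..c + \<Lambda>})"
 proof
  fix y assume "y \<in> ?S"
  then obtain z where z: "norm z = t" and y: "y = ln (norm (w z))" by auto
  define T where "T i = norm (b i z * w z ^ i)" for i
  have Tpos: "T i > 0" if "i \<in> Ind" for i using bpos[OF that z] wnz[OF z] by (simp add: T_def)
  obtain i where i: "i \<in> Ind" "\<And>l. l \<in> Ind \<Longrightarrow> T l \<le> T i"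
  proof -
   have "Max (T ` Ind) \<in> T ` Ind" using fin Ind(1) by (intro Max_in) auto
   then obtain i where "i \<in> Ind" "T i = Max (T ` Ind)" by force
   thus ?thesis using that[of i] Max_ge[of "T ` Ind"] fin by simp
  qed
  \<comment> \<open>Otherwise the remaining terms, at most \<open>D\<close> of them, are too small
    to cancel the largest one.\<close>
  have "\<exists>l\<in>Ind - {i}. T i \<le> (real D + 1) * T l"
  proof (rule ccontr)
   assume "\<not> ?thesis"
   hence lt: "(real D + 1) * T l \<le> T i" if "l \<in> Ind - {i}" for l using that by force
   have "b i z * w z ^ i = - (\<Sum>l\<in>Ind - {i}. b l z * w z ^ l)"
    using rel[OF z] sum.remove[OF fin i(1), of "\<lambda>l. b l z * w z ^ l"] by (simp add: eq_neg_iff_add_eq_0)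
   hence "T i \<le> (\<Sum>l\<in>Ind - {i}. T l)" unfolding T_def using norm_sum[of "\<lambda>l. b l z * w z ^ l" "Ind - {i}"] by simp
   also have "\<dots> \<le> (\<Sum>l\<in>Ind - {i}. T i / (real D + 1))"
    using lt by (intro sum_mono) (simp add: field_simps)
   also have "\<dots> = real (card (Ind - {i})) * (T i / (real D + 1))" by simp
   also have "\<dots> < (real D + 1) * (T i / (real D + 1))"
   proof (rule mult_strict_right_mono)
    have "card (Ind - {i}) \<le> card ({..D} - {i})" using Ind by (intro card_mono) auto
    also have "\<dots> \<le> D" using i Ind by auto
    finally show "real (card (Ind - {i})) < real D + 1" by simp
   qed (use Tpos[OF i(1)] in auto)
   finally show False by simp
  qed
  then obtain l where l: "l \<in> Ind" "l \<noteq> i" "T i \<le> (real D + 1) * T l" by auto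
  define x where "x = ln (norm (w z))"
  have lnT: "ln (T j) = ln (norm (b j z)) + real j * x" if "j \<in> Ind" for j
   using bpos[OF that z] wnz[OF z] unfolding T_def x_def norm_mult norm_power
   by (subst ln_mult_pos) (auto simp: ln_realpow)
  have lnb: "ln (norm (b j z)) \<le> ln (m j)" "ln (m j) - L \<le> ln (norm (b j z))" if "j \<in> Ind" for j
  proof -
   show "ln (norm (b j z)) \<le> ln (m j)" using up[OF that z] bpos[OF that z] m[OF that] by simp
   have "ln (m j * exp (- L)) \<le> ln (norm (b j z))"
    using lo[OF that z] bpos[OF that z] m[OF that] by (subst ln_le_cancel_iff) auto
   thus "ln (m j) - L \<le> ln (norm (b j z))" using m[OF that] by (simp add: ln_mult_pos)
  qed
  have "ln (T i) \<le> ln ((real D + 1) * T l)" using l Tpos i by (subst ln_le_cancel_iff) auto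
  hence 1: "ln (T i) \<le> ln (real D + 1) + ln (T l)" using Tpos[OF l(1)] by (simp add: ln_mult_pos)
  have 2: "ln (T l) \<le> ln (T i)" using i(2)[OF l(1)] Tpos l i by (subst ln_le_cancel_iff) auto
  have ln0: "ln (real D + 1) \<ge> 0" by simp
  have "\<bar>(real i - real l) * x - (ln (m l) - ln (m i))\<bar> \<le> \<Lambda>"
   using 1 2 ln0 lnb[OF i(1)] lnb[OF l(1)] unfolding lnT[OF i(1)] lnT[OF l(1)] \<Lambda>_def left_diff_distrib
   by linarith
  \<comment> \<open>Distinct exponents differ by at least 1, so dividing by their difference does
    not enlarge the error.\<close>
  moreover have il: "\<bar>real i - real l\<bar> \<ge> 1" using l(2) by linarith
  have "(real i - real l) * x - (ln (m l) - ln (m i)) = (real i - real l) * (x - ctr (i, l))"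
   using il by (auto simp: ctr_def field_simps)
  ultimately have "\<bar>real i - real l\<bar> * \<bar>x - ctr (i, l)\<bar> \<le> \<Lambda>" by (simp add: abs_mult)
  moreover have "1 * \<bar>x - ctr (i, l)\<bar> \<le> \<bar>real i - real l\<bar> * \<bar>x - ctr (i, l)\<bar>"
   using il by (intro mult_right_mono) auto
  ultimately have "1 * \<bar>x - ctr (i, l)\<bar> \<le> \<Lambda>" by (rule order_trans[rotated])
  hence "\<bar>x - ctr (i, l)\<bar> \<le> \<Lambda>" by simp
  thus "y \<in> (\<Union>c\<in>X. {c - \<Lambda>..c + \<Lambda>})" unfolding y x_def[symmetric]
   by (intro UN_I[of "ctr (i, l)"]) (auto simp: X_def i l abs_le_iff)
 qed
 show "ln (norm (w 0)) - ln (norm (w z1)) \<le> 2 * (L + ln (real D + 1)) * (real D + 1)^2 \<or> w 0 = 0"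
 proof (cases "w 0 = 0")
  case False
  obtain z2 where z2: "norm z2 = t" "norm (w 0) \<le> norm (w z2)"
  proof -
   have "continuous_on (sphere 0 t) (\<lambda>z. norm (w z))"
    using t by (intro continuous_intros continuous_on_subset[OF contw]) auto
   moreover have "complex_of_real t \<in> sphere 0 t" using t by simp
   ultimately obtain z2 where z2: "z2 \<in> sphere 0 t" "\<And>z. z \<in> sphere 0 t \<Longrightarrow> norm (w z) \<le> norm (w z2)"
    using continuous_attains_sup[of "sphere (0::complex) t" "\<lambda>z. norm (w z)"] compact_sphere by blast
   have "norm (w 0) \<le> norm (w z2)"
   proof (rule maximum_modulus_frontier[of w "cball 0 t"])
    show "w holomorphic_on interior (cball 0 t)" using t by (intro holomorphic_on_subset[OF w]) auto
    show "continuous_on (closure (cball 0 t)) w" using t by (intro continuous_on_subset[OF contw]) auto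
   qed (use z2 t in auto)
   thus ?thesis using that z2 by auto
  qed
  have "ln (norm (w z2)) - ln (norm (w z1)) \<le> 2 * \<Lambda> * card X"
   by (rule connected_covered_by_intervals[OF conn finX cov]) (use z1 z2 \<Lambda> in auto)
  also have "\<dots> \<le> 2 * \<Lambda> * (real D + 1)^2" using cX \<Lambda> by (intro mult_left_mono) auto
  finally have "ln (norm (w z2)) - ln (norm (w z1)) \<le> 2 * \<Lambda> * (real D + 1)^2" .
  moreover have "ln (norm (w 0)) \<le> ln (norm (w z2))"
   using z2(2) False by (smt (verit) ln_le_cancel_iff zero_less_norm_iff)
  ultimately show ?thesis unfolding \<Lambda>_def by linarith
 qed auto
qed

text \<open>Bounds the integral over \<open>{1/2..1}\<close> of the oscillation estimate on circles:
  the losses of at most \<open>D + 1\<close> coefficients of degree \<open>K\<close> add up to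
  \<open>7 K (D + 1)\<close>, and \<open>ln (D + 1)\<close> is the price of comparing
  \<open>D + 1\<close> terms.\<close>

definition osc_bound :: "nat \<Rightarrow> nat \<Rightarrow> real" where
 "osc_bound D K = 2 * (7 * real K * (real D + 1) + ln (real D + 1)) * (real D + 1)^2"

text \<open>Integrates the oscillation estimate over the radii, with \<open>z1\<close> on the
  positive real axis. Radii that are moduli of roots of some coefficient form a finite set. For all
  other radii \<open>w\<close> is nonzero on the circle, so the value infinity at its zeros does no
  harm.\<close>

lemma algebraic_function_log_integral:
 fixes w :: "complex \<Rightarrow> complex" and \<beta> :: "nat \<Rightarrow> complex poly"
 assumes w: "w holomorphic_on ball 0 2" "w 0 \<noteq> 0"
  and deg: "\<And>i. i \<le> D \<Longrightarrow> degree (\<beta> i) \<le> K" and ex: "\<exists>i\<le>D. \<beta> i \<noteq> 0"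
  and rel: "\<And>z. z \<in> ball 0 2 \<Longrightarrow> (\<Sum>i\<le>D. poly (\<beta> i) z * w z ^ i) = 0"
 shows "(\<integral>\<^sup>+t. (if w (complex_of_real t) = 0 then \<infinity> else ennreal (ln (norm (w 0)) - ln (norm (w (complex_of_real t)))))
   * indicator {1/2..1} t \<partial>lborel) \<le> ennreal (osc_bound D K)"
proof -
 \<comment> \<open>Dividing by \<open>w ^ i0\<close> makes the constant coefficient nonzero, as the
   circle estimate requires. Near 0 the function \<open>w\<close> does not vanish, and the divided
   relation extends to the disc by the identity theorem.\<close>
 define i0 where "i0 = (LEAST i. i \<le> D \<and> \<beta> i \<noteq> 0)"
 have i0: "i0 \<le> D" "\<beta> i0 \<noteq> 0" using LeastI_ex[of "\<lambda>i. i \<le> D \<and> \<beta> i \<noteq> 0"] ex unfolding i0_def by auto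
 have i0l: "\<beta> i = 0" if "i < i0" for i
  using not_less_Least[of i "\<lambda>i. i \<le> D \<and> \<beta> i \<noteq> 0"] that i0 unfolding i0_def by auto
 define Ind where "Ind = {i. i + i0 \<le> D \<and> \<beta> (i + i0) \<noteq> 0}"
 have Ind: "0 \<in> Ind" "Ind \<subseteq> {..D}" using i0 by (auto simp: Ind_def)
 have fin: "finite Ind" using Ind finite_subset by blast
 define g where "g z = (\<Sum>i\<in>Ind. poly (\<beta> (i + i0)) z * w z ^ i)" for z
 have gw: "(\<Sum>i\<le>D. poly (\<beta> i) z * w z ^ i) = w z ^ i0 * g z" for z
 proof -
  have "(\<Sum>i\<le>D. poly (\<beta> i) z * w z ^ i) = (\<Sum>i\<in>(\<lambda>i. i + i0) ` Ind. poly (\<beta> i) z * w z ^ i)"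
  proof (rule sum.mono_neutral_right)
   show "\<forall>i\<in>{..D} - (\<lambda>i. i + i0) ` Ind. poly (\<beta> i) z * w z ^ i = 0"
   proof
    fix i assume i: "i \<in> {..D} - (\<lambda>i. i + i0) ` Ind"
    show "poly (\<beta> i) z * w z ^ i = 0"
    proof (cases "i < i0")
     case False
     hence "i - i0 \<notin> Ind" using i by (metis Diff_iff imageI le_add_diff_inverse2 not_le)
     thus ?thesis using i False by (auto simp: Ind_def)
    qed (simp add: i0l)
   qed
  qed (auto simp: Ind_def)
  also have "\<dots> = (\<Sum>i\<in>Ind. poly (\<beta> (i + i0)) z * w z ^ (i + i0))" by (subst sum.reindex) auto
  also have "\<dots> = w z ^ i0 * g z" by (simp add: g_def sum_distrib_left power_add algebra_simps)
  finally show ?thesis .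
 qed
 have contw: "continuous_on (ball 0 2) w" using w(1) by (rule holomorphic_on_imp_continuous_on)
 have holg: "g holomorphic_on ball 0 2" unfolding g_def by (intro holomorphic_intros w(1))
 have g0: "g z = 0" if z: "z \<in> ball 0 2" for z
 proof -
  have "isCont w 0" using contw continuous_on_eq_continuous_at[of "ball 0 2" w] by auto
  hence "eventually (\<lambda>z. w z \<noteq> 0) (nhds 0)"
   using w(2) by (auto simp: isCont_def dest: tendsto_imp_eventually_ne[of _ _ _ 0] simp: eventually_at_filter
     elim!: eventually_mono)
  then obtain S where S: "open S" "0 \<in> S" "\<And>z. z \<in> S \<Longrightarrow> w z \<noteq> 0" by (auto simp: eventually_nhds)
  show ?thesis
  proof (rule analytic_continuation_open[of "S \<inter> ball 0 2" "ball 0 2" g "\<lambda>_. 0" z])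
   show "g z = 0" if "z \<in> S \<inter> ball 0 2" for z using gw[of z] rel[of z] S(3)[of z] that by auto
  qed (use S holg z in auto)
 qed
 have "\<exists>m L X I. m > 0 \<and> finite X \<and> (L has_integral I) {1/2..1::real} \<and> I \<le> 7 * real K \<and>
  (\<forall>t\<in>{1/2..1}. L t \<ge> 0) \<and> (\<forall>z. norm (poly (\<beta> (i + i0)) z) \<le> m * max 1 (norm z) ^ K) \<and>
  (\<forall>z. norm z \<in> {1/2..1} - X \<longrightarrow> m * exp (- L (norm z)) \<le> norm (poly (\<beta> (i + i0)) z))" if "i \<in> Ind" for i
 proof -
  have "\<beta> (i + i0) \<noteq> 0" "degree (\<beta> (i + i0)) \<le> K" using that deg by (auto simp: Ind_def)
  note bb = poly_circle_bounds[OF this]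
  obtain m L X I where "m > 0" "finite X" "(L has_integral I) {1/2..1::real}" "I \<le> 7 * real K"
   "\<And>t. t \<in> {1/2..1} \<Longrightarrow> L t \<ge> 0"
   "\<And>z. norm (poly (\<beta> (i + i0)) z) \<le> m * max 1 (norm z) ^ K"
   "\<And>t z. t \<in> {1/2..1} - X \<Longrightarrow> norm z = t \<Longrightarrow> m * exp (- L t) \<le> norm (poly (\<beta> (i + i0)) z)"
   by (rule bb) blast
  thus ?thesis by (intro exI[of _ m] exI[of _ L] exI[of _ X] exI[of _ I]) simp
 qed
 hence "\<forall>i\<in>Ind. \<exists>q. case q of (m, L, X, I) \<Rightarrow> m > 0 \<and> finite X \<and> (L has_integral I) {1/2..1::real} \<and> I \<le> 7 * real K \<and>
  (\<forall>t\<in>{1/2..1}. L t \<ge> 0) \<and> (\<forall>z. norm (poly (\<beta> (i + i0)) z) \<le> m * max 1 (norm z) ^ K) \<and>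
  (\<forall>z. norm z \<in> {1/2..1} - X \<longrightarrow> m * exp (- L (norm z)) \<le> norm (poly (\<beta> (i + i0)) z))"
  by (simp add: split_paired_Ex)
 from bchoice[OF this] obtain q where q: "\<forall>i\<in>Ind. case q i of (m, L, X, I) \<Rightarrow> m > 0 \<and> finite X \<and> (L has_integral I) {1/2..1::real} \<and> I \<le> 7 * real K \<and>
  (\<forall>t\<in>{1/2..1}. L t \<ge> 0) \<and> (\<forall>z. norm (poly (\<beta> (i + i0)) z) \<le> m * max 1 (norm z) ^ K) \<and>
  (\<forall>z. norm z \<in> {1/2..1} - X \<longrightarrow> m * exp (- L (norm z)) \<le> norm (poly (\<beta> (i + i0)) z))" by blast
 define m where "m i = fst (q i)" for i
 define L where "L i = fst (snd (q i))" for i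
 define X where "X i = fst (snd (snd (q i)))" for i
 define I where "I i = snd (snd (snd (q i)))" for i
 have *: "\<And>i. i \<in> Ind \<Longrightarrow> m i > (0::real)" "\<And>i. i \<in> Ind \<Longrightarrow> finite (X i)"
  "\<And>i. i \<in> Ind \<Longrightarrow> (L i has_integral I i) {1/2..1::real}" "\<And>i. i \<in> Ind \<Longrightarrow> I i \<le> 7 * real K"
  "\<And>i t. i \<in> Ind \<Longrightarrow> t \<in> {1/2..1} \<Longrightarrow> L i t \<ge> 0"
  "\<And>i z. i \<in> Ind \<Longrightarrow> norm (poly (\<beta> (i + i0)) z) \<le> m i * max 1 (norm z) ^ K"
  "\<And>i z. i \<in> Ind \<Longrightarrow> norm z \<in> {1/2..1} - X i \<Longrightarrow> m i * exp (- L i (norm z)) \<le> norm (poly (\<beta> (i + i0)) z)"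
  using q by (auto simp: m_def L_def X_def I_def split_beta)
 \<comment> \<open>The sum dominates every single loss, so one function serves all
   coefficients.\<close>
 define LL where "LL t = (\<Sum>i\<in>Ind. L i t)" for t
 define XX where "XX = (\<Union>i\<in>Ind. X i)"
 have finXX: "finite XX" using * fin by (auto simp: XX_def)
 define h where "h t = 2 * (LL t + ln (real D + 1)) * (real D + 1)^2" for t
 have LL: "LL t \<ge> 0" if "t \<in> {1/2..1}" for t unfolding LL_def using * that by (intro sum_nonneg) auto
 have key: "w (complex_of_real t) \<noteq> 0 \<and> ln (norm (w 0)) - ln (norm (w (complex_of_real t))) \<le> h t"
  if t: "t \<in> {1/2..1}" "t \<notin> XX" for t
 proof -
  have "norm (poly (\<beta> (i + i0)) z) \<le> m i \<and> m i * exp (- LL t) \<le> norm (poly (\<beta> (i + i0)) z)" if "i \<in> Ind" "norm z = t" for i z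
  proof -
   have "L i t \<le> LL t" unfolding LL_def using * t that fin by (intro member_le_sum) auto
   hence "m i * exp (- LL t) \<le> m i * exp (- L i t)" using *(1)[OF that(1)] by (intro mult_left_mono) auto
   moreover have "max 1 (norm z) = 1" using that t by auto
   ultimately show ?thesis using *(6)[OF that(1), of z] *(7)[OF that(1), of z] that t by (auto simp: XX_def)
  qed
  moreover have "(\<Sum>i\<in>Ind. poly (\<beta> (i + i0)) z * w z ^ i) = 0" if "norm z = t" for z
   using g0[of z] that t by (auto simp: g_def)
  ultimately show ?thesis
   using algebraic_function_osc_on_circle[of w t Ind D m "LL t" "\<lambda>i. poly (\<beta> (i + i0))" "complex_of_real t"]
    w t Ind *(1) LL[OF t(1)] unfolding h_def by auto
 qed
 have hint: "(h has_integral (2 * ((\<Sum>i\<in>Ind. I i) + (1 - 1/2) *\<^sub>R ln (real D + 1)) * (real D + 1)^2)) {1/2..1}"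
  unfolding h_def LL_def using fin * has_integral_const_real[of "ln (real D + 1)" "1/2" 1]
  by (intro has_integral_mult_left has_integral_mult_right has_integral_add has_integral_sum) auto
 have h0: "h t \<ge> 0" if "t \<in> {1/2..1}" for t unfolding h_def using LL[OF that] by simp
 have "AE t in lborel. t \<notin> XX" using finite_imp_null_set_lborel[OF finXX] by (rule AE_not_in)
 hence "(\<integral>\<^sup>+t. (if w (complex_of_real t) = 0 then \<infinity> else ennreal (ln (norm (w 0)) - ln (norm (w (complex_of_real t)))))
   * indicator {1/2..1} t \<partial>lborel) \<le> (\<integral>\<^sup>+t. ennreal (h t) * indicator {1/2..1} t \<partial>lborel)"
 proof (intro nn_integral_mono_AE, eventually_elim)
  case (elim t)
  thus ?case using key[of t] by (auto simp: indicator_def intro!: ennreal_leI)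
 qed
 also have "\<dots> = ennreal (2 * ((\<Sum>i\<in>Ind. I i) + (1 - 1/2) *\<^sub>R ln (real D + 1)) * (real D + 1)^2)"
  by (rule nn_integral_has_integral_lebesgue'[OF h0 hint])
 also have "\<dots> \<le> ennreal (osc_bound D K)"
 proof (rule ennreal_leI)
  have "(\<Sum>i\<in>Ind. I i) \<le> real (card Ind) * (7 * real K)" using * by (intro sum_bounded_above) auto
  also have "\<dots> \<le> (real D + 1) * (7 * real K)" using card_mono[OF _ Ind(2)] by (intro mult_right_mono) auto
  finally have "(\<Sum>i\<in>Ind. I i) \<le> (real D + 1) * (7 * real K)" .
  thus "2 * ((\<Sum>i\<in>Ind. I i) + (1 - 1/2) *\<^sub>R ln (real D + 1)) * (real D + 1)^2 \<le> osc_bound D K"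
  proof -
   assume a: "(\<Sum>i\<in>Ind. I i) \<le> (real D + 1) * (7 * real K)"
   have "(\<Sum>i\<in>Ind. I i) + (1 - 1/2) *\<^sub>R ln (real D + 1) \<le> 7 * real K * (real D + 1) + ln (real D + 1)"
   proof -
    have "ln (real D + 1) \<ge> 0" by simp
    moreover have "s + (1 - 1/2) * x \<le> y + x" if "s \<le> y" "0 \<le> x" for s x y :: real using that by simp
    ultimately show ?thesis using a unfolding real_scaleR_def mult.commute[of "real D + 1"] by blast
   qed
   thus ?thesis unfolding osc_bound_def by (intro mult_right_mono mult_left_mono) auto
  qed
 qed
 finally show ?thesis .
qed

section \<open>Hausdorff measure\<close>

lemma diameter_le_dist:
 fixes S :: "'a::metric_space set"
 assumes "0 \<le> r" "\<And>x y. x \<in> S \<Longrightarrow> y \<in> S \<Longrightarrow> dist x y \<le> r" shows "diameter S \<le> r"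
 using assms by (auto simp: diameter_def intro: cSUP_least)

definition hterm :: "nat \<Rightarrow> 'a::metric_space set \<Rightarrow> ennreal" where
 "hterm d S = (if S = {} then 0 else ennreal (unit_ball_vol (real d) * (diameter S / 2) ^ d))"

definition hcov :: "real \<Rightarrow> 'a::metric_space set \<Rightarrow> (nat \<Rightarrow> 'a set) set" where
 "hcov \<delta> A = {S. A \<subseteq> (\<Union>i. S i) \<and> (\<forall>i. bounded (S i) \<and> diameter (S i) \<le> \<delta>)}"

lemma hausdorff_pre_eq: "hausdorff_pre d \<delta> A = (INF S \<in> hcov \<delta> A. \<Sum>i. hterm d (S i))"
 unfolding hausdorff_pre_def hcov_def hterm_def ..

lemma hterm_empty [simp]: "hterm d {} = 0" by (simp add: hterm_def)

lemma hausdorff_pre_le: "S \<in> hcov \<delta> A \<Longrightarrow> hausdorff_pre d \<delta> A \<le> (\<Sum>i. hterm d (S i))"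
 unfolding hausdorff_pre_eq by (rule INF_lower)

lemma hausdorff_pre_mono: "A \<subseteq> B \<Longrightarrow> hausdorff_pre d \<delta> A \<le> hausdorff_pre d \<delta> B"
 unfolding hausdorff_pre_eq by (rule INF_superset_mono) (auto simp: hcov_def)

lemma hausdorff_pre_antimono: "\<delta> \<le> \<delta>' \<Longrightarrow> hausdorff_pre d \<delta>' A \<le> hausdorff_pre d \<delta> A"
 unfolding hausdorff_pre_eq by (rule INF_superset_mono) (auto simp: hcov_def intro: order_trans)

lemma hausdorff_pre_empty: assumes "\<delta> > 0" shows "hausdorff_pre d \<delta> {} = 0"
proof -
 have "(\<lambda>_. {}) \<in> hcov \<delta> {}" using assms by (auto simp: hcov_def diameter_def)
 from hausdorff_pre_le[OF this, of d] show ?thesis by simp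
qed

lemma hausdorff_pre_countable_subadditive:
 assumes "\<delta> > 0" shows "hausdorff_pre d \<delta> (\<Union>i. A i) \<le> (\<Sum>i. hausdorff_pre d \<delta> (A i))"
proof (cases "(\<Sum>i. hausdorff_pre d \<delta> (A i)) = \<infinity>")
 case False
 hence fin: "hausdorff_pre d \<delta> (A i) < \<infinity>" for i
  using ennreal_suminf_lessD[of "\<lambda>i. hausdorff_pre d \<delta> (A i)" \<infinity> i] by (simp add: less_top)
 show ?thesis
 proof (rule ennreal_le_epsilon)
  fix e :: real assume e: "e > 0"
  have "\<exists>S\<in>hcov \<delta> (A i). (\<Sum>j. hterm d (S j)) < hausdorff_pre d \<delta> (A i) + ennreal (e * (1/2) ^ Suc i)" for i
  proof -
   have "hausdorff_pre d \<delta> (A i) < hausdorff_pre d \<delta> (A i) + ennreal (e * (1/2) ^ Suc i)"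
    using fin[of i] e by (simp add: ennreal_less_zero_iff less_top)
   thus ?thesis unfolding hausdorff_pre_eq[of d \<delta> "A i"] by (subst (asm) INF_less_iff) auto
  qed
  then obtain S where S: "\<And>i. S i \<in> hcov \<delta> (A i)"
   "\<And>i. (\<Sum>j. hterm d (S i j)) < hausdorff_pre d \<delta> (A i) + ennreal (e * (1/2) ^ Suc i)" by metis
  define T where "T n = S (fst (prod_decode n)) (snd (prod_decode n))" for n
  have "T \<in> hcov \<delta> (\<Union>i. A i)"
  proof -
   have "x \<in> (\<Union>n. T n)" if "x \<in> A i" for x i
   proof -
    obtain j where "x \<in> S i j" using S(1)[of i] \<open>x \<in> A i\<close> by (auto simp: hcov_def)
    hence "x \<in> T (prod_encode (i, j))" by (simp add: T_def)
    thus ?thesis by blast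
   qed
   moreover have "bounded (T n) \<and> diameter (T n) \<le> \<delta>" for n
    using S(1)[of "fst (prod_decode n)"] unfolding T_def hcov_def by blast
   ultimately show ?thesis by (auto simp: hcov_def)
  qed
  hence "hausdorff_pre d \<delta> (\<Union>i. A i) \<le> (\<Sum>n. hterm d (T n))" by (rule hausdorff_pre_le)
  also have "\<dots> = (\<Sum>n. (\<lambda>(i, j). hterm d (S i j)) (prod_decode n))"
   by (simp add: T_def split_beta)
  also have "\<dots> = (\<Sum>i. \<Sum>j. hterm d (S i j))" by (rule suminf_ennreal_2dimen) simp
  also have "\<dots> \<le> (\<Sum>i. hausdorff_pre d \<delta> (A i) + ennreal (e * (1/2) ^ Suc i))"
   by (intro suminf_le allI less_imp_le S) auto
  also have "\<dots> = (\<Sum>i. hausdorff_pre d \<delta> (A i)) + (\<Sum>i. ennreal (e * (1/2) ^ Suc i))"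
   by (subst suminf_add[symmetric]) auto
  also have "(\<Sum>i. ennreal (e * (1/2) ^ Suc i)) = ennreal e"
  proof (rule suminf_ennreal_eq)
   show "(\<lambda>i. e * (1 / 2) ^ Suc i) sums e" using sums_mult[OF power_half_series, of e] by simp
  qed (use e in auto)
  finally show "hausdorff_pre d \<delta> (\<Union>i. A i) \<le> (\<Sum>i. hausdorff_pre d \<delta> (A i)) + ennreal e" .
 qed
qed simp

lemma hausdorff_outer_mono: "A \<subseteq> B \<Longrightarrow> hausdorff_outer d A \<le> hausdorff_outer d B"
 unfolding hausdorff_outer_def by (intro SUP_mono) (auto intro: hausdorff_pre_mono)

lemma hausdorff_pre_le_outer: "\<delta> > 0 \<Longrightarrow> hausdorff_pre d \<delta> A \<le> hausdorff_outer d A"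
 unfolding hausdorff_outer_def by (rule SUP_upper) auto

lemma hausdorff_outer_empty [simp]: "hausdorff_outer d {} = 0"
proof -
 have "hausdorff_outer d {} \<le> 0" unfolding hausdorff_outer_def
  by (rule SUP_least) (simp add: hausdorff_pre_empty)
 thus ?thesis by simp
qed

lemma hausdorff_outer_countable_subadditive:
 "hausdorff_outer d (\<Union>i. A i) \<le> (\<Sum>i. hausdorff_outer d (A i))"
 unfolding hausdorff_outer_def[of d "\<Union>i. A i"]
proof (rule SUP_least)
 fix \<delta> :: real assume "\<delta> \<in> {0<..}"
 hence "hausdorff_pre d \<delta> (\<Union>i. A i) \<le> (\<Sum>i. hausdorff_pre d \<delta> (A i))"
  by (intro hausdorff_pre_countable_subadditive) auto
 also have "\<dots> \<le> (\<Sum>i. hausdorff_outer d (A i))"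
  using \<open>\<delta> \<in> {0<..}\<close> by (intro suminf_le) (auto intro: hausdorff_pre_le_outer)
 finally show "hausdorff_pre d \<delta> (\<Union>i. A i) \<le> (\<Sum>i. hausdorff_outer d (A i))" .
qed

lemma hausdorff_outer_space: "outer_measure_space UNIV (hausdorff_outer d)"
 unfolding outer_measure_space_def
proof (intro conjI)
 show "positive UNIV (hausdorff_outer d)" by (simp add: positive_def)
 show "increasing UNIV (hausdorff_outer d)" by (simp add: increasing_def hausdorff_outer_mono)
 show "countably_subadditive UNIV (hausdorff_outer d)"
  by (simp add: countably_subadditive_def hausdorff_outer_countable_subadditive)
qed

lemma hausdorff_outer_subadditive: "hausdorff_outer d (A \<union> B) \<le> hausdorff_outer d A + hausdorff_outer d B"
proof -
 have "hausdorff_outer d (\<Union>i. binaryset A B i) \<le> (\<Sum>i. hausdorff_outer d (binaryset A B i))"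
  by (rule hausdorff_outer_countable_subadditive)
 also have "\<dots> = hausdorff_outer d A + hausdorff_outer d B" by (rule suminf_binaryset_eq) simp
 finally show ?thesis by (simp add: UN_binaryset_eq)
qed

text \<open>A covering set of diameter below \<open>\<eta>\<close> meets at most one of
  \<open>A\<close> and \<open>B\<close>, so a fine cover of the union splits into covers of
  both.\<close>

lemma hausdorff_outer_metric:
 assumes "\<eta> > 0" "\<And>a b. a \<in> A \<Longrightarrow> b \<in> B \<Longrightarrow> dist a b \<ge> \<eta>"
 shows "hausdorff_outer d A + hausdorff_outer d B \<le> hausdorff_outer d (A \<union> B)"
proof -
 have "hausdorff_outer d A + hausdorff_outer d B = (SUP \<delta>\<in>{0<..}. hausdorff_pre d \<delta> A + hausdorff_pre d \<delta> B)"
  unfolding hausdorff_outer_def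
 proof (rule SUP_add_directed_ennreal[symmetric])
  fix i j :: real assume "i \<in> {0<..}" "j \<in> {0<..}"
  thus "\<exists>k\<in>{0<..}. hausdorff_pre d i A + hausdorff_pre d j B \<le> hausdorff_pre d k A + hausdorff_pre d k B"
   by (intro bexI[of _ "min i j"] add_mono hausdorff_pre_antimono) auto
 qed
 also have "\<dots> \<le> hausdorff_outer d (A \<union> B)"
 proof (rule SUP_least)
  fix \<delta>' :: real assume d': "\<delta>' \<in> {0<..}"
  define \<delta> where "\<delta> = min \<delta>' (\<eta>/2)"
  have \<delta>: "\<delta> > 0" "\<delta> < \<eta>" using d' assms by (auto simp: \<delta>_def)
  have "hausdorff_pre d \<delta>' A + hausdorff_pre d \<delta>' B \<le> hausdorff_pre d \<delta> A + hausdorff_pre d \<delta> B"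
   by (intro add_mono hausdorff_pre_antimono) (auto simp: \<delta>_def)
  also have "\<dots> \<le> hausdorff_pre d \<delta> (A \<union> B)"
   unfolding hausdorff_pre_eq[of d \<delta> "A \<union> B"]
  proof (rule INF_greatest)
   fix S assume S: "S \<in> hcov \<delta> (A \<union> B)"
   define SA where "SA i = (if S i \<inter> A = {} then {} else S i)" for i
   define SB where "SB i = (if S i \<inter> A = {} then S i else {})" for i
   have "SA \<in> hcov \<delta> A" using S \<delta>
    unfolding hcov_def SA_def by (auto simp: diameter_def[of "{}"] subset_eq) blast
   moreover have "SB \<in> hcov \<delta> B"
   proof -
    have "b \<in> (\<Union>i. SB i)" if b: "b \<in> B" for b
    proof -
     obtain i where i: "b \<in> S i" using S b by (auto simp: hcov_def)
     have "S i \<inter> A = {}"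
     proof (rule ccontr)
      assume "S i \<inter> A \<noteq> {}"
      then obtain a where a: "a \<in> S i" "a \<in> A" by blast
      have "dist a b \<le> diameter (S i)" using S a i by (intro diameter_bounded_bound) (auto simp: hcov_def)
      moreover have "diameter (S i) \<le> \<delta>" using S by (auto simp: hcov_def)
      ultimately show False using assms(2)[OF a(2) b] \<delta> by simp
     qed
     thus ?thesis using i by (auto simp: SB_def)
    qed
    thus ?thesis using S \<delta> unfolding hcov_def SB_def by (auto simp: diameter_def[of "{}"])
   qed
   ultimately have "hausdorff_pre d \<delta> A + hausdorff_pre d \<delta> B \<le> (\<Sum>i. hterm d (SA i)) + (\<Sum>i. hterm d (SB i))"
    by (intro add_mono hausdorff_pre_le)
   also have "\<dots> = (\<Sum>i. hterm d (SA i) + hterm d (SB i))" by (rule suminf_add) auto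
   also have "\<dots> = (\<Sum>i. hterm d (S i))" by (intro suminf_cong) (simp add: SA_def SB_def)
   finally show "hausdorff_pre d \<delta> A + hausdorff_pre d \<delta> B \<le> (\<Sum>i. hterm d (S i))" .
  qed
  also have "\<dots> \<le> hausdorff_outer d (A \<union> B)" using \<delta> by (intro hausdorff_pre_le_outer)
  finally show "hausdorff_pre d \<delta>' A + hausdorff_pre d \<delta>' B \<le> hausdorff_outer d (A \<union> B)" .
 qed
 finally show ?thesis .
qed

text \<open>Induction on the number of pieces; as only finite sums are treated, the gap may depend
  on \<open>n\<close>.\<close>

lemma hausdorff_outer_separated_sum:
 assumes "\<And>n. \<exists>\<eta>>0. \<forall>k<n. \<forall>x\<in>Q k. \<forall>y\<in>Q n. dist x y \<ge> \<eta>" "\<And>n. Q n \<subseteq> A"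
 shows "(\<Sum>k<(n::nat). hausdorff_outer d (Q k)) \<le> hausdorff_outer d A"
proof -
 have "(\<Sum>k<n. hausdorff_outer d (Q k)) \<le> hausdorff_outer d (\<Union>k<n. Q k)"
 proof (induct n)
  case (Suc n)
  obtain \<eta> where \<eta>: "\<eta> > 0" "\<forall>k<n. \<forall>x\<in>Q k. \<forall>y\<in>Q n. dist x y \<ge> \<eta>" using assms(1) by blast
  have "(\<Sum>k<Suc n. hausdorff_outer d (Q k)) \<le> hausdorff_outer d (\<Union>k<n. Q k) + hausdorff_outer d (Q n)"
   using Suc by (simp add: add_mono)
  also have "\<dots> \<le> hausdorff_outer d ((\<Union>k<n. Q k) \<union> Q n)"
   by (rule hausdorff_outer_metric[OF \<eta>(1)]) (use \<eta>(2) in blast)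
  finally show ?case by (simp add: lessThan_Suc Un_commute)
 qed simp
 also have "\<dots> \<le> hausdorff_outer d A" using assms(2) by (intro hausdorff_outer_mono) auto
 finally show ?thesis .
qed

text \<open>Caratheodory's criterion for metric outer measures: the part of the complement of \<^term>\<open>F\<close> close to
 \<^term>\<open>F\<close> is split into annuli; those of even (odd) index are pairwise at positive distance.\<close>
lemma hausdorff_outer_closed_measurable:
 fixes F :: "'a::metric_space set"
 assumes F: "closed F"
 shows "hausdorff_outer d (A \<inter> F) + hausdorff_outer d (A - F) \<le> hausdorff_outer d A"
proof (cases "F = {} \<or> hausdorff_outer d A = \<infinity>")
 case False
 hence Fne: "F \<noteq> {}" and fin: "hausdorff_outer d A \<noteq> \<infinity>" by auto
 define u where "u x = infdist x F" for x :: 'a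
 have u_lip: "u x \<le> u y + dist x y" for x y unfolding u_def by (rule infdist_triangle)
 define E where "E n = {x \<in> A - F. u x \<ge> 1 / (real n + 1)}" for n
 define R where "R n = {x \<in> A - F. 1 / (real n + 2) \<le> u x \<and> u x < 1 / (real n + 1)}" for n
 have EF: "hausdorff_outer d (A \<inter> F) + hausdorff_outer d (E n) \<le> hausdorff_outer d A" for n
 proof -
  have "hausdorff_outer d (A \<inter> F) + hausdorff_outer d (E n) \<le> hausdorff_outer d ((A \<inter> F) \<union> E n)"
  proof (rule hausdorff_outer_metric[of "1 / (real n + 1)"])
   fix a b assume "a \<in> A \<inter> F" "b \<in> E n"
   thus "1 / (real n + 1) \<le> dist a b" using u_lip[of b a] Fne by (auto simp: E_def u_def dist_commute)
  qed auto
  also have "\<dots> \<le> hausdorff_outer d A" by (rule hausdorff_outer_mono) (auto simp: E_def)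
  finally show ?thesis .
 qed
 have half: "(\<Sum>k<n. hausdorff_outer d (R (2 * k + c))) \<le> hausdorff_outer d A" for n c
 proof (rule hausdorff_outer_separated_sum)
  fix n
  \<comment> \<open>Points of \<open>R (2 * k + c)\<close> with \<open>k < n\<close> have distance
    at least \<open>1 / (2 n + c)\<close> from \<open>F\<close>, points of
    \<open>R (2 * n + c)\<close> less than \<open>1 / (2 n + c + 1)\<close>.\<close>
  let ?\<eta> = "1 / (real (2 * n + c)) - 1 / (real (2 * n + c) + 1)"
  show "\<exists>\<eta>>0. \<forall>k<n. \<forall>x\<in>R (2 * k + c). \<forall>y\<in>R (2 * n + c). \<eta> \<le> dist x y"
  proof (cases "n = 0")
   case True thus ?thesis by (auto intro: exI[of _ 1])
  next
   case False
   hence "?\<eta> > 0" using divide_strict_left_mono[of "real (2 * n + c)" "real (2 * n + c) + 1" 1] by simp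
   moreover have "?\<eta> \<le> dist x y" if k: "k < n" and x: "x \<in> R (2 * k + c)" and y: "y \<in> R (2 * n + c)" for k x y
   proof -
    have "1 / real (2 * n + c) \<le> 1 / (real (2 * k + c) + 2)" using k by (intro divide_left_mono) auto
    also have "\<dots> \<le> u x" using x by (auto simp: R_def)
    finally show ?thesis using y u_lip[of x y] by (auto simp: R_def)
   qed
   ultimately show ?thesis by blast
  qed
 qed (auto simp: R_def)
 define f where "f k = hausdorff_outer d (R k)" for k
 have part: "(\<Sum>k<2 * n. f k) = (\<Sum>k<n. f (2 * k + 0)) + (\<Sum>k<n. f (2 * k + 1))" for n
  by (induction n) (auto simp: algebra_simps)
 have "(\<Sum>k<n. f k) \<le> 2 * hausdorff_outer d A" for n
 proof -
  have "(\<Sum>k<n. f k) \<le> (\<Sum>k<2 * n. f k)" by (intro sum_mono2) auto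
  also have "\<dots> \<le> hausdorff_outer d A + hausdorff_outer d A"
   unfolding part using half[of 0 n] half[of 1 n] by (intro add_mono) (auto simp: f_def)
  finally show ?thesis by (simp add: mult_2)
 qed
 hence "suminf f \<le> 2 * hausdorff_outer d A" by (intro suminf_le_const) auto
 hence sf: "suminf f < \<infinity>" using fin by (simp add: ennreal_mult_less_top less_top order_le_less_trans)
 have ft: "f k \<noteq> \<infinity>" for k using ennreal_suminf_lessD[OF sf, of k] by simp
 define r where "r k = enn2real (f k)" for k
 have fr: "f k = ennreal (r k)" for k using ft[of k] by (simp add: r_def less_top)
 have "summable r"
  using sf unfolding fr by (intro summable_suminf_not_top) (auto simp: r_def)
 have "hausdorff_outer d (A \<inter> F) + hausdorff_outer d (A - F) \<le> hausdorff_outer d A + ennreal e" if e: "e > 0" for e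
 proof -
  \<comment> \<open>The annuli from index \<open>N\<close> on carry little measure because their sum
    converges; what remains is \<open>E N\<close>, at positive distance from
    \<open>F\<close>.\<close>
  obtain N where N: "norm (\<Sum>i. r (i + N)) < e" using suminf_exist_split[OF e \<open>summable r\<close>] by auto
  have "A - F \<subseteq> E N \<union> (\<Union>i. R (i + N))"
  proof
   fix x assume x: "x \<in> A - F"
   show "x \<in> E N \<union> (\<Union>i. R (i + N))"
   proof (cases "u x \<ge> 1 / (real N + 1)")
    case False
    have "u x > 0" using x F Fne unfolding u_def by (metis DiffD2 in_closed_iff_infdist_zero infdist_nonneg less_eq_real_def)
    then obtain n0 where n0: "inverse (real (Suc n0)) < u x" using reals_Archimedean by blast
    define m where "m = (LEAST m. 1 / (real m + 2) \<le> u x)"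
    have ex: "1 / (real n0 + 2) \<le> u x"
    proof -
     have "1 / (real n0 + 2) \<le> inverse (real (Suc n0))" by (simp add: field_simps)
     thus ?thesis using n0 by simp
    qed
    have m: "1 / (real m + 2) \<le> u x" unfolding m_def by (rule LeastI[of _ n0]) (rule ex)
    have mN: "m \<ge> N"
    proof (rule ccontr)
     assume "\<not> m \<ge> N"
     hence "1 / (real N + 1) \<le> 1 / (real m + 2)" by (intro divide_left_mono) auto
     thus False using m False by simp
    qed
    have "u x < 1 / (real m + 1)"
    proof (cases "m = N")
     case True thus ?thesis using False by simp
    next
     case F2: False
     hence "m - 1 < m" using mN by simp
     from not_less_Least[OF this[unfolded m_def]] have "\<not> 1 / (real (m - 1) + 2) \<le> u x" by (simp add: m_def)
     moreover have "real (m - 1) + 2 = real m + 1" using F2 mN by simp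
     ultimately show ?thesis by (simp add: add.commute not_le)
    qed
    hence "x \<in> R ((m - N) + N)" using x m mN by (auto simp: R_def)
    thus ?thesis by blast
   qed (use x in \<open>auto simp: E_def\<close>)
  qed
  hence "hausdorff_outer d (A - F) \<le> hausdorff_outer d (E N) + hausdorff_outer d (\<Union>i. R (i + N))"
   by (meson hausdorff_outer_mono hausdorff_outer_subadditive order_trans)
  also have "hausdorff_outer d (\<Union>i. R (i + N)) \<le> (\<Sum>i. f (i + N))"
   unfolding f_def by (rule hausdorff_outer_countable_subadditive)
  also have "(\<Sum>i. f (i + N)) = ennreal (\<Sum>i. r (i + N))"
  proof -
   have "r i \<ge> 0" for i by (simp add: r_def)
   moreover have "summable (\<lambda>i. r (i + N))" using \<open>summable r\<close> by (simp add: summable_iff_shift)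
   ultimately show ?thesis unfolding fr by (intro suminf_ennreal2) auto
  qed
  also have "\<dots> \<le> ennreal e" using N by (intro ennreal_leI) auto
  finally have "hausdorff_outer d (A - F) \<le> hausdorff_outer d (E N) + ennreal e" by (simp add: add_left_mono)
  hence "hausdorff_outer d (A \<inter> F) + hausdorff_outer d (A - F) \<le> hausdorff_outer d (A \<inter> F) + hausdorff_outer d (E N) + ennreal e"
   by (simp add: add.assoc add_left_mono)
  also have "\<dots> \<le> hausdorff_outer d A + ennreal e" by (intro add_right_mono EF)
  finally show ?thesis .
 qed
 thus ?thesis by (rule ennreal_le_epsilon)
qed auto

lemma sets_hausdorff [simp, measurable_cong]: "sets (hausdorff_measure d) = sets borel"
 unfolding hausdorff_measure_def by (simp add: sets.sigma_sets_eq[of borel, simplified])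

lemma space_hausdorff [simp]: "space (hausdorff_measure d) = UNIV"
 unfolding hausdorff_measure_def by (simp add: space_measure_of_conv)

text \<open>By Caratheodory the closed sets, hence all Borel sets, split every set additively. Only
  with this countable additivity does \<open>measure_of\<close> return the outer measure instead of
  a default value.\<close>

lemma emeasure_hausdorff:
 fixes A :: "'a::metric_space set"
 assumes "A \<in> sets borel" shows "emeasure (hausdorff_measure d) A = hausdorff_outer d A"
proof -
 let ?L = "lambda_system (UNIV::'a set) UNIV (hausdorff_outer d)"
 interpret U: sigma_algebra UNIV "UNIV :: 'a set set" using sigma_algebra_Pow[of "UNIV::'a set"] by simp
 have ms: "measure_space UNIV ?L (hausdorff_outer d)"
  by (rule U.caratheodory_lemma[OF hausdorff_outer_space])
 hence sa: "sigma_algebra UNIV ?L" by (simp add: measure_space_def)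
 have "S \<in> ?L" if "open S" for S :: "'a set"
 proof -
  have "- S \<in> ?L"
   unfolding U.lambda_system_eq
  proof (intro CollectI conjI ballI)
   fix x :: "'a set"
   show "hausdorff_outer d (x \<inter> - S) + hausdorff_outer d (x - - S) = hausdorff_outer d x"
   proof (rule antisym)
    show "hausdorff_outer d (x \<inter> - S) + hausdorff_outer d (x - - S) \<le> hausdorff_outer d x"
     using that by (intro hausdorff_outer_closed_measurable) (simp add: closed_Compl)
    have "x = (x \<inter> - S) \<union> (x - - S)" by auto
    thus "hausdorff_outer d x \<le> hausdorff_outer d (x \<inter> - S) + hausdorff_outer d (x - - S)"
     using hausdorff_outer_subadditive by metis
   qed
  qed auto
  then show ?thesis using sigma_algebra.axioms(1)[OF sa] algebra.compl_sets[OF sigma_algebra.axioms(1)[OF sa], of "- S"]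
   by (simp add: Diff_eq)
 qed
 hence "sigma_sets UNIV {S::'a set. open S} \<subseteq> ?L"
  by (intro sigma_algebra.sigma_sets_subset[OF sa]) auto
 hence bL: "sets (borel :: 'a measure) \<subseteq> ?L" by (simp add: borel_def)
 show ?thesis unfolding hausdorff_measure_def
 proof (rule emeasure_measure_of_sigma[OF _ _ _ assms])
  show "sigma_algebra UNIV (sets (borel::'a measure))" using sets.sigma_algebra_axioms[of "borel::'a measure"] by simp
  show "positive (sets (borel::'a measure)) (hausdorff_outer d)" by (simp add: positive_def)
  show "countably_additive (sets (borel::'a measure)) (hausdorff_outer d)"
   using ms bL unfolding measure_space_def countably_additive_def by (meson subset_iff)
 qed
qed

text \<open>The image of a cover at scale \<open>\<delta> / M\<close> is a cover at scale
  \<open>\<delta>\<close>. The covering sets are intersected with \<open>A\<close> before mapping,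
  since \<open>f\<close> is controlled on \<open>A\<close> only.\<close>

lemma hausdorff_outer_lipschitz_image:
 fixes f :: "'a::metric_space \<Rightarrow> 'b::metric_space"
 assumes M: "M > 0" and lip: "\<And>x y. x \<in> A \<Longrightarrow> y \<in> A \<Longrightarrow> dist (f x) (f y) \<le> M * dist x y"
 shows "hausdorff_outer d (f ` A) \<le> ennreal (M ^ d) * hausdorff_outer d A"
 unfolding hausdorff_outer_def[of d "f ` A"]
proof (rule SUP_least)
 fix \<delta> :: real assume "\<delta> \<in> {0<..}"
 hence d: "\<delta> / M > 0" using M by simp
 have "hausdorff_pre d \<delta> (f ` A) \<le> ennreal (M ^ d) * (\<Sum>i. hterm d (S i))" if S: "S \<in> hcov (\<delta> / M) A" for S
 proof -
  define T where "T i = f ` (S i \<inter> A)" for i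
  have di: "dist x y \<le> M * diameter (S i)" if "x \<in> T i" "y \<in> T i" for x y i
  proof -
   have "x \<in> f ` (S i \<inter> A)" "y \<in> f ` (S i \<inter> A)" using that by (auto simp: T_def)
   then obtain a b where ab: "a \<in> S i \<inter> A" "b \<in> S i \<inter> A" "x = f a" "y = f b" by blast
   have "dist x y \<le> M * dist a b" using ab lip by auto
   also have "\<dots> \<le> M * diameter (S i)" using M S ab
    by (intro mult_left_mono diameter_bounded_bound) (auto simp: hcov_def)
   finally show ?thesis .
  qed
  have dS: "0 \<le> diameter (S i)" for i using S by (intro diameter_ge_0) (auto simp: hcov_def)
  have dT: "diameter (T i) \<le> M * diameter (S i)" for i
   using di M dS[of i] by (intro diameter_le_dist) auto
  have bT: "bounded (T i)" for i
   using di[of _ i] unfolding bounded_def by blast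
  have "T \<in> hcov \<delta> (f ` A)"
   unfolding hcov_def
  proof (intro CollectI conjI allI bT)
   show "f ` A \<subseteq> (\<Union>i. T i)" using S by (auto simp: T_def hcov_def) blast
   fix i
   have "M * diameter (S i) \<le> M * (\<delta> / M)" using S M by (intro mult_left_mono) (auto simp: hcov_def)
   thus "diameter (T i) \<le> \<delta>" using dT[of i] M by simp
  qed
  hence "hausdorff_pre d \<delta> (f ` A) \<le> (\<Sum>i. hterm d (T i))" by (rule hausdorff_pre_le)
  also have "\<dots> \<le> (\<Sum>i. ennreal (M ^ d) * hterm d (S i))"
  proof (intro suminf_le)
   fix i
   show "hterm d (T i) \<le> ennreal (M ^ d) * hterm d (S i)"
   proof (cases "T i = {}")
    case False
    hence S': "S i \<noteq> {}" by (auto simp: T_def)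
    have "unit_ball_vol (real d) * (diameter (T i) / 2) ^ d \<le> unit_ball_vol (real d) * ((M * diameter (S i)) / 2) ^ d"
     using dT[of i] diameter_ge_0[OF bT[of i]] by (intro mult_left_mono power_mono divide_right_mono) auto
    also have "\<dots> = M ^ d * (unit_ball_vol (real d) * (diameter (S i) / 2) ^ d)"
     by (simp add: power_mult_distrib power_divide)
    finally show ?thesis using False S' M dS[of i]
     by (simp add: hterm_def ennreal_mult[symmetric] ennreal_leI)
   qed simp
  qed auto
  also have "\<dots> = ennreal (M ^ d) * (\<Sum>i. hterm d (S i))" by simp
  finally show ?thesis .
 qed
 note cover = this
 have "hausdorff_pre d \<delta> (f ` A) \<le> ennreal (M ^ d) * hausdorff_pre d (\<delta> / M) A"
 proof (rule ennreal_le_epsilon)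
  fix e :: real assume "ennreal (M ^ d) * hausdorff_pre d (\<delta> / M) A < top" and e: "0 < e"
  hence "hausdorff_pre d (\<delta> / M) A < top" using M by (auto simp: ennreal_mult_less_top)
  hence "hausdorff_pre d (\<delta> / M) A < hausdorff_pre d (\<delta> / M) A + ennreal (e / M ^ d)"
   using e M by (simp add: ennreal_less_zero_iff less_top)
  then obtain S where S: "S \<in> hcov (\<delta> / M) A" "(\<Sum>i. hterm d (S i)) < hausdorff_pre d (\<delta> / M) A + ennreal (e / M ^ d)"
   unfolding hausdorff_pre_eq[of d "\<delta> / M" A] by (subst (asm) INF_less_iff) auto
  have "hausdorff_pre d \<delta> (f ` A) \<le> ennreal (M ^ d) * (hausdorff_pre d (\<delta> / M) A + ennreal (e / M ^ d))"
   using cover[OF S(1)] S(2) by (meson less_imp_le mult_left_mono order_trans zero_le)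
  also have "\<dots> = ennreal (M ^ d) * hausdorff_pre d (\<delta> / M) A + ennreal e"
   using M e by (simp add: distrib_left ennreal_mult[symmetric])
  finally show "hausdorff_pre d \<delta> (f ` A) \<le> ennreal (M ^ d) * hausdorff_pre d (\<delta> / M) A + ennreal e" .
 qed
 also have "\<dots> \<le> ennreal (M ^ d) * hausdorff_outer d A" using d by (intro mult_left_mono hausdorff_pre_le_outer) auto
 finally show "hausdorff_pre d \<delta> (f ` A) \<le> ennreal (M ^ d) * hausdorff_outer d A" .
qed

section \<open>Coordinate projections and balls in coordinate subspaces\<close>

definition pj :: "'n set \<Rightarrow> real^'n \<Rightarrow> real^'n" where
 "pj J z = (\<chi> i. if i \<in> J then z $ i else 0)"

lemma pj_nth [simp]: "pj J z $ i = (if i \<in> J then z $ i else 0)" by (simp add: pj_def)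

lemma pj_linear: "linear (pj J)"
 by (auto intro!: linearI simp: vec_eq_iff)

lemma pj_add [simp]: "pj J (x + y) = pj J x + pj J y" by (auto simp: vec_eq_iff)
lemma pj_diff [simp]: "pj J (x - y) = pj J x - pj J y" by (auto simp: vec_eq_iff)
lemma pj_scale [simp]: "pj J (s *\<^sub>R x) = s *\<^sub>R pj J x" by (auto simp: vec_eq_iff)
lemma pj_0 [simp]: "pj J 0 = 0" by (auto simp: vec_eq_iff)
lemma pj_pj [simp]: "pj J (pj J x) = pj J x" by (auto simp: vec_eq_iff)

lemma norm_pj_le: "norm (pj J (z :: real^'n)) \<le> norm z"
 unfolding norm_vec_def L2_set_def by (intro real_sqrt_le_mono sum_mono) auto

lemma continuous_on_pj [continuous_intros]:
 "continuous_on S f \<Longrightarrow> continuous_on S (\<lambda>x. pj J (f x :: real^'n))"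
 using linear_continuous_on[of "pj J"] linear_conv_bounded_linear[of "pj J"] pj_linear[of J]
 by (metis continuous_on_compose2 subset_UNIV)

text \<open>A coordinate subspace stays inside the ambient type as the set of points with zero
  coordinates outside \<open>J\<close>; this is a ball in it.\<close>

definition jball :: "'n set \<Rightarrow> real \<Rightarrow> (real^'n) set" where
 "jball J r = {z. pj J z = z \<and> norm z < r}"

lemma jball_borel [measurable]: "jball J r \<in> sets (borel :: (real^'n) measure)"
proof -
 have "jball J r = {z. pj J z = z} \<inter> ball 0 r" by (auto simp: jball_def)
 moreover have "closed {z :: real^'n. pj J z = z}"
  by (intro closed_Collect_eq continuous_intros)
 ultimately show ?thesis by (auto intro!: borel_closed)
qed

lemma jball_scale: assumes "s > 0" shows "(\<lambda>z. s *\<^sub>R z) ` jball J r = jball J (s * r)"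
proof (intro equalityI subsetI)
 fix z assume "z \<in> jball J (s * r)"
 hence "(1/s) *\<^sub>R z \<in> jball J r" "z = s *\<^sub>R ((1/s) *\<^sub>R z)" using assms by (auto simp: jball_def field_simps)
 thus "z \<in> (\<lambda>z. s *\<^sub>R z) ` jball J r" by blast
qed (use assms in \<open>auto simp: jball_def\<close>)

lemma hausdorff_outer_scale:
 fixes A :: "'a::real_normed_vector set"
 assumes s: "s > 0"
 shows "hausdorff_outer d ((\<lambda>z. s *\<^sub>R z) ` A) = ennreal (s ^ d) * hausdorff_outer d A"
proof (rule antisym)
 show "hausdorff_outer d ((\<lambda>z. s *\<^sub>R z) ` A) \<le> ennreal (s ^ d) * hausdorff_outer d A"
  using s by (intro hausdorff_outer_lipschitz_image) (auto simp: dist_norm simp flip: scaleR_diff_right)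
 have "hausdorff_outer d ((\<lambda>z. (1/s) *\<^sub>R z) ` (\<lambda>z. s *\<^sub>R z) ` A) \<le> ennreal ((1/s) ^ d) * hausdorff_outer d ((\<lambda>z. s *\<^sub>R z) ` A)"
  using s by (intro hausdorff_outer_lipschitz_image) (auto simp: dist_norm simp flip: scaleR_diff_right)
 also have "(\<lambda>z. (1/s) *\<^sub>R z) ` (\<lambda>z. s *\<^sub>R z) ` A = A" using s by (simp add: image_image)
 finally have "ennreal (s ^ d) * hausdorff_outer d A \<le> ennreal (s ^ d) * (ennreal ((1/s) ^ d) * hausdorff_outer d ((\<lambda>z. s *\<^sub>R z) ` A))"
  by (intro mult_left_mono) auto
 also have "\<dots> = hausdorff_outer d ((\<lambda>z. s *\<^sub>R z) ` A)"
  using s by (simp add: mult.assoc[symmetric] ennreal_mult[symmetric] power_divide)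
 finally show "ennreal (s ^ d) * hausdorff_outer d A \<le> hausdorff_outer d ((\<lambda>z. s *\<^sub>R z) ` A)" .
qed

lemma hausdorff_pre_finite_cover:
 assumes "finite K" "A \<subseteq> (\<Union>k\<in>K. T k)" "\<And>k. k \<in> K \<Longrightarrow> bounded (T k)" "\<And>k. k \<in> K \<Longrightarrow> diameter (T k) \<le> \<delta>" "\<delta> > 0"
 shows "hausdorff_pre d \<delta> A \<le> (\<Sum>k\<in>K. hterm d (T k))"
proof -
 obtain h where h: "bij_betw h {..<card K} K" using ex_bij_betw_nat_finite[OF assms(1)] by (auto simp: atLeast0LessThan)
 define S where "S i = (if i < card K then T (h i) else {})" for i
 have hK: "h i \<in> K" if "i < card K" for i using h that by (auto simp: bij_betw_def)
 have "S \<in> hcov \<delta> A"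
  unfolding hcov_def
 proof (intro CollectI conjI allI)
  show "A \<subseteq> (\<Union>i. S i)"
  proof
   fix x assume "x \<in> A"
   then obtain k where k: "k \<in> K" "x \<in> T k" using assms(2) by blast
   then obtain i where "i < card K" "k = h i" using h by (auto simp: bij_betw_def)
   thus "x \<in> (\<Union>i. S i)" using k by (auto simp: S_def)
  qed
 qed (use assms hK in \<open>auto simp: S_def diameter_def[of "{}"]\<close>)
 hence "hausdorff_pre d \<delta> A \<le> (\<Sum>i. hterm d (S i))" by (rule hausdorff_pre_le)
 also have "\<dots> = (\<Sum>i<card K. hterm d (S i))" by (rule suminf_finite) (auto simp: S_def)
 also have "\<dots> = (\<Sum>i<card K. hterm d (T (h i)))" by (intro sum.cong) (auto simp: S_def)
 also have "\<dots> = (\<Sum>k\<in>K. hterm d (T k))" by (rule sum.reindex_bij_betw[OF h])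
 finally show ?thesis .
qed

text \<open>A grid of \<open>N ^ d\<close> cubes covers the ball; their diameters are bounded
  crudely through the sum norm, which changes only the constant.\<close>

lemma hausdorff_jball_finite:
 fixes J :: "'n::finite set"
 shows "hausdorff_outer (card J) (jball J 1) < \<infinity>"
proof -
 define d where "d = card J"
 define n where "n = real (card (UNIV :: 'n set))"
 have n1: "n \<ge> 1" unfolding n_def using card_gt_0_iff[of "UNIV::'n set"] by simp
 define B where "B = unit_ball_vol (real d) * n ^ d"
 have "hausdorff_outer d (jball J 1) \<le> ennreal B"
  unfolding hausdorff_outer_def
 proof (rule SUP_least)
  fix \<delta> :: real assume "\<delta> \<in> {0<..}"
  hence \<delta>: "\<delta> > 0" by simp
  obtain N0 :: nat where N0: "2 * n / \<delta> < real N0" using reals_Archimedean2 by blast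
  define N where "N = Suc N0"
  have N: "N > 0" "2 * n / real N \<le> \<delta>" using N0 \<delta> by (auto simp: N_def field_simps)
  define Q where "Q k = {z :: real^'n. pj J z = z \<and> (\<forall>i\<in>J. -1 + 2 * real (k i) / real N \<le> z $ i \<and> z $ i \<le> -1 + 2 * (real (k i) + 1) / real N)}" for k :: "'n \<Rightarrow> nat"
  have dQ: "dist x y \<le> 2 * n / real N" if "x \<in> Q k" "y \<in> Q k" for x y k
  proof -
   have "\<bar>(x - y) $ i\<bar> \<le> 2 / real N" for i
   proof (cases "i \<in> J")
    case True
    have "2 * (real (k i) + 1) / real N = 2 * real (k i) / real N + 2 / real N" by (simp add: add_divide_distrib)
    moreover have "-1 + 2 * real (k i) / real N \<le> x $ i" "x $ i \<le> -1 + 2 * (real (k i) + 1) / real N"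
     "-1 + 2 * real (k i) / real N \<le> y $ i" "y $ i \<le> -1 + 2 * (real (k i) + 1) / real N"
     using that True by (auto simp: Q_def)
    ultimately show ?thesis by simp
   next
    case False
    have "x $ i = 0" "y $ i = 0" using that False pj_nth[of J x i] pj_nth[of J y i] by (auto simp: Q_def simp del: pj_nth)
    thus ?thesis by simp
   qed
   hence "(\<Sum>i\<in>UNIV. \<bar>(x - y) $ i\<bar>) \<le> (\<Sum>i\<in>(UNIV::'n set). 2 / real N)" by (intro sum_mono)
   thus ?thesis using norm_le_l1_cart[of "x - y"] by (simp add: dist_norm n_def mult.commute)
  qed
  have diaQ: "diameter (Q k) \<le> 2 * n / real N" for k using dQ n1 by (intro diameter_le_dist) auto
  have bQ: "bounded (Q k)" for k using dQ[of _ k] unfolding bounded_def by blast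
  define K where "K = (PiE J (\<lambda>_. {..<N}))"
  have K: "finite K" "card K = N ^ d" by (auto simp: K_def d_def card_PiE intro: finite_PiE)
  have "hausdorff_pre d \<delta> (jball J 1) \<le> (\<Sum>k\<in>K. hterm d (Q k))"
  proof (rule hausdorff_pre_finite_cover[OF K(1) _ bQ _ \<delta>])
   show "jball J 1 \<subseteq> (\<Union>k\<in>K. Q k)"
   proof
    fix z :: "real^'n" assume z: "z \<in> jball J 1"
    define k where "k = restrict (\<lambda>i. nat \<lfloor>(z $ i + 1) / 2 * real N\<rfloor>) J"
    have zi: "\<bar>z $ i\<bar> < 1" for i using z component_le_norm_cart[of z i] by (auto simp: jball_def)
    have fl: "0 \<le> (z $ i + 1) / 2 * real N" "(z $ i + 1) / 2 * real N < real N" for i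
    proof -
     have "(z $ i + 1) / 2 < 1" "0 \<le> (z $ i + 1) / 2" using zi[of i] by (auto simp: abs_less_iff)
     thus "0 \<le> (z $ i + 1) / 2 * real N" "(z $ i + 1) / 2 * real N < real N" using N by auto
    qed
    have kk: "real (k i) \<le> (z $ i + 1) / 2 * real N" "(z $ i + 1) / 2 * real N \<le> real (k i) + 1" if "i \<in> J" for i
    proof -
     have "real (nat \<lfloor>y\<rfloor>) \<le> y \<and> y \<le> real (nat \<lfloor>y\<rfloor>) + 1" if "0 \<le> y" for y :: real
      using that of_int_floor_le[of y] real_of_int_floor_add_one_ge[of y] by simp
     from this[OF fl(1)[of i]] have "real (k i) \<le> (z $ i + 1) / 2 * real N \<and> (z $ i + 1) / 2 * real N \<le> real (k i) + 1"
      using \<open>i \<in> J\<close> unfolding k_def restrict_def by (simp only: if_True)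
     thus "real (k i) \<le> (z $ i + 1) / 2 * real N" "(z $ i + 1) / 2 * real N \<le> real (k i) + 1"
      by blast+
    qed
    have "k \<in> K"
     unfolding K_def
    proof (rule PiE_I)
     fix i assume "i \<in> J"
     hence "real (k i) < real N" using kk(1)[of i] fl(2)[of i] by simp
     thus "k i \<in> {..<N}" by simp
    qed (auto simp: k_def)
    moreover have "z \<in> Q k"
     unfolding Q_def
    proof (intro CollectI conjI ballI)
     fix i assume "i \<in> J"
     from kk[OF this] show "-1 + 2 * real (k i) / real N \<le> z $ i" "z $ i \<le> -1 + 2 * (real (k i) + 1) / real N"
      using N by (auto simp: field_simps)
    qed (use z in \<open>auto simp: jball_def\<close>)
    ultimately show "z \<in> (\<Union>k\<in>K. Q k)" by blast
   qed
  qed (use diaQ N in \<open>auto intro: order_trans\<close>)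
  also have "\<dots> \<le> (\<Sum>k\<in>K. ennreal (unit_ball_vol (real d) * (n / real N) ^ d))"
  proof (rule sum_mono)
   fix k
   show "hterm d (Q k) \<le> ennreal (unit_ball_vol (real d) * (n / real N) ^ d)"
    using diaQ[of k] diameter_ge_0[OF bQ[of k]] unfolding hterm_def
    by (auto intro!: ennreal_leI mult_left_mono power_mono)
  qed
  also have "\<dots> = of_nat (N ^ d) * ennreal (unit_ball_vol (real d) * (n / real N) ^ d)"
   by (simp add: K)
  also have "\<dots> = ennreal (real (N ^ d) * (unit_ball_vol (real d) * (n / real N) ^ d))"
   by (simp add: ennreal_mult' ennreal_of_nat_eq_real_of_nat del: of_nat_power)
  also have "real (N ^ d) * (unit_ball_vol (real d) * (n / real N) ^ d) = B"
   using N by (simp add: B_def power_divide)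
  finally show "hausdorff_pre d \<delta> (jball J 1) \<le> ennreal B" .
 qed
 thus ?thesis unfolding d_def[symmetric] by (auto intro: order_le_less_trans)
qed

text \<open>Comparison with Lebesgue measure of the ambient space: each covering set is thickened to
  a box of side 2 in the directions outside \<open>J\<close>, and these boxes cover the unit
  ball.\<close>

lemma hausdorff_jball_pos:
 fixes J :: "'n::finite set"
 shows "hausdorff_outer (card J) (jball J 1) > 0"
proof -
 define d where "d = card J"
 define n where "n = card (UNIV :: 'n set)"
 define u where "u = unit_ball_vol (real d)"
 have u: "u > 0" by (simp add: u_def unit_ball_vol_pos)
 \<comment> \<open>The ratio of the box volume \<open>(2 diam) ^ d * 2 ^ (n - d)\<close> to the
   Hausdorff term \<open>u * (diam / 2) ^ d\<close>.\<close>
 define c where "c = 4 ^ d * 2 ^ (n - d) / u"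
 have c: "c > 0" using u by (simp add: c_def)
 have "emeasure lborel (ball (0::real^'n) 1) \<le> ennreal c * (\<Sum>i. hterm d (S i))" if S: "S \<in> hcov 1 (jball J 1)" for S
 proof -
  define s where "s i = (SOME z. z \<in> S i)" for i
  have s: "s i \<in> S i" if "S i \<noteq> {}" for i using that unfolding s_def by (meson ex_in_conv someI)
  define a where "a i = (\<chi> j. if j \<in> J then s i $ j - diameter (S i) else -1)" for i
  define b where "b i = (\<chi> j. if j \<in> J then s i $ j + diameter (S i) else 1)" for i
  define X where "X i = (if S i = {} then {} else cbox (a i) (b i))" for i
  have "ball 0 1 \<subseteq> (\<Union>i. X i)"
  proof
   fix z :: "real^'n" assume z: "z \<in> ball 0 1"
   have "pj J z \<in> jball J 1" using z norm_pj_le[of J z] by (auto simp: jball_def)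
   then obtain i where i: "pj J z \<in> S i" using S by (auto simp: hcov_def)
   hence ne: "S i \<noteq> {}" by auto
   have dd: "norm (pj J z - s i) \<le> diameter (S i)"
    using diameter_bounded_bound[OF _ i s[OF ne]] S by (auto simp: hcov_def dist_norm)
   have "a i $ j \<le> z $ j \<and> z $ j \<le> b i $ j" for j
   proof (cases "j \<in> J")
    case True
    have "\<bar>(pj J z - s i) $ j\<bar> \<le> diameter (S i)" using dd component_le_norm_cart order_trans by blast
    thus ?thesis using True by (simp add: a_def b_def abs_le_iff)
   next
    case False
    thus ?thesis using z component_le_norm_cart[of z j] by (auto simp: a_def b_def)
   qed
   hence "z \<in> X i" using ne by (auto simp: X_def mem_box_cart)
   thus "z \<in> (\<Union>i. X i)" by blast
  qed
  hence "emeasure lborel (ball (0::real^'n) 1) \<le> emeasure lborel (\<Union>i. X i)"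
   by (rule emeasure_mono) (auto simp: X_def)
  also have "\<dots> \<le> (\<Sum>i. emeasure lborel (X i))"
   by (rule emeasure_subadditive_countably) (auto simp: X_def)
  also have "\<dots> \<le> (\<Sum>i. ennreal c * hterm d (S i))"
  proof (intro suminf_le)
   fix i
   show "emeasure lborel (X i) \<le> ennreal c * hterm d (S i)"
   proof (cases "S i = {}")
    case False
    have D0: "diameter (S i) \<ge> 0" using S by (intro diameter_ge_0) (auto simp: hcov_def)
    have "a i \<in> cbox (a i) (b i)" using D0 by (auto simp: mem_box_cart a_def b_def)
    hence ne: "cbox (a i) (b i) \<noteq> {}" by auto
    have "emeasure lborel (X i) = ennreal (measure lborel (cbox (a i) (b i)))"
     using False emeasure_lborel_cbox_finite[of "a i" "b i"] by (simp add: X_def emeasure_eq_ennreal_measure less_top[symmetric])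
    also have "measure lborel (cbox (a i) (b i)) = (\<Prod>j\<in>UNIV. b i $ j - a i $ j)"
     by (rule content_cbox_cart[OF ne])
    also have "\<dots> = (\<Prod>j\<in>UNIV. if j \<in> J then 2 * diameter (S i) else 2)"
     by (intro prod.cong) (auto simp: a_def b_def)
    also have "\<dots> = (2 * diameter (S i)) ^ d * 2 ^ (n - d)"
     by (subst prod.If_cases) (auto simp: d_def n_def card_Diff_subset Compl_eq_Diff_UNIV)
    also have "\<dots> = c * (u * (diameter (S i) / 2) ^ d)"
    proof -
     have "(4::real) ^ d = 2 ^ d * 2 ^ d" by (simp add: power_mult_distrib[symmetric])
     thus ?thesis using u by (simp add: c_def power_mult_distrib power_divide)
    qed
    finally show ?thesis using False c u D0 by (simp add: hterm_def u_def ennreal_mult)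
   qed (simp add: X_def)
  qed auto
  also have "\<dots> = ennreal c * (\<Sum>i. hterm d (S i))" by simp
  finally show ?thesis .
 qed
 hence "ennreal (1/c) * emeasure lborel (ball (0::real^'n) 1) \<le> (\<Sum>i. hterm d (S i))" if "S \<in> hcov 1 (jball J 1)" for S
 proof -
  have "ennreal (1/c) * emeasure lborel (ball (0::real^'n) 1) \<le> ennreal (1/c) * (ennreal c * (\<Sum>i. hterm d (S i)))"
   using \<open>\<And>S. S \<in> hcov 1 (jball J 1) \<Longrightarrow> _\<close>[OF that] by (intro mult_left_mono) auto
  thus ?thesis using c by (simp add: mult.assoc[symmetric] ennreal_mult[symmetric])
 qed
 hence "ennreal (1/c) * emeasure lborel (ball (0::real^'n) 1) \<le> hausdorff_pre d 1 (jball J 1)"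
  unfolding hausdorff_pre_eq by (rule INF_greatest)
 also have "\<dots> \<le> hausdorff_outer d (jball J 1)" by (rule hausdorff_pre_le_outer) simp
 finally have "ennreal (1/c) * emeasure lborel (ball (0::real^'n) 1) \<le> hausdorff_outer d (jball J 1)" .
 moreover have "ennreal (1/c) * emeasure lborel (ball (0::real^'n) 1) > 0"
  using c by (simp add: ennreal_zero_less_mult_iff emeasure_ball unit_ball_vol_pos)
 ultimately show ?thesis unfolding d_def[symmetric] by (rule order_less_le_trans[rotated])
qed

text \<open>Enters later estimates only as a positive finite constant, so its exact value is left
  open.\<close>

definition hball :: "'n::finite set \<Rightarrow> real" where
 "hball J = enn2real (hausdorff_outer (card J) (jball J 1))"

lemma hball_pos: "hball J > 0"
 unfolding hball_def using hausdorff_jball_pos[of J] hausdorff_jball_finite[of J]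
 by (simp add: enn2real_positive_iff)

lemma hausdorff_jball:
 assumes "r > 0" shows "hausdorff_outer (card J) (jball J r) = ennreal (r ^ card J * hball J)"
proof -
 have "hausdorff_outer (card J) (jball J r) = ennreal (r ^ card J) * hausdorff_outer (card J) (jball J 1)"
  using hausdorff_outer_scale[OF assms, of "card J" "jball J 1"] jball_scale[OF assms, of J 1] by simp
 also have "hausdorff_outer (card J) (jball J 1) = ennreal (hball J)"
  unfolding hball_def using hausdorff_jball_finite[of J] by simp
 finally show ?thesis using assms hball_pos[of J] by (simp add: ennreal_mult)
qed

section \<open>Integrals against Hausdorff measure\<close>

lemma nn_integral_hausdorff_transport:
 fixes f :: "'a::metric_space \<Rightarrow> 'b::metric_space"
 assumes [measurable]: "B \<in> sets borel" "A \<in> sets borel" "f \<in> borel_measurable borel" "G \<in> borel_measurable borel"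
  and M: "M > 0" and lip: "\<And>x y. x \<in> A \<Longrightarrow> y \<in> A \<Longrightarrow> dist (f x) (f y) \<le> M * dist x y"
  and sub: "B \<subseteq> f ` A"
 shows "(\<integral>\<^sup>+y. G y * indicator B y \<partial>hausdorff_measure d) \<le> ennreal (M ^ d) * (\<integral>\<^sup>+v. G (f v) * indicator A v \<partial>hausdorff_measure d)"
proof -
 let ?H = "hausdorff_measure d :: 'b measure" and ?K = "hausdorff_measure d :: 'a measure"
 \<comment> \<open>The Lipschitz estimate compares these two measures on every Borel set; the
   inequality of integrals follows from the inequality of measures.\<close>
 define N1 where "N1 = density ?H (indicator B)"
 define N2 where "N2 = scale_measure (ennreal (M ^ d)) (distr (density ?K (indicator A)) borel f)"
 have le: "N1 \<le> N2"
 proof (subst le_measure)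
  show "sets N1 = sets N2" by (simp add: N1_def N2_def)
  show "\<forall>E\<in>sets N1. emeasure N1 E \<le> emeasure N2 E"
  proof
   fix E assume "E \<in> sets N1"
   hence E[measurable]: "E \<in> sets borel" by (simp add: N1_def)
   have m: "A \<inter> f -` E \<in> sets borel" by measurable
   have "emeasure N1 E = hausdorff_outer d (B \<inter> E)"
    unfolding N1_def by (subst emeasure_density)
     (auto simp: emeasure_hausdorff indicator_inter_arith[symmetric] simp del: nn_integral_indicator' intro!: trans[OF nn_integral_indicator])
   also have "\<dots> \<le> hausdorff_outer d (f ` (A \<inter> f -` E))" using sub by (intro hausdorff_outer_mono) blast
   also have "\<dots> \<le> ennreal (M ^ d) * hausdorff_outer d (A \<inter> f -` E)"
    by (rule hausdorff_outer_lipschitz_image[OF M]) (use lip in auto)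
   also have "\<dots> = emeasure N2 E"
   proof -
    have "emeasure (distr (density ?K (indicator A)) borel f) E = emeasure (density ?K (indicator A)) (f -` E)"
     by (subst emeasure_distr) auto
    also have "\<dots> = emeasure ?K (A \<inter> f -` E)"
     using measurable_sets[of f borel borel E]
     by (subst emeasure_density)
       (auto simp: indicator_inter_arith[symmetric] simp del: nn_integral_indicator' intro!: trans[OF nn_integral_indicator])
    finally show ?thesis using m by (simp add: N2_def emeasure_hausdorff)
   qed
   finally show "emeasure N1 E \<le> emeasure N2 E" .
  qed
 qed
 have "(\<integral>\<^sup>+y. G y * indicator B y \<partial>?H) = (\<integral>\<^sup>+y. G y \<partial>N1)"
  unfolding N1_def by (subst nn_integral_density) (auto simp: mult.commute)
 also have "\<dots> \<le> (\<integral>\<^sup>+y. G y \<partial>N2)"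
  by (rule nn_integral_mono_measure[OF _ le]) (simp add: N1_def N2_def)
 also have "\<dots> = ennreal (M ^ d) * (\<integral>\<^sup>+v. G (f v) * indicator A v \<partial>?K)"
  unfolding N2_def by (subst nn_integral_scale_measure, simp, subst nn_integral_distr)
   (auto simp: nn_integral_density mult.commute)
 finally show ?thesis .
qed

lemma nn_integral_hausdorff_scale:
 fixes g :: "real^'n \<Rightarrow> ennreal"
 assumes [measurable]: "g \<in> borel_measurable borel" and s: "s > 0"
 shows "(\<integral>\<^sup>+v. g v \<partial>hausdorff_measure d) = ennreal (s ^ d) * (\<integral>\<^sup>+v. g (s *\<^sub>R v) \<partial>hausdorff_measure d)"
proof -
 let ?H = "hausdorff_measure d :: (real^'n) measure"
 have eq: "?H = scale_measure (ennreal (s ^ d)) (distr ?H borel (\<lambda>v. s *\<^sub>R v))"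
 proof (rule measure_eqI)
  fix E assume "E \<in> sets ?H"
  hence E[measurable]: "E \<in> sets borel" by simp
  have "(\<lambda>v::real^'n. s *\<^sub>R v) \<in> borel_measurable borel" by measurable
  hence m: "(\<lambda>v. s *\<^sub>R v) -` E \<in> sets borel" using measurable_sets[of _ borel borel E] E by fastforce
  have im: "(\<lambda>v. s *\<^sub>R v) ` ((\<lambda>v. s *\<^sub>R v) -` E) = E"
  proof (intro equalityI subsetI)
   fix x assume "x \<in> E"
   hence "(1/s) *\<^sub>R x \<in> (\<lambda>v. s *\<^sub>R v) -` E" "x = s *\<^sub>R ((1/s) *\<^sub>R x)" using s by auto
   thus "x \<in> (\<lambda>v. s *\<^sub>R v) ` ((\<lambda>v. s *\<^sub>R v) -` E)" by (rule rev_image_eqI)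
  qed auto
  have "emeasure ?H E = ennreal (s ^ d) * hausdorff_outer d ((\<lambda>v. s *\<^sub>R v) -` E)"
   using hausdorff_outer_scale[OF s, of d "(\<lambda>v. s *\<^sub>R v) -` E"] unfolding im by (simp add: emeasure_hausdorff)
  also have "hausdorff_outer d ((\<lambda>v. s *\<^sub>R v) -` E) = emeasure (distr ?H borel (\<lambda>v. s *\<^sub>R v)) E"
   using m by (subst emeasure_distr) (auto simp: emeasure_hausdorff)
  finally show "emeasure ?H E = emeasure (scale_measure (ennreal (s ^ d)) (distr ?H borel (\<lambda>v. s *\<^sub>R v))) E"
   by simp
 qed simp
 have "(\<integral>\<^sup>+v. g v \<partial>?H) = (\<integral>\<^sup>+v. g v \<partial>(scale_measure (ennreal (s ^ d)) (distr ?H borel (\<lambda>v. s *\<^sub>R v))))"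
  using eq by simp
 also have "\<dots> = ennreal (s ^ d) * (\<integral>\<^sup>+v. g (s *\<^sub>R v) \<partial>?H)"
  by (subst nn_integral_scale_measure, simp, subst nn_integral_distr) auto
 finally show ?thesis .
qed

text \<open>Averaging over dilations replaces integration in polar coordinates on the coordinate subspace.\<close>
lemma nn_integral_dilation_average:
 fixes g :: "real^'n \<Rightarrow> ennreal"
 assumes g[measurable]: "g \<in> borel_measurable borel" and R: "R > 0"
 shows "(\<integral>\<^sup>+v. g v * indicator (jball J R) v \<partial>hausdorff_measure (card J))
  \<le> 2 * (\<integral>\<^sup>+v. (\<integral>\<^sup>+t. g (t *\<^sub>R v) * indicator {1/2..1} t \<partial>lborel) * indicator (jball J (2 * R)) v \<partial>hausdorff_measure (card J))"
  (is "?L \<le> 2 * ?Q")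
proof -
 let ?H = "hausdorff_measure (card J) :: (real^'n) measure"
 \<comment> \<open>Fubini asks for a sigma-finite factor. The Hausdorff measure of the whole space
   is not one when \<open>card J\<close> is below the ambient dimension, so it is restricted to a
   ball of the subspace.\<close>
 define H' where "H' = restrict_space ?H (jball J (2 * R))"
 have sp: "jball J (2 * R) \<inter> space ?H \<in> sets ?H" by simp
 have "emeasure H' (space H') < \<infinity>"
  unfolding H'_def using R by (simp add: space_restrict_space emeasure_restrict_space emeasure_hausdorff hausdorff_jball)
 then interpret F: finite_measure H' by (intro finite_measureI) auto
 interpret P: pair_sigma_finite lborel H' ..
 have res: "(\<integral>\<^sup>+v. h v * indicator (jball J (2 * R)) v \<partial>?H) = (\<integral>\<^sup>+v. h v \<partial>H')" for h
  unfolding H'_def using nn_integral_restrict_space[OF sp] by simp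
 have id_H': "(\<lambda>v. v) \<in> measurable H' borel" unfolding H'_def
  by (intro measurable_restrict_space1) (simp add: measurable_def)
 \<comment> \<open>For \<open>t \<le> 1\<close> the substitution costs at most the factor 1, and
   \<open>t \<ge> 1/2\<close> keeps \<open>v\<close> in the ball of twice the radius.\<close>
 have step: "?L \<le> (\<integral>\<^sup>+v. g (t *\<^sub>R v) \<partial>H')" if t: "t \<in> {1/2..1}" for t :: real
 proof -
  have t0: "t > 0" using t by auto
  have "?L = ennreal (t ^ card J) * (\<integral>\<^sup>+v. g (t *\<^sub>R v) * indicator (jball J R) (t *\<^sub>R v) \<partial>?H)"
   by (rule nn_integral_hausdorff_scale[OF _ t0]) measurable
  also have "\<dots> \<le> 1 * (\<integral>\<^sup>+v. g (t *\<^sub>R v) * indicator (jball J (2 * R)) v \<partial>?H)"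
  proof (rule mult_mono[OF _ nn_integral_mono])
   show "ennreal (t ^ card J) \<le> 1" using t by (simp add: power_le_one)
   fix v :: "real^'n"
   have "v \<in> jball J (2 * R)" if "t *\<^sub>R v \<in> jball J R"
   proof -
    have v: "pj J v = v" "t * norm v < R" using that t0 by (auto simp: jball_def)
    have "1/2 * norm v \<le> t * norm v" using t by (intro mult_right_mono) auto
    thus ?thesis using v by (auto simp: jball_def)
   qed
   thus "g (t *\<^sub>R v) * indicator (jball J R) (t *\<^sub>R v) \<le> g (t *\<^sub>R v) * indicator (jball J (2 * R)) v"
    by (auto simp: indicator_def)
  qed auto
  also have "\<dots> = (\<integral>\<^sup>+v. g (t *\<^sub>R v) \<partial>H')" by (simp add: res)
  finally show ?thesis .
 qed
 have m: "(\<lambda>(t, v). g (t *\<^sub>R v) * indicator {1/2..1} t) \<in> borel_measurable (lborel \<Otimes>\<^sub>M H')"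
  using id_H' by measurable
 \<comment> \<open>The interval of dilations has length 1/2, which accounts for the factor
   2.\<close>
 have "ennreal (1/2) * ?L = (\<integral>\<^sup>+t. ?L * indicator {1/2..1::real} t \<partial>lborel)"
  by (subst nn_integral_cmult_indicator) (auto simp: mult.commute)
 also have "\<dots> \<le> (\<integral>\<^sup>+t. (\<integral>\<^sup>+v. g (t *\<^sub>R v) * indicator {1/2..1} t \<partial>H') \<partial>lborel)"
  using step by (intro nn_integral_mono) (auto simp: indicator_def)
 also have "\<dots> = (\<integral>\<^sup>+v. (\<integral>\<^sup>+t. g (t *\<^sub>R v) * indicator {1/2..1} t \<partial>lborel) \<partial>H')"
  using P.Fubini'[OF m] by simp
 also have "\<dots> = ?Q" by (simp add: res)
 finally have "2 * (ennreal (1/2) * ?L) \<le> 2 * ?Q" by (intro mult_left_mono) auto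
 moreover have "2 * (ennreal (1/2) * ?L) = ?L"
  by (simp add: mult.assoc[symmetric] ennreal_mult[symmetric, of 2 "1/2", simplified])
 ultimately show ?thesis by simp
qed

section \<open>Algebraic relations between coordinates\<close>

text \<open>Gaussian elimination: one equation removes one unknown.\<close>

lemma homogeneous_system_nontrivial_solution:
 fixes M :: "'a \<Rightarrow> 'b \<Rightarrow> real"
 assumes "finite B" "finite A" "card B < card A"
 shows "\<exists>c. (\<exists>a\<in>A. c a \<noteq> 0) \<and> (\<forall>b\<in>B. (\<Sum>a\<in>A. c a * M a b) = 0)"
 using assms
proof (induction B arbitrary: A M rule: finite_induct)
 case empty
 thus ?case by (intro exI[of _ "\<lambda>_. 1"]) (auto simp: card_gt_0_iff)
next
 case (insert b B)
 show ?case
 proof (cases "\<forall>a\<in>A. M a b = 0")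
  case True
  have "card B < card A" using insert by simp
  from insert.IH[OF insert.prems(1) this, of M] obtain c where "\<exists>a\<in>A. c a \<noteq> 0" "\<forall>b\<in>B. (\<Sum>a\<in>A. c a * M a b) = 0" by blast
  thus ?thesis using True by (intro exI[of _ c]) auto
 next
  case False
  then obtain a0 where a0: "a0 \<in> A" "M a0 b \<noteq> 0" by blast
  define A' where "A' = A - {a0}"
  define M' where "M' a x = M a x - M a b / M a0 b * M a0 x" for a x
  have "finite A'" "card B < card A'" using insert a0 by (auto simp: A'_def)
  from insert.IH[OF this, of M'] obtain c where c: "\<exists>a\<in>A'. c a \<noteq> 0" "\<forall>b\<in>B. (\<Sum>a\<in>A'. c a * M' a b) = 0" by blast
  define c0 where "c0 = - (\<Sum>a\<in>A'. c a * (M a b / M a0 b))"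
  define c' where "c' = c(a0 := c0)"
  have S: "(\<Sum>a\<in>A. c' a * M a x) = (\<Sum>a\<in>A'. c a * M a x) + c0 * M a0 x" for x
  proof -
   have "(\<Sum>a\<in>A. c' a * M a x) = c' a0 * M a0 x + (\<Sum>a\<in>A'. c' a * M a x)"
    unfolding A'_def using insert a0 by (intro sum.remove) auto
   also have "(\<Sum>a\<in>A'. c' a * M a x) = (\<Sum>a\<in>A'. c a * M a x)"
    by (intro sum.cong) (auto simp: c'_def A'_def)
   finally show ?thesis by (simp add: c'_def)
  qed
  have T: "(\<Sum>a\<in>A'. c a * M a x) + c0 * M a0 x = (\<Sum>a\<in>A'. c a * M' a x)" for x
   by (simp add: c0_def M'_def sum_subtractf right_diff_distrib) (simp add: sum_distrib_left algebra_simps)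
  have Z: "(\<Sum>a\<in>A'. c a * M' a b) = 0" using a0 by (simp add: M'_def)
  have "\<exists>a\<in>A. c' a \<noteq> 0" using c(1) by (auto simp: A'_def c'_def)
  moreover have "\<forall>x\<in>insert b B. (\<Sum>a\<in>A. c' a * M a x) = 0" unfolding S T using c(2) Z by auto
  ultimately show ?thesis by blast
 qed
qed

section \<open>Linear dependence of functions on a set; counting monomials\<close>

definition inspan :: "'x set \<Rightarrow> ('b \<Rightarrow> 'x \<Rightarrow> real) \<Rightarrow> 'b set \<Rightarrow> ('x \<Rightarrow> real) \<Rightarrow> bool" where
 "inspan C G B f \<longleftrightarrow> (\<exists>m. \<forall>x\<in>C. f x = (\<Sum>b\<in>B. m b * G b x))"

lemma inspan_base: "finite B \<Longrightarrow> b \<in> B \<Longrightarrow> (\<And>x. x \<in> C \<Longrightarrow> f x = G b x) \<Longrightarrow> inspan C G B f"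
 unfolding inspan_def
 by (rule exI[of _ "\<lambda>b'. if b' = b then 1 else 0"]) (simp add: if_distrib[of "\<lambda>u. u * _"] cong: if_cong)

lemma inspan_cong: "inspan C G B f \<Longrightarrow> (\<And>x. x \<in> C \<Longrightarrow> g x = f x) \<Longrightarrow> inspan C G B g"
 unfolding inspan_def by auto

lemma inspan_mono: assumes "inspan C G B f" "B \<subseteq> B'" "finite B'" shows "inspan C G B' f"
proof -
 obtain m where m: "\<forall>x\<in>C. f x = (\<Sum>b\<in>B. m b * G b x)" using assms by (auto simp: inspan_def)
 have "f x = (\<Sum>b\<in>B'. (if b \<in> B then m b else 0) * G b x)" if "x \<in> C" for x
  using m that assms(2,3) by (auto intro!: sum.mono_neutral_cong_left)
 thus ?thesis unfolding inspan_def by (intro exI[of _ "\<lambda>b. if b \<in> B then m b else 0"]) blast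
qed

lemma inspan_0: "inspan C G B (\<lambda>_. 0)"
 unfolding inspan_def by (intro exI[of _ "\<lambda>_. 0"]) simp

lemma inspan_add: assumes "inspan C G B f" "inspan C G B g" shows "inspan C G B (\<lambda>x. f x + g x)"
proof -
 obtain m l where "\<forall>x\<in>C. f x = (\<Sum>b\<in>B. m b * G b x)" "\<forall>x\<in>C. g x = (\<Sum>b\<in>B. l b * G b x)"
  using assms by (auto simp: inspan_def)
 hence "\<forall>x\<in>C. f x + g x = (\<Sum>b\<in>B. (m b + l b) * G b x)" by (simp add: distrib_right sum.distrib)
 thus ?thesis unfolding inspan_def by (intro exI[of _ "\<lambda>b. m b + l b"])
qed

lemma inspan_cmult: assumes "inspan C G B f" shows "inspan C G B (\<lambda>x. c * f x)"
proof -
 obtain m where "\<forall>x\<in>C. f x = (\<Sum>b\<in>B. m b * G b x)" using assms by (auto simp: inspan_def)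
 hence "\<forall>x\<in>C. c * f x = (\<Sum>b\<in>B. (c * m b) * G b x)" by (simp add: sum_distrib_left algebra_simps)
 thus ?thesis unfolding inspan_def by (intro exI[of _ "\<lambda>b. c * m b"])
qed

lemma inspan_sum: "(\<And>a. a \<in> A \<Longrightarrow> inspan C G B (f a)) \<Longrightarrow> inspan C G B (\<lambda>x. \<Sum>a\<in>A. f a x)"
 by (induction A rule: infinite_finite_induct) (auto intro: inspan_add inspan_0)

text \<open>The source of all algebraic relations below. Equalities are asked on \<open>C\<close>
  only, which amounts to calculating modulo the functions that vanish on \<open>C\<close>.\<close>

lemma inspan_dependent:
 assumes "finite A" "finite B" "card B < card A" "\<And>a. a \<in> A \<Longrightarrow> inspan C G B (F a)"
 shows "\<exists>c. (\<exists>a\<in>A. c a \<noteq> 0) \<and> (\<forall>x\<in>C. (\<Sum>a\<in>A. c a * F a x) = 0)"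
proof -
 have "\<forall>a\<in>A. \<exists>m. \<forall>x\<in>C. F a x = (\<Sum>b\<in>B. m b * G b x)" using assms(4) by (simp add: inspan_def)
 from bchoice[OF this] obtain M where M: "\<forall>a\<in>A. \<forall>x\<in>C. F a x = (\<Sum>b\<in>B. M a b * G b x)" by blast
 from homogeneous_system_nontrivial_solution[OF assms(2,1,3), of M]
 obtain c where c: "\<exists>a\<in>A. c a \<noteq> 0" "\<forall>b\<in>B. (\<Sum>a\<in>A. c a * M a b) = 0" by blast
 have "(\<Sum>a\<in>A. c a * F a x) = 0" if "x \<in> C" for x
 proof -
  have "(\<Sum>a\<in>A. c a * F a x) = (\<Sum>a\<in>A. \<Sum>b\<in>B. (c a * M a b) * G b x)"
   using M that by (simp add: sum_distrib_left mult.assoc)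
  also have "\<dots> = (\<Sum>b\<in>B. (\<Sum>a\<in>A. c a * M a b) * G b x)" by (subst sum.swap) (simp add: sum_distrib_right)
  also have "\<dots> = 0" using c by simp
  finally show ?thesis .
 qed
 with c(1) show ?thesis by blast
qed

text \<open>Exponents of normal forms: variables outside \<open>I\<close> are reduced below
  \<open>s\<close>, those in \<open>I\<close> run freely up to \<open>r\<close>. With
  \<open>s = 1\<close> only the variables in \<open>I\<close> occur.\<close>

definition box_exps :: "'n::finite set \<Rightarrow> nat \<Rightarrow> nat \<Rightarrow> ('n \<Rightarrow> nat) set" where
 "box_exps I r s = {\<alpha>. (\<forall>i\<in>I. \<alpha> i < r) \<and> (\<forall>i. i \<notin> I \<longrightarrow> \<alpha> i < s)}"

lemma box_exps_PiE: "box_exps I r s = PiE UNIV (\<lambda>i. if i \<in> I then {..<r} else {..<s})"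
 by (auto simp: box_exps_def PiE_def Pi_def split: if_splits)

lemma finite_box_exps [simp]: "finite (box_exps I r s)"
 unfolding box_exps_PiE by (rule finite_PiE) auto

lemma card_box_exps: "card (box_exps (I :: 'n::finite set) r s) = r ^ card I * s ^ card (- I)"
proof -
 have "card (box_exps I r s) = (\<Prod>i\<in>UNIV. if i \<in> I then r else s)"
  unfolding box_exps_PiE by (subst card_PiE) (auto intro!: prod.cong)
 thus ?thesis by (simp add: prod.If_cases)
qed

lemma box_exps_mono: "r \<le> r' \<Longrightarrow> box_exps I r s \<subseteq> box_exps I r' s"
 by (auto simp: box_exps_def intro: less_le_trans)

lemma box_exps_one_sum:
 fixes I :: "'n::finite set"
 assumes "\<alpha> \<in> box_exps I N 1" shows "\<alpha> \<in> mons I (card I * N)"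
proof -
 have z: "\<alpha> i = 0" if "i \<notin> I" for i using assms that by (auto simp: box_exps_def)
 have "(\<Sum>i\<in>UNIV. \<alpha> i) = (\<Sum>i\<in>I. \<alpha> i)" using z by (intro sum.mono_neutral_right) auto
 also have "\<dots> \<le> card I * N" using assms by (intro order_trans[OF sum_bounded_above[of I \<alpha> N]]) (auto simp: box_exps_def intro: less_imp_le)
 finally show ?thesis using z by (auto simp: mons_def)
qed

lemma mons_component_le: "\<alpha> \<in> mons I k \<Longrightarrow> \<alpha> i \<le> k"
proof -
 assume "\<alpha> \<in> mons I k"
 moreover have "\<alpha> i \<le> (\<Sum>i\<in>UNIV. \<alpha> i)" by (rule member_le_sum) auto
 ultimately show ?thesis by (auto simp: mons_def)
qed

lemma mon_reduce: assumes "\<alpha> i \<ge> s" shows "mon \<alpha> x = x $ i ^ s * mon (\<alpha>(i := \<alpha> i - s)) x"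
proof -
 have "mon \<alpha> x = x $ i ^ (s + (\<alpha> i - s)) * mon (\<alpha>(i := 0)) x" using assms by (subst mon_split[of _ _ i]) simp
 moreover have "mon (\<alpha>(i := \<alpha> i - s)) x = x $ i ^ (\<alpha> i - s) * mon (\<alpha>(i := 0)) x" by (subst mon_split[of _ _ i]) simp
 ultimately show ?thesis by (simp add: power_add)
qed

lemma mons_reduce:
 fixes \<alpha> :: "'n::finite \<Rightarrow> nat"
 assumes "\<alpha> \<in> mons UNIV k" "\<alpha> i \<ge> s" shows "s \<le> k" "\<alpha>(i := \<alpha> i - s) \<in> mons UNIV (k - s)"
proof -
 have e: "(\<Sum>j\<in>UNIV. \<alpha> j) = \<alpha> i + (\<Sum>j\<in>UNIV - {i}. \<alpha> j)" by (rule sum.remove) auto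
 have "(\<Sum>j\<in>UNIV. (\<alpha>(i := \<alpha> i - s)) j) = (\<alpha> i - s) + (\<Sum>j\<in>UNIV - {i}. \<alpha> j)"
  by (subst sum.remove[of _ i]) auto
 thus "s \<le> k" "\<alpha>(i := \<alpha> i - s) \<in> mons UNIV (k - s)" using assms e by (auto simp: mons_def)
qed

text \<open>On the set of pairs \<^term>\<open>(\<epsilon>, x)\<close> where \<^term>\<open>x\<close> is critical, in the variables outside \<^term>\<open>I\<close>, for
 the perturbation of \<^term>\<open>q\<close> by \<open>\<epsilon> \<Sum> x\<^sub>i^(2g+2)\<close>, high powers of these variables reduce to lower degree,
 at the cost of one factor \<^term>\<open>\<epsilon>\<close> each.\<close>
definition crit_set :: "'n::finite set \<Rightarrow> nat \<Rightarrow> ('n \<Rightarrow> real^'n \<Rightarrow> real) \<Rightarrow> (real \<times> (real^'n)) set" where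
 "crit_set I g dq = {(\<epsilon>, x). \<epsilon> \<noteq> 0 \<and> (\<forall>i. i \<notin> I \<longrightarrow> dq i x + \<epsilon> * (real (2 * g + 2) * (x $ i) ^ (2 * g + 1)) = 0)}"

text \<open>On the critical set, monomials times enough powers of \<open>\<epsilon>\<close> reduce
  to normal forms, whose number grows like \<open>N ^ (m + 1)\<close> with
  \<open>m = card I\<close>. The products of monomials in \<open>I\<close>, powers of
  \<open>\<epsilon>\<close> and powers of \<open>q\<close> number \<open>E * N ^ (m + 1)\<close>;
  for large \<open>E\<close> they are dependent, and this dependence is the relation.\<close>

lemma crit_set_relation:
 fixes I :: "'n::finite set"
 assumes q: "pfun UNIV g q" and dq: "\<And>i. pfun UNIV g (dq i)"
 obtains N E K a where "\<And>b c. pfun I K (a b c)" "\<exists>b<(N::nat). \<exists>c<(E::nat). \<exists>x. a b c x \<noteq> (0::real)"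
  "\<And>\<epsilon> x. (\<epsilon>, x) \<in> crit_set I g dq \<Longrightarrow> (\<Sum>b<N. \<Sum>c<E. a b c x * \<epsilon> ^ b * q x ^ c) = 0"
proof -
 \<comment> \<open>The partial derivatives of the perturbation have degree \<open>2 g + 1\<close>,
   above the degree bound \<open>g\<close> for those of \<open>q\<close>; so the critical equation
   expresses \<open>\<epsilon> * x $ i ^ s\<close> by terms of lower degree.\<close>
 define s where "s = 2 * g + 1"
 define C where "C = crit_set I g dq"
 define G where "G = (\<lambda>(\<alpha> :: 'n \<Rightarrow> nat, b) (\<epsilon>, x :: real^'n). \<epsilon> ^ b * mon \<alpha> x :: real)"
 define B where "B k l = box_exps I (Suc k) s \<times> {..(l::nat)}" for k l
 have finB: "finite (B k l)" for k l by (simp add: B_def)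
 have Bmono: "B k l \<subseteq> B k' l'" if "k \<le> k'" "l \<le> l'" for k l k' l'
  using box_exps_mono[of "Suc k" "Suc k'" I s] that by (auto simp: B_def)
 have red: "inspan C G (B k k) (\<lambda>(\<epsilon>, x). \<epsilon> ^ k * mon \<alpha> x)" if "\<alpha> \<in> mons UNIV k" for \<alpha> k
  using that
 proof (induction k arbitrary: \<alpha>)
  case 0
  hence "\<alpha> = (\<lambda>_. 0)" by (auto simp: mons_def)
  thus ?case by (intro inspan_base[OF finB, of "(\<alpha>, 0)"]) (auto simp: B_def box_exps_def s_def G_def)
 next
  case (Suc k)
  show ?case
  proof (cases "\<forall>i. i \<notin> I \<longrightarrow> \<alpha> i < s")
   case True
   hence "\<alpha> \<in> box_exps I (Suc (Suc k)) s" using mons_component_le[OF Suc.prems] by (auto simp: box_exps_def less_Suc_eq_le)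
   thus ?thesis using finB by (intro inspan_base[of _ "(\<alpha>, Suc k)"]) (auto simp: B_def G_def)
  next
   case False
   then obtain i where i: "i \<notin> I" "\<alpha> i \<ge> s" by force
   define \<alpha>' where "\<alpha>' = \<alpha>(i := \<alpha> i - s)"
   have a': "s \<le> Suc k" "\<alpha>' \<in> mons UNIV (Suc k - s)" using mons_reduce[OF Suc.prems i(2)] by (auto simp: \<alpha>'_def)
   have "pfun UNIV (g + (Suc k - s)) (\<lambda>x. dq i x * (1 * mon \<alpha>' x))"
    by (intro pfun_mult dq pfun_mon a')
   hence "pfun UNIV k (\<lambda>x. dq i x * mon \<alpha>' x)"
    using a'(1) by (auto simp: s_def elim!: pfun_mono)
   then obtain c where c: "(\<lambda>x. dq i x * mon \<alpha>' x) = (\<lambda>x. \<Sum>\<beta>\<in>mons UNIV k. c \<beta> * mon \<beta> x)"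
    by (auto simp: pfun_def)
   have "inspan C G (B k k) (\<lambda>z. \<Sum>\<beta>\<in>mons UNIV k. (- c \<beta> / real (2 * g + 2)) * (case z of (\<epsilon>, x) \<Rightarrow> \<epsilon> ^ k * mon \<beta> x))"
    by (intro inspan_sum inspan_cmult Suc.IH)
   hence "inspan C G (B (Suc k) (Suc k)) (\<lambda>z. \<Sum>\<beta>\<in>mons UNIV k. (- c \<beta> / real (2 * g + 2)) * (case z of (\<epsilon>, x) \<Rightarrow> \<epsilon> ^ k * mon \<beta> x))"
    by (rule inspan_mono[OF _ Bmono finB]) auto
   thus ?thesis
   proof (rule inspan_cong)
    fix z assume z: "z \<in> C"
    obtain \<epsilon> x where zz: "z = (\<epsilon>, x)" by force
    have cr: "\<epsilon> * x $ i ^ s = - dq i x / real (2 * g + 2)"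
     using z i unfolding C_def crit_set_def zz s_def
     by (auto simp: field_simps eq_neg_iff_add_eq_0)
    have "\<epsilon> ^ Suc k * mon \<alpha> x = \<epsilon> ^ k * (\<epsilon> * x $ i ^ s) * mon \<alpha>' x"
     by (subst mon_reduce[of s \<alpha> i, OF i(2)]) (simp add: \<alpha>'_def)
    also have "\<dots> = - (\<epsilon> ^ k / real (2 * g + 2)) * (dq i x * mon \<alpha>' x)" unfolding cr by simp
    also have "\<dots> = (\<Sum>\<beta>\<in>mons UNIV k. (- c \<beta> / real (2 * g + 2)) * (\<epsilon> ^ k * mon \<beta> x))"
     unfolding fun_cong[OF c] sum_distrib_left by (intro sum.cong) auto
    finally show "(case z of (\<epsilon>, x) \<Rightarrow> \<epsilon> ^ Suc k * mon \<alpha> x) = (\<Sum>\<beta>\<in>mons UNIV k. (- c \<beta> / real (2 * g + 2)) * (case z of (\<epsilon>, x) \<Rightarrow> \<epsilon> ^ k * mon \<beta> x))"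
     by (simp add: zz)
   qed
  qed
 qed
 have redp: "inspan C G (B k (k + b)) (\<lambda>(\<epsilon>, x). \<epsilon> ^ (k + b) * h x)" if "pfun UNIV k h" for h k b
 proof -
  obtain c where c: "h = (\<lambda>x. \<Sum>\<beta>\<in>mons UNIV k. c \<beta> * mon \<beta> x)" using \<open>pfun UNIV k h\<close> by (auto simp: pfun_def)
  have 1: "inspan C G (B k k) (\<lambda>z. \<Sum>\<beta>\<in>mons UNIV k. c \<beta> * (case z of (\<epsilon>, x) \<Rightarrow> \<epsilon> ^ k * mon \<beta> x))"
   by (intro inspan_sum inspan_cmult red)
  then obtain m where m: "\<forall>z\<in>C. (\<Sum>\<beta>\<in>mons UNIV k. c \<beta> * (case z of (\<epsilon>, x) \<Rightarrow> \<epsilon> ^ k * mon \<beta> x)) = (\<Sum>y\<in>B k k. m y * G y z)"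
   by (auto simp: inspan_def)
  have "inspan C G (B k (k + b)) (\<lambda>z. \<Sum>y\<in>B k k. m y * G (fst y, snd y + b) z)"
   by (intro inspan_sum inspan_cmult inspan_base[OF finB]) (auto simp: B_def)
  thus ?thesis
  proof (rule inspan_cong)
   fix z assume z: "z \<in> C"
   obtain \<epsilon> x where zz: "z = (\<epsilon>, x)" by force
   have "\<epsilon> ^ (k + b) * h x = \<epsilon> ^ b * (\<Sum>\<beta>\<in>mons UNIV k. c \<beta> * (\<epsilon> ^ k * mon \<beta> x))"
    unfolding c sum_distrib_left by (intro sum.cong) (auto simp: power_add)
   also have "\<dots> = \<epsilon> ^ b * (\<Sum>y\<in>B k k. m y * G y z)" using m z by (auto simp: zz)
   also have "\<dots> = (\<Sum>y\<in>B k k. m y * G (fst y, snd y + b) z)"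
    unfolding sum_distrib_left by (intro sum.cong) (auto simp: G_def zz power_add)
   finally show "(case z of (\<epsilon>, x) \<Rightarrow> \<epsilon> ^ (k + b) * h x) = (\<Sum>y\<in>B k k. m y * G (fst y, snd y + b) z)" by (simp add: zz)
  qed
 qed
 define m where "m = card I"
 \<comment> \<open>\<open>E\<close> beats the constant factor in the size of
   \<open>B k0 (k0 + N)\<close>. The choice \<open>N = g * E + 1\<close> makes \<open>k0 + 1\<close>
   equal to \<open>(m + 1) * N\<close>, so both counts are multiples of
   \<open>N ^ (m + 1)\<close>.\<close>
 define E where "E = (m + 1) ^ m * (m + 2) * s ^ card (- I) + 1"
 define N where "N = g * E + 1"
 define k0 where "k0 = m * N + E * g"
 define A where "A = box_exps I N 1 \<times> {..<N} \<times> {..<E}"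
 \<comment> \<open>\<open>k0\<close> bounds the degree of \<open>mon \<alpha> * q ^ c\<close>, so
   that many factors \<open>\<epsilon>\<close> pay for its reduction. They cancel in the end because
   \<open>\<epsilon>\<close> is nonzero on the critical set.\<close>
 define F where "F = (\<lambda>(\<alpha>, b, c) (\<epsilon>, x). \<epsilon> ^ (k0 + b) * (mon \<alpha> x * q x ^ c))"
 have finA: "finite A" by (simp add: A_def)
 have cardA: "card A = N ^ m * N * E" by (simp add: A_def card_cartesian_product card_box_exps m_def)
 have "card (B k0 (k0 + N)) = ((m + 1) * N) ^ m * s ^ card (- I) * ((m + 2) * N)"
 proof -
  have 1: "Suc k0 = (m + 1) * N" by (simp add: k0_def N_def algebra_simps)
  have 2: "k0 + N + 1 = (m + 2) * N" using 1 by simp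
  have "card {..k0 + N} = (m + 2) * N" using 2 by simp
  thus ?thesis unfolding B_def card_cartesian_product card_box_exps 1 m_def[symmetric] by (simp only:)
 qed
 also have "\<dots> = N ^ m * N * ((m + 1) ^ m * (m + 2) * s ^ card (- I))" by (simp only: power_mult_distrib mult_ac)
 also have "\<dots> < card A" unfolding cardA by (intro mult_strict_left_mono) (auto simp: E_def N_def)
 finally have lt: "card (B k0 (k0 + N)) < card A" .
 have Fsp: "inspan C G (B k0 (k0 + N)) (F y)" if y: "y \<in> A" for y
 proof -
  obtain \<alpha> b c where yy: "y = (\<alpha>, b, c)" by (cases y)
  have "\<alpha> \<in> mons I (m * N)" "b < N" "c < E" using y yy box_exps_one_sum[of \<alpha> I N] by (auto simp: A_def m_def)
  hence "pfun UNIV (m * N) (\<lambda>x. 1 * mon \<alpha> x)" by (intro pfun_mono[OF pfun_mon]) auto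
  hence "pfun UNIV (m * N + c * g) (\<lambda>x. (1 * mon \<alpha> x) * q x ^ c)" by (intro pfun_mult pfun_power q)
  hence "pfun UNIV k0 (\<lambda>x. mon \<alpha> x * q x ^ c)"
   using \<open>c < E\<close> by (auto simp: k0_def elim!: pfun_mono)
  from redp[OF this, of b] have "inspan C G (B k0 (k0 + b)) (F y)" by (simp add: F_def yy split_beta')
  thus ?thesis using \<open>b < N\<close> by (rule_tac inspan_mono[OF _ Bmono finB]) auto
 qed
 from inspan_dependent[OF finA finB lt Fsp]
 obtain c where "(\<exists>a\<in>A. c a \<noteq> 0) \<and> (\<forall>z\<in>C. (\<Sum>a\<in>A. c a * F a z) = 0)" ..
 note c = conjunct1[OF this] conjunct2[OF this]
 define a where "a b l x = (\<Sum>\<alpha>\<in>box_exps I N 1. c (\<alpha>, b, l) * mon \<alpha> x)" for b l x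
 show ?thesis
 proof (rule that[of "m * N" a N E])
  show "pfun I (m * N) (a b l)" for b l unfolding a_def m_def
   by (intro pfun_sum pfun_mon box_exps_one_sum)
  obtain \<alpha> b l where y: "(\<alpha>, b, l) \<in> A" "c (\<alpha>, b, l) \<noteq> 0" using c(1) by auto
  have "\<exists>x. a b l x \<noteq> 0"
  proof (rule ccontr)
   assume "\<not> ?thesis"
   hence "c (\<alpha>, b, l) = 0" using y(1) unfolding a_def
    by (intro monomials_independent[of "box_exps I N 1" "\<lambda>\<alpha>. c (\<alpha>, b, l)"]) (auto simp: A_def)
   thus False using y by simp
  qed
  thus "\<exists>b<N. \<exists>l<E. \<exists>x. a b l x \<noteq> 0" using y(1) by (auto simp: A_def)
  fix \<epsilon> x assume z: "(\<epsilon>, x) \<in> crit_set I g dq"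
  have "0 = (\<Sum>(\<alpha>, b, l)\<in>A. c (\<alpha>, b, l) * (\<epsilon> ^ (k0 + b) * (mon \<alpha> x * q x ^ l)))"
   using bspec[OF c(2), of "(\<epsilon>, x)"] z by (simp add: C_def F_def split_beta')
  also have "\<dots> = (\<Sum>\<alpha>\<in>box_exps I N 1. \<Sum>b<N. \<Sum>l<E. c (\<alpha>, b, l) * (\<epsilon> ^ (k0 + b) * (mon \<alpha> x * q x ^ l)))"
   unfolding A_def by (simp add: sum.cartesian_product)
  also have "\<dots> = (\<Sum>b<N. \<Sum>l<E. \<Sum>\<alpha>\<in>box_exps I N 1. c (\<alpha>, b, l) * (\<epsilon> ^ (k0 + b) * (mon \<alpha> x * q x ^ l)))"
   by (subst sum.swap, rule sum.cong[OF refl], subst sum.swap, rule refl)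
  also have "\<dots> = \<epsilon> ^ k0 * (\<Sum>b<N. \<Sum>l<E. a b l x * \<epsilon> ^ b * q x ^ l)"
   unfolding a_def sum_distrib_left sum_distrib_right
   by (intro sum.cong) (auto simp: power_add)
  finally show "(\<Sum>b<N. \<Sum>l<E. a b l x * \<epsilon> ^ b * q x ^ l) = 0" using z by (auto simp: crit_set_def)
 qed
qed

text \<open>A minimiser of the perturbed \<open>q\<close> on the fibre over \<open>u\<close> is
  critical, hence satisfies the previous relation with coefficients that depend on \<open>u\<close>
  alone. Letting \<open>\<epsilon>\<close> tend to 0 gives an equation for the minimum of
  \<open>q\<close> on the fibre. Off the projection of \<open>V\<close> this minimum is nonzero, so
  its lowest power can be divided out. When \<open>u\<close> tends to a point of \<open>V\<close>
  the minimum tends to 0, and only the coefficient \<open>a b0 c0\<close> survives, which therefore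
  vanishes at that point.\<close>

lemma algebraic_relation_on_projection:
 fixes I :: "'n::finite set" and q :: "real^'n \<Rightarrow> real"
 assumes q: "pfun UNIV g q" and q0: "\<And>x. q x \<ge> 0" and V: "V = {x. q x = 0}" "compact V"
  and thin: "\<And>x \<delta>. x \<in> V \<Longrightarrow> \<delta> > 0 \<Longrightarrow> \<exists>u. dist u x < \<delta> \<and> (\<forall>y\<in>V. \<exists>i\<in>I. y $ i \<noteq> u $ i)"
 obtains K a where "pfun I K a" "\<exists>x. a x \<noteq> (0::real)" "\<And>x. x \<in> V \<Longrightarrow> a x = 0"
proof -
 have "\<forall>i. \<exists>dq. pfun UNIV g dq \<and> (\<forall>x. ((\<lambda>s. q (x + s *\<^sub>R axis i 1)) has_real_derivative dq x) (at 0))"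
  using pfun_deriv[OF q] by metis
 then obtain dq where dq: "\<And>i. pfun UNIV g (dq i)"
  "\<And>i x. ((\<lambda>s. q (x + s *\<^sub>R axis i 1)) has_real_derivative dq i x) (at 0)" by metis
 obtain N E K a where rel: "\<And>b c. pfun I K (a b c)" "\<exists>b<(N::nat). \<exists>c<(E::nat). \<exists>x. a b c x \<noteq> (0::real)"
  "\<And>\<epsilon> x. (\<epsilon>, x) \<in> crit_set I g dq \<Longrightarrow> (\<Sum>b<N. \<Sum>c<E. a b c x * \<epsilon> ^ b * q x ^ c) = 0"
  by (rule crit_set_relation[where I = I and dq = dq, OF q dq(1)]) blast
 obtain R where R: "R > 0" "\<And>x. x \<in> V \<Longrightarrow> norm x < R"
 proof -
  obtain B where "\<forall>x\<in>V. norm x \<le> B" using compact_imp_bounded[OF V(2)] bounded_iff by blast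
  thus ?thesis using that[of "max 1 (B + 1)"] by fastforce
 qed
 have Ri: "\<bar>x $ i\<bar> < R" if "x \<in> V" for x i using R(2)[OF that] component_le_norm_cart[of x i] by linarith
 have contq: "continuous_on S q" for S using q by (rule pfun_continuous)
 \<comment> \<open>The fibre over \<open>u\<close>, cut off by a box that contains \<open>V\<close>
   in its interior.\<close>
 define F where "F u = cbox (\<chi> i. if i \<in> I then u $ i else -R) (\<chi> i. if i \<in> I then u $ i else R)" for u :: "real^'n"
 have F_iff: "x \<in> F u \<longleftrightarrow> (\<forall>i\<in>I. x $ i = u $ i) \<and> (\<forall>i. i \<notin> I \<longrightarrow> \<bar>x $ i\<bar> \<le> R)" for x u
 proof -
  have "(if i \<in> I then u $ i else -R) \<le> x $ i \<and> x $ i \<le> (if i \<in> I then u $ i else R) \<longleftrightarrow>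
   (i \<in> I \<longrightarrow> x $ i = u $ i) \<and> (i \<notin> I \<longrightarrow> \<bar>x $ i\<bar> \<le> R)" for i
   by (cases "i \<in> I") (auto simp: abs_le_iff)
  thus ?thesis unfolding F_def mem_box_cart vec_lambda_beta by blast
 qed
 have Fne: "(\<chi> i. if i \<in> I then u $ i else 0) \<in> F u" for u using R by (auto simp: F_iff)
 have Fcomp: "compact (F u)" for u by (simp add: F_def)
 have "\<forall>u. \<exists>x. x \<in> F u \<and> (\<forall>y\<in>F u. q x \<le> q y)"
  using continuous_attains_inf[OF Fcomp _ contq] Fne by (metis empty_iff)
 then obtain xm where xm: "\<And>u. xm u \<in> F u" "\<And>u y. y \<in> F u \<Longrightarrow> q (xm u) \<le> q y" by metis
 \<comment> \<open>On the faces in the free directions \<open>q\<close> has a positive lower bound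
   \<open>c\<close>. A minimiser with smaller value is interior in these directions, so the partial
   derivatives vanish there.\<close>
 define Bd where "Bd = {x. (\<forall>i. \<bar>x $ i\<bar> \<le> R) \<and> (\<exists>i. i \<notin> I \<and> \<bar>x $ i\<bar> = R)}"
 obtain c where c: "c > 0" "\<And>x. x \<in> Bd \<Longrightarrow> q x \<ge> c"
 proof (cases "Bd = {}")
  case False
  have "Bd = cbox (\<chi> i. -R) (\<chi> i. R) \<inter> (\<Union>i\<in>-I. {x. \<bar>x $ i\<bar> = R})"
   unfolding Bd_def by (auto simp: mem_box_cart abs_le_iff minus_le_iff)
  moreover have "closed (\<Union>i\<in>-I. {x :: real^'n. \<bar>x $ i\<bar> = R})"
  proof -
   have "closed {x :: real^'n. \<bar>x $ i\<bar> = R}" for i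
    by (intro closed_Collect_eq continuous_intros)
   thus ?thesis by (intro closed_UN) auto
  qed
  ultimately have "compact Bd" by (simp add: compact_Int_closed)
  then obtain x where x: "x \<in> Bd" "\<And>y. y \<in> Bd \<Longrightarrow> q x \<le> q y"
   using continuous_attains_inf[OF _ False contq] by blast
  have "x \<notin> V" using x(1) Ri by (fastforce simp: Bd_def)
  hence "q x > 0" using q0[of x] V(1) by (simp add: less_le)
  thus ?thesis using that x by blast
 qed (use that[of 1] in auto)
 \<comment> \<open>The lowest power of \<open>\<epsilon>\<close> with a coefficient that is not the
   zero polynomial, and for it the lowest such power of \<open>q\<close>; these survive the two
   limits.\<close>
 define b0 where "b0 = (LEAST b. b < N \<and> (\<exists>c<E. \<exists>x. a b c x \<noteq> 0))"
 have b0: "b0 < N" "\<exists>c<E. \<exists>x. a b0 c x \<noteq> 0"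
  using LeastI_ex[of "\<lambda>b. b < N \<and> (\<exists>c<E. \<exists>x. a b c x \<noteq> 0)"] rel(2) unfolding b0_def by blast+
 have b0l: "a b c x = 0" if "b < b0" "c < E" for b c x
  using not_less_Least[OF that(1)[unfolded b0_def]] that b0(1) by auto
 define c0 where "c0 = (LEAST c. c < E \<and> (\<exists>x. a b0 c x \<noteq> 0))"
 have c0: "c0 < E" "\<exists>x. a b0 c0 x \<noteq> 0"
  using LeastI_ex[of "\<lambda>c. c < E \<and> (\<exists>x. a b0 c x \<noteq> 0)"] b0(2) unfolding c0_def by blast+
 have c0l: "a b0 c x = 0" if "c < c0" for c x
  using not_less_Least[OF that(1)[unfolded c0_def]] that c0(1) by auto
 have star: "(\<Sum>c<E. a b0 c u * q (xm u) ^ c) = 0" if u: "\<And>i. i \<in> I \<Longrightarrow> \<bar>u $ i\<bar> \<le> R" and qc: "q (xm u) < c" for u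
 proof -
  define e where "e = 2 * g + 2"
  define h where "h x = (\<Sum>i\<in>-I. (x $ i) ^ e)" for x :: "real^'n"
  have "even e" by (simp add: e_def)
  hence h0: "h x \<ge> 0" for x unfolding h_def by (intro sum_nonneg zero_le_even_power)
  have conth: "continuous_on S h" for S unfolding h_def by (intro continuous_intros)
  define H where "H = h (xm u)"
  have H0: "H \<ge> 0" by (simp add: H_def h0)
  \<comment> \<open>Small enough that the perturbation at the unperturbed minimiser stays below the
    margin \<open>c - q (xm u)\<close>, and tending to 0.\<close>
  define \<epsilon> where "\<epsilon> n = (c - q (xm u)) / (H + 1) / (real n + 2)" for n
  have \<epsilon>: "\<epsilon> n > 0" "\<epsilon> n * H < c - q (xm u)" for n
  proof -
   show "\<epsilon> n > 0" unfolding \<epsilon>_def using qc H0 by (intro divide_pos_pos) auto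
   have "\<epsilon> n * H \<le> \<epsilon> n * (H + 1)" using \<open>\<epsilon> n > 0\<close> by simp
   also have "\<dots> = (c - q (xm u)) / (real n + 2)" using H0 by (simp add: \<epsilon>_def)
   also have "\<dots> < (c - q (xm u)) / 1" using qc by (intro divide_strict_left_mono) auto
   finally show "\<epsilon> n * H < c - q (xm u)" by simp
  qed
  have "\<exists>x. (\<epsilon> n, x) \<in> crit_set I g dq \<and> x \<in> F u \<and> q x \<le> q (xm u) + \<epsilon> n * H" for n
  proof -
   define qe where "qe x = q x + \<epsilon> n * h x" for x
   have "continuous_on (F u) qe" unfolding qe_def by (intro continuous_intros contq conth)
   then obtain x where x: "x \<in> F u" "\<And>y. y \<in> F u \<Longrightarrow> qe x \<le> qe y"
    using continuous_attains_inf[OF Fcomp, of u qe] Fne by blast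
   have "q x \<le> qe x" unfolding qe_def using h0[of x] \<epsilon>(1)[of n] by simp
   also have "\<dots> \<le> qe (xm u)" by (rule x(2)[OF xm(1)])
   finally have qx: "q x \<le> q (xm u) + \<epsilon> n * H" by (simp add: qe_def H_def)
   hence "q x < c" using \<epsilon>(2)[of n] by linarith
   hence "x \<notin> Bd" using c(2) by force
   hence xi: "\<bar>x $ i\<bar> < R" if "i \<notin> I" for i
    using x(1) that u unfolding F_iff Bd_def by (smt (verit) mem_Collect_eq)
   have "dq i x + \<epsilon> n * (real (2 * g + 2) * (x $ i) ^ (2 * g + 1)) = 0" if i: "i \<notin> I" for i
   proof (rule DERIV_local_min)
    have 1: "h (x + s *\<^sub>R axis i 1) = (x $ i + s) ^ e + (\<Sum>j\<in>-I - {i}. (x $ j) ^ e)" for s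
    proof -
     have "h (x + s *\<^sub>R axis i 1) = ((x + s *\<^sub>R axis i 1) $ i) ^ e + (\<Sum>j\<in>-I - {i}. ((x + s *\<^sub>R axis i 1) $ j) ^ e)"
      unfolding h_def using i by (intro sum.remove) auto
     also have "(\<Sum>j\<in>-I - {i}. ((x + s *\<^sub>R axis i 1) $ j) ^ e) = (\<Sum>j\<in>-I - {i}. (x $ j) ^ e)"
      by (intro sum.cong) (auto simp: axis_def)
     finally show ?thesis by (simp add: axis_def)
    qed
    show "((\<lambda>s. qe (x + s *\<^sub>R axis i 1)) has_real_derivative dq i x + \<epsilon> n * (real (2 * g + 2) * (x $ i) ^ (2 * g + 1))) (at 0)"
    proof -
     have "((\<lambda>s. (x $ i + s) ^ e + (\<Sum>j\<in>-I - {i}. (x $ j) ^ e)) has_real_derivative real e * (x $ i) ^ (e - 1)) (at 0)"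
      by (auto intro!: derivative_eq_intros)
     from DERIV_add[OF dq(2)[of x i] DERIV_cmult[OF this, of "\<epsilon> n"]]
     show ?thesis unfolding qe_def 1 by (simp only: e_def diff_add_assoc) simp
    qed
    show "0 < R - \<bar>x $ i\<bar>" using xi[OF i] by simp
    show "\<forall>s. \<bar>0 - s\<bar> < R - \<bar>x $ i\<bar> \<longrightarrow> qe (x + 0 *\<^sub>R axis i 1) \<le> qe (x + s *\<^sub>R axis i 1)"
    proof (intro allI impI)
     fix s assume s: "\<bar>0 - s\<bar> < R - \<bar>x $ i\<bar>"
     have "x + s *\<^sub>R axis i 1 \<in> F u" using x(1) i s unfolding F_iff by (auto simp: axis_def)
     from x(2)[OF this] show "qe (x + 0 *\<^sub>R axis i 1) \<le> qe (x + s *\<^sub>R axis i 1)" by simp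
    qed
   qed
   hence "(\<epsilon> n, x) \<in> crit_set I g dq" using \<epsilon>(1)[of n] by (auto simp: crit_set_def)
   thus ?thesis using qx x(1) by blast
  qed
  then obtain x where x: "\<And>n. (\<epsilon> n, x n) \<in> crit_set I g dq" "\<And>n. x n \<in> F u" "\<And>n. q (x n) \<le> q (xm u) + \<epsilon> n * H" by metis
  \<comment> \<open>The relation divided by \<open>\<epsilon> n ^ b0\<close>, with the division
    carried out in the exponents so that \<open>\<epsilon> = 0\<close> can be inserted.\<close>
  define \<Psi> where "\<Psi> n = (\<Sum>b<N. \<Sum>l<E. (if b < b0 then 0 else a b l u * \<epsilon> n ^ (b - b0) * q (x n) ^ l))" for n
  have "\<Psi> n = 0" for n
  proof -
   have au: "a b l (x n) = a b l u" for b l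
    by (rule pfun_cong[OF rel(1)]) (use x(2)[of n] in \<open>auto simp: F_iff\<close>)
   have "0 = (\<Sum>b<N. \<Sum>l<E. a b l u * \<epsilon> n ^ b * q (x n) ^ l)" using rel(3)[OF x(1)[of n]] by (simp add: au)
   also have "\<dots> = \<epsilon> n ^ b0 * \<Psi> n"
    unfolding \<Psi>_def sum_distrib_left
   proof (intro sum.cong refl)
     fix b l assume "b \<in> {..<N}" "l \<in> {..<E}"
     show "a b l u * \<epsilon> n ^ b * q (x n) ^ l = \<epsilon> n ^ b0 * (if b < b0 then 0 else a b l u * \<epsilon> n ^ (b - b0) * q (x n) ^ l)"
      using power_add[of "\<epsilon> n" b0 "b - b0"] \<open>l \<in> {..<E}\<close> by (cases "b < b0") (auto simp: b0l)
    qed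
   finally show ?thesis using \<epsilon>(1)[of n] by simp
  qed
  moreover have "\<epsilon> \<longlonglongrightarrow> 0"
  proof -
   have "(\<lambda>n. (c - q (xm u)) / (H + 1) / (real n + 2)) \<longlonglongrightarrow> 0" by real_asymp
   thus ?thesis by (simp add: \<epsilon>_def[abs_def])
  qed
  moreover have "(\<lambda>n. q (x n)) \<longlonglongrightarrow> q (xm u)"
  proof (rule tendsto_sandwich[of "\<lambda>_. q (xm u)" _ _ "\<lambda>n. q (xm u) + \<epsilon> n * H"])
   show "(\<lambda>n. q (xm u) + \<epsilon> n * H) \<longlonglongrightarrow> q (xm u)"
    using tendsto_add[OF tendsto_const tendsto_mult_left_zero[OF \<open>\<epsilon> \<longlonglongrightarrow> 0\<close>], of "q (xm u)" H] by simp
  qed (use x xm in auto)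
  ultimately have lim: "\<Psi> \<longlonglongrightarrow> (\<Sum>b<N. \<Sum>l<E. (if b < b0 then 0 else a b l u * 0 ^ (b - b0) * q (xm u) ^ l))"
   unfolding \<Psi>_def by (intro tendsto_sum) (auto intro!: tendsto_intros)
  have "(\<Sum>b<N. \<Sum>l<E. (if b < b0 then 0 else a b l u * 0 ^ (b - b0) * q (xm u) ^ l))
   = (\<Sum>b<N. if b = b0 then (\<Sum>l<E. a b0 l u * q (xm u) ^ l) else 0)"
   by (intro sum.cong refl) (auto intro!: sum.neutral)
  also have "\<dots> = (\<Sum>l<E. a b0 l u * q (xm u) ^ l)" using b0 by simp
  finally have "\<Psi> \<longlonglongrightarrow> (\<Sum>l<E. a b0 l u * q (xm u) ^ l)" using lim by simp
  moreover have "\<Psi> = (\<lambda>_. 0)" using \<open>\<And>n. \<Psi> n = 0\<close> by auto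
  ultimately show ?thesis by (simp add: LIMSEQ_const_iff)
 qed
 have "a b0 c0 x = 0" if x: "x \<in> V" for x
 proof -
  have "\<forall>n. \<exists>u. dist u x < 1 / (real n + 1) \<and> (\<forall>y\<in>V. \<exists>i\<in>I. y $ i \<noteq> u $ i)"
   using thin[OF x] by simp
  then obtain u where u: "\<And>n. dist (u n) x < 1 / (real n + 1)" "\<And>n y. y \<in> V \<Longrightarrow> \<exists>i\<in>I. y $ i \<noteq> u n $ i" by metis
  have ux: "u \<longlonglongrightarrow> x"
  proof (rule metric_tendsto_imp_tendsto[of "\<lambda>n. 1 / (real n + 1)" 0])
   show "(\<lambda>n. 1 / (real n + 1)) \<longlonglongrightarrow> 0" by real_asymp
  qed (use u(1) in \<open>auto intro!: always_eventually less_imp_le\<close>)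
  have uxi: "(\<lambda>n. u n $ i) \<longlonglongrightarrow> x $ i" for i using ux by (rule tendsto_vec_nth)
  define mm where "mm n = q (xm (u n))" for n
  have "mm \<longlonglongrightarrow> 0"
  proof (rule tendsto_sandwich[of "\<lambda>_. 0"])
   \<comment> \<open>Moving only the coordinates in \<open>I\<close> from \<open>x\<close> to
     \<open>u n\<close> gives a competitor in the fibre at which \<open>q\<close> tends to
     0.\<close>
   define v where "v n = (\<chi> i. if i \<in> I then u n $ i else x $ i)" for n
   have "v \<longlonglongrightarrow> x"
   proof (rule vec_tendstoI)
    fix i show "(\<lambda>n. v n $ i) \<longlonglongrightarrow> x $ i" using uxi[of i] by (cases "i \<in> I") (auto simp: v_def)
   qed
   moreover have "isCont q x" using contq[of UNIV] by (simp add: continuous_on_eq_continuous_at)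
   ultimately have "(\<lambda>n. q (v n)) \<longlonglongrightarrow> q x" by (rule isCont_tendsto_compose[rotated])
   thus "(\<lambda>n. q (v n)) \<longlonglongrightarrow> 0" using x V by simp
   have "v n \<in> F (u n)" for n using Ri[OF x] by (auto simp: F_iff v_def less_imp_le)
   thus "\<forall>\<^sub>F n in sequentially. mm n \<le> q (v n)" unfolding mm_def by (intro always_eventually allI xm)
  qed (auto simp: mm_def q0)
  have ev: "\<forall>\<^sub>F n in sequentially. (\<Sum>l<E. if l < c0 then 0 else a b0 l (u n) * mm n ^ (l - c0)) = 0"
  proof -
   have "\<forall>\<^sub>F n in sequentially. \<bar>u n $ i\<bar> < R" for i
    using order_tendstoD(2)[OF tendsto_rabs[OF uxi[of i]] Ri[OF x, of i]] .
   hence "\<forall>\<^sub>F n in sequentially. \<forall>i. \<bar>u n $ i\<bar> < R" by (intro eventually_all_finite) auto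
   moreover have "\<forall>\<^sub>F n in sequentially. mm n < c" using order_tendstoD(2)[OF \<open>mm \<longlonglongrightarrow> 0\<close> c(1)] .
   ultimately show ?thesis
   proof eventually_elim
    case (elim n)
    have "(\<Sum>l<E. a b0 l (u n) * mm n ^ l) = 0" unfolding mm_def
     using elim by (intro star) (auto simp: mm_def less_imp_le)
    moreover have "(\<Sum>l<E. a b0 l (u n) * mm n ^ l) = mm n ^ c0 * (\<Sum>l<E. if l < c0 then 0 else a b0 l (u n) * mm n ^ (l - c0))"
     unfolding sum_distrib_left
    proof (intro sum.cong refl)
     fix l
     show "a b0 l (u n) * mm n ^ l = mm n ^ c0 * (if l < c0 then 0 else a b0 l (u n) * mm n ^ (l - c0))"
      using power_add[of "mm n" c0 "l - c0"] by (auto simp: c0l)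
    qed
    \<comment> \<open>A zero minimum would put a point of \<open>V\<close> over
      \<open>u n\<close>.\<close>
    moreover have "mm n \<noteq> 0"
    proof
     assume "mm n = 0"
     hence "xm (u n) \<in> V" by (simp add: V mm_def)
     from u(2)[OF this, of n] xm(1)[of "u n"] show False by (auto simp: F_iff)
    qed
    ultimately show ?case by simp
   qed
  qed
  have "(\<lambda>n. a b0 l (u n)) \<longlonglongrightarrow> a b0 l x" for l
  proof (rule isCont_tendsto_compose[OF _ ux])
   show "isCont (a b0 l) x" using pfun_continuous[OF rel(1), of UNIV b0 l] by (simp add: continuous_on_eq_continuous_at)
  qed
  hence "(\<lambda>n. \<Sum>l<E. if l < c0 then 0 else a b0 l (u n) * mm n ^ (l - c0)) \<longlonglongrightarrow>
    (\<Sum>l<E. if l < c0 then 0 else a b0 l x * 0 ^ (l - c0))"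
   by (intro tendsto_sum) (auto intro!: tendsto_intros \<open>mm \<longlonglongrightarrow> 0\<close>)
  moreover have "(\<Sum>l<E. if l < c0 then 0 else a b0 l x * 0 ^ (l - c0)) = (\<Sum>l<E. if l = c0 then a b0 c0 x else 0)"
   by (intro sum.cong refl) auto
  ultimately have "(\<lambda>n. \<Sum>l<E. if l < c0 then 0 else a b0 l (u n) * mm n ^ (l - c0)) \<longlonglongrightarrow> a b0 c0 x"
   using c0 by simp
  moreover have "(\<lambda>n. \<Sum>l<E. if l < c0 then 0 else a b0 l (u n) * mm n ^ (l - c0)) \<longlonglongrightarrow> 0"
   using ev by (rule tendsto_eventually)
  ultimately show ?thesis by (rule LIMSEQ_unique)
 qed
 with c0(2) show ?thesis by (rule that[OF rel(1)])
qed

section \<open>Elimination of the coordinates outside \<open>J\<close>\<close>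

lemma pfun_split_variable:
 assumes "pfun (insert j J) K a" "j \<notin> J" "\<exists>x. a x \<noteq> 0"
 obtains A e where "\<And>i. pfun J K (A i)" "e \<le> K" "\<exists>x. A e x \<noteq> (0::real)"
  "\<And>x. a x = (\<Sum>i\<le>e. A i x * x $ j ^ i)"
proof -
 obtain c where c: "a = (\<lambda>x. \<Sum>\<alpha>\<in>mons (insert j J) K. c \<alpha> * mon \<alpha> x)" using assms by (auto simp: pfun_def)
 define A where "A i x = (\<Sum>\<alpha>\<in>{\<alpha>\<in>mons (insert j J) K. \<alpha> j = i}. c \<alpha> * mon (\<alpha>(j := 0)) x)" for i x
 have A: "pfun J K (A i)" for i
  unfolding A_def
 proof (intro pfun_sum pfun_mon)
  fix \<alpha> assume "\<alpha> \<in> {\<alpha>\<in>mons (insert j J) K. \<alpha> j = i}"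
  moreover have "(\<Sum>l\<in>UNIV. (\<alpha>(j := 0)) l) \<le> (\<Sum>l\<in>UNIV. \<alpha> l)" by (rule sum_mono) auto
  ultimately show "\<alpha>(j := 0) \<in> mons J K" by (auto simp: mons_def)
 qed
 have aA: "a x = (\<Sum>i\<le>K. A i x * x $ j ^ i)" for x
 proof -
  have "a x = (\<Sum>i\<le>K. \<Sum>\<alpha>\<in>{\<alpha>\<in>mons (insert j J) K. \<alpha> j = i}. c \<alpha> * mon \<alpha> x)"
   unfolding c by (rule sum.group[symmetric]) (auto intro: mons_component_le)
  also have "\<dots> = (\<Sum>i\<le>K. A i x * x $ j ^ i)"
   unfolding A_def sum_distrib_right by (intro sum.cong refl) (subst mon_split[of _ _ j], auto)
  finally show ?thesis .
 qed
 have ex: "\<exists>i\<le>K. \<exists>x. A i x \<noteq> 0"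
 proof (rule ccontr)
  assume "\<not> ?thesis"
  hence "a x = 0" for x unfolding aA by (intro sum.neutral) auto
  thus False using assms by blast
 qed
 define S where "S = {i. i \<le> K \<and> (\<exists>x. A i x \<noteq> 0)}"
 have S: "finite S" "S \<noteq> {}" using ex by (auto simp: S_def)
 define e where "e = Max S"
 have e: "e \<in> S" unfolding e_def using S by (rule Max_in)
 have "A i x = 0" if "i > e" "i \<le> K" for i x
  using Max_ge[OF S(1), folded e_def, of i] that by (fastforce simp: S_def)
 hence "a x = (\<Sum>i\<le>e. A i x * x $ j ^ i)" for x
  unfolding aA using e by (intro sum.mono_neutral_right) (auto simp: S_def)
 thus ?thesis using that[of A e] A e by (auto simp: S_def)
qed

lemma pfun_prod_nonzero:
 assumes "finite S" "\<And>j. j \<in> S \<Longrightarrow> pfun I K (L j)" "\<And>j. j \<in> S \<Longrightarrow> \<exists>x. L j x \<noteq> 0"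
 shows "\<exists>x. (\<Prod>j\<in>S. L j x) \<noteq> (0::real)"
 using assms
proof (induction S)
 case (insert j S)
 then obtain x y where xy: "L j x \<noteq> 0" "(\<Prod>j\<in>S. L j y) \<noteq> 0" by (metis insertCI)
 have "pfun I K (L j)" "pfun I (\<Sum>j\<in>S. K) (\<lambda>x. \<Prod>j\<in>S. L j x)" using insert by (blast intro: pfun_prod)+
 from pfun_mult_nonzero[OF this xy] obtain z where "L j z \<noteq> 0" "(\<Prod>j\<in>S. L j z) \<noteq> 0" .
 thus ?case using insert by (intro exI[of _ z]) auto
qed auto

text \<open>Multiplying by powers of \<open>x $ j\<close> brings the relations for all
  \<open>j\<close> to one exponent \<open>E\<close>. The leading coefficient cannot be inverted
  among polynomials, so it is carried along as \<open>L j\<close>.\<close>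

lemma leading_coefficient_relation:
 fixes J :: "'n::finite set"
 assumes "\<And>j. j \<notin> J \<Longrightarrow> \<exists>K a. pfun (insert j J) K a \<and> (\<exists>x. a x \<noteq> (0::real)) \<and> (\<forall>x\<in>V. a x = 0)"
 obtains K E L l where "E > 0" "\<And>j. j \<notin> J \<Longrightarrow> pfun J K (L j)" "\<And>j i. j \<notin> J \<Longrightarrow> pfun J K (l j i)"
  "\<And>j. j \<notin> J \<Longrightarrow> \<exists>x. L j x \<noteq> (0::real)"
  "\<And>j x. j \<notin> J \<Longrightarrow> x \<in> V \<Longrightarrow> L j x * x $ j ^ E = (\<Sum>i<E. l j i x * x $ j ^ i)"
proof -
 have "\<forall>j\<in>-J. \<exists>K. \<exists>a. pfun (insert j J) K a \<and> (\<exists>x. a x \<noteq> (0::real)) \<and> (\<forall>x\<in>V. a x = 0)" using assms by blast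
 from bchoice[OF this] obtain k where k: "\<forall>j\<in>-J. \<exists>a. pfun (insert j J) (k j) a \<and> (\<exists>x. a x \<noteq> (0::real)) \<and> (\<forall>x\<in>V. a x = 0)" by blast
 define K where "K = (\<Sum>j\<in>-J. k j)"
 define E where "E = K + 1"
 have "\<exists>L l. pfun J K L \<and> (\<forall>i. pfun J K (l i)) \<and> (\<exists>x. L x \<noteq> (0::real)) \<and> (\<forall>x\<in>V. L x * x $ j ^ E = (\<Sum>i<E. l i x * x $ j ^ i))"
  if j: "j \<notin> J" for j
 proof -
  obtain a where a: "pfun (insert j J) (k j) a" "\<exists>x. a x \<noteq> 0" "\<forall>x\<in>V. a x = 0" using k j by blast
  have "k j \<le> K" unfolding K_def using j by (intro member_le_sum) auto
  hence "pfun (insert j J) K a" using a(1) by (rule_tac pfun_mono) auto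
  then obtain A e where A: "\<And>i. pfun J K (A i)" "e \<le> K" "\<exists>x. A e x \<noteq> (0::real)"
   "\<And>x. a x = (\<Sum>i\<le>e. A i x * x $ j ^ i)" by (rule pfun_split_variable[OF _ j a(2)]) blast
  \<comment> \<open>The lower coefficients change sign on the other side of the equation, and their
    indices move up by \<open>E - e\<close>.\<close>
  define l where "l i = (if i < E - e then (\<lambda>x. 0) else (\<lambda>x. - A (i - (E - e)) x))" for i
  have "A e x * x $ j ^ E = (\<Sum>i<E. l i x * x $ j ^ i)" if x: "x \<in> V" for x
  proof -
   have "0 = (\<Sum>i\<le>e. A i x * x $ j ^ i)" using a(3) x A(4)[of x] by simp
   also have "\<dots> = (\<Sum>i<e. A i x * x $ j ^ i) + A e x * x $ j ^ e" by (simp add: lessThan_Suc_atMost[symmetric])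
   finally have "A e x * x $ j ^ e = - (\<Sum>i<e. A i x * x $ j ^ i)" by simp
   hence "A e x * x $ j ^ e * x $ j ^ (E - e) = - (\<Sum>i<e. A i x * x $ j ^ i) * x $ j ^ (E - e)" by simp
   moreover have "x $ j ^ e * x $ j ^ (E - e) = x $ j ^ E" using A(2) by (simp add: power_add[symmetric] E_def)
   ultimately have "A e x * x $ j ^ E = (\<Sum>i<e. - A i x * x $ j ^ (i + (E - e)))"
    by (simp add: mult.assoc sum_distrib_right power_add sum_negf)
   also have "\<dots> = (\<Sum>i\<in>(\<lambda>i. i + (E - e)) ` {..<e}. l i x * x $ j ^ i)"
    by (subst sum.reindex) (auto simp: l_def)
   also have "\<dots> = (\<Sum>i<E. l i x * x $ j ^ i)"
   proof (rule sum.mono_neutral_left)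
    show "\<forall>i\<in>{..<E} - (\<lambda>i. i + (E - e)) ` {..<e}. l i x * x $ j ^ i = 0"
    proof
     fix i assume i: "i \<in> {..<E} - (\<lambda>i. i + (E - e)) ` {..<e}"
     have "i < E - e"
     proof (rule ccontr)
      assume "\<not> i < E - e"
      hence "i = (i - (E - e)) + (E - e)" "i - (E - e) < e" using i A(2) by (auto simp: E_def)
      thus False using i by blast
     qed
     thus "l i x * x $ j ^ i = 0" by (simp add: l_def)
    qed
   qed (use A(2) in \<open>auto simp: E_def\<close>)
   finally show ?thesis .
  qed
  moreover have "pfun J K (l i)" for i using A(1) by (auto simp: l_def intro: pfun_uminus)
  ultimately show ?thesis using A by blast
 qed
 hence "\<forall>j\<in>-J. \<exists>Ll. pfun J K (fst Ll) \<and> (\<forall>i. pfun J K (snd Ll i)) \<and> (\<exists>x. fst Ll x \<noteq> (0::real)) \<and> (\<forall>x\<in>V. fst Ll x * x $ j ^ E = (\<Sum>i<E. snd Ll i x * x $ j ^ i))"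
  by (auto simp: split_paired_Ex)
 from bchoice[OF this] obtain Ll where Ll: "\<forall>j\<in>-J. pfun J K (fst (Ll j)) \<and> (\<forall>i. pfun J K (snd (Ll j) i)) \<and> (\<exists>x. fst (Ll j) x \<noteq> (0::real)) \<and> (\<forall>x\<in>V. fst (Ll j) x * x $ j ^ E = (\<Sum>i<E. snd (Ll j) i x * x $ j ^ i))"
  by blast
 show ?thesis
  by (rule that[of E K "\<lambda>j. fst (Ll j)" "\<lambda>j. snd (Ll j)"]) (use Ll in \<open>auto simp: E_def\<close>)
qed

text \<open>Factors in the coordinates of \<open>J\<close> leave the exponents outside
  \<open>J\<close> untouched, so a normal form stays one at the cost of a larger range in
  \<open>J\<close>.\<close>

lemma inspan_mon_pfun_mult:
 assumes f: "inspan V mon (box_exps J r s) f" and h: "pfun J K h"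
 shows "inspan V mon (box_exps J (r + K) s) (\<lambda>x. h x * f x)"
proof -
 obtain m where m: "\<forall>x\<in>V. f x = (\<Sum>\<beta>\<in>box_exps J r s. m \<beta> * mon \<beta> x)" using f by (auto simp: inspan_def)
 obtain c where c: "h = (\<lambda>x. \<Sum>\<alpha>\<in>mons J K. c \<alpha> * mon \<alpha> x)" using h by (auto simp: pfun_def)
 have "inspan V mon (box_exps J (r + K) s) (\<lambda>x. \<Sum>\<alpha>\<in>mons J K. \<Sum>\<beta>\<in>box_exps J r s. (c \<alpha> * m \<beta>) * mon (\<lambda>i. \<alpha> i + \<beta> i) x)"
 proof (intro inspan_sum inspan_cmult)
  fix \<alpha> \<beta> assume ab: "\<alpha> \<in> mons J K" "\<beta> \<in> box_exps J r s"
  have "\<alpha> i + \<beta> i < r + K" if "i \<in> J" for i using ab that mons_component_le[OF ab(1), of i] by (auto simp: box_exps_def add.commute intro: add_le_less_mono)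
  moreover have "\<alpha> i + \<beta> i < s" if "i \<notin> J" for i using ab that by (auto simp: box_exps_def mons_def)
  ultimately have "(\<lambda>i. \<alpha> i + \<beta> i) \<in> box_exps J (r + K) s" by (auto simp: box_exps_def)
  thus "inspan V mon (box_exps J (r + K) s) (\<lambda>x. mon (\<lambda>i. \<alpha> i + \<beta> i) x)"
   by (rule inspan_base[OF finite_box_exps]) auto
 qed
 thus ?thesis
  by (rule inspan_cong) (use m in \<open>auto simp: c sum_product mon_mult[symmetric] mult_ac\<close>)
qed

text \<open>After multiplication by a power of the product of the leading coefficients, powers of \<^term>\<open>p\<close> reduce
 to monomials of bounded degree in the coordinates outside \<^term>\<open>J\<close>; more powers than monomials are dependent.\<close>
lemma uniform_algebraic_relation:
 fixes J :: "'n::finite set"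
 assumes "\<And>j. j \<notin> J \<Longrightarrow> \<exists>K a. pfun (insert j J) K a \<and> (\<exists>x. a x \<noteq> (0::real)) \<and> (\<forall>x\<in>V. a x = 0)"
 obtains D C :: nat where "\<And>k p. k \<ge> 1 \<Longrightarrow> pfun UNIV k p \<Longrightarrow>
   \<exists>b. (\<forall>i. pfun J (C * k) (b i)) \<and> (\<exists>i\<le>D. \<exists>x. b i x \<noteq> 0) \<and> (\<forall>x\<in>V. (\<Sum>i\<le>D. b i x * p x ^ i) = 0)"
proof -
 obtain K E L l where E: "E > 0" and L: "\<And>j. j \<notin> J \<Longrightarrow> pfun J K (L j)" and l: "\<And>j i. j \<notin> J \<Longrightarrow> pfun J K (l j i)"
  and Lnz: "\<And>j. j \<notin> J \<Longrightarrow> \<exists>x. L j x \<noteq> (0::real)"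
  and rel: "\<And>j x. j \<notin> J \<Longrightarrow> x \<in> V \<Longrightarrow> L j x * x $ j ^ E = (\<Sum>i<E. l j i x * x $ j ^ i)"
  by (rule leading_coefficient_relation[OF assms]) auto
 define \<Delta> where "\<Delta> x = (\<Prod>j\<in>-J. L j x)" for x
 define K2 where "K2 = card (- J) * K"
 have \<Delta>: "pfun J K2 \<Delta>"
  using pfun_prod[of "-J" J "\<lambda>_. K" L] L unfolding \<Delta>_def[abs_def] K2_def by simp
 obtain x\<Delta> where x\<Delta>: "\<Delta> x\<Delta> \<noteq> 0" using pfun_prod_nonzero[of "-J" J K L] L Lnz by (auto simp: \<Delta>_def)
 \<comment> \<open>One reduction step multiplies by \<open>\<Delta>' * l j i\<close>, of degree at
   most \<open>K2 + K\<close> in the coordinates of \<open>J\<close>; the summand 1 accounts for the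
   exponents of \<open>\<alpha>\<close> itself.\<close>
 define c where "c = K2 + K + 1"
 have red: "inspan V mon (box_exps J (Suc (c * k)) E) (\<lambda>x. \<Delta> x ^ k * mon \<alpha> x)" if "\<alpha> \<in> mons UNIV k" for \<alpha> k
  using that
 proof (induction k arbitrary: \<alpha>)
  case 0
  hence "\<alpha> = (\<lambda>_. 0)" by (auto simp: mons_def)
  thus ?case using E by (intro inspan_base[OF finite_box_exps, of \<alpha>]) (auto simp: box_exps_def)
 next
  case (Suc k)
  show ?case
  proof (cases "\<forall>j. j \<notin> J \<longrightarrow> \<alpha> j < E")
   case True
   hence "\<alpha> \<in> box_exps J (Suc (Suc k)) E" using mons_component_le[OF Suc.prems] by (auto simp: box_exps_def less_Suc_eq_le)
   hence "inspan V mon (box_exps J (Suc (Suc k)) E) (mon \<alpha>)" by (rule inspan_base[OF finite_box_exps]) auto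
   from inspan_mon_pfun_mult[OF this pfun_power[OF \<Delta>, of "Suc k"]]
   show ?thesis by (rule inspan_mono) (auto intro!: box_exps_mono simp: c_def algebra_simps)
  next
   case False
   then obtain j where j: "j \<notin> J" "\<alpha> j \<ge> E" by force
   define \<alpha>' where "\<alpha>' = \<alpha>(j := \<alpha> j - E)"
   have a': "E \<le> Suc k" "\<alpha>' \<in> mons UNIV (Suc k - E)" using mons_reduce[OF Suc.prems j(2)] by (auto simp: \<alpha>'_def)
   define \<Delta>' where "\<Delta>' x = (\<Prod>i\<in>-J-{j}. L i x)" for x
   have \<Delta>': "pfun J K2 \<Delta>'"
   proof -
    have "pfun J (\<Sum>i\<in>-J-{j}. K) \<Delta>'" unfolding \<Delta>'_def[abs_def] using L by (intro pfun_prod) auto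
    moreover have "(\<Sum>i\<in>-J-{j}. K) \<le> K2" unfolding K2_def by (simp add: card_mono mult_right_mono)
    ultimately show ?thesis by (blast intro: pfun_mono)
   qed
   \<comment> \<open>One factor \<open>\<Delta>\<close> is spent per step: \<open>L j\<close> serves
     to rewrite the power \<open>E\<close> of the coordinate \<open>j\<close>, and
     \<open>\<Delta>'\<close> goes into the coefficient.\<close>
   have \<Delta>L: "\<Delta> x = \<Delta>' x * L j x" for x
    unfolding \<Delta>_def \<Delta>'_def using j by (subst prod.remove[of _ j]) (auto simp: mult.commute)
   define \<beta> where "\<beta> i = \<alpha>'(j := \<alpha>' j + i)" for i
   have mb: "mon (\<beta> i) x = x $ j ^ i * mon \<alpha>' x" for i x
    by (subst mon_reduce[of i _ j]) (auto simp: \<beta>_def)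
   have bm: "\<beta> i \<in> mons UNIV k" if "i < E" for i
   proof -
    have "(\<Sum>l\<in>UNIV. \<beta> i l) = (\<Sum>l\<in>UNIV. \<alpha>' l) + i"
     by (subst (1 2) sum.remove[of _ j]) (auto simp: \<beta>_def)
    thus ?thesis using a' that by (auto simp: mons_def)
   qed
   have "inspan V mon (box_exps J (Suc (c * Suc k)) E) (\<lambda>x. \<Sum>i<E. (\<Delta>' x * l j i x) * (\<Delta> x ^ k * mon (\<beta> i) x))"
   proof (rule inspan_sum)
    fix i assume i: "i \<in> {..<E}"
    have "pfun J (K2 + K) (\<lambda>x. \<Delta>' x * l j i x)" by (intro pfun_mult \<Delta>' l j)
    from inspan_mon_pfun_mult[OF Suc.IH[OF bm] this]
    have "inspan V mon (box_exps J (Suc (c * k) + (K2 + K)) E) (\<lambda>x. \<Delta>' x * l j i x * (\<Delta> x ^ k * mon (\<beta> i) x))"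
     using i by auto
    thus "inspan V mon (box_exps J (Suc (c * Suc k)) E) (\<lambda>x. \<Delta>' x * l j i x * (\<Delta> x ^ k * mon (\<beta> i) x))"
     by (rule inspan_mono) (auto intro!: box_exps_mono simp: c_def algebra_simps)
   qed
   thus ?thesis
   proof (rule inspan_cong)
    fix x assume x: "x \<in> V"
    have "\<Delta> x ^ Suc k * mon \<alpha> x = \<Delta> x ^ k * \<Delta>' x * (L j x * x $ j ^ E) * mon \<alpha>' x"
     by (subst mon_reduce[of E \<alpha> j, OF j(2)]) (simp add: \<alpha>'_def \<Delta>L)
    also have "\<dots> = (\<Sum>i<E. \<Delta>' x * l j i x * (\<Delta> x ^ k * mon (\<beta> i) x))"
     unfolding rel[OF j(1) x] sum_distrib_left sum_distrib_right mb by (intro sum.cong) auto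
    finally show "\<Delta> x ^ Suc k * mon \<alpha> x = (\<Sum>i<E. \<Delta>' x * l j i x * (\<Delta> x ^ k * mon (\<beta> i) x))" .
   qed
  qed
 qed
 have redp: "inspan V mon (box_exps J (Suc (c * k)) E) (\<lambda>x. \<Delta> x ^ k * h x)" if h: "pfun UNIV k h" for h k
 proof -
  obtain e where e: "h = (\<lambda>x. \<Sum>\<alpha>\<in>mons UNIV k. e \<alpha> * mon \<alpha> x)" using h by (auto simp: pfun_def)
  have "inspan V mon (box_exps J (Suc (c * k)) E) (\<lambda>x. \<Sum>\<alpha>\<in>mons UNIV k. e \<alpha> * (\<Delta> x ^ k * mon \<alpha> x))"
   by (intro inspan_sum inspan_cmult red)
  thus ?thesis by (rule inspan_cong) (auto simp: e sum_distrib_left mult_ac)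
 qed
 define d where "d = card J"
 \<comment> \<open>With exponents in \<open>J\<close> running up to \<open>(d + 1) * N\<close> there
   are \<open>N ^ d * D\<close> normal forms against \<open>N ^ d * (D + 1)\<close> candidates;
   \<open>D\<close> does not involve \<open>k\<close>.\<close>
 define D where "D = (d + 1) ^ d * E ^ card (- J)"
 define C where "C = K2 * D + d * (c * D + 1)"
 show ?thesis
 proof (rule that[of C D])
  fix k :: nat and p :: "real^'n \<Rightarrow> real" assume k: "k \<ge> 1" and p: "pfun UNIV k p"
  define N where "N = c * (k * D) + 1"
  define A where "A = box_exps J N 1 \<times> {..D}"
  define F where "F = (\<lambda>(\<alpha>, i) x. mon \<alpha> x * (\<Delta> x ^ (k * D) * p x ^ i))"
  define B where "B = box_exps J (Suc (c * (k * D)) + d * N) E"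
  have "Suc (c * (k * D)) + d * N = (d + 1) * N" by (simp add: N_def)
  hence "card B = ((d + 1) * N) ^ d * E ^ card (- J)" unfolding B_def card_box_exps d_def by (simp only:)
  also have "\<dots> = N ^ d * D" by (simp only: power_mult_distrib D_def mult_ac)
  also have "\<dots> < N ^ d * (D + 1)" by (simp add: N_def)
  also have "\<dots> = card A" by (simp add: A_def card_cartesian_product card_box_exps d_def)
  finally have lt: "card B < card A" .
  have Fsp: "inspan V mon B (F y)" if y: "y \<in> A" for y
  proof -
   obtain \<alpha> i where yy: "y = (\<alpha>, i)" by force
   have al: "\<alpha> \<in> mons J (d * N)" "i \<le> D" using y yy box_exps_one_sum[of \<alpha> J N] by (auto simp: A_def d_def)
   have "pfun UNIV (k * D) (\<lambda>x. p x ^ i)" using al(2) by (intro pfun_mono[OF pfun_power[OF p, of i]]) auto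
   from inspan_mon_pfun_mult[OF redp[OF this] pfun_mon[OF al(1), of 1]]
   show ?thesis by (simp add: B_def F_def yy)
  qed
  have finAB: "finite A" "finite B" by (auto simp: A_def B_def)
  from inspan_dependent[OF finAB lt Fsp]
  obtain \<kappa> where "(\<exists>a\<in>A. \<kappa> a \<noteq> 0) \<and> (\<forall>x\<in>V. (\<Sum>a\<in>A. \<kappa> a * F a x) = 0)" ..
  note \<kappa> = conjunct1[OF this] conjunct2[OF this]
  define e where "e i x = (\<Sum>\<alpha>\<in>box_exps J N 1. \<kappa> (\<alpha>, i) * mon \<alpha> x)" for i x
  define b where "b i x = \<Delta> x ^ (k * D) * e i x" for i x
  have e: "pfun J (d * N) (e i)" for i unfolding e_def[abs_def] d_def
   by (intro pfun_sum pfun_mon box_exps_one_sum)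
  have "pfun J (C * k) (b i)" for i
  proof -
   have "pfun J (k * D * K2 + d * N) (b i)" unfolding b_def[abs_def] by (intro pfun_mult pfun_power \<Delta> e)
   \<comment> \<open>Here \<open>k \<ge> 1\<close> absorbs the constant summand of
     \<open>N\<close>.\<close>
   moreover have "k * D * K2 + d * N \<le> C * k" using k by (simp add: C_def N_def algebra_simps)
   ultimately show ?thesis by (blast intro: pfun_mono)
  qed
  moreover have "\<exists>i\<le>D. \<exists>x. b i x \<noteq> 0"
  proof -
   obtain \<alpha> i where y: "(\<alpha>, i) \<in> A" "\<kappa> (\<alpha>, i) \<noteq> 0" using \<kappa>(1) by auto
   have "\<exists>x. e i x \<noteq> 0"
   proof (rule ccontr)
    assume "\<not> ?thesis"
    hence "\<kappa> (\<alpha>, i) = 0" using y(1) unfolding e_def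
     by (intro monomials_independent[of "box_exps J N 1" "\<lambda>\<alpha>. \<kappa> (\<alpha>, i)"]) (auto simp: A_def)
    thus False using y by simp
   qed
   then obtain xe where "e i xe \<noteq> 0" by blast
   from pfun_mult_nonzero[OF \<Delta> e x\<Delta> this] obtain z where "\<Delta> z \<noteq> 0" "e i z \<noteq> 0" .
   hence "b i z \<noteq> 0" by (simp add: b_def)
   thus ?thesis using y by (auto simp: A_def)
  qed
  moreover have "(\<Sum>i\<le>D. b i x * p x ^ i) = 0" if x: "x \<in> V" for x
  proof -
   have "0 = (\<Sum>(\<alpha>, i)\<in>A. \<kappa> (\<alpha>, i) * (mon \<alpha> x * (\<Delta> x ^ (k * D) * p x ^ i)))"
    using bspec[OF \<kappa>(2) x] by (simp add: F_def split_beta')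
   also have "\<dots> = (\<Sum>\<alpha>\<in>box_exps J N 1. \<Sum>i\<le>D. \<kappa> (\<alpha>, i) * (mon \<alpha> x * (\<Delta> x ^ (k * D) * p x ^ i)))"
    unfolding A_def by (simp add: sum.cartesian_product)
   also have "\<dots> = (\<Sum>i\<le>D. b i x * p x ^ i)"
    unfolding b_def e_def by (subst sum.swap) (simp add: sum_distrib_left sum_distrib_right mult_ac)
   finally show ?thesis by simp
  qed
  ultimately show "\<exists>b. (\<forall>i. pfun J (C * k) (b i)) \<and> (\<exists>i\<le>D. \<exists>x. b i x \<noteq> 0) \<and> (\<forall>x\<in>V. (\<Sum>i\<le>D. b i x * p x ^ i) = 0)"
   by blast
 qed
qed

section \<open>Analyticity of smooth algebraic functions\<close>

text \<open>The condition f = O(|x - a|^N), including the point \<open>x = a\<close>: for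
  \<open>N \<ge> 1\<close> it forces \<open>f a = 0\<close>, and \<open>N = 0\<close> means
  boundedness near \<open>a\<close>.\<close>

definition small :: "'a::real_normed_vector \<Rightarrow> nat \<Rightarrow> ('a \<Rightarrow> 'b::real_normed_vector) \<Rightarrow> bool" where
 "small a N f \<longleftrightarrow> (\<exists>C \<delta>. \<delta> > 0 \<and> (\<forall>x. norm (x - a) < \<delta> \<longrightarrow> norm (f x) \<le> C * norm (x - a) ^ N))"

lemma smallE:
 assumes "small a N f"
 obtains C \<delta> where "C \<ge> 0" "\<delta> > 0" "\<And>x. norm (x - a) < \<delta> \<Longrightarrow> norm (f x) \<le> C * norm (x - a) ^ N"
proof -
 obtain C \<delta> where *: "\<delta> > 0" "\<And>x. norm (x - a) < \<delta> \<Longrightarrow> norm (f x) \<le> C * norm (x - a) ^ N"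
  using assms unfolding small_def by blast
 show ?thesis
 proof (rule that[of "max C 0" \<delta>])
  fix x assume "norm (x - a) < \<delta>"
  from *(2)[OF this] show "norm (f x) \<le> max C 0 * norm (x - a) ^ N"
   by (rule order_trans) (intro mult_right_mono, auto)
 qed (use * in auto)
qed

lemma small_add: assumes "small a N f" "small a N g" shows "small a N (\<lambda>x. f x + g x)"
proof -
 obtain C \<delta> where 1: "C \<ge> 0" "\<delta> > 0" "\<And>x. norm (x - a) < \<delta> \<Longrightarrow> norm (f x) \<le> C * norm (x - a) ^ N"
  by (rule smallE[OF assms(1)]) blast
 obtain D \<epsilon> where 2: "D \<ge> 0" "\<epsilon> > 0" "\<And>x. norm (x - a) < \<epsilon> \<Longrightarrow> norm (g x) \<le> D * norm (x - a) ^ N"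
  by (rule smallE[OF assms(2)]) blast
 have "norm (f x + g x) \<le> (C + D) * norm (x - a) ^ N" if "norm (x - a) < min \<delta> \<epsilon>" for x
  using 1(3)[of x] 2(3)[of x] that norm_triangle_ineq[of "f x" "g x"] by (auto simp: distrib_right)
 thus ?thesis unfolding small_def using 1 2 by (intro exI[of _ "C + D"] exI[of _ "min \<delta> \<epsilon>"]) auto
qed

lemma small_minus: "small a N f \<Longrightarrow> small a N (\<lambda>x. - f x)"
 by (simp add: small_def)

lemma small_diff: "small a N f \<Longrightarrow> small a N g \<Longrightarrow> small a N (\<lambda>x. f x - g x)"
 using small_add[of a N f "\<lambda>x. - g x"] small_minus[of a N g] by simp

lemma small_zero [simp]: "small a N (\<lambda>x. 0)"
 unfolding small_def by (intro exI[of _ 0] exI[of _ 1]) auto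

lemma small_sum: "(\<And>i. i \<in> A \<Longrightarrow> small a N (f i)) \<Longrightarrow> small a N (\<lambda>x. \<Sum>i\<in>A. f i x)"
 by (induction A rule: infinite_finite_induct) (auto intro: small_add)

lemma small_mult:
 fixes f g :: "'a::real_normed_vector \<Rightarrow> 'b::real_normed_algebra"
 assumes "small a N f" "small a M g" shows "small a (N + M) (\<lambda>x. f x * g x)"
proof -
 obtain C \<delta> where 1: "C \<ge> 0" "\<delta> > 0" "\<And>x. norm (x - a) < \<delta> \<Longrightarrow> norm (f x) \<le> C * norm (x - a) ^ N"
  by (rule smallE[OF assms(1)]) blast
 obtain D \<epsilon> where 2: "D \<ge> 0" "\<epsilon> > 0" "\<And>x. norm (x - a) < \<epsilon> \<Longrightarrow> norm (g x) \<le> D * norm (x - a) ^ M"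
  by (rule smallE[OF assms(2)]) blast
 have "norm (f x * g x) \<le> (C * D) * norm (x - a) ^ (N + M)" if "norm (x - a) < min \<delta> \<epsilon>" for x
 proof -
  have "norm (f x * g x) \<le> norm (f x) * norm (g x)" by (rule norm_mult_ineq)
  also have "\<dots> \<le> (C * norm (x - a) ^ N) * (D * norm (x - a) ^ M)"
   using 1 2 that by (intro mult_mono) auto
  finally show ?thesis by (simp add: power_add mult_ac)
 qed
 thus ?thesis unfolding small_def using 1 2 by (intro exI[of _ "C * D"] exI[of _ "min \<delta> \<epsilon>"]) auto
qed

lemma small_mono: assumes "small a N f" "M \<le> N" shows "small a M f"
proof -
 obtain C \<delta> where 1: "C \<ge> 0" "\<delta> > 0" "\<And>x. norm (x - a) < \<delta> \<Longrightarrow> norm (f x) \<le> C * norm (x - a) ^ N"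
  by (rule smallE[OF assms(1)]) blast
 have "norm (f x) \<le> C * norm (x - a) ^ M" if "norm (x - a) < min \<delta> 1" for x
 proof -
  have "norm (f x) \<le> C * norm (x - a) ^ N" using that by (intro 1(3)) auto
  also have "\<dots> \<le> C * norm (x - a) ^ M" using 1 that assms(2) by (intro mult_left_mono power_decreasing) auto
  finally show ?thesis .
 qed
 thus ?thesis unfolding small_def using 1 by (intro exI[of _ C] exI[of _ "min \<delta> 1"]) auto
qed

lemma small_0_continuous: assumes "isCont f a" shows "small a 0 f"
proof -
 obtain d where "d > 0" "\<forall>x. dist x a < d \<longrightarrow> dist (f x) (f a) < 1"
  using assms unfolding continuous_at_eps_delta by (metis zero_less_one)
 hence "norm (f x) \<le> (norm (f a) + 1) * norm (x - a) ^ 0" if "norm (x - a) < d" for x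
  using that norm_triangle_ineq2[of "f x" "f a"] by (fastforce simp: dist_norm)
 thus ?thesis unfolding small_def using \<open>d > 0\<close> by blast
qed

lemma small_const [simp]: "small a 0 (\<lambda>x. c)"
 by (rule small_0_continuous) simp

lemma small_cong: assumes "small a N f" "\<delta> > 0" "\<And>x. norm (x - a) < \<delta> \<Longrightarrow> g x = f x" shows "small a N g"
proof -
 obtain C \<epsilon> where 1: "C \<ge> 0" "\<epsilon> > 0" "\<And>x. norm (x - a) < \<epsilon> \<Longrightarrow> norm (f x) \<le> C * norm (x - a) ^ N"
  by (rule smallE[OF assms(1)]) blast
 thus ?thesis unfolding small_def using assms by (intro exI[of _ C] exI[of _ "min \<delta> \<epsilon>"]) auto
qed

lemma small_power_diff:
 fixes f g :: "'a::real_normed_vector \<Rightarrow> real"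
 assumes "small a N (\<lambda>x. f x - g x)" "small a 0 f" "small a 0 g"
 shows "small a N (\<lambda>x. f x ^ i - g x ^ i)"
proof (induction i)
 case (Suc i)
 have fpow: "small a 0 (\<lambda>x. f x ^ i)" for i
 proof (induction i)
  case (Suc i)
  from small_mult[OF assms(2) Suc] show ?case by simp
 qed simp
 have "small a N (\<lambda>x. (f x - g x) * f x ^ i)" using small_mult[OF assms(1) fpow[of i]] by simp
 moreover have "small a N (\<lambda>x. g x * (f x ^ i - g x ^ i))" using small_mult[OF assms(3) Suc] by simp
 ultimately have "small a N (\<lambda>x. (f x - g x) * f x ^ i + g x * (f x ^ i - g x ^ i))" by (rule small_add)
 thus ?case by (rule small_cong[OF _ zero_less_one]) (simp add: algebra_simps)
qed simp

lemma small_line: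
 assumes "small (a + s0 *\<^sub>R v) N f" shows "small s0 N (\<lambda>s::real. f (a + s *\<^sub>R v))"
proof -
 obtain C \<delta> where 1: "C \<ge> 0" "\<delta> > 0" "\<And>x. norm (x - (a + s0 *\<^sub>R v)) < \<delta> \<Longrightarrow> norm (f x) \<le> C * norm (x - (a + s0 *\<^sub>R v)) ^ N"
  by (rule smallE[OF assms(1)]) blast
 have e: "norm (a + s *\<^sub>R v - (a + s0 *\<^sub>R v)) = \<bar>s - s0\<bar> * norm v" for s
  by (simp add: scaleR_left_diff_distrib[symmetric])
 have "norm (f (a + s *\<^sub>R v)) \<le> (C * norm v ^ N) * norm (s - s0) ^ N" if "norm (s - s0) < \<delta> / (norm v + 1)" for s
 proof -
  have n: "norm v + 1 > 0" by (smt (verit) norm_ge_zero)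
  have "\<bar>s - s0\<bar> * norm v \<le> \<bar>s - s0\<bar> * (norm v + 1)" by (intro mult_left_mono) auto
  also have "\<dots> < \<delta>" using that n by (simp add: field_simps)
  finally have "norm (f (a + s *\<^sub>R v)) \<le> C * norm (a + s *\<^sub>R v - (a + s0 *\<^sub>R v)) ^ N" using e by (intro 1(3)) simp
  thus ?thesis unfolding e by (simp add: power_mult_distrib mult_ac)
 qed
 moreover have "\<delta> / (norm v + 1) > 0" using 1 by (intro divide_pos_pos) (auto intro: add_nonneg_pos)
 ultimately show ?thesis unfolding small_def by blast
qed

section \<open>Order of vanishing of polynomials and holomorphic functions\<close>

lemma cpoly_eqI:
 assumes "\<And>s::real. poly P (complex_of_real s) = poly Q (complex_of_real s)" shows "P = Q"
proof (rule ccontr)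
 assume "P \<noteq> Q"
 hence "finite {z. poly (P - Q) z = 0}" by (intro poly_roots_finite) simp
 moreover have "range complex_of_real \<subseteq> {z. poly (P - Q) z = 0}" using assms by auto
 moreover have "infinite (range complex_of_real)" using infinite_UNIV_char_0 inj_of_real
  by (metis finite_imageD)
 ultimately show False using finite_subset by blast
qed

text \<open>Continuity gives the constant coefficient, and dividing by the variable lowers
  \<open>N\<close>. The bound is asked along a sequence only, so that accumulating zeros can be used
  later.\<close>

lemma poly_small_sequence:
 fixes P :: "complex poly"
 assumes "t \<longlonglongrightarrow> 0" "\<And>n. t n \<noteq> 0" "\<And>n. norm (poly P (t n)) \<le> C * norm (t n) ^ N" "i < N"
 shows "coeff P i = 0"
 using assms(3,4)
proof (induction N arbitrary: P i)
 case (Suc N)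
 have "(\<lambda>n. poly P (t n)) \<longlonglongrightarrow> poly P 0" by (intro tendsto_intros assms(1))
 moreover have "(\<lambda>n. poly P (t n)) \<longlonglongrightarrow> 0"
 proof (rule Lim_null_comparison)
  show "\<forall>\<^sub>F n in sequentially. norm (poly P (t n)) \<le> C * norm (t n) ^ Suc N" using Suc.prems by simp
  show "(\<lambda>n. C * norm (t n) ^ Suc N) \<longlonglongrightarrow> 0" using assms(1) by (auto intro!: tendsto_eq_intros)
 qed
 ultimately have "poly P 0 = 0" by (rule LIMSEQ_unique)
 moreover obtain a Q where "P = pCons a Q" by (cases P)
 ultimately have Q: "P = pCons 0 Q" by simp
 have "norm (poly Q (t n)) \<le> C * norm (t n) ^ N" for n
 proof -
  have "norm (t n) * norm (poly Q (t n)) \<le> norm (t n) * (C * norm (t n) ^ N)"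
   using Suc.prems(1)[of n] by (simp add: Q norm_mult mult_ac)
  thus ?thesis using assms(2)[of n] by simp
 qed
 from Suc.IH[OF this] show ?case using Suc.prems(2) by (cases i) (auto simp: Q)
qed auto

lemma harmonic_tendsto: "(\<lambda>n. complex_of_real (\<delta> / (real n + 2))) \<longlonglongrightarrow> 0"
proof -
 have "(\<lambda>n. \<delta> / (real n + 2)) \<longlonglongrightarrow> 0" by real_asymp
 from tendsto_of_real[OF this] show ?thesis by (simp only: of_real_0)
qed

lemma poly_small_coeff_complex:
 fixes P :: "complex poly"
 assumes "small 0 N (\<lambda>s::real. poly P (complex_of_real s))" "i < N" shows "coeff P i = 0"
proof -
 obtain C \<delta> where 1: "C \<ge> 0" "\<delta> > 0" "\<And>s. norm (s - 0) < \<delta> \<Longrightarrow> norm (poly P (complex_of_real s)) \<le> C * norm (s - 0) ^ N"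
  by (rule smallE[OF assms(1)]) blast
 show ?thesis
 proof (rule poly_small_sequence[OF harmonic_tendsto[of \<delta>] _ _ assms(2)])
  fix n
  have "\<delta> / (real n + 2) < \<delta> / 1" using 1 by (intro divide_strict_left_mono) auto
  hence "\<bar>\<delta> / (real n + 2)\<bar> < \<delta>" using 1 by simp
  moreover have "norm (poly P (complex_of_real x)) \<le> C * \<bar>x\<bar> ^ N" if "\<bar>x\<bar> < \<delta>" for x
   using 1(3)[of x] that by simp
  ultimately show "norm (poly P (complex_of_real (\<delta> / (real n + 2)))) \<le> C * norm (complex_of_real (\<delta> / (real n + 2))) ^ N"
   by (simp only: norm_of_real)
  have "\<delta> / (real n + 2) \<noteq> 0" using 1 by simp
  thus "complex_of_real (\<delta> / (real n + 2)) \<noteq> 0" by (simp only: of_real_eq_0_iff not_False_eq_True)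
 qed
qed

lemma poly_small_coeff:
 fixes P :: "real poly"
 assumes "small 0 N (poly P)" "i < N" shows "coeff P i = 0"
proof -
 have "small 0 N (\<lambda>s::real. poly (cpoly P) (complex_of_real s))"
  using assms(1) by (simp add: small_def)
 from poly_small_coeff_complex[OF this assms(2)] show ?thesis by simp
qed

lemma poly_small_of_coeffs:
 fixes P :: "'a::real_normed_field poly"
 assumes "\<And>i. i < N \<Longrightarrow> coeff P i = 0" shows "small 0 N (poly P)"
proof -
 have "monom 1 N dvd P" using assms by (simp add: monom_1_dvd_iff')
 then obtain Q where Q: "P = monom 1 N * Q" by (elim dvdE)
 have "small 0 N (\<lambda>s::'a. s ^ N)" unfolding small_def by (intro exI[of _ 1]) (auto simp: norm_power)
 from small_mult[OF this small_0_continuous[of 0 "poly Q"]]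
 have "small 0 (N + 0) (\<lambda>s. s ^ N * poly Q s)" by simp
 moreover have "poly P = (\<lambda>s. s ^ N * poly Q s)" by (auto simp: Q poly_monom)
 ultimately show ?thesis by simp
qed

lemma poly_norm_le_coeff_sum:
 fixes P :: "complex poly"
 assumes "norm s \<le> 1" "\<And>i. i > K \<Longrightarrow> coeff P i = 0" shows "norm (poly P s) \<le> (\<Sum>i\<le>K. norm (coeff P i))"
proof -
 have "poly P s = (\<Sum>i\<le>K. coeff P i * s ^ i)"
 proof (cases "degree P \<le> K")
  case True
  thus ?thesis unfolding poly_altdef using assms(2)
   by (intro sum.mono_neutral_left) (auto simp: coeff_eq_0)
 next
  case False
  hence "coeff P (degree P) = 0" using assms(2) by simp
  thus ?thesis using False by simp
 qed
 also have "norm \<dots> \<le> (\<Sum>i\<le>K. norm (coeff P i * s ^ i))" by (rule norm_sum)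
 also have "\<dots> \<le> (\<Sum>i\<le>K. norm (coeff P i))"
  using assms(1) by (intro sum_mono) (simp add: norm_mult norm_power mult_left_le power_le_one)
 finally show ?thesis .
qed

lemma higher_deriv_poly: "(deriv ^^ n) (poly P) = poly ((pderiv ^^ n) P)" for P :: "complex poly"
proof (induction n arbitrary: P)
 case (Suc n)
 have "deriv (poly P) = poly (pderiv P)" using DERIV_imp_deriv[OF poly_DERIV] by blast
 thus ?case using Suc[of "pderiv P"] by (simp add: funpow_Suc_right del: funpow.simps)
qed simp

lemma higher_deriv_poly_0: "(deriv ^^ n) (poly P) 0 = fact n * coeff P n" for P :: "complex poly"
 by (simp add: higher_deriv_poly poly_0_coeff_0 coeff_higher_pderiv pochhammer_fact[symmetric])

text \<open>Cauchy's inequality on circles of radius \<open>e\<close> shrinking to 0 gives a bound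
  of order \<open>e ^ (Suc n - j)\<close>.\<close>

lemma higher_deriv_small:
 assumes "g holomorphic_on ball 0 r" "r > 0" "small 0 (Suc n) g" "j \<le> n"
 shows "(deriv ^^ j) g 0 = 0"
proof -
 obtain C \<delta> where 1: "C \<ge> 0" "\<delta> > 0" "\<And>s. norm (s - 0) < \<delta> \<Longrightarrow> norm (g s) \<le> C * norm (s - 0) ^ Suc n"
  by (rule smallE[OF assms(3)]) blast
 define m where "m = min \<delta> (min r 1)"
 have m: "m > 0" using 1 assms by (simp add: m_def)
 have le: "norm ((deriv ^^ j) g 0) \<le> fact j * C * e" if e: "0 < e" "e < m" for e
 proof -
  have "norm ((deriv ^^ j) g 0) \<le> fact j * (C * e ^ Suc n) / e ^ j"
  proof (rule Cauchy_inequality)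
   show "g holomorphic_on ball 0 e" using assms e by (auto simp: m_def elim!: holomorphic_on_subset)
   show "continuous_on (cball 0 e) g" using assms e
    by (intro holomorphic_on_imp_continuous_on holomorphic_on_subset[OF assms(1)]) (auto simp: m_def)
   show "norm (g x) \<le> C * e ^ Suc n" if "norm (0 - x) = e" for x
    using 1(3)[of x] that e by (simp add: m_def)
  qed (use e in auto)
  also have "\<dots> = fact j * C * e ^ (Suc n - j)" using e assms(4) by (simp add: power_diff)
  also have "\<dots> \<le> fact j * C * e ^ 1" using 1 e assms(4) by (intro mult_left_mono power_decreasing) (auto simp: m_def)
  finally show ?thesis by simp
 qed
 have "norm ((deriv ^^ j) g 0) \<le> 0"
 proof (rule tendsto_lowerbound)
  show "((\<lambda>e. fact j * C * e) \<longlongrightarrow> 0) (at_right 0)" by (auto intro!: tendsto_eq_intros)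
  show "\<forall>\<^sub>F e in at_right 0. norm ((deriv ^^ j) g 0) \<le> fact j * C * e"
   using eventually_at_right_less[of 0] eventually_at_right_field[of "\<lambda>e. norm ((deriv ^^ j) g 0) \<le> fact j * C * e" 0] m le by blast
 qed simp
 thus ?thesis by simp
qed

text \<open>The coefficients of a polynomial that solves \<open>s A + (\<delta> + s B) z + s \<Sum> C\<^sub>m z^m = 0\<close> approximately are
 compared with those of the iterates of the map \<open>z \<mapsto> - s (A + \<Sum> C\<^sub>m z^m) / (\<delta> + s B)\<close>, which are holomorphic and
 bounded on a disc of controlled radius.\<close>
lemma approximate_root_coeff_bound:
 fixes A B z :: "complex poly" and C :: "nat \<Rightarrow> complex poly" and \<delta> :: complex
 assumes c: "0 < c" "c \<le> 1" "c \<le> norm \<delta>" and M: "M \<ge> 1"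
  and bd: "\<And>s. norm s \<le> 1 \<Longrightarrow> norm (poly A s) \<le> M" "\<And>s. norm s \<le> 1 \<Longrightarrow> norm (poly B s) \<le> M"
   "\<And>s m. norm s \<le> 1 \<Longrightarrow> norm (poly (C m) s) \<le> M"
  and z0: "poly z 0 = 0"
  and E: "small 0 (Suc n) (\<lambda>s. s * poly A s + (\<delta> + s * poly B s) * poly z s + s * (\<Sum>m\<in>{2..D}. poly (C m) s * poly z s ^ m))"
 shows "norm (coeff z n) \<le> (8 * M * (real D + 2)^2 / c) ^ n"
proof -
 define Q where "Q = (real D + 2)^2"
 have Q: "Q \<ge> 4" "Q \<ge> real D + 2" "Q \<ge> 1 + real D * real D"
  unfolding Q_def power2_eq_square by (auto simp: algebra_simps)
 \<comment> \<open>Chosen so that on the disc of radius \<open>s0\<close> the denominator stays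
   above \<open>c / 2\<close> and the numerator below \<open>c / 4\<close>; the iteration then
   preserves the unit disc.\<close>
 define s0 where "s0 = c / (4 * M * Q)"
 have MQ: "4 * M * Q \<ge> 16" using mult_mono[of 4 "4 * M" 4 Q] M Q by simp
 have s0: "s0 > 0" "s0 \<le> 1" using c MQ by (auto simp: s0_def divide_le_eq_1)
 have s0M: "s0 * (M * Q) = c / 4" using MQ M Q by (simp add: s0_def)
 have den: "norm (\<delta> + s * poly B s) \<ge> c / 2" if "norm s < s0" for s
 proof -
  have "norm (s * poly B s) \<le> s0 * M" unfolding norm_mult using that bd(2)[of s] s0 by (intro mult_mono) auto
  also have "\<dots> \<le> s0 * (M * Q)" using s0 M Q by (intro mult_left_mono) (auto simp: mult_le_cancel_left1)
  finally have "norm (s * poly B s) \<le> c / 4" using s0M by simp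
  thus ?thesis using c norm_diff_ineq[of \<delta> "s * poly B s"] by linarith
 qed
 define N where "N s y = poly A s + (\<Sum>m\<in>{2..D}. poly (C m) s * y ^ m)" for s y
 define T where "T s y = - (s * N s y) / (\<delta> + s * poly B s)" for s y
 have Tb: "norm (T s y) \<le> 1" if s: "norm s < s0" and y: "norm y \<le> 1" for s y
 proof -
  have "norm (N s y) \<le> M + (\<Sum>m\<in>{2..D}. M * 1)"
   unfolding N_def using bd[of s] s s0 y M
   by (intro order_trans[OF norm_triangle_ineq] add_mono sum_norm_le)
     (auto simp: norm_mult norm_power intro!: mult_mono[of _ M _ 1, simplified] power_le_one)
  also have "\<dots> \<le> M + real D * M" using M by (simp add: mult_right_mono)
  also have "\<dots> \<le> M * (real D + 2)" using M by (simp add: algebra_simps)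
  also have "\<dots> \<le> M * Q" using M Q by (intro mult_left_mono) auto
  finally have "norm (s * N s y) \<le> s0 * (M * Q)" unfolding norm_mult using s s0 by (intro mult_mono) auto
  hence 1: "norm (s * N s y) \<le> c / 4" using s0M by simp
  have "norm (T s y) = norm (s * N s y) / norm (\<delta> + s * poly B s)" unfolding T_def by (simp add: norm_divide)
  also have "\<dots> \<le> (c / 4) / (c / 2)" using 1 den[OF s] c by (intro frac_le) auto
  finally show ?thesis using c by simp
 qed
 define y where "y i = ((\<lambda>y s. T s (y s)) ^^ i) (\<lambda>_. 0)" for i
 have y0: "y 0 = (\<lambda>_. 0)" and yS: "y (Suc i) = (\<lambda>s. T s (y i s))" for i by (auto simp: y_def)
 have yb: "norm (y i s) \<le> 1" if "norm s < s0" for i s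
  by (induction i) (auto simp: y0 yS intro: Tb that)
 have yh: "y i holomorphic_on ball 0 s0" for i
 proof (induction i)
  case (Suc i)
  have "\<delta> + s * poly B s \<noteq> 0" if "s \<in> ball 0 s0" for s using den[of s] that c by auto
  thus ?case unfolding yS T_def N_def by (intro holomorphic_intros Suc)
 qed (simp add: y0)
 \<comment> \<open>The map contracts by a factor of order \<open>s\<close>, so each iterate agrees
   with \<open>z\<close> to one more order, until the order \<open>n + 1\<close> of the error term
   is reached.\<close>
 have diff: "small 0 (Suc i) (\<lambda>s. poly z s - y i s)" if "i \<le> n" for i
  using that
 proof (induction i)
  case 0
  have "small 0 1 (poly z)" using z0 by (intro poly_small_of_coeffs) (auto simp: poly_0_coeff_0)
  thus ?case by (simp add: y0)
 next
  case (Suc i)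
  define Es where "Es s = s * poly A s + (\<delta> + s * poly B s) * poly z s + s * (\<Sum>m\<in>{2..D}. poly (C m) s * poly z s ^ m)" for s
  obtain C1 d1 where 1: "C1 \<ge> 0" "d1 > 0" "\<And>s. norm (s - 0) < d1 \<Longrightarrow> norm (Es s) \<le> C1 * norm (s - 0) ^ Suc n"
   by (rule smallE[OF E[folded Es_def]]) blast
  obtain C2 d2 where 2: "C2 \<ge> 0" "d2 > 0" "\<And>s. norm (s - 0) < d2 \<Longrightarrow> norm (poly z s - y i s) \<le> C2 * norm (s - 0) ^ Suc i"
   by (rule smallE[OF Suc.IH[OF Suc_leD[OF Suc.prems]]]) blast
  have "isCont (poly z) 0" by simp
  then obtain d3 where 3: "d3 > 0" "\<And>s. norm s < d3 \<Longrightarrow> norm (poly z s) < 1"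
   unfolding continuous_at_eps_delta using z0 by (metis dist_0_norm dist_commute zero_less_one)
  define K where "K = 2 / c * (C1 + M * (real D * real D) * C2)"
  have "norm (poly z s - y (Suc i) s) \<le> K * norm (s - 0) ^ Suc (Suc i)"
   if s: "norm (s - 0) < min (min d1 d2) (min d3 s0)" for s
  proof -
   have s': "norm s < s0" "norm s \<le> 1" using s s0 by auto
   have dn: "norm (\<delta> + s * poly B s) \<ge> c / 2" by (rule den) (rule s')
   hence dn0: "\<delta> + s * poly B s \<noteq> 0" using c by auto
   have zb: "norm (poly z s) \<le> 1" using 3(2)[of s] s by auto
   have pw: "norm (poly z s ^ m - y i s ^ m) \<le> real m * norm (poly z s - y i s)" for m
    by (rule norm_power_diff) (use zb yb s' in auto)
   have e: "poly z s - y (Suc i) s = (Es s - s * (\<Sum>m\<in>{2..D}. poly (C m) s * (poly z s ^ m - y i s ^ m))) / (\<delta> + s * poly B s)"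
    using dn0 unfolding yS T_def N_def Es_def
    by (simp add: field_simps sum_subtractf)
   have "norm (\<Sum>m\<in>{2..D}. poly (C m) s * (poly z s ^ m - y i s ^ m)) \<le> (\<Sum>m\<in>{2..D}. M * (real D * norm (poly z s - y i s)))"
   proof (rule sum_norm_le)
    fix m assume m: "m \<in> {2..D}"
    have "norm (poly z s ^ m - y i s ^ m) \<le> real D * norm (poly z s - y i s)"
     using pw[of m] m by (smt (verit, best) atLeastAtMost_iff mult_right_mono norm_ge_zero of_nat_mono)
    thus "norm (poly (C m) s * (poly z s ^ m - y i s ^ m)) \<le> M * (real D * norm (poly z s - y i s))"
     unfolding norm_mult using bd(3)[OF s'(2), of m] M by (intro mult_mono) auto
   qed
   also have "\<dots> \<le> real D * (M * (real D * norm (poly z s - y i s)))"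
    using M by (simp add: mult_right_mono)
   also have "\<dots> = M * (real D * real D) * norm (poly z s - y i s)" by simp
   also have "\<dots> \<le> M * (real D * real D) * (C2 * norm s ^ Suc i)"
    using 2(3)[of s] s M by (intro mult_left_mono) auto
   finally have S: "norm (s * (\<Sum>m\<in>{2..D}. poly (C m) s * (poly z s ^ m - y i s ^ m))) \<le> norm s * (M * (real D * real D) * (C2 * norm s ^ Suc i))"
    unfolding norm_mult by (intro mult_left_mono) auto
   have "norm (Es s) \<le> C1 * norm s ^ Suc n" using 1(3)[of s] s by simp
   also have "\<dots> \<le> C1 * norm s ^ Suc (Suc i)" using 1 Suc.prems s'
    by (intro mult_left_mono power_decreasing) auto
   finally have "norm (Es s - s * (\<Sum>m\<in>{2..D}. poly (C m) s * (poly z s ^ m - y i s ^ m))) \<le> (C1 + M * (real D * real D) * C2) * norm s ^ Suc (Suc i)"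
    using S norm_triangle_ineq4[of "Es s" "s * (\<Sum>m\<in>{2..D}. poly (C m) s * (poly z s ^ m - y i s ^ m))"]
    by (simp add: algebra_simps)
   hence "norm (poly z s - y (Suc i) s) \<le> ((C1 + M * (real D * real D) * C2) * norm s ^ Suc (Suc i)) / (c / 2)"
    (is "_ \<le> ?X / _") unfolding e norm_divide
   proof -
    assume a: "norm (Es s - s * (\<Sum>m\<in>{2..D}. poly (C m) s * (poly z s ^ m - y i s ^ m))) \<le> ?X"
    show "norm (Es s - s * (\<Sum>m\<in>{2..D}. poly (C m) s * (poly z s ^ m - y i s ^ m))) / norm (\<delta> + s * poly B s) \<le> ?X / (c / 2)"
     using order_trans[OF norm_ge_zero a] a dn c by (intro frac_le) auto
   qed
   also have "\<dots> = K * norm (s - 0) ^ Suc (Suc i)" using c by (simp add: K_def)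
   finally show ?thesis .
  qed
  thus ?case unfolding small_def using 1 2 3 s0 by (intro exI[of _ K] exI[of _ "min (min d1 d2) (min d3 s0)"]) auto
 qed
 have zh: "poly z holomorphic_on ball 0 s0" by (intro holomorphic_intros)
 have "(deriv ^^ n) (\<lambda>s. poly z s - y n s) 0 = 0"
  by (rule higher_deriv_small[OF _ s0(1) diff]) (auto intro!: holomorphic_intros yh)
 moreover have "(deriv ^^ n) (\<lambda>s. poly z s - y n s) 0 = (deriv ^^ n) (poly z) 0 - (deriv ^^ n) (y n) 0"
  by (rule higher_deriv_diff[OF zh yh open_ball]) (use s0 in auto)
 ultimately have "fact n * coeff z n = (deriv ^^ n) (y n) 0" by (simp add: higher_deriv_poly_0)
 \<comment> \<open>Cauchy's inequality on a circle where all iterates are bounded by 1; half of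
   \<open>s0\<close> keeps the closed disc inside the domain.\<close>
 also have "norm \<dots> \<le> fact n * 1 / (s0 / 2) ^ n"
 proof (rule Cauchy_inequality)
  show "y n holomorphic_on ball 0 (s0 / 2)" using s0 by (intro holomorphic_on_subset[OF yh]) auto
  show "continuous_on (cball 0 (s0 / 2)) (y n)" using s0
   by (intro holomorphic_on_imp_continuous_on holomorphic_on_subset[OF yh]) auto
  show "norm (y n x) \<le> 1" if "norm (0 - x) = s0 / 2" for x using that s0 by (intro yb) auto
 qed (use s0 in auto)
 finally have "fact n * norm (coeff z n) \<le> fact n * (1 / (s0 / 2) ^ n)" by (simp add: norm_mult)
 hence "norm (coeff z n) \<le> 1 / (s0 / 2) ^ n" by (subst (asm) mult_le_cancel_left_pos) auto
 also have "\<dots> = (2 / s0) ^ n" by (simp add: power_divide)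
 also have "2 / s0 = 8 * M * (real D + 2)^2 / c" using c by (simp add: s0_def Q_def)
 finally show ?thesis .
qed

text \<open>The difference quotient at \<open>s0\<close>, completed by the derivative, is again
  holomorphic, so Taylor polynomials arise by induction.\<close>

lemma holomorphic_taylor_small:
 assumes "h holomorphic_on S" "open S" "s0 \<in> S"
 shows "\<exists>U::complex poly. small s0 N (\<lambda>s. h s - poly U s)"
 using assms(1)
proof (induction N arbitrary: h)
 case 0
 have "isCont h s0" using 0 assms continuous_on_eq_continuous_at holomorphic_on_imp_continuous_on by blast
 thus ?case by (intro exI[of _ 0]) (simp add: small_0_continuous)
next
 case (Suc N)
 define h1 where "h1 z = (if z = s0 then deriv h s0 else (h z - h s0) / (z - s0))" for z
 have "h1 holomorphic_on S" unfolding h1_def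
  using pole_lemma[OF Suc.prems, of s0] assms by (simp add: interior_open)
 from Suc.IH[OF this] obtain U where U: "small s0 N (\<lambda>s. h1 s - poly U s)" ..
 have "small s0 1 (\<lambda>s. s - s0)" unfolding small_def by (intro exI[of _ 1]) auto
 from small_mult[OF this U] have "small s0 (Suc N) (\<lambda>s. (s - s0) * (h1 s - poly U s))" by simp
 moreover have "(\<lambda>s. (s - s0) * (h1 s - poly U s)) = (\<lambda>s. h s - poly ([:h s0:] + [:- s0, 1:] * U) s)"
 proof
  fix s
  have "(s - s0) * h1 s = h s - h s0" by (simp add: h1_def)
  thus "(s - s0) * (h1 s - poly U s) = h s - poly ([:h s0:] + [:- s0, 1:] * U) s"
   by (simp add: right_diff_distrib) (simp add: algebra_simps)
 qed
 ultimately show ?case by metis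
qed

lemma small_of_real_comp:
 assumes "small (complex_of_real s0) N h" shows "small s0 N (\<lambda>s. h (complex_of_real s))"
proof -
 obtain C \<delta> where 1: "C \<ge> 0" "\<delta> > 0" "\<And>x. norm (x - complex_of_real s0) < \<delta> \<Longrightarrow> norm (h x) \<le> C * norm (x - complex_of_real s0) ^ N"
  by (rule smallE[OF assms]) blast
 have "norm (h (complex_of_real s)) \<le> C * norm (s - s0) ^ N" if "norm (s - s0) < \<delta>" for s
  using 1(3)[of "complex_of_real s"] that by (metis norm_of_real of_real_diff real_norm_def)
 thus ?thesis unfolding small_def using 1 by blast
qed

lemma small_of_real: "small a N f \<Longrightarrow> small a N (\<lambda>x. complex_of_real (f x))"
 by (simp add: small_def)

text \<open>Insert \<open>h + \<psi>\<close> into the relation and expand in powers of the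
  difference \<open>\<psi>\<close>. The first coefficient \<open>\<gamma> m0\<close> that is not
  identically zero vanishes to finite order at each point, while the higher terms are flat wherever
  \<open>\<psi>\<close> is; so \<open>\<psi>\<close> is zero near every point at which it is flat.
  The flat points thus form an open set. It is closed because zeros of \<open>\<psi>\<close>
  accumulating at a point kill all its Taylor coefficients there.\<close>

lemma algebraic_quasi_analytic:
 fixes \<phi> :: "real \<Rightarrow> real" and h :: "complex \<Rightarrow> complex" and \<beta> :: "nat \<Rightarrow> real poly"
 assumes h: "h holomorphic_on ball 0 2" and nz: "\<exists>i\<le>D. \<beta> i \<noteq> 0"
  and rel: "\<And>s. \<bar>s\<bar> < 3/2 \<Longrightarrow> (\<Sum>i\<le>D. poly (\<beta> i) s * \<phi> s ^ i) = 0"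
  and tay: "\<And>s0 N. \<bar>s0\<bar> < 3/2 \<Longrightarrow> \<exists>T::real poly. small s0 N (\<lambda>s. \<phi> s - poly T s)"
  and flat0: "\<And>N. small 0 N (\<lambda>s::real. complex_of_real (\<phi> s) - h (complex_of_real s))"
  and s: "\<bar>s\<bar> < 3/2"
 shows "complex_of_real (\<phi> s) = h (complex_of_real s)"
proof -
 define \<psi> where "\<psi> s = complex_of_real (\<phi> s) - h (complex_of_real s)" for s
 define I where "I = {-3/2<..<3/2::real}"
 define Z where "Z = {s0 \<in> I. \<forall>N. small s0 N \<psi>}"
 have Iball: "complex_of_real s \<in> ball 0 2" if "s \<in> I" for s using that by (auto simp: I_def)
 define \<gamma> where "\<gamma> m z = (\<Sum>i\<le>D. of_nat (i choose m) * (poly (cpoly (\<beta> i)) z * h z ^ (i - m)))" for m z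
 have h\<gamma>: "\<gamma> m holomorphic_on ball 0 2" for m unfolding \<gamma>_def by (intro holomorphic_intros h)
 have expand: "(\<Sum>m\<le>D. \<gamma> m (complex_of_real s) * \<psi> s ^ m) = 0" if "s \<in> I" for s
 proof -
  have "\<bar>s\<bar> < 3/2" using that by (auto simp: I_def abs_less_iff)
  from rel[OF this] have "0 = complex_of_real (\<Sum>i\<le>D. poly (\<beta> i) s * \<phi> s ^ i)" by (simp only: of_real_0)
  also have "\<dots> = (\<Sum>i\<le>D. poly (cpoly (\<beta> i)) s * (\<psi> s + h s) ^ i)" by (simp add: \<psi>_def)
  also have "\<dots> = (\<Sum>i\<le>D. \<Sum>m\<le>D. of_nat (i choose m) * (poly (cpoly (\<beta> i)) s * h s ^ (i - m)) * \<psi> s ^ m)"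
  proof (rule sum.cong[OF refl])
   fix i assume i: "i \<in> {..D}"
   have "(\<psi> s + h s) ^ i = (\<Sum>m\<le>i. of_nat (i choose m) * \<psi> s ^ m * h s ^ (i - m))" by (rule binomial_ring)
   also have "\<dots> = (\<Sum>m\<le>D. of_nat (i choose m) * \<psi> s ^ m * h s ^ (i - m))"
    using i by (intro sum.mono_neutral_left) auto
   finally show "poly (cpoly (\<beta> i)) s * (\<psi> s + h s) ^ i = (\<Sum>m\<le>D. of_nat (i choose m) * (poly (cpoly (\<beta> i)) s * h s ^ (i - m)) * \<psi> s ^ m)"
    by (simp add: sum_distrib_left mult_ac)
  qed
  also have "\<dots> = (\<Sum>m\<le>D. \<gamma> m s * \<psi> s ^ m)" unfolding \<gamma>_def by (subst sum.swap) (simp add: sum_distrib_right)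
  finally show ?thesis by simp
 qed
 \<comment> \<open>For the largest index with \<open>\<beta> i \<noteq> 0\<close> only one term
   remains, a nonzero polynomial.\<close>
 have ex\<gamma>: "\<exists>m. m \<le> D \<and> (\<exists>z\<in>ball 0 2. \<gamma> m z \<noteq> 0)"
 proof -
  define i1 where "i1 = Max {i. i \<le> D \<and> \<beta> i \<noteq> 0}"
  have i1: "i1 \<in> {i. i \<le> D \<and> \<beta> i \<noteq> 0}" unfolding i1_def using nz by (intro Max_in) auto
  have top: "\<beta> i = 0" if "i > i1" "i \<le> D" for i
  proof (rule ccontr)
   assume "\<beta> i \<noteq> 0"
   hence "i \<le> i1" unfolding i1_def using that by (intro Max_ge) auto
   thus False using that by simp
  qed
  have "\<gamma> i1 z = poly (cpoly (\<beta> i1)) z" for z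
  proof -
   have "\<gamma> i1 z = (\<Sum>i\<le>D. if i = i1 then poly (cpoly (\<beta> i1)) z else 0)"
    unfolding \<gamma>_def
   proof (rule sum.cong[OF refl])
    fix i assume "i \<in> {..D}"
    thus "of_nat (i choose i1) * (poly (cpoly (\<beta> i)) z * h z ^ (i - i1)) = (if i = i1 then poly (cpoly (\<beta> i1)) z else 0)"
     using top[of i] by (cases i i1 rule: linorder_cases) auto
   qed
   thus ?thesis using i1 by simp
  qed
  moreover have "\<exists>z\<in>ball 0 2. poly (cpoly (\<beta> i1)) z \<noteq> 0"
  proof (rule ccontr)
   assume "\<not> ?thesis"
   hence "ball 0 2 \<subseteq> {z. poly (cpoly (\<beta> i1)) z = 0}" by blast
   moreover have "finite {z. poly (cpoly (\<beta> i1)) z = 0}" using i1 by (intro poly_roots_finite) simp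
   moreover have "infinite (ball (0::complex) 2)" using uncountable_ball[of 2 "0::complex"] countable_finite by auto
   ultimately show False using finite_subset by blast
  qed
  ultimately show ?thesis using i1 by (intro exI[of _ i1]) auto
 qed
 define m0 where "m0 = (LEAST m. m \<le> D \<and> (\<exists>z\<in>ball 0 2. \<gamma> m z \<noteq> 0))"
 have m0: "m0 \<le> D" "\<exists>z\<in>ball 0 2. \<gamma> m0 z \<noteq> 0" using LeastI_ex[OF ex\<gamma>] unfolding m0_def by auto
 have m0l: "\<gamma> m z = 0" if "m < m0" "z \<in> ball 0 2" for m z
  using not_less_Least[OF that(1)[unfolded m0_def]] that m0(1) by auto
 have A: "\<exists>\<epsilon>>0. \<forall>s. \<bar>s - s0\<bar> < \<epsilon> \<longrightarrow> s \<in> I \<and> \<psi> s = 0" if s0: "s0 \<in> Z" for s0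
 proof -
  have s0I: "s0 \<in> I" using s0 by (simp add: Z_def)
  have cont: "isCont (\<lambda>s. \<gamma> m (complex_of_real s)) s0" for m
  proof -
   have "isCont (\<gamma> m) (complex_of_real s0)"
    using h\<gamma>[of m] Iball[OF s0I] continuous_on_eq_continuous_at[of "ball 0 2" "\<gamma> m"] holomorphic_on_imp_continuous_on by blast
   moreover have "isCont complex_of_real s0" by simp
   ultimately show ?thesis using isCont_o2 by blast
  qed
  \<comment> \<open>A lower bound of finite order, whether or not \<open>\<gamma> m0\<close>
    vanishes at \<open>s0\<close>.\<close>
  obtain k n r where k: "0 < k" "0 < r" "\<And>w. w \<in> ball (complex_of_real s0) r \<Longrightarrow> k * norm (w - complex_of_real s0) ^ n \<le> norm (\<gamma> m0 w)"
  proof (cases "\<gamma> m0 (complex_of_real s0) = 0")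
   case True
   obtain z where z: "z \<in> ball 0 2" "\<gamma> m0 z \<noteq> \<gamma> m0 (complex_of_real s0)" using m0(2) True by auto
   obtain k n r where k: "0 < k" "0 < r" "\<And>w. w \<in> ball (complex_of_real s0) r \<Longrightarrow> k * norm (w - complex_of_real s0) ^ n \<le> norm (\<gamma> m0 w - \<gamma> m0 (complex_of_real s0))"
    using holomorphic_lower_bound_difference[OF h\<gamma> open_ball connected_ball Iball[OF s0I] z] by metis
   thus ?thesis using that[of k r n] True by simp
  next
   case False
   have "isCont (\<gamma> m0) (complex_of_real s0)"
    using h\<gamma>[of m0] Iball[OF s0I] continuous_on_eq_continuous_at[of "ball 0 2" "\<gamma> m0"] holomorphic_on_imp_continuous_on by blast
   then obtain r where r: "r > 0" "\<And>w. dist w (complex_of_real s0) < r \<Longrightarrow> dist (\<gamma> m0 w) (\<gamma> m0 (complex_of_real s0)) < norm (\<gamma> m0 (complex_of_real s0)) / 2"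
    unfolding continuous_at_eps_delta using False by (metis half_gt_zero zero_less_norm_iff)
   show ?thesis
   proof (rule that[of "norm (\<gamma> m0 (complex_of_real s0)) / 2" r 0])
    fix w assume "w \<in> ball (complex_of_real s0) r"
    hence "dist w (complex_of_real s0) < r" by (simp add: dist_commute)
    from r(2)[OF this] have "norm (\<gamma> m0 w - \<gamma> m0 (complex_of_real s0)) < norm (\<gamma> m0 (complex_of_real s0)) / 2"
     by (simp add: dist_norm)
    thus "norm (\<gamma> m0 (complex_of_real s0)) / 2 * norm (w - complex_of_real s0) ^ 0 \<le> norm (\<gamma> m0 w)"
     using norm_triangle_ineq2[of "\<gamma> m0 (complex_of_real s0)" "\<gamma> m0 w"] by (simp add: norm_minus_commute)
   qed (use r False in auto)
  qed
  \<comment> \<open>The terms of index above \<open>m0\<close>, divided by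
    \<open>\<psi> ^ (m0 + 1)\<close>.\<close>
  define R where "R s = (\<Sum>m\<in>{m0<..D}. \<gamma> m (complex_of_real s) * \<psi> s ^ (m - m0 - 1))" for s
  have \<psi>s: "small s0 N \<psi>" for N using s0 by (simp add: Z_def)
  have "small s0 0 (\<lambda>s. \<psi> s ^ j)" for j
  proof (induction j)
   case (Suc j)
   from small_mult[OF \<psi>s[of 0] Suc] show ?case by simp
  qed simp
  hence "small s0 0 (\<lambda>s. \<gamma> m (complex_of_real s) * \<psi> s ^ j)" for m j
   using small_mult[OF small_0_continuous[OF cont[of m]], of 0 "\<lambda>s. \<psi> s ^ j"] by simp
  hence "small s0 0 R" unfolding R_def by (intro small_sum)
  from small_mult[OF \<psi>s[of "Suc n"] this] have "small s0 (Suc n) (\<lambda>s. \<psi> s * R s)" by simp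
  then obtain C \<delta> where C: "C \<ge> 0" "\<delta> > 0" "\<And>s. norm (s - s0) < \<delta> \<Longrightarrow> norm (\<psi> s * R s) \<le> C * norm (s - s0) ^ Suc n"
   by (rule smallE) blast
  obtain e where e: "e > 0" "\<And>s. \<bar>s - s0\<bar> < e \<Longrightarrow> s \<in> I"
  proof -
   have "open I" by (simp add: I_def)
   thus ?thesis using that s0I unfolding open_dist dist_real_def by blast
  qed
  have \<psi>0: "\<psi> s0 = 0"
  proof -
   obtain C1 \<delta>1 where C1: "C1 \<ge> 0" "\<delta>1 > 0" "\<And>s. norm (s - s0) < \<delta>1 \<Longrightarrow> norm (\<psi> s) \<le> C1 * norm (s - s0) ^ 1"
    by (rule smallE[OF \<psi>s[of 1]]) blast
   show ?thesis using C1(3)[of s0] C1(2) by simp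
  qed
  define \<epsilon> where "\<epsilon> = Min {r, \<delta>, e, k / (C + 1)}"
  have \<epsilon>: "\<epsilon> > 0" "\<epsilon> \<le> r" "\<epsilon> \<le> \<delta>" "\<epsilon> \<le> e" "\<epsilon> \<le> k / (C + 1)" unfolding \<epsilon>_def using k C e by auto
  have "\<psi> s = 0" if s: "\<bar>s - s0\<bar> < \<epsilon>" for s
  proof (rule ccontr)
   assume nz: "\<psi> s \<noteq> 0"
   hence ne: "s \<noteq> s0" using \<psi>0 by auto
   have sI: "s \<in> I" using s \<epsilon> e by auto
   have "(\<Sum>m\<le>D. \<gamma> m (complex_of_real s) * \<psi> s ^ m) = (\<Sum>m\<in>{m0..D}. \<gamma> m (complex_of_real s) * \<psi> s ^ m)"
    using m0l Iball[OF sI] by (intro sum.mono_neutral_right) auto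
   also have "\<dots> = \<gamma> m0 (complex_of_real s) * \<psi> s ^ m0 + (\<Sum>m\<in>{m0<..D}. \<gamma> m (complex_of_real s) * \<psi> s ^ m)"
    using m0(1) by (simp add: sum.head)
   also have "(\<Sum>m\<in>{m0<..D}. \<gamma> m (complex_of_real s) * \<psi> s ^ m) = \<psi> s ^ m0 * (\<psi> s * R s)"
    unfolding R_def sum_distrib_left
   proof (rule sum.cong[OF refl])
    fix m assume "m \<in> {m0<..D}"
    hence "m = m0 + 1 + (m - m0 - 1)" by auto
    hence "\<psi> s ^ m = \<psi> s ^ m0 * \<psi> s * \<psi> s ^ (m - m0 - 1)" by (metis power_add power_one_right)
    thus "\<gamma> m (complex_of_real s) * \<psi> s ^ m = \<psi> s ^ m0 * (\<psi> s * (\<gamma> m (complex_of_real s) * \<psi> s ^ (m - m0 - 1)))" by simp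
   qed
   finally have "\<psi> s ^ m0 * (\<gamma> m0 (complex_of_real s) + \<psi> s * R s) = 0" using expand[OF sI] by (simp add: algebra_simps)
   hence "\<gamma> m0 (complex_of_real s) = - (\<psi> s * R s)" using nz by (simp add: eq_neg_iff_add_eq_0)
   hence "norm (\<gamma> m0 (complex_of_real s)) = norm (\<psi> s * R s)" by simp
   moreover have nn: "norm (complex_of_real s - complex_of_real s0) = \<bar>s - s0\<bar>" by (metis norm_of_real of_real_diff)
   moreover have "dist (complex_of_real s0) (complex_of_real s) = \<bar>s - s0\<bar>" using nn by (metis dist_commute dist_norm)
   hence "complex_of_real s \<in> ball (complex_of_real s0) r" using s \<epsilon> by simp
   ultimately have "k * \<bar>s - s0\<bar> ^ n \<le> C * \<bar>s - s0\<bar> ^ Suc n" using k(3)[of "complex_of_real s"] C(3)[of s] s \<epsilon> by simp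
   hence "\<bar>s - s0\<bar> ^ n * k \<le> \<bar>s - s0\<bar> ^ n * (C * \<bar>s - s0\<bar>)" by (simp add: mult_ac)
   hence "k \<le> C * \<bar>s - s0\<bar>" using ne by simp
   also have "\<dots> \<le> (C + 1) * \<bar>s - s0\<bar>" by (intro mult_right_mono) auto
   also have "\<dots> < (C + 1) * (k / (C + 1))" using s \<epsilon> C by (intro mult_strict_left_mono) auto
   also have "\<dots> = k" using C by simp
   finally show False by simp
  qed
  thus ?thesis using \<epsilon> e by (intro exI[of _ \<epsilon>]) auto
 qed
 have "open Z"
  unfolding open_dist
 proof
  fix s0 assume "s0 \<in> Z"
  from A[OF this] obtain \<epsilon> where \<epsilon>: "\<epsilon> > 0" "\<And>s. \<bar>s - s0\<bar> < \<epsilon> \<Longrightarrow> s \<in> I \<and> \<psi> s = 0" by blast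
  have "s \<in> Z" if "dist s s0 < \<epsilon>" for s
  proof -
   have "small s N \<psi>" for N
   proof (rule small_cong[OF small_zero])
    show "0 < \<epsilon> - dist s s0" using that by simp
    show "\<psi> x = 0" if "norm (x - s) < \<epsilon> - dist s s0" for x using \<epsilon>(2)[of x] that by (simp add: dist_real_def)
   qed
   thus ?thesis using \<epsilon>(2)[of s] that by (simp add: Z_def dist_real_def)
  qed
  thus "\<exists>e>0. \<forall>y. dist y s0 < e \<longrightarrow> y \<in> Z" using \<epsilon>(1) by blast
 qed
 hence opn: "openin (top_of_set I) Z" by (intro open_openin_trans) (auto simp: Z_def I_def intro: open_subset)
 have cls: "closedin (top_of_set I) Z"
  unfolding closedin_limpt
 proof (intro conjI allI impI)
  show "Z \<subseteq> I" by (auto simp: Z_def)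
  fix s0 assume "s0 islimpt Z \<and> s0 \<in> I"
  then obtain t where t: "\<And>n::nat. t n \<in> Z - {s0}" "t \<longlonglongrightarrow> s0" and s0I: "s0 \<in> I" unfolding islimpt_sequential by blast
  have t0: "\<psi> (t n) = 0" for n using A[of "t n"] t(1)[of n] by (metis DiffD1 abs_zero cancel_comm_monoid_add_class.diff_cancel)
  have "small s0 N \<psi>" for N
  proof -
   have "\<bar>s0\<bar> < 3/2" using s0I by (auto simp: I_def abs_less_iff)
   from tay[OF this, of N] obtain T :: "real poly" where T: "small s0 N (\<lambda>s. \<phi> s - poly T s)" ..
   obtain U where U: "small (complex_of_real s0) N (\<lambda>s. h s - poly U s)"
    using holomorphic_taylor_small[OF h open_ball Iball[OF s0I]] by blast
   \<comment> \<open>The difference of the two Taylor polynomials at \<open>s0\<close>. At the zeros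
     \<open>t n\<close> of \<open>\<psi>\<close> it is of order \<open>N\<close>, hence it is of
     order \<open>N\<close> altogether.\<close>
   define d where "d = cpoly T - U"
   have e: "small s0 N (\<lambda>s. \<psi> s - poly d (complex_of_real s))"
   proof -
    have "small s0 N (\<lambda>s. complex_of_real (\<phi> s - poly T s) - (h (complex_of_real s) - poly U (complex_of_real s)))"
     by (intro small_diff small_of_real T small_of_real_comp[OF U])
    thus ?thesis by (simp add: d_def \<psi>_def algebra_simps)
   qed
   then obtain C \<delta> where C: "C \<ge> 0" "\<delta> > 0" "\<And>s. norm (s - s0) < \<delta> \<Longrightarrow> norm (\<psi> s - poly d (complex_of_real s)) \<le> C * norm (s - s0) ^ N"
    by (rule smallE) blast
   obtain n0 where n0: "\<And>n. n \<ge> n0 \<Longrightarrow> dist (t n) s0 < \<delta>" using metric_LIMSEQ_D[OF t(2) C(2)] by blast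
   define P where "P = pcompose d [:complex_of_real s0, 1:]"
   have Pd: "poly P (complex_of_real (s - s0)) = poly d (complex_of_real s)" for s
    by (simp add: P_def poly_pcompose)
   have "coeff P i = 0" if "i < N" for i
   proof (rule poly_small_sequence[of "\<lambda>n. complex_of_real (t (n + n0) - s0)" P C N])
    have "(\<lambda>n. t (n + n0) - s0) \<longlonglongrightarrow> 0" using LIMSEQ_ignore_initial_segment[OF t(2), of n0] by (simp add: LIM_zero)
    from tendsto_of_real[OF this] show "(\<lambda>n. complex_of_real (t (n + n0) - s0)) \<longlonglongrightarrow> 0" by (simp only: of_real_0)
    fix n
    have "t (n + n0) - s0 \<noteq> 0" using t(1)[of "n + n0"] by simp
    thus "complex_of_real (t (n + n0) - s0) \<noteq> 0" by (simp only: of_real_eq_0_iff not_False_eq_True)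
    show "norm (poly P (complex_of_real (t (n + n0) - s0))) \<le> C * norm (complex_of_real (t (n + n0) - s0)) ^ N"
     using C(3)[of "t (n + n0)"] n0[of "n + n0"] t0[of "n + n0"] unfolding Pd norm_of_real by (simp add: dist_norm)
   qed (use that in auto)
   hence "small 0 N (poly P)" by (rule poly_small_of_coeffs)
   then obtain C' \<delta>' where C': "C' \<ge> 0" "\<delta>' > 0" "\<And>s. norm (s - 0) < \<delta>' \<Longrightarrow> norm (poly P s) \<le> C' * norm (s - 0) ^ N"
    by (rule smallE) blast
   have "small s0 N (\<lambda>s. poly d (complex_of_real s))"
    unfolding small_def
   proof (intro exI conjI allI impI)
    show "\<delta>' > 0" by fact
    fix s assume "norm (s - s0) < \<delta>'"
    hence "norm (poly P (complex_of_real (s - s0))) \<le> C' * norm (complex_of_real (s - s0)) ^ N"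
     using C'(3)[of "complex_of_real (s - s0)"] unfolding diff_zero norm_of_real real_norm_def by blast
    thus "norm (poly d (complex_of_real s)) \<le> C' * norm (s - s0) ^ N" unfolding Pd norm_of_real real_norm_def .
   qed
   from small_add[OF e this] show ?thesis by simp
  qed
  thus "s0 \<in> Z" using s0I by (simp add: Z_def)
 qed
 have "connected I" by (simp add: I_def)
 moreover have "0 \<in> Z" using flat0 by (simp add: Z_def I_def \<psi>_def[abs_def])
 ultimately have "Z = I" using opn cls unfolding connected_clopen by blast
 moreover have "s \<in> I" using s by (auto simp: I_def)
 ultimately have "\<psi> s = 0" using A[of s] by (metis abs_zero cancel_comm_monoid_add_class.diff_cancel)
 thus ?thesis by (simp add: \<psi>_def)
qed

section \<open>Homogeneous parts of polynomials\<close>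

definition rpoly :: "(real^'n \<Rightarrow> real) \<Rightarrow> real^'n \<Rightarrow> real poly" where
 "rpoly T \<zeta> = (SOME P. \<forall>s. poly P s = T (s *\<^sub>R \<zeta>))"

text \<open>The homogeneous part of degree \<open>j\<close>, read off along the ray through
  \<open>\<zeta>\<close>.\<close>

definition hpart :: "(real^'n \<Rightarrow> real) \<Rightarrow> nat \<Rightarrow> real^'n \<Rightarrow> real" where
 "hpart T j \<zeta> = coeff (rpoly T \<zeta>) j"

lemma poly_rpoly: assumes "pfun I k T" shows "poly (rpoly T \<zeta>) s = T (s *\<^sub>R \<zeta>)"
proof -
 obtain P :: "real poly" where "\<And>s. poly P s = T (0 + s *\<^sub>R \<zeta>)" using pfun_line[OF assms] by metis
 hence "\<exists>P. \<forall>s. poly P s = T (s *\<^sub>R \<zeta>)" by auto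
 from someI_ex[OF this] show ?thesis unfolding rpoly_def by blast
qed

lemma real_poly_eqI: "(\<And>s. poly P s = poly Q s) \<Longrightarrow> P = (Q :: real poly)"
 by (metis ext poly_eq_poly_eq_iff)

lemma hpart_properties:
 fixes T :: "real^'n::finite \<Rightarrow> real"
 assumes "pfun UNIV k T"
 shows hpart_pfun: "pfun UNIV j (hpart T j)"
  and hpart_scale: "hpart T j (s *\<^sub>R \<zeta>) = s ^ j * hpart T j \<zeta>"
  and hpart_gt: "j > k \<Longrightarrow> hpart T j \<zeta> = 0"
  and hpart_sum: "T \<zeta> = (\<Sum>j\<le>k. hpart T j \<zeta>)"
proof -
 obtain c where c: "T = (\<lambda>x. \<Sum>\<alpha>\<in>mons UNIV k. c \<alpha> * mon \<alpha> x)" using assms by (auto simp: pfun_def)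
 define A where "A j = {\<alpha> :: 'n \<Rightarrow> nat. \<alpha> \<in> mons UNIV k \<and> (\<Sum>i\<in>UNIV. \<alpha> i) = j}" for j :: nat
 define H where "H j \<zeta> = (\<Sum>\<alpha>\<in>A j. c \<alpha> * mon \<alpha> \<zeta>)" for j \<zeta>
 have ev: "T (s *\<^sub>R \<zeta>) = (\<Sum>j\<le>k. H j \<zeta> * s ^ j)" for s \<zeta>
 proof -
  have "T (s *\<^sub>R \<zeta>) = (\<Sum>j\<le>k. \<Sum>\<alpha>\<in>A j. c \<alpha> * mon \<alpha> (s *\<^sub>R \<zeta>))"
   unfolding c A_def by (rule sum.group[symmetric], rule finite_mons, rule finite_atMost) (auto simp: mons_def)
  also have "\<dots> = (\<Sum>j\<le>k. H j \<zeta> * s ^ j)"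
   unfolding H_def sum_distrib_right by (intro sum.cong refl) (auto simp: A_def mon_scale)
  finally show ?thesis .
 qed
 have eq: "rpoly T \<zeta> = (\<Sum>j\<le>k. monom (H j \<zeta>) j)" for \<zeta>
  by (rule real_poly_eqI) (simp add: poly_rpoly[OF assms] ev poly_sum poly_monom)
 have hH: "hpart T j \<zeta> = (if j \<le> k then H j \<zeta> else 0)" for j \<zeta>
  unfolding hpart_def eq by (simp add: coeff_sum)
 show "pfun UNIV j (hpart T j)"
 proof (cases "j \<le> k")
  case True
  hence "hpart T j = H j" by (simp add: hH fun_eq_iff)
  thus ?thesis by (auto simp: H_def[abs_def] A_def mons_def intro!: pfun_sum pfun_mon)
 next
  case False
  hence "hpart T j = (\<lambda>_. 0)" by (simp add: hH fun_eq_iff)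
  thus ?thesis by simp
 qed
 show "hpart T j (s *\<^sub>R \<zeta>) = s ^ j * hpart T j \<zeta>"
  unfolding hH H_def by (auto simp: sum_distrib_left A_def mon_scale intro!: sum.cong)
 show "j > k \<Longrightarrow> hpart T j \<zeta> = 0" by (simp add: hH)
 show "T \<zeta> = (\<Sum>j\<le>k. hpart T j \<zeta>)" using ev[of 1 \<zeta>] by (simp add: hH)
qed

lemma hpart_bounded:
 assumes "pfun UNIV k T"
 obtains M where "M \<ge> 0" "\<And>j \<zeta>. norm \<zeta> \<le> 1 \<Longrightarrow> \<bar>hpart T j \<zeta>\<bar> \<le> M"
proof -
 have "\<exists>M. \<forall>\<zeta>. norm \<zeta> \<le> 1 \<longrightarrow> \<bar>hpart T j \<zeta>\<bar> \<le> M" for j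
 proof -
  have "compact (hpart T j ` cball 0 1)"
   by (intro compact_continuous_image pfun_continuous[OF hpart_pfun[OF assms]]) simp
  hence "bounded (hpart T j ` cball 0 1)" by (rule compact_imp_bounded)
  then obtain M where "\<forall>y\<in>hpart T j ` cball 0 1. norm y \<le> M" unfolding bounded_iff by blast
  thus ?thesis by (intro exI[of _ M]) auto
 qed
 then obtain M where M: "\<And>j \<zeta>. norm \<zeta> \<le> 1 \<Longrightarrow> \<bar>hpart T j \<zeta>\<bar> \<le> M j" by metis
 have M0: "M j \<ge> 0" for j using M[of 0 j] abs_ge_zero[of "hpart T j 0"] by simp
 show ?thesis
 proof (rule that[of "\<Sum>j\<le>k. M j"])
  show "(\<Sum>j\<le>k. M j) \<ge> 0" using M0 by (intro sum_nonneg)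
  fix j and \<zeta> :: "real^'a" assume z: "norm \<zeta> \<le> 1"
  show "\<bar>hpart T j \<zeta>\<bar> \<le> (\<Sum>j\<le>k. M j)"
  proof (cases "j \<le> k")
   case True
   thus ?thesis using M[OF z, of j] member_le_sum[of j "{..k}" M] M0 by force
  next
   case False
   thus ?thesis using hpart_gt[OF assms, of j] M0 by (simp add: sum_nonneg)
  qed
 qed
qed

lemma small_of_hpart:
 assumes T: "pfun UNIV k T" and z: "\<And>j \<zeta>. j < N \<Longrightarrow> hpart T j \<zeta> = 0"
 shows "small 0 N T"
proof -
 obtain M where M: "M \<ge> 0" "\<And>j \<zeta>. norm \<zeta> \<le> 1 \<Longrightarrow> \<bar>hpart T j \<zeta>\<bar> \<le> M" by (rule hpart_bounded[OF T]) blast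
 have "small 0 N (hpart T j)" for j
 proof (cases "j < N")
  case False
  have "\<bar>hpart T j x\<bar> \<le> M * norm x ^ j" for x
  proof (cases "x = 0")
   case True
   show ?thesis using hpart_scale[OF T, of j 0 0] M True M(2)[of 0 j] by (cases j) auto
  next
   case False
   have "hpart T j x = norm x ^ j * hpart T j ((1 / norm x) *\<^sub>R x)"
    using hpart_scale[OF T, of j "norm x" "(1 / norm x) *\<^sub>R x"] False by simp
   thus ?thesis using M(2)[of "(1 / norm x) *\<^sub>R x" j] False by (simp add: abs_mult mult.commute mult_right_mono)
  qed
  hence "small 0 j (hpart T j)" unfolding small_def by (intro exI[of _ M] exI[of _ 1]) auto
  thus ?thesis using False by (auto intro: small_mono)
 next
  case True
  hence "hpart T j = (\<lambda>_. 0)" using z by auto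
  thus ?thesis by simp
 qed
 hence "small 0 N (\<lambda>x. \<Sum>j\<le>k. hpart T j x)" by (intro small_sum)
 moreover have "T = (\<lambda>x. \<Sum>j\<le>k. hpart T j x)" using hpart_sum[OF T] by auto
 ultimately show ?thesis by simp
qed

lemma hpart_of_small:
 assumes T: "pfun UNIV k T" and s: "small 0 N T" "j < N" shows "hpart T j \<zeta> = 0"
proof -
 have "small 0 N (\<lambda>s::real. T (0 + s *\<^sub>R \<zeta>))" by (rule small_line) (use s in simp)
 moreover have "(\<lambda>s::real. T (0 + s *\<^sub>R \<zeta>)) = poly (rpoly T \<zeta>)" using poly_rpoly[OF T] by auto
 ultimately show ?thesis unfolding hpart_def using poly_small_coeff s(2) by metis
qed

text \<open>Makes the homogeneous Taylor parts of a function independent of the approximating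
  polynomial, once its order exceeds \<open>j\<close>.\<close>

lemma hpart_diff_small:
 assumes "pfun UNIV k T" "pfun UNIV l U" "small 0 N (\<lambda>x. T x - U x)" "j < N"
 shows "hpart T j \<zeta> = hpart U j \<zeta>"
proof -
 have TU: "pfun UNIV (max k l) (\<lambda>x. T x - U x)"
  by (intro pfun_diff pfun_mono[OF assms(1)] pfun_mono[OF assms(2)]) auto
 have "rpoly (\<lambda>x. T x - U x) \<zeta> = rpoly T \<zeta> - rpoly U \<zeta>"
  by (rule real_poly_eqI) (simp add: poly_rpoly[OF TU] poly_rpoly[OF assms(1)] poly_rpoly[OF assms(2)])
 thus ?thesis using hpart_of_small[OF TU assms(3,4), of \<zeta>] by (simp add: hpart_def)
qed

text \<open>If the derivative of the relation with respect to \<open>f\<close> is flat as well, it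
  is a relation of smaller degree and replaces the original. The process ends because a nonzero
  polynomial in the variables alone is not flat.\<close>

lemma flat_relation_with_nonflat_derivative:
 fixes b :: "nat \<Rightarrow> real^'n \<Rightarrow> real"
 assumes "\<And>i. pfun UNIV g (b i)" "\<exists>i\<le>D. \<exists>x. b i x \<noteq> 0" "\<And>N. small 0 N (\<lambda>z. \<Sum>i\<le>D. b i z * f z ^ i)"
 shows "\<exists>D' B. (\<forall>i. pfun UNIV g (B i)) \<and> (\<forall>N. small 0 N (\<lambda>z. \<Sum>i\<le>D'. B i z * f z ^ i)) \<and>
  (\<exists>N. \<not> small 0 N (\<lambda>z. \<Sum>i\<le>D'. real i * B i z * f z ^ (i - 1)))"
proof -
 have zero: "b x = 0" if "pfun UNIV g b" "\<And>N. small 0 N b" for b :: "real^'n \<Rightarrow> real" and x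
 proof -
  have "hpart b j x = 0" for j using hpart_of_small[OF that(1) that(2)[of "Suc j"], of j] by simp
  thus ?thesis using hpart_sum[OF that(1), of x] by simp
 qed
 show ?thesis using assms
 proof (induction D arbitrary: b)
  case 0
  have "b 0 x = 0" for x using 0 by (intro zero) auto
  thus ?case using 0(2) by auto
 next
  case (Suc D)
  define b' where "b' i z = real (Suc i) * b (Suc i) z" for i z
  have eq: "(\<Sum>i\<le>Suc D. real i * b i z * f z ^ (i - 1)) = (\<Sum>i\<le>D. b' i z * f z ^ i)" for z
   by (subst sum.atMost_Suc_shift) (simp add: b'_def)
  show ?case
  proof (cases "\<forall>N. small 0 N (\<lambda>z. \<Sum>i\<le>D. b' i z * f z ^ i)")
   case False
   thus ?thesis using Suc.prems eq by (intro exI[of _ "Suc D"] exI[of _ b]) auto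
  next
   case True
   have b': "pfun UNIV g (b' i)" for i unfolding b'_def[abs_def] by (intro pfun_cmult Suc.prems)
   show ?thesis
   proof (cases "\<exists>i\<le>D. \<exists>x. b' i x \<noteq> 0")
    case nz: True
    show ?thesis by (rule Suc.IH[OF b' nz]) (use True in blast)
   next
    case False
    hence z: "b (Suc i) x = 0" if "i \<le> D" for i x using that by (auto simp: b'_def)
    have "(\<Sum>i\<le>Suc D. b i z * f z ^ i) = b 0 z" for z
     by (subst sum.atMost_Suc_shift) (simp add: z)
    hence "b 0 x = 0" for x using Suc.prems by (intro zero) auto
    hence "b i x = 0" if "i \<le> Suc D" for i x using that z by (cases i) auto
    thus ?thesis using Suc.prems(2) by blast
   qed
  qed
 qed
qed

text \<open>A Hensel type argument along rays. Let \<open>\<nu>\<close> be the order at 0 of the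
  derivative relation, and \<open>Tn\<close> a Taylor polynomial of order
  \<open>2 * \<nu> + 1\<close>. A finer one differs from \<open>Tn\<close> along the ray by
  \<open>s ^ (\<nu> + 1)\<close> times a polynomial \<open>zr\<close>, and the relation divided by
  \<open>s ^ (2 * \<nu> + 1)\<close> takes the form treated in
  \<open>approximate_root_coeff_bound\<close>, with \<open>\<delta>\<close> the lowest homogeneous
  part of the derivative. That part is not identically zero, so it is bounded below on some ball of
  directions, which need not contain 0.\<close>

lemma taylor_parts_bounded_on_ball:
 fixes f :: "real^'n \<Rightarrow> real" and T :: "nat \<Rightarrow> real^'n \<Rightarrow> real"
 assumes B: "\<And>i. pfun UNIV g (B i)"
  and flat: "\<And>N. small 0 N (\<lambda>z. \<Sum>i\<le>D. B i z * f z ^ i)"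
  and nonflat: "\<exists>N. \<not> small 0 N (\<lambda>z. \<Sum>i\<le>D. real i * B i z * f z ^ (i - 1))"
  and T: "\<And>N. pfun UNIV (dg N) (T N)" "\<And>N. small 0 (Suc N) (\<lambda>z. f z - T N z)"
 obtains \<zeta>0 \<eta> M R where "\<eta> > 0" "\<eta> \<le> 1/2" "norm \<zeta>0 \<le> 1/2" "M \<ge> 0" "R \<ge> 1"
  "\<And>\<zeta> l. norm (\<zeta> - \<zeta>0) < \<eta> \<Longrightarrow> \<bar>hpart (T l) l \<zeta>\<bar> \<le> M * R ^ l"
proof -
 define q where "q z = (\<Sum>i\<le>D. real i * B i z * f z ^ (i - 1))" for z
 define \<nu> where "\<nu> = (LEAST N. \<not> small 0 (Suc N) q)"
 have f0: "small 0 0 f"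
 proof -
  have "small 0 0 (\<lambda>z. f z - T 0 z)" by (rule small_mono[OF T(2)[of 0]]) simp
  moreover have "small 0 0 (T 0)" using pfun_continuous[OF T(1)[of 0], of UNIV]
   by (intro small_0_continuous) (simp add: continuous_on_eq_continuous_at)
  ultimately have "small 0 0 (\<lambda>z. (f z - T 0 z) + T 0 z)" by (rule small_add)
  thus ?thesis by simp
 qed
 have p0: "small 0 0 h" if "pfun UNIV k h" for h :: "real^'n \<Rightarrow> real" and k
  using pfun_continuous[OF that, of UNIV] by (intro small_0_continuous) (simp add: continuous_on_eq_continuous_at)
 have pw0: "small 0 0 (\<lambda>z. h z ^ i)" if "small 0 0 h" for h :: "real^'n \<Rightarrow> real" and i
 proof (induction i)
  case (Suc i)
  from small_mult[OF that Suc] show ?case by simp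
 qed simp
 have q0: "small 0 0 q"
 proof -
  have "small 0 0 (\<lambda>z. real i * B i z * f z ^ (i - 1))" for i
   using small_mult[OF p0[OF pfun_cmult[OF B[of i], of "real i"]] pw0[OF f0, of "i - 1"]] by simp
  thus ?thesis unfolding q_def by (intro small_sum)
 qed
 have "\<exists>N. \<not> small 0 (Suc N) q"
  using nonflat small_mono[of 0 "Suc _" q] unfolding q_def[symmetric] by (metis le_SucI order_refl)
 hence n1: "\<not> small 0 (Suc \<nu>) q" unfolding \<nu>_def by (rule LeastI_ex)
 have n2: "small 0 \<nu> q"
 proof (cases \<nu>)
  case (Suc m)
  hence "m < \<nu>" by simp
  thus ?thesis using not_less_Least[of m "\<lambda>N. \<not> small 0 (Suc N) q"] Suc unfolding \<nu>_def by auto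
 qed (use q0 in simp)
 \<comment> \<open>The order \<open>2 * \<nu> + 1\<close> makes \<open>P 0\<close> of order
   \<open>2 * \<nu> + 2\<close> and leaves the order \<open>\<nu>\<close> of the derivative
   unchanged.\<close>
 define Tn where "Tn = T (2 * \<nu> + 1)"
 define dT where "dT = dg (2 * \<nu> + 1)"
 have Tn: "pfun UNIV dT Tn" "small 0 (2 * \<nu> + 2) (\<lambda>z. f z - Tn z)"
  using T(1)[of "2 * \<nu> + 1"] T(2)[of "2 * \<nu> + 1"] by (simp_all add: Tn_def dT_def)
 define S where "S z = (\<Sum>i\<le>D. real i * B i z * Tn z ^ (i - 1))" for z
 have pd: "small 0 (2 * \<nu> + 2) (\<lambda>z. f z ^ i - Tn z ^ i)" for i
  by (rule small_power_diff[OF Tn(2) f0 p0[OF Tn(1)]])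
 have dS: "small 0 (2 * \<nu> + 2) (\<lambda>z. q z - S z)"
 proof -
  have "small 0 (2 * \<nu> + 2) (\<lambda>z. \<Sum>i\<le>D. (real i * B i z) * (f z ^ (i - 1) - Tn z ^ (i - 1)))"
   using small_mult[OF p0[OF pfun_cmult[OF B]] pd] by (intro small_sum) simp
  thus ?thesis by (simp add: q_def S_def sum_subtractf right_diff_distrib)
 qed
 have S1: "small 0 \<nu> S"
  using small_diff[OF n2 small_mono[OF dS, of \<nu>]] by simp
 have S2: "\<not> small 0 (Suc \<nu>) S"
  using n1 small_add[OF small_mono[OF dS, of "Suc \<nu>"], of S] by auto
 define kk where "kk = g + D * dT"
 \<comment> \<open>The coefficients of the relation expanded around \<open>Tn\<close>;
   \<open>P 1\<close> is the derivative \<open>S\<close>.\<close>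
 define P where "P m z = (\<Sum>i\<le>D. real (i choose m) * (B i z * Tn z ^ (i - m)))" for m z
 have P: "pfun UNIV kk (P m)" for m
  unfolding P_def[abs_def]
 proof (intro pfun_sum pfun_cmult)
  fix i assume i: "i \<in> {..D}"
  have "pfun UNIV (g + (i - m) * dT) (\<lambda>x. B i x * Tn x ^ (i - m))" by (intro pfun_mult pfun_power B Tn)
  moreover have "g + (i - m) * dT \<le> kk" using i by (auto simp: kk_def intro!: mult_right_mono)
  ultimately show "pfun UNIV kk (\<lambda>x. B i x * Tn x ^ (i - m))" by (blast intro: pfun_mono)
 qed
 have PS: "P 1 = S" by (simp add: P_def[abs_def] S_def[abs_def] mult.assoc)
 have P0: "small 0 (2 * \<nu> + 2) (P 0)"
 proof -
  have "small 0 (2 * \<nu> + 2) (\<lambda>z. \<Sum>i\<le>D. B i z * (f z ^ i - Tn z ^ i))"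
   using small_mult[OF p0[OF B] pd] by (intro small_sum) simp
  from small_diff[OF flat this] show ?thesis by (simp add: P_def[abs_def] sum_subtractf right_diff_distrib)
 qed
 have kS: "pfun UNIV kk S" using P[of 1] PS by simp
 have "\<exists>\<zeta>. hpart S \<nu> \<zeta> \<noteq> 0"
 proof (rule ccontr)
  assume a: "\<not> ?thesis"
  have "hpart S j \<zeta> = 0" if "j < Suc \<nu>" for j \<zeta>
   using that a hpart_of_small[OF kS S1, of j \<zeta>] by (cases "j = \<nu>") auto
  from small_of_hpart[OF kS this] S2 show False by simp
 qed
 then obtain \<zeta>' where "hpart S \<nu> \<zeta>' \<noteq> 0" by blast
 \<comment> \<open>Taking the direction close to 0 keeps the later ball inside the unit ball, where
   the homogeneous parts are bounded.\<close>
 from pfun_nonzero_near[OF hpart_pfun[OF kS] this, of "1/2" 0]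
 obtain \<zeta>0 where \<zeta>0: "norm \<zeta>0 < 1/2" "hpart S \<nu> \<zeta>0 \<noteq> 0" by (auto simp: dist_norm)
 define c where "c = min 1 (\<bar>hpart S \<nu> \<zeta>0\<bar> / 2)"
 have c: "c > 0" "c \<le> 1" using \<zeta>0 by (auto simp: c_def)
 obtain \<eta> where \<eta>: "\<eta> > 0" "\<eta> \<le> 1/2" "\<And>\<zeta>. norm (\<zeta> - \<zeta>0) < \<eta> \<Longrightarrow> c \<le> \<bar>hpart S \<nu> \<zeta>\<bar>"
 proof -
  have "isCont (hpart S \<nu>) \<zeta>0" using pfun_continuous[OF hpart_pfun[OF kS], of UNIV \<nu>]
   by (simp add: continuous_on_eq_continuous_at)
  moreover have "\<bar>hpart S \<nu> \<zeta>0\<bar> / 2 > 0" using \<zeta>0 by simp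
  ultimately obtain e where e: "e > 0" "\<And>\<zeta>. dist \<zeta> \<zeta>0 < e \<Longrightarrow> dist (hpart S \<nu> \<zeta>) (hpart S \<nu> \<zeta>0) < \<bar>hpart S \<nu> \<zeta>0\<bar> / 2"
   unfolding continuous_at_eps_delta by blast
  show ?thesis
  proof (rule that[of "min e (1/2)"])
   fix \<zeta> assume "norm (\<zeta> - \<zeta>0) < min e (1/2)"
   hence "\<bar>hpart S \<nu> \<zeta> - hpart S \<nu> \<zeta>0\<bar> < \<bar>hpart S \<nu> \<zeta>0\<bar> / 2" using e(2)[of \<zeta>] by (simp add: dist_norm)
   thus "c \<le> \<bar>hpart S \<nu> \<zeta>\<bar>" unfolding c_def by linarith
  qed (use e in auto)
 qed
 have "\<exists>M. \<forall>j \<zeta>. norm \<zeta> \<le> 1 \<longrightarrow> \<bar>hpart (P m) j \<zeta>\<bar> \<le> M" for m using hpart_bounded[OF P[of m]] by metis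
 then obtain Mm where Mm: "\<And>m j \<zeta>. norm \<zeta> \<le> 1 \<Longrightarrow> \<bar>hpart (P m) j \<zeta>\<bar> \<le> Mm m" by metis
 have Mm0: "Mm m \<ge> 0" for m using Mm[of 0 m 0] abs_ge_zero[of "hpart (P m) 0 0"] by simp
 obtain MT where MT: "MT \<ge> 0" "\<And>j \<zeta>. norm \<zeta> \<le> 1 \<Longrightarrow> \<bar>hpart Tn j \<zeta>\<bar> \<le> MT" by (rule hpart_bounded[OF Tn(1)]) blast
 define M where "M = 1 + (real kk + 1) * (\<Sum>m\<le>Suc D. Mm m)"
 have M1: "M \<ge> 1" unfolding M_def using Mm0 by (simp add: sum_nonneg)
 have pbound: "norm (poly P' s) \<le> M" if "norm s \<le> 1" "m \<le> Suc D" "norm \<zeta> \<le> 1" "\<And>i. coeff P' i = complex_of_real (hpart (P m) (i + j) \<zeta>)" for P' s m \<zeta> j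
 proof -
  have "norm (poly P' s) \<le> (\<Sum>i\<le>kk. norm (coeff P' i))"
   using that hpart_gt[OF P[of m]] by (intro poly_norm_le_coeff_sum) auto
  also have "\<dots> \<le> (\<Sum>i\<le>kk. Mm m)" using that Mm by (intro sum_mono) auto
  also have "\<dots> = (real kk + 1) * Mm m" by simp
  also have "\<dots> \<le> (real kk + 1) * (\<Sum>m\<le>Suc D. Mm m)" using that Mm0
   by (intro mult_left_mono member_le_sum) auto
  finally show ?thesis by (simp add: M_def)
 qed
 define R where "R = max 1 (8 * M * (real D + 2)^2 / c)"
 have main: "\<bar>hpart (T (n + \<nu> + 1)) (n + \<nu> + 1) \<zeta>\<bar> \<le> R ^ n + MT" if z: "norm \<zeta> \<le> 1" "c \<le> \<bar>hpart S \<nu> \<zeta>\<bar>" for n \<zeta>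
 proof -
  \<comment> \<open>After division by \<open>s ^ (2 * \<nu> + 1)\<close> an error of order
    \<open>N0 + 1\<close> becomes one of order \<open>n + 1\<close>.\<close>
  define N0 where "N0 = n + 1 + 2 * \<nu>"
  define U where "U = T N0"
  have U: "pfun UNIV (dg N0) U" "small 0 (Suc N0) (\<lambda>z. f z - U z)" using T[of N0] by (auto simp: U_def)
  have UT: "small 0 (2 * \<nu> + 2) (\<lambda>z. U z - Tn z)"
  proof -
   have "small 0 (2 * \<nu> + 2) (\<lambda>z. f z - U z)" by (rule small_mono[OF U(2)]) (simp add: N0_def)
   from small_diff[OF Tn(2) this] show ?thesis by simp
  qed
  define \<delta> where "\<delta> = hpart S \<nu> \<zeta>"
  \<comment> \<open>The shifts divide by the powers of \<open>s\<close> contained in the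
    polynomials; \<open>Cr m\<close> keeps the surplus powers of the nonlinear terms.\<close>
  define zr where "zr = poly_shift (\<nu> + 1) (rpoly U \<zeta> - rpoly Tn \<zeta>)"
  define Ar where "Ar = poly_shift (2 * \<nu> + 2) (rpoly (P 0) \<zeta>)"
  define Br where "Br = poly_shift (\<nu> + 1) (rpoly S \<zeta>)"
  define Cr where "Cr m = (if m \<le> D then monom 1 ((m - 2) * (\<nu> + 1)) * rpoly (P m) \<zeta> else 0)" for m
  have shift: "poly p s = s ^ k * poly (poly_shift k p) s" if "\<And>i. i < k \<Longrightarrow> coeff p i = 0" for p :: "real poly" and k s
  proof -
   have "p = monom 1 k * poly_shift k p"
    by (rule poly_eqI) (use that in \<open>auto simp: coeff_monom_mult coeff_poly_shift\<close>)
   thus ?thesis by (metis poly_mult poly_monom mult_1)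
  qed
  have cz: "coeff zr j = hpart U (j + \<nu> + 1) \<zeta> - hpart Tn (j + \<nu> + 1) \<zeta>" for j
   by (simp add: zr_def coeff_poly_shift hpart_def add.assoc)
  have hUT: "hpart U j \<zeta> = hpart Tn j \<zeta>" if "j < 2 * \<nu> + 2" for j
   by (rule hpart_diff_small[OF U(1) Tn(1) UT that])
  have e1: "U (s *\<^sub>R \<zeta>) = Tn (s *\<^sub>R \<zeta>) + s ^ (\<nu> + 1) * poly zr s" for s
  proof -
   have "poly (rpoly U \<zeta> - rpoly Tn \<zeta>) s = s ^ (\<nu> + 1) * poly zr s" unfolding zr_def
    by (rule shift) (use hUT in \<open>auto simp: hpart_def\<close>)
   thus ?thesis by (simp add: poly_rpoly[OF U(1)] poly_rpoly[OF Tn(1)])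
  qed
  have e2: "P 0 (s *\<^sub>R \<zeta>) = s ^ (2 * \<nu> + 2) * poly Ar s" for s
   unfolding Ar_def poly_rpoly[OF P, symmetric]
   by (rule shift) (use hpart_of_small[OF P P0] in \<open>auto simp: hpart_def\<close>)
  have e3: "S (s *\<^sub>R \<zeta>) = s ^ \<nu> * \<delta> + s ^ (\<nu> + 1) * poly Br s" for s
  proof -
   have "poly (rpoly S \<zeta> - monom \<delta> \<nu>) s = s ^ (\<nu> + 1) * poly (poly_shift (\<nu> + 1) (rpoly S \<zeta> - monom \<delta> \<nu>)) s"
   proof (rule shift)
    fix i assume "i < \<nu> + 1"
    thus "coeff (rpoly S \<zeta> - monom \<delta> \<nu>) i = 0"
     using hpart_of_small[OF kS S1, of i \<zeta>] by (cases "i = \<nu>") (auto simp: hpart_def \<delta>_def)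
   qed
   moreover have "poly_shift (\<nu> + 1) (rpoly S \<zeta> - monom \<delta> \<nu>) = Br"
    unfolding Br_def by (rule poly_eqI) (simp add: coeff_poly_shift)
   ultimately show ?thesis by (simp add: poly_rpoly[OF kS] poly_monom algebra_simps)
  qed
  define QU where "QU z = (\<Sum>i\<le>D. B i z * U z ^ i)" for z
  have QUp: "pfun UNIV (g + D * dg N0) QU"
   unfolding QU_def[abs_def]
  proof (intro pfun_sum)
   fix i assume i: "i \<in> {..D}"
   have "pfun UNIV (g + i * dg N0) (\<lambda>x. B i x * U x ^ i)" by (intro pfun_mult pfun_power B U)
   thus "pfun UNIV (g + D * dg N0) (\<lambda>x. B i x * U x ^ i)" using i by (elim pfun_mono) auto
  qed
  have QUs: "small 0 (Suc N0) QU"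
  proof -
   have "small 0 (Suc N0) (\<lambda>z. \<Sum>i\<le>D. B i z * (f z ^ i - U z ^ i))"
    using small_mult[OF p0[OF B] small_power_diff[OF U(2) f0 p0[OF U(1)]]] by (intro small_sum) simp
   from small_diff[OF flat this] show ?thesis by (simp add: QU_def[abs_def] sum_subtractf right_diff_distrib)
  qed
  have D1: "D \<ge> 1"
  proof (rule ccontr)
   assume "\<not> D \<ge> 1"
   hence "D = 0" by simp
   hence "S = (\<lambda>_. 0)" by (simp add: S_def[abs_def])
   thus False using S2 by simp
  qed
  have QUe: "QU (s *\<^sub>R \<zeta>) = (\<Sum>m\<le>D. P m (s *\<^sub>R \<zeta>) * (s ^ (\<nu> + 1) * poly zr s) ^ m)" for s
  proof -
   define w Y where "w = Tn (s *\<^sub>R \<zeta>)" and "Y = s ^ (\<nu> + 1) * poly zr s"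
   have "QU (s *\<^sub>R \<zeta>) = (\<Sum>i\<le>D. B i (s *\<^sub>R \<zeta>) * (Y + w) ^ i)" unfolding QU_def e1 w_def Y_def by (simp add: add.commute)
   also have "\<dots> = (\<Sum>i\<le>D. \<Sum>m\<le>D. real (i choose m) * (B i (s *\<^sub>R \<zeta>) * w ^ (i - m)) * Y ^ m)"
   proof (rule sum.cong[OF refl])
    fix i assume i: "i \<in> {..D}"
    have "(Y + w) ^ i = (\<Sum>m\<le>i. real (i choose m) * Y ^ m * w ^ (i - m))" by (rule binomial_ring)
    also have "\<dots> = (\<Sum>m\<le>D. real (i choose m) * Y ^ m * w ^ (i - m))" using i by (intro sum.mono_neutral_left) auto
    finally show "B i (s *\<^sub>R \<zeta>) * (Y + w) ^ i = (\<Sum>m\<le>D. real (i choose m) * (B i (s *\<^sub>R \<zeta>) * w ^ (i - m)) * Y ^ m)"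
     by (simp add: sum_distrib_left mult_ac)
   qed
   also have "\<dots> = (\<Sum>m\<le>D. P m (s *\<^sub>R \<zeta>) * Y ^ m)" unfolding P_def w_def by (subst sum.swap) (simp add: sum_distrib_right)
   finally show ?thesis unfolding Y_def .
  qed
  define Er where "Er = pCons 0 Ar + ([:\<delta>:] + pCons 0 Br) * zr + pCons 0 (\<Sum>m\<in>{2..D}. Cr m * zr ^ m)"
  have "monom 1 (2 * \<nu> + 1) * Er = rpoly QU \<zeta>"
  proof (rule real_poly_eqI)
   fix s
   have "(\<Sum>m\<le>D. P m (s *\<^sub>R \<zeta>) * (s ^ (\<nu> + 1) * poly zr s) ^ m) = P 0 (s *\<^sub>R \<zeta>) + (P 1 (s *\<^sub>R \<zeta>) * (s ^ (\<nu> + 1) * poly zr s)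
    + (\<Sum>m\<in>{2..D}. P m (s *\<^sub>R \<zeta>) * (s ^ (\<nu> + 1) * poly zr s) ^ m))"
   proof -
    have "{..D} = insert 0 (insert 1 {2..D})" using D1 by auto
    thus ?thesis by simp
   qed
   also have "(\<Sum>m\<in>{2..D}. P m (s *\<^sub>R \<zeta>) * (s ^ (\<nu> + 1) * poly zr s) ^ m) = s ^ (2 * \<nu> + 2) * (\<Sum>m\<in>{2..D}. poly (Cr m) s * poly zr s ^ m)"
    unfolding sum_distrib_left
   proof (rule sum.cong[OF refl])
    fix m assume m: "m \<in> {2..D}"
    have "m * (\<nu> + 1) = (2 * \<nu> + 2) + (m - 2) * (\<nu> + 1)"
    proof -
     have "m = 2 + (m - 2)" using m by (metis atLeastAtMost_iff le_add_diff_inverse)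
     hence "m * (\<nu> + 1) = (2 + (m - 2)) * (\<nu> + 1)" by simp
     thus ?thesis by (simp add: distrib_right)
    qed
    hence "(s ^ (\<nu> + 1)) ^ m = s ^ (2 * \<nu> + 2) * s ^ ((m - 2) * (\<nu> + 1))"
     by (metis power_add power_mult mult.commute)
    thus "P m (s *\<^sub>R \<zeta>) * (s ^ (\<nu> + 1) * poly zr s) ^ m = s ^ (2 * \<nu> + 2) * (poly (Cr m) s * poly zr s ^ m)"
     using m by (simp add: Cr_def poly_monom poly_rpoly[OF P] power_mult_distrib)
   qed
   finally have "(\<Sum>m\<le>D. P m (s *\<^sub>R \<zeta>) * (s ^ (\<nu> + 1) * poly zr s) ^ m) = P 0 (s *\<^sub>R \<zeta>) + (P 1 (s *\<^sub>R \<zeta>) * (s ^ (\<nu> + 1) * poly zr s) + s ^ (2 * \<nu> + 2) * (\<Sum>m\<in>{2..D}. poly (Cr m) s * poly zr s ^ m))" .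
   hence "QU (s *\<^sub>R \<zeta>) = s ^ (2 * \<nu> + 1) * poly Er s"
   proof -
    have sq: "s ^ \<nu> * s ^ \<nu> = s ^ (\<nu> * 2)" by (simp add: power_mult power2_eq_square)
    assume "(\<Sum>m\<le>D. P m (s *\<^sub>R \<zeta>) * (s ^ (\<nu> + 1) * poly zr s) ^ m) = P 0 (s *\<^sub>R \<zeta>) + (P 1 (s *\<^sub>R \<zeta>) * (s ^ (\<nu> + 1) * poly zr s) + s ^ (2 * \<nu> + 2) * (\<Sum>m\<in>{2..D}. poly (Cr m) s * poly zr s ^ m))"
    thus ?thesis unfolding QUe[symmetric] PS e2 e3 by (simp add: Er_def poly_sum algebra_simps power_add mult_2 sq)
   qed
   thus "poly (monom 1 (2 * \<nu> + 1) * Er) s = poly (rpoly QU \<zeta>) s" by (simp add: poly_monom poly_rpoly[OF QUp])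
  qed
  note Eeq = this
  have cE: "coeff Er i = hpart QU (2 * \<nu> + 1 + i) \<zeta>" for i
   unfolding hpart_def Eeq[symmetric] coeff_monom_mult by simp
  define Ec where "Ec = pCons 0 (cpoly Ar) + ([:complex_of_real \<delta>:] + pCons 0 (cpoly Br)) * cpoly zr + pCons 0 (\<Sum>m\<in>{2..D}. cpoly (Cr m) * cpoly zr ^ m)"
  have EcE: "cpoly Er = Ec" by (rule cpoly_eqI) (simp add: Er_def Ec_def poly_sum)
  have "small 0 (Suc n) (poly Ec)" unfolding EcE[symmetric]
  proof (rule poly_small_of_coeffs)
   fix i assume "i < Suc n"
   hence "2 * \<nu> + 1 + i < Suc N0" by (simp add: N0_def)
   from hpart_of_small[OF QUp QUs this] show "coeff (cpoly Er) i = 0" by (simp add: cE)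
  qed
  moreover have "poly Ec = (\<lambda>s. s * poly (cpoly Ar) s + (complex_of_real \<delta> + s * poly (cpoly Br) s) * poly (cpoly zr) s + s * (\<Sum>m\<in>{2..D}. poly (cpoly (Cr m)) s * poly (cpoly zr) s ^ m))"
   by (rule ext) (simp add: Ec_def poly_sum algebra_simps)
  ultimately have E: "small 0 (Suc n) (\<lambda>s. s * poly (cpoly Ar) s + (complex_of_real \<delta> + s * poly (cpoly Br) s) * poly (cpoly zr) s + s * (\<Sum>m\<in>{2..D}. poly (cpoly (Cr m)) s * poly (cpoly zr) s ^ m))"
   by simp
  have "norm (coeff (cpoly zr) n) \<le> (8 * M * (real D + 2)^2 / c) ^ n"
  proof (rule approximate_root_coeff_bound[OF c _ M1 _ _ _ _ E])
   show "c \<le> norm (complex_of_real \<delta>)" using z by (simp add: \<delta>_def)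
   show "norm (poly (cpoly Ar) s) \<le> M" if "norm s \<le> 1" for s
    by (rule pbound[OF that _ z(1), of 0 _ "2 * \<nu> + 2"]) (auto simp: Ar_def coeff_poly_shift hpart_def)
   show "norm (poly (cpoly Br) s) \<le> M" if "norm s \<le> 1" for s
    by (rule pbound[OF that _ z(1), of 1 _ "\<nu> + 1"]) (auto simp: Br_def coeff_poly_shift hpart_def PS[unfolded One_nat_def])
   show "norm (poly (cpoly (Cr m)) s) \<le> M" if "norm s \<le> 1" for s m
   proof (cases "m \<le> D")
    case True
    have eq: "cpoly (Cr m) = monom 1 ((m - 2) * (\<nu> + 1)) * cpoly (rpoly (P m) \<zeta>)"
     by (rule cpoly_eqI) (use True in \<open>simp add: Cr_def poly_monom\<close>)
    have "norm (poly (cpoly (rpoly (P m) \<zeta>)) s) \<le> M"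
     by (rule pbound[OF that _ z(1), of m _ 0]) (use True in \<open>auto simp: hpart_def\<close>)
    moreover have "norm (s ^ ((m - 2) * (\<nu> + 1))) \<le> 1" using that by (simp add: norm_power power_le_one)
    ultimately show ?thesis unfolding eq using mult_mono[of "norm (s ^ ((m - 2) * (\<nu> + 1)))" 1 "norm (poly (cpoly (rpoly (P m) \<zeta>)) s)" M]
     by (simp add: poly_monom norm_mult)
   next
    case False
    thus ?thesis using M1 by (simp add: Cr_def)
   qed
   have "coeff zr 0 = 0" using hUT[of "\<nu> + 1"] by (simp add: cz)
   thus "poly (cpoly zr) 0 = 0" by (simp add: poly_0_coeff_0)
  qed
  also have "\<dots> \<le> R ^ n" unfolding R_def using c M1 by (intro power_mono) auto
  finally have "\<bar>hpart U (n + \<nu> + 1) \<zeta> - hpart Tn (n + \<nu> + 1) \<zeta>\<bar> \<le> R ^ n" by (simp add: cz flip: of_real_diff)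
  hence "\<bar>hpart U (n + \<nu> + 1) \<zeta>\<bar> \<le> R ^ n + MT" using MT(2)[OF z(1), of "n + \<nu> + 1"] by linarith
  moreover have "hpart U (n + \<nu> + 1) \<zeta> = hpart (T (n + \<nu> + 1)) (n + \<nu> + 1) \<zeta>"
  proof (rule hpart_diff_small[OF U(1) T(1)])
   have "small 0 (Suc (n + \<nu> + 1)) (\<lambda>z. f z - U z)" by (rule small_mono[OF U(2)]) (simp add: N0_def)
   from small_diff[OF T(2) this] show "small 0 (Suc (n + \<nu> + 1)) (\<lambda>z. U z - T (n + \<nu> + 1) z)" by simp
  qed simp
  ultimately show ?thesis by simp
 qed
 show ?thesis
 proof (rule that[OF \<eta>(1,2), of \<zeta>0 "1 + MT" R])
  show "norm \<zeta>0 \<le> 1/2" using \<zeta>0 by simp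
  show R1: "R \<ge> 1" by (simp add: R_def)
  show "1 + MT \<ge> 0" using MT by simp
  fix \<zeta> l assume near: "norm (\<zeta> - \<zeta>0) < \<eta>"
  have z1: "norm \<zeta> \<le> 1" using near \<zeta>0 \<eta>(2) norm_triangle_ineq[of "\<zeta> - \<zeta>0" \<zeta>0] by simp
  have Rl: "R ^ l \<ge> 1" using R1 by simp
  show "\<bar>hpart (T l) l \<zeta>\<bar> \<le> (1 + MT) * R ^ l"
  proof (cases "l \<ge> \<nu> + 1")
   case True
   define n where "n = l - (\<nu> + 1)"
   have l: "l = n + \<nu> + 1" using True by (simp add: n_def)
   have "\<bar>hpart (T l) l \<zeta>\<bar> \<le> R ^ n + MT" unfolding l by (rule main[OF z1 \<eta>(3)[OF near]])
   also have "R ^ n \<le> R ^ l" using R1 by (intro power_increasing) (auto simp: l)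
   also have "MT \<le> MT * R ^ l" using MT Rl by (simp add: mult_le_cancel_left1)
   finally show ?thesis by (simp add: algebra_simps)
  next
   case False
   have "hpart (T l) l \<zeta> = hpart Tn l \<zeta>"
   proof (rule hpart_diff_small[OF T(1) Tn(1)])
    have "small 0 (Suc l) (\<lambda>z. f z - Tn z)" by (rule small_mono[OF Tn(2)]) (use False in simp)
    from small_diff[OF this T(2)] show "small 0 (Suc l) (\<lambda>z. T l z - Tn z)" by simp
   qed simp
   hence "\<bar>hpart (T l) l \<zeta>\<bar> \<le> (1 + MT) * 1" using MT(2)[OF z1, of l] by simp
   also have "\<dots> \<le> (1 + MT) * R ^ l" using MT Rl by (intro mult_left_mono) auto
   finally show ?thesis .
  qed
 qed
qed

lemma isCont_of_small:
 assumes "isCont T a" "small a 1 (\<lambda>x. f x - T x)" shows "isCont f a"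
proof -
 obtain C \<delta> where 1: "C \<ge> 0" "\<delta> > 0" "\<And>x. norm (x - a) < \<delta> \<Longrightarrow> norm (f x - T x) \<le> C * norm (x - a) ^ 1"
  by (rule smallE[OF assms(2)]) blast
 have fa: "f a = T a" using 1(3)[of a] 1(2) by simp
 have "((\<lambda>x. f x - T x) \<longlongrightarrow> 0) (at a)"
 proof (rule Lim_null_comparison)
  show "\<forall>\<^sub>F x in at a. norm (f x - T x) \<le> C * norm (x - a)"
   unfolding eventually_at using 1 by (intro exI[of _ \<delta>]) (auto simp: dist_norm)
  have "((\<lambda>x. C * norm (x - a)) \<longlongrightarrow> C * norm (a - a)) (at a)" by (intro tendsto_intros)
  thus "((\<lambda>x. C * norm (x - a)) \<longlongrightarrow> 0) (at a)" by simp
 qed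
 from tendsto_add[OF this assms(1)[unfolded isCont_def]] show ?thesis by (simp add: isCont_def fa)
qed

text \<open>The bounds on the homogeneous Taylor parts are carried from a ball of directions to the
  unit ball, and from real to complex parameters, by the segment inequality, each time with a larger
  geometric ratio; homogeneity then makes the series converge near 0. By quasi-analyticity its sum
  agrees with \<open>f\<close> on those lines through 0 on which the relation is not trivial, and
  elsewhere by density and continuity.\<close>

lemma analytic_extension:
 fixes f :: "real^'n \<Rightarrow> real" and b :: "nat \<Rightarrow> real^'n \<Rightarrow> real"
 assumes r: "r > 0"
  and tay: "\<And>a N. norm a < r \<Longrightarrow> \<exists>k T. pfun UNIV k T \<and> small a N (\<lambda>x. f x - T x)"
  and b: "\<And>i. pfun UNIV g (b i)" and nz: "\<exists>i\<le>D. \<exists>x. b i x \<noteq> 0"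
  and rel: "\<And>z. norm z < r \<Longrightarrow> (\<Sum>i\<le>D. b i z * f z ^ i) = 0"
 obtains \<rho> where "\<rho> > 0" "\<And>a v. norm a \<le> \<rho> \<Longrightarrow> norm v \<le> \<rho> \<Longrightarrow>
   \<exists>W. W holomorphic_on ball 0 2 \<and> (\<forall>s::real. \<bar>s\<bar> \<le> 1 \<longrightarrow> W (complex_of_real s) = complex_of_real (f (a + s *\<^sub>R v)))"
proof -
 have flat: "small 0 N (\<lambda>z. \<Sum>i\<le>D. b i z * f z ^ i)" for N
  by (rule small_cong[OF small_zero r]) (use rel in auto)
 from flat_relation_with_nonflat_derivative[of g b D f, OF b nz flat]
 obtain D' B where B: "\<And>i. pfun UNIV g (B i)" "\<And>N. small 0 N (\<lambda>z. \<Sum>i\<le>D'. B i z * f z ^ i)"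
  "\<exists>N. \<not> small 0 N (\<lambda>z. \<Sum>i\<le>D'. real i * B i z * f z ^ (i - 1))" by blast
 have "\<forall>N. \<exists>kT. pfun UNIV (fst kT) (snd kT) \<and> small 0 (Suc N) (\<lambda>x. f x - snd kT x)"
  using tay[of 0] r by (auto simp: split_paired_Ex)
 from choice[OF this] obtain kT where kT: "\<forall>N. pfun UNIV (fst (kT N)) (snd (kT N)) \<and> small 0 (Suc N) (\<lambda>x. f x - snd (kT N) x)" ..
 define dg where "dg N = fst (kT N)" for N
 define T where "T N = snd (kT N)" for N
 have T: "\<And>N. pfun UNIV (dg N) (T N)" "\<And>N. small 0 (Suc N) (\<lambda>z. f z - T N z)"
  using kT by (auto simp: dg_def T_def)
 obtain \<zeta>0 \<eta> M R where *: "\<eta> > 0" "\<eta> \<le> 1/2" "norm \<zeta>0 \<le> 1/2" "M \<ge> 0" "R \<ge> 1"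
  "\<And>\<zeta> l. norm (\<zeta> - \<zeta>0) < \<eta> \<Longrightarrow> \<bar>hpart (T l) l \<zeta>\<bar> \<le> M * R ^ l"
  by (rule taylor_parts_bounded_on_ball[where B = B and f = f and T = T and D = D', OF B T]) blast
 define F where "F l = hpart (T l) l" for l
 have F: "pfun UNIV l (F l)" for l unfolding F_def by (rule hpart_pfun[OF T(1)])
 have Fsc: "F l (s *\<^sub>R y) = s ^ l * F l y" for l s y unfolding F_def by (rule hpart_scale[OF T(1)])
 \<comment> \<open>In degree \<open>l\<close> the constant of the segment inequality is itself
   geometric in \<open>l\<close>.\<close>
 have expl: "exp (14 * real l + 2) = exp 2 * exp 14 ^ l" for l
  by (simp add: exp_add exp_of_nat2_mult)
 define M2 where "M2 = M * exp 2"
 define R2 where "R2 = R * exp 14 * (4 / \<eta>)"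
 have M2: "M2 \<ge> 0" using * by (simp add: M2_def)
 have R2: "R2 \<ge> 1"
 proof -
  have "1 * 1 * 1 \<le> R * exp 14 * (4 / \<eta>)" using * by (intro mult_mono) auto
  thus ?thesis by (simp add: R2_def)
 qed
 \<comment> \<open>On the line from \<open>\<zeta>0\<close> towards \<open>a\<close> the parameters
   in \<open>{1/2..1}\<close> lie in the good ball, and the parameter \<open>1 / \<tau>\<close> is
   the point \<open>a\<close>.\<close>
 have F1: "\<bar>F l a\<bar> \<le> M2 * R2 ^ l" if a: "norm a \<le> 1" for a l
 proof -
  define \<tau> where "\<tau> = \<eta> / 4"
  have \<tau>: "\<tau> > 0" "\<tau> \<le> 1" using * by (auto simp: \<tau>_def)
  obtain Q :: "real poly" where Q: "degree Q \<le> l" "\<And>s. poly Q s = F l (\<zeta>0 + s *\<^sub>R (\<tau> *\<^sub>R (a - \<zeta>0)))"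
   by (rule pfun_line[OF F]) blast
  have "norm (poly (cpoly Q) (complex_of_real (1 / \<tau>))) \<le> M * R ^ l * exp (14 * real l + 2) * max 1 (norm (complex_of_real (1 / \<tau>))) ^ l"
  proof (rule poly_bound_from_segment)
   show "degree (cpoly Q) \<le> l" using Q by simp
   show "0 \<le> M * R ^ l" using * by simp
   fix t :: real assume t: "t \<in> {1/2..1}"
   have "norm (a - \<zeta>0) \<le> 2" using a *(3) norm_triangle_ineq4[of a \<zeta>0] by simp
   hence "t * (\<tau> * norm (a - \<zeta>0)) \<le> 1 * (\<tau> * 2)" using t \<tau> by (intro mult_mono) auto
   moreover have "norm (t *\<^sub>R (\<tau> *\<^sub>R (a - \<zeta>0))) = t * (\<tau> * norm (a - \<zeta>0))"
   proof -
    have "\<bar>t\<bar> = t" "\<bar>\<tau>\<bar> = \<tau>" using t \<tau>(1) by auto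
    thus ?thesis by (simp only: norm_scaleR)
   qed
   ultimately have "norm (t *\<^sub>R (\<tau> *\<^sub>R (a - \<zeta>0))) \<le> 1 * (\<tau> * 2)" by (simp only:)
   also have "\<dots> < \<eta>" using * by (simp add: \<tau>_def)
   finally have "\<bar>poly Q t\<bar> \<le> M * R ^ l" unfolding Q(2) F_def by (intro *(6)) simp
   thus "norm (poly (cpoly Q) (complex_of_real t)) \<le> M * R ^ l" by simp
  qed
  also have "max 1 (norm (complex_of_real (1 / \<tau>))) = 4 / \<eta>"
   unfolding norm_of_real using * by (simp add: \<tau>_def max_def)
  also have "poly (cpoly Q) (complex_of_real (1 / \<tau>)) = complex_of_real (F l a)"
   unfolding poly_cpoly Q(2) using \<tau> by simp
  finally show ?thesis unfolding expl norm_of_real by (simp only: M2_def R2_def power_mult_distrib mult_ac)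
 qed
 define L where "L l a v = (SOME Q. degree Q \<le> l \<and> (\<forall>s. poly Q s = F l (a + s *\<^sub>R v)))" for l a v
 have L: "degree (L l a v) \<le> l" "poly (L l a v) s = F l (a + s *\<^sub>R v)" for l a v s
 proof -
  obtain Q where "degree Q \<le> l" "\<And>s. poly Q s = F l (a + s *\<^sub>R v)" by (rule pfun_line[OF F]) blast
  hence "\<exists>Q. degree Q \<le> l \<and> (\<forall>s. poly Q s = F l (a + s *\<^sub>R v))" by blast
  from someI_ex[OF this] show "degree (L l a v) \<le> l" "poly (L l a v) s = F l (a + s *\<^sub>R v)"
   unfolding L_def by blast+
 qed
 define M3 where "M3 = M2 * exp 2"
 define R3 where "R3 = R2 * exp 14 * 2"
 have M3: "M3 \<ge> 0" using M2 by (simp add: M3_def)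
 have R3: "R3 \<ge> 1"
 proof -
  have "1 * 1 * 1 \<le> R2 * exp 14 * (2::real)" using R2 by (intro mult_mono) auto
  thus ?thesis by (simp add: R3_def)
 qed
 have L1: "norm (poly (cpoly (L l a v)) s) \<le> M3 * R3 ^ l" if av: "norm a \<le> 1/2" "norm v \<le> 1/2" and s: "norm s \<le> 2" for l a v s
 proof -
  have "norm (poly (cpoly (L l a v)) s) \<le> M2 * R2 ^ l * exp (14 * real l + 2) * max 1 (norm s) ^ l"
  proof (rule poly_bound_from_segment)
   show "degree (cpoly (L l a v)) \<le> l" using L by simp
   show "0 \<le> M2 * R2 ^ l" using M2 R2 by simp
   fix t :: real assume t: "t \<in> {1/2..1}"
   have "t * norm v \<le> 1 * (1/2)" using t av by (intro mult_mono) auto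
   hence "norm (t *\<^sub>R v) \<le> 1/2" using t by simp
   hence "norm (a + t *\<^sub>R v) \<le> 1" using av norm_triangle_ineq[of a "t *\<^sub>R v"] by simp
   from F1[OF this] show "norm (poly (cpoly (L l a v)) (complex_of_real t)) \<le> M2 * R2 ^ l" by (simp add: L)
  qed
  also have "\<dots> \<le> M2 * R2 ^ l * exp (14 * real l + 2) * 2 ^ l" using s M2 R2
   by (intro mult_left_mono power_mono) auto
  also have "\<dots> = M3 * R3 ^ l" unfolding expl by (simp only: M3_def R3_def power_mult_distrib mult_ac)
  finally show ?thesis .
 qed
 \<comment> \<open>Shrinking the arguments by \<open>\<theta>\<close> turns the ratio
   \<open>R3\<close> into 1/2.\<close>
 define \<theta> where "\<theta> = 1 / (2 * R3)"
 have \<theta>: "\<theta> > 0" using R3 by (simp add: \<theta>_def)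
 have L2: "norm (poly (cpoly (L l a v)) s) \<le> M3 * (1/2) ^ l" if av: "norm a \<le> \<theta> / 2" "norm v \<le> \<theta> / 2" and s: "norm s \<le> 2" for l a v s
 proof -
  have "L l a v = smult (\<theta> ^ l) (L l ((1/\<theta>) *\<^sub>R a) ((1/\<theta>) *\<^sub>R v))"
  proof (rule real_poly_eqI)
   fix s
   have "a + s *\<^sub>R v = \<theta> *\<^sub>R ((1/\<theta>) *\<^sub>R a + s *\<^sub>R ((1/\<theta>) *\<^sub>R v))" using \<theta> by (simp add: scaleR_add_right)
   thus "poly (L l a v) s = poly (smult (\<theta> ^ l) (L l ((1/\<theta>) *\<^sub>R a) ((1/\<theta>) *\<^sub>R v))) s"
    using Fsc[of l \<theta>] by (simp add: L)
  qed
  hence "cpoly (L l a v) = smult (complex_of_real (\<theta> ^ l)) (cpoly (L l ((1/\<theta>) *\<^sub>R a) ((1/\<theta>) *\<^sub>R v)))"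
   by (intro cpoly_eqI) simp
  hence "norm (poly (cpoly (L l a v)) s) = \<theta> ^ l * norm (poly (cpoly (L l ((1/\<theta>) *\<^sub>R a) ((1/\<theta>) *\<^sub>R v))) s)"
   using \<theta> by (simp add: norm_mult norm_power)
  also have "\<dots> \<le> \<theta> ^ l * (M3 * R3 ^ l)" using \<theta> av s by (intro mult_left_mono L1) (auto simp: field_simps)
  also have "\<dots> = M3 * (\<theta> * R3) ^ l" by (simp add: power_mult_distrib)
  also have "\<theta> * R3 = 1/2" using R3 by (simp add: \<theta>_def)
  finally show ?thesis .
 qed
 have geo: "summable (\<lambda>l. M3 * (1/2::real) ^ l)" by (intro summable_mult summable_geometric) simp
 define W where "W a v s = (\<Sum>l. poly (cpoly (L l a v)) s)" for a v s
 have Wh: "W a v holomorphic_on ball 0 2" if av: "norm a \<le> \<theta> / 2" "norm v \<le> \<theta> / 2" for a v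
 proof -
  have u: "uniform_limit (ball 0 2) (\<lambda>n s. \<Sum>l<n. poly (cpoly (L l a v)) s) (W a v) sequentially"
   unfolding W_def by (rule Weierstrass_m_test[OF _ geo]) (intro L2 av, auto)
  show ?thesis
  proof (rule holomorphic_uniform_sequence[where f = "\<lambda>n s. \<Sum>l<n. poly (cpoly (L l a v)) s"])
   fix x :: complex assume "x \<in> ball 0 2"
   then obtain d where "d > 0" "cball x d \<subseteq> ball 0 2" using open_contains_cball open_ball by blast
   thus "\<exists>d>0. cball x d \<subseteq> ball 0 2 \<and> uniform_limit (cball x d) (\<lambda>n s. \<Sum>l<n. poly (cpoly (L l a v)) s) (W a v) sequentially"
    using uniform_limit_on_subset[OF u] by blast
  qed (auto intro!: holomorphic_intros)
 qed
 define FF where "FF y = (\<Sum>l. F l y)" for y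
 have Fb: "\<bar>F l (a + s *\<^sub>R v)\<bar> \<le> M3 * (1/2) ^ l" if "norm a \<le> \<theta> / 2" "norm v \<le> \<theta> / 2" "\<bar>s\<bar> \<le> 2" for l a v s
  using L2[OF that(1,2), of "complex_of_real s" l] that(3) by (simp add: L)
 have WFF: "W a v (complex_of_real s) = complex_of_real (FF (a + s *\<^sub>R v))"
  if av: "norm a \<le> \<theta> / 2" "norm v \<le> \<theta> / 2" "\<bar>s\<bar> \<le> 2" for a v s
 proof -
  have "summable (\<lambda>l. F l (a + s *\<^sub>R v))"
   by (rule summable_comparison_test[OF _ geo]) (use Fb[OF av] in auto)
  from suminf_of_real[OF this, where 'a = complex] show ?thesis unfolding W_def FF_def by (simp add: L)
 qed
 define \<rho>1 where "\<rho>1 = min (\<theta> / 2) (r / 2)"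
 have \<rho>1: "\<rho>1 > 0" "\<rho>1 \<le> \<theta> / 2" "\<rho>1 \<le> r / 2" using \<theta> r by (auto simp: \<rho>1_def)
 have gen: "f y = FF y" if y: "norm y \<le> \<rho>1" "\<exists>i\<le>D. b i y \<noteq> 0" for y
 proof -
  have y2: "norm y \<le> \<theta> / 2" using y \<rho>1 by linarith
  have t2: "norm (0::real^'n) \<le> \<theta> / 2" using \<theta> by simp
  have in_r: "norm (s *\<^sub>R y) < r" if "\<bar>s\<bar> < 3/2" for s
  proof -
   have "\<bar>s\<bar> * norm y \<le> 3/2 * (r / 2)" using that y \<rho>1 by (intro mult_mono) auto
   also have "\<dots> < r" using r by simp
   finally show ?thesis by simp
  qed
  have "complex_of_real (f (1 *\<^sub>R y)) = W 0 y (complex_of_real 1)"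
  proof (rule algebraic_quasi_analytic[where \<phi> = "\<lambda>s. f (s *\<^sub>R y)" and \<beta> = "\<lambda>i. rpoly (b i) y" and D = D])
   show "W 0 y holomorphic_on ball 0 2" by (rule Wh[OF t2 y2])
   obtain i where i: "i \<le> D" "b i y \<noteq> 0" using y by blast
   hence "poly (rpoly (b i) y) 1 \<noteq> 0" by (simp add: poly_rpoly[OF b])
   thus "\<exists>i\<le>D. rpoly (b i) y \<noteq> 0" using i by (intro exI[of _ i]) auto
   show "(\<Sum>i\<le>D. poly (rpoly (b i) y) s * f (s *\<^sub>R y) ^ i) = 0" if "\<bar>s\<bar> < 3/2" for s
    using rel[OF in_r[OF that]] by (simp add: poly_rpoly[OF b])
   show "\<exists>T::real poly. small s0 N (\<lambda>s. f (s *\<^sub>R y) - poly T s)" if "\<bar>s0\<bar> < 3/2" for s0 N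
   proof -
    from tay[OF in_r[OF that], of N] obtain k T0 where T0: "pfun UNIV k T0" "small (s0 *\<^sub>R y) N (\<lambda>x. f x - T0 x)" by blast
    have "small s0 N (\<lambda>s. f (0 + s *\<^sub>R y) - T0 (0 + s *\<^sub>R y))" by (rule small_line) (use T0 in simp)
    thus ?thesis by (intro exI[of _ "rpoly T0 y"]) (simp add: poly_rpoly[OF T0(1)])
   qed
   \<comment> \<open>Three comparisons: \<open>f\<close> with its Taylor polynomial, that polynomial
     with the partial sum, and the partial sum with the series.\<close>
   show "small 0 N (\<lambda>s. complex_of_real (f (s *\<^sub>R y)) - W 0 y (complex_of_real s))" for N
   proof -
    have 1: "small 0 N (\<lambda>s. f (s *\<^sub>R y) - T N (s *\<^sub>R y))"
    proof -
     have "small 0 N (\<lambda>s. f (0 + s *\<^sub>R y) - T N (0 + s *\<^sub>R y))"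
      by (rule small_line) (use small_mono[OF T(2)[of N], of N] in simp)
     thus ?thesis by simp
    qed
    have 2: "small 0 N (\<lambda>s. T N (s *\<^sub>R y) - (\<Sum>l<N. F l (s *\<^sub>R y)))"
    proof -
     have "small 0 N (poly (rpoly (T N) y - (\<Sum>l<N. monom (F l y) l)))"
     proof (rule poly_small_of_coeffs)
      fix i assume i: "i < N"
      have "hpart (T N) i y = hpart (T i) i y"
      proof (rule hpart_diff_small[OF T(1) T(1)])
       have "small 0 (Suc i) (\<lambda>z. f z - T N z)" by (rule small_mono[OF T(2)]) (use i in simp)
       from small_diff[OF T(2)[of i] this] show "small 0 (Suc i) (\<lambda>z. T N z - T i z)" by simp
      qed simp
      thus "coeff (rpoly (T N) y - (\<Sum>l<N. monom (F l y) l)) i = 0"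
       using i by (simp add: coeff_sum F_def hpart_def)
     qed
     moreover have "poly (rpoly (T N) y - (\<Sum>l<N. monom (F l y) l)) = (\<lambda>s. T N (s *\<^sub>R y) - (\<Sum>l<N. F l (s *\<^sub>R y)))"
      by (auto simp: poly_rpoly[OF T(1)] poly_sum poly_monom Fsc mult.commute)
     ultimately show ?thesis by simp
    qed
    have 3: "small 0 N (\<lambda>s. FF (s *\<^sub>R y) - (\<Sum>l<N. F l (s *\<^sub>R y)))"
     unfolding small_def
    proof (rule exI[of _ "\<Sum>l. M3 * (1/2) ^ (l + N)"], rule exI[of _ 1], intro conjI allI impI)
     fix s :: real assume "norm (s - 0) < 1"
     hence s: "\<bar>s\<bar> \<le> 1" by simp
     have Fy: "\<bar>F l y\<bar> \<le> M3 * (1/2) ^ l" for l using Fb[OF t2 y2, of 1 l] by simp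
     have sm: "summable (\<lambda>l. F l (s *\<^sub>R y))"
      by (rule summable_comparison_test[OF _ geo]) (use Fb[OF t2 y2, of s] s in auto)
     have gN: "summable (\<lambda>l. M3 * (1/2::real) ^ (l + N))" using geo by (rule summable_ignore_initial_segment)
     have "FF (s *\<^sub>R y) - (\<Sum>l<N. F l (s *\<^sub>R y)) = (\<Sum>l. F (l + N) (s *\<^sub>R y))"
      unfolding FF_def using suminf_split_initial_segment[OF sm, of N] by simp
     also have "norm \<dots> \<le> (\<Sum>l. M3 * (1/2) ^ (l + N) * \<bar>s\<bar> ^ N)"
     proof (rule norm_suminf_le)
      fix l
      have "\<bar>F (l + N) (s *\<^sub>R y)\<bar> = \<bar>s\<bar> ^ (l + N) * \<bar>F (l + N) y\<bar>" by (simp add: Fsc abs_mult power_abs)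
      also have "\<dots> \<le> \<bar>s\<bar> ^ N * (M3 * (1/2) ^ (l + N))"
       using s by (intro mult_mono Fy power_decreasing) auto
      finally show "norm (F (l + N) (s *\<^sub>R y)) \<le> M3 * (1/2) ^ (l + N) * \<bar>s\<bar> ^ N" by (simp add: mult.commute)
     qed (rule summable_mult2[OF gN])
     also have "\<dots> = (\<Sum>l. M3 * (1/2) ^ (l + N)) * \<bar>s\<bar> ^ N" by (rule suminf_mult2[OF gN, symmetric])
     finally show "norm (FF (s *\<^sub>R y) - (\<Sum>l<N. F l (s *\<^sub>R y))) \<le> (\<Sum>l. M3 * (1/2) ^ (l + N)) * norm (s - 0) ^ N" by simp
    qed simp
    have "small 0 N (\<lambda>s. f (s *\<^sub>R y) - FF (s *\<^sub>R y))"
     using small_add[OF small_add[OF 1 2] small_minus[OF 3]] by simp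
    from small_of_real[OF this] show ?thesis
     by (rule small_cong[where \<delta> = 1]) (use WFF[OF t2 y2] in auto)
   qed
  qed auto
  also have "\<dots> = complex_of_real (FF y)" using WFF[OF t2 y2, of 1] by simp
  finally show ?thesis by simp
 qed
 have all: "f y = FF y" if y: "norm y < \<rho>1" for y
 proof -
  obtain i x0 where i: "i \<le> D" "b i x0 \<noteq> 0" using nz by blast
  have "\<exists>z. dist z y < 1 / (real n + 1) \<and> b i z \<noteq> 0" for n
   using pfun_nonzero_near[OF b i(2), of "1 / (real n + 1)" y] by (metis add_nonneg_pos divide_pos_pos of_nat_0_le_iff zero_less_one)
  then obtain u where u: "\<And>n. dist (u n) y < 1 / (real n + 1)" "\<And>n. b i (u n) \<noteq> 0" by metis
  have uy: "u \<longlonglongrightarrow> y"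
  proof (rule metric_tendsto_imp_tendsto[of "\<lambda>n. 1 / (real n + 1)" 0])
   show "(\<lambda>n. 1 / (real n + 1)) \<longlonglongrightarrow> 0" by real_asymp
  qed (use u(1) in \<open>auto intro!: always_eventually less_imp_le\<close>)
  have contf: "isCont f y"
  proof -
   have "norm y < r" using y \<rho>1 r by linarith
   from tay[OF this, of 1] obtain k T0 where T0: "pfun UNIV k T0" "small y 1 (\<lambda>x. f x - T0 x)" by blast
   show ?thesis using pfun_continuous[OF T0(1), of UNIV]
    by (intro isCont_of_small[OF _ T0(2)]) (simp add: continuous_on_eq_continuous_at)
  qed
  have ul: "uniform_limit (ball 0 \<rho>1) (\<lambda>n x. \<Sum>i<n. F i x) FF sequentially"
   unfolding FF_def[abs_def]
  proof (rule Weierstrass_m_test[OF _ geo])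
   show "norm (F n x) \<le> M3 * (1/2) ^ n" if "x \<in> ball 0 \<rho>1" for n x
    using Fb[of x 0 0 n] that \<rho>1 \<theta> by simp
  qed
  have "continuous_on (ball 0 \<rho>1) FF"
   by (rule uniform_limit_theorem[OF _ ul])
    (auto intro!: always_eventually continuous_intros pfun_continuous[OF F])
  hence contFF: "isCont FF y" using y continuous_on_eq_continuous_at[of "ball 0 \<rho>1" FF] by simp
  have "(\<lambda>n. f (u n) - FF (u n)) \<longlonglongrightarrow> f y - FF y"
   by (intro tendsto_diff isCont_tendsto_compose[OF contf uy] isCont_tendsto_compose[OF contFF uy])
  moreover have "\<forall>\<^sub>F n in sequentially. f (u n) - FF (u n) = 0"
  proof -
   have "\<forall>\<^sub>F n in sequentially. norm (u n) < \<rho>1" using order_tendstoD(2)[OF tendsto_norm[OF uy] y] .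
   thus ?thesis
   proof eventually_elim
    case (elim n)
    thus ?case using gen[of "u n"] u(2)[of n] i(1) by auto
   qed
  qed
  hence "(\<lambda>n. f (u n) - FF (u n)) \<longlonglongrightarrow> 0" by (rule tendsto_eventually)
  ultimately have "f y - FF y = 0" by (rule LIMSEQ_unique)
  thus ?thesis by simp
 qed
 show ?thesis
 proof (rule that[of "\<rho>1 / 3"])
  show "\<rho>1 / 3 > 0" using \<rho>1 by simp
  fix a v :: "real^'n" assume av: "norm a \<le> \<rho>1 / 3" "norm v \<le> \<rho>1 / 3"
  have av': "norm a \<le> \<theta> / 2" "norm v \<le> \<theta> / 2" using av \<rho>1 by linarith+
  show "\<exists>W. W holomorphic_on ball 0 2 \<and> (\<forall>s::real. \<bar>s\<bar> \<le> 1 \<longrightarrow> W (complex_of_real s) = complex_of_real (f (a + s *\<^sub>R v)))"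
  proof (intro exI conjI allI impI)
   show "W a v holomorphic_on ball 0 2" by (rule Wh[OF av'])
   fix s :: real assume s: "\<bar>s\<bar> \<le> 1"
   have "\<bar>s\<bar> * norm v \<le> 1 * (\<rho>1 / 3)" using s av by (intro mult_mono) auto
   hence "norm (a + s *\<^sub>R v) < \<rho>1" using norm_triangle_ineq[of a "s *\<^sub>R v"] av \<rho>1 by simp
   thus "W a v (complex_of_real s) = complex_of_real (f (a + s *\<^sub>R v))"
    using all WFF[OF av', of s] s by simp
  qed
 qed
qed

section \<open>Graph charts\<close>

text \<open>Taylor expansions of every order at one point, without reference to derivatives nearby.
  In this form smoothness passes to inverse maps by calculation with polynomials.\<close>

definition peano :: "(real^'n \<Rightarrow> real) \<Rightarrow> real^'n \<Rightarrow> bool" where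
 "peano f a \<longleftrightarrow> (\<forall>N. \<exists>k T. pfun UNIV k T \<and> small a N (\<lambda>x. f x - T x))"

lemma peano_pfun: "pfun UNIV k f \<Longrightarrow> peano f a"
 unfolding peano_def by (intro allI exI[of _ k] exI[of _ f]) simp

lemma peano_add: assumes "peano f a" "peano g a" shows "peano (\<lambda>x. f x + g x) a"
 unfolding peano_def
proof
 fix N
 obtain k T l S where "pfun UNIV k T" "small a N (\<lambda>x. f x - T x)" "pfun UNIV l S" "small a N (\<lambda>x. g x - S x)"
  using assms unfolding peano_def by metis
 moreover from small_add[OF this(2,4)] have "small a N (\<lambda>x. (f x + g x) - (T x + S x))" by (simp add: algebra_simps)
 moreover have "pfun UNIV (max k l) (\<lambda>x. T x + S x)"
  by (intro pfun_add pfun_mono[OF calculation(1)] pfun_mono[OF calculation(3)]) auto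
 ultimately show "\<exists>k T. pfun UNIV k T \<and> small a N (\<lambda>x. f x + g x - T x)" by blast
qed

lemma small_cmult: "small a N f \<Longrightarrow> small a N (\<lambda>x. c * f x :: real)"
 using small_mult[of a 0 "\<lambda>_. c" N f] by simp

lemma peano_cmult: assumes "peano f a" shows "peano (\<lambda>x. c * f x) a"
 unfolding peano_def
proof
 fix N
 obtain k T where "pfun UNIV k T" "small a N (\<lambda>x. f x - T x)" using assms unfolding peano_def by metis
 moreover from small_cmult[OF this(2), of c] have "small a N (\<lambda>x. c * f x - c * T x)" by (simp add: right_diff_distrib)
 ultimately show "\<exists>k T. pfun UNIV k T \<and> small a N (\<lambda>x. c * f x - T x)" using pfun_cmult by blast
qed

lemma peano_sum: "(\<And>i. i \<in> A \<Longrightarrow> peano (f i) a) \<Longrightarrow> peano (\<lambda>x. \<Sum>i\<in>A. f i x) a"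
proof (induction A rule: infinite_finite_induct)
 case (insert i A)
 thus ?case using peano_add[of "f i" a "\<lambda>x. \<Sum>i\<in>A. f i x"] by simp
qed (auto intro: peano_pfun[of 0])

lemma linear_component:
 fixes K :: "real^'n::finite \<Rightarrow> real^'m::finite"
 assumes "linear K" shows "K y $ i = (\<Sum>j\<in>UNIV. (K (axis j 1) $ i) * y $ j)"
proof -
 have "K y = K (\<Sum>j\<in>UNIV. y $ j *\<^sub>R axis j 1)" by (simp add: basis_expansion[of y, unfolded scalar_mult_eq_scaleR])
 also have "\<dots> = (\<Sum>j\<in>UNIV. y $ j *\<^sub>R K (axis j 1))" by (simp add: linear_sum[OF assms] linear_scale[OF assms])
 finally show ?thesis by (simp add: mult.commute)
qed

lemma C_inf_on_differentiable:
 assumes "C_inf_on U f" "x \<in> U"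
 shows "(f has_derivative frechet_derivative f (at x)) (at x)"
proof -
 have "smooth_dirs [0] U f" "open U" using assms by (auto simp: C_inf_on_def)
 hence "f differentiable_on U" by simp
 thus ?thesis using assms \<open>open U\<close> by (simp add: differentiable_on_eq_differentiable_at frechet_derivative_works)
qed

lemma C_inf_on_derivative: "C_inf_on U f \<Longrightarrow> C_inf_on U (\<lambda>x. frechet_derivative f (at x) v)"
 unfolding C_inf_on_def by (metis smooth_dirs.simps(2))

lemma C_inf_on_continuous: "C_inf_on U f \<Longrightarrow> continuous_on U f"
 unfolding C_inf_on_def by (metis smooth_dirs.simps(1))

text \<open>Induction on the order, for all smooth \<open>f\<close> at once: expansions of the
  partial derivatives are integrated along rays from \<open>a\<close>. The polynomials approximating
  the partial derivatives need not be the gradient of one polynomial, which radial integration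
  tolerates.\<close>

lemma C_inf_on_peano:
 fixes f :: "real^'n::finite \<Rightarrow> real^'m::finite"
 assumes "C_inf_on U f" "a \<in> U" shows "peano (\<lambda>x. f x $ i) a"
proof -
 have "\<exists>k T. pfun UNIV k T \<and> small a N (\<lambda>x. f x $ i - T x)" for N
  using assms(1)
 proof (induction N arbitrary: f)
  case 0
  have "isCont (\<lambda>x. f x $ i) a"
   using C_inf_on_continuous[OF 0] assms(2) 0 unfolding C_inf_on_def
   by (intro continuous_intros) (simp add: continuous_on_eq_continuous_at)
  hence "small a 0 (\<lambda>x. f x $ i - 0)" using small_0_continuous by simp
  thus ?case using pfun_const by blast
 next
  case (Suc N)
  define fj where "fj j x = frechet_derivative f (at x) (axis j 1)" for j x
  have "\<forall>j. \<exists>kT. pfun UNIV (fst kT) (snd kT) \<and> small a N (\<lambda>x. fj j x $ i - snd kT x)"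
   using Suc.IH[OF C_inf_on_derivative[OF Suc.prems]] unfolding fj_def by (auto simp: split_paired_Ex)
  from choice[OF this] obtain kT where kT: "\<forall>j. pfun UNIV (fst (kT j)) (snd (kT j)) \<and> small a N (\<lambda>x. fj j x $ i - snd (kT j) x)" ..
  define k where "k = (\<Sum>j\<in>UNIV. fst (kT j))"
  define T where "T j = snd (kT j)" for j
  have T: "pfun UNIV k (T j)" "small a N (\<lambda>x. fj j x $ i - T j x)" for j
  proof -
   have "fst (kT j) \<le> k" unfolding k_def by (rule member_le_sum) auto
   thus "pfun UNIV k (T j)" using kT unfolding T_def by (blast intro: pfun_mono)
   show "small a N (\<lambda>x. fj j x $ i - T j x)" using kT by (simp add: T_def)
  qed
  define S where "S j s = T j (a + s)" for j s
  have vshift: "pfun UNIV 1 (\<lambda>x. (c + x) $ l)" for l and c :: "real^'n"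
   unfolding vector_add_component by (intro pfun_add pfun_const pfun_var) simp
  have S: "pfun UNIV k (S j)" for j
   using pfun_comp[OF T(1), of UNIV 1 "\<lambda>s. a + s" j] vshift unfolding S_def[abs_def] by simp
  \<comment> \<open>The integral over \<open>t\<close> in \<open>{0..1}\<close> of the sum of
    \<open>s $ j * S j (t *\<^sub>R s)\<close>; a part of degree \<open>l\<close> contributes the
    factor \<open>1 / (l + 1)\<close>.\<close>
  define H where "H s = (\<Sum>j\<in>UNIV. s $ j * (\<Sum>l\<le>k. 1 / (real l + 1) * hpart (S j) l s))" for s :: "real^'n"
  have Hp: "pfun UNIV (1 + k) H"
   unfolding H_def[abs_def]
   by (intro pfun_sum pfun_mult pfun_cmult pfun_var UNIV_I) (auto intro: pfun_mono[OF hpart_pfun[OF S]])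
  define Q where "Q x = f a $ i + H (- a + x)" for x
  have Qp: "pfun UNIV (1 + k) Q"
   unfolding Q_def[abs_def] using pfun_comp[OF Hp, OF vshift, of "- a"]
   by (intro pfun_add pfun_const) (simp only: mult_1 mult_1_right)
  have "\<forall>j. \<exists>C\<delta>. fst C\<delta> \<ge> 0 \<and> snd C\<delta> > 0 \<and> (\<forall>x. norm (x - a) < snd C\<delta> \<longrightarrow> norm (fj j x $ i - T j x) \<le> fst C\<delta> * norm (x - a) ^ N)"
  proof
   fix j
   obtain C \<delta> where "C \<ge> 0" "\<delta> > 0" "\<And>x. norm (x - a) < \<delta> \<Longrightarrow> norm (fj j x $ i - T j x) \<le> C * norm (x - a) ^ N"
    by (rule smallE[OF T(2)]) blast
   thus "\<exists>C\<delta>. fst C\<delta> \<ge> 0 \<and> snd C\<delta> > 0 \<and> (\<forall>x. norm (x - a) < snd C\<delta> \<longrightarrow> norm (fj j x $ i - T j x) \<le> fst C\<delta> * norm (x - a) ^ N)"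
    by (intro exI[of _ "(C, \<delta>)"]) auto
  qed
  from choice[OF this] obtain C\<delta> where "\<forall>j. fst (C\<delta> j) \<ge> 0 \<and> snd (C\<delta> j) > 0 \<and> (\<forall>x. norm (x - a) < snd (C\<delta> j) \<longrightarrow> norm (fj j x $ i - T j x) \<le> fst (C\<delta> j) * norm (x - a) ^ N)" ..
  hence C: "\<And>j. fst (C\<delta> j) \<ge> 0" "\<And>j. snd (C\<delta> j) > 0" "\<And>j x. norm (x - a) < snd (C\<delta> j) \<Longrightarrow> \<bar>fj j x $ i - T j x\<bar> \<le> fst (C\<delta> j) * norm (x - a) ^ N"
   by auto
  obtain e where e: "e > 0" "ball a e \<subseteq> U" using assms(2) Suc.prems unfolding C_inf_on_def by (meson open_contains_ball)
  define \<delta> where "\<delta> = min e (Min (range (\<lambda>j. snd (C\<delta> j))))"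
  have \<delta>: "\<delta> > 0" "\<delta> \<le> e" "\<And>j. \<delta> \<le> snd (C\<delta> j)"
   unfolding \<delta>_def using e C(2) by (auto simp: min_le_iff_disj)
  define CC where "CC = (\<Sum>j\<in>UNIV. fst (C\<delta> j))"
  have "norm (f x $ i - Q x) \<le> CC * norm (x - a) ^ Suc N" if x: "norm (x - a) < \<delta>" for x
  proof -
   define s where "s = x - a"
   have inU: "a + t *\<^sub>R s \<in> U" "norm (t *\<^sub>R s) \<le> norm s" if t: "0 \<le> t" "t \<le> 1" for t
   proof -
    have "\<bar>t\<bar> * norm s \<le> 1 * norm s" using t by (intro mult_right_mono) auto
    thus "norm (t *\<^sub>R s) \<le> norm s" by simp
    hence "a + t *\<^sub>R s \<in> ball a e" using x \<delta>(2) by (simp add: s_def dist_norm)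
    thus "a + t *\<^sub>R s \<in> U" using e by blast
   qed
   \<comment> \<open>\<open>f\<close> minus the radial primitive along the ray. Its derivative is
     the error in the expansions of the partial derivatives times a component of \<open>s\<close>,
     so the mean value theorem gains one order.\<close>
   define u where "u t = f (a + t *\<^sub>R s) $ i - (\<Sum>j\<in>UNIV. s $ j * (\<Sum>l\<le>k. 1 / (real l + 1) * (t ^ Suc l * hpart (S j) l s)))" for t
   have du: "(u has_real_derivative (\<Sum>j\<in>UNIV. s $ j * (fj j (a + t *\<^sub>R s) $ i - T j (a + t *\<^sub>R s)))) (at t)"
    if t: "0 \<le> t" "t \<le> 1" for t
   proof -
    let ?D = "frechet_derivative f (at (a + t *\<^sub>R s))"
    have D: "(f has_derivative ?D) (at (a + t *\<^sub>R s))" by (rule C_inf_on_differentiable[OF Suc.prems inU(1)[OF t]])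
    have lin: "linear ?D" using D by (rule has_derivative_linear)
    have "((\<lambda>t. a + t *\<^sub>R s) has_derivative (\<lambda>h. h *\<^sub>R s)) (at t)" by (auto intro!: derivative_eq_intros)
    from has_derivative_compose[OF this D] have "((\<lambda>t. f (a + t *\<^sub>R s)) has_derivative (\<lambda>h. ?D (h *\<^sub>R s))) (at t)" .
    hence "((\<lambda>t. f (a + t *\<^sub>R s) $ i) has_derivative (\<lambda>h. ?D (h *\<^sub>R s) $ i)) (at t)"
     by (rule bounded_linear.has_derivative[OF bounded_linear_vec_nth])
    moreover have "(\<lambda>h. ?D (h *\<^sub>R s) $ i) = (\<lambda>h. (\<Sum>j\<in>UNIV. s $ j * fj j (a + t *\<^sub>R s) $ i) * h)"
    proof
     fix h
     have "?D (h *\<^sub>R s) $ i = (\<Sum>j\<in>UNIV. fj j (a + t *\<^sub>R s) $ i * (h * s $ j))"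
      unfolding fj_def by (subst linear_component[OF lin]) simp
     thus "?D (h *\<^sub>R s) $ i = (\<Sum>j\<in>UNIV. s $ j * fj j (a + t *\<^sub>R s) $ i) * h"
      by (simp add: sum_distrib_left mult_ac)
    qed
    ultimately have 1: "((\<lambda>t. f (a + t *\<^sub>R s) $ i) has_real_derivative (\<Sum>j\<in>UNIV. s $ j * fj j (a + t *\<^sub>R s) $ i)) (at t)"
     by (simp add: has_field_derivative_def)
    have dp: "((\<lambda>x. x ^ Suc l) has_real_derivative real (Suc l) * t ^ l) (at t)" for l
     using DERIV_pow[of "Suc l" t UNIV] by simp
    have 2: "((\<lambda>t. \<Sum>j\<in>UNIV. s $ j * (\<Sum>l\<le>k. 1 / (real l + 1) * (t ^ Suc l * hpart (S j) l s))) has_real_derivative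
      (\<Sum>j\<in>UNIV. s $ j * (\<Sum>l\<le>k. 1 / (real l + 1) * ((real (Suc l) * t ^ l) * hpart (S j) l s)))) (at t)"
     by (intro DERIV_sum DERIV_cmult DERIV_cmult_right dp)
    have 3: "(\<Sum>l\<le>k. 1 / (real l + 1) * ((real (Suc l) * t ^ l) * hpart (S j) l s)) = T j (a + t *\<^sub>R s)" for j
    proof -
     have "T j (a + t *\<^sub>R s) = S j (t *\<^sub>R s)" by (simp add: S_def)
     also have "\<dots> = (\<Sum>l\<le>k. t ^ l * hpart (S j) l s)" by (subst hpart_sum[OF S]) (simp add: hpart_scale[OF S])
     also have "\<dots> = (\<Sum>l\<le>k. 1 / (real l + 1) * ((real (Suc l) * t ^ l) * hpart (S j) l s))"
      by (intro sum.cong refl) (simp add: field_simps)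
     finally show ?thesis by simp
    qed
    from DERIV_diff[OF 1 2] show ?thesis unfolding u_def 3 by (simp add: sum_subtractf right_diff_distrib)
   qed
   have "\<exists>z. 0 < z \<and> z < 1 \<and> u 1 - u 0 = (1 - 0) * (\<Sum>j\<in>UNIV. s $ j * (fj j (a + z *\<^sub>R s) $ i - T j (a + z *\<^sub>R s)))"
    by (rule MVT2) (use du in auto)
   then obtain t where t: "0 < t" "t < 1" "u 1 - u 0 = (\<Sum>j\<in>UNIV. s $ j * (fj j (a + t *\<^sub>R s) $ i - T j (a + t *\<^sub>R s)))" by auto
   have ts: "norm (t *\<^sub>R s) \<le> norm s" using inU(2)[of t] t by simp
   have "f x $ i - Q x = u 1 - u 0"
   proof -
    have sx: "a + s = x" "- a + x = s" by (auto simp: s_def)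
    show ?thesis unfolding Q_def sx by (simp add: u_def H_def sx)
   qed
   also have "norm (u 1 - u 0) \<le> (\<Sum>j\<in>UNIV. norm s * (fst (C\<delta> j) * norm s ^ N))"
    unfolding t(3)
   proof (rule sum_norm_le)
    fix j
    have "norm (a + t *\<^sub>R s - a) < snd (C\<delta> j)" using ts x \<delta>(3)[of j] by (simp add: s_def)
    from C(3)[OF this] have "\<bar>fj j (a + t *\<^sub>R s) $ i - T j (a + t *\<^sub>R s)\<bar> \<le> fst (C\<delta> j) * norm (t *\<^sub>R s) ^ N" by simp
    also have "\<dots> \<le> fst (C\<delta> j) * norm s ^ N" using C(1) ts by (intro mult_left_mono power_mono) auto
    finally show "norm (s $ j * (fj j (a + t *\<^sub>R s) $ i - T j (a + t *\<^sub>R s))) \<le> norm s * (fst (C\<delta> j) * norm s ^ N)"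
     unfolding norm_mult using component_le_norm_cart[of s j] by (intro mult_mono) auto
   qed
   also have "\<dots> = CC * norm (x - a) ^ Suc N" by (simp add: CC_def s_def sum_distrib_right sum_distrib_left mult_ac)
   finally show ?thesis .
  qed
  hence "small a (Suc N) (\<lambda>x. f x $ i - Q x)" unfolding small_def using \<delta>(1) by blast
  with Qp show ?case by blast
 qed
 thus ?thesis by (simp add: peano_def)
qed

section \<open>Expansion of inverse maps\<close>

lemma small_dominated:
 assumes "small a N g" "\<delta> > 0" "\<And>x. norm (x - a) < \<delta> \<Longrightarrow> norm (f x) \<le> norm (g x)"
 shows "small a N f"
proof -
 obtain C \<epsilon> where 1: "C \<ge> 0" "\<epsilon> > 0" "\<And>x. norm (x - a) < \<epsilon> \<Longrightarrow> norm (g x) \<le> C * norm (x - a) ^ N"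
  by (rule smallE[OF assms(1)]) blast
 have "norm (f x) \<le> C * norm (x - a) ^ N" if "norm (x - a) < min \<delta> \<epsilon>" for x
  using assms(3)[of x] 1(3)[of x] that by simp
 thus ?thesis unfolding small_def using 1 assms by (intro exI[of _ C] exI[of _ "min \<delta> \<epsilon>"]) auto
qed

lemma small_norm: "small a N f \<Longrightarrow> small a N (\<lambda>x. norm (f x))"
 by (simp add: small_def)

lemma small_linear:
 assumes "small a N f" "bounded_linear B" shows "small a N (\<lambda>x. B (f x))"
proof -
 obtain K where K: "\<And>x. norm (B x) \<le> norm x * K" using bounded_linear.bounded[OF assms(2)] by blast
 have "small a N (\<lambda>x. K * norm (f x))" by (intro small_cmult small_norm assms)
 thus ?thesis
 proof (rule small_dominated[OF _ zero_less_one])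
  show "norm (B (f x)) \<le> norm (K * norm (f x))" for x using K[of "f x"] by (simp add: mult.commute)
 qed
qed

lemma small_vec:
 fixes f :: "'a::real_normed_vector \<Rightarrow> real^'n"
 assumes "\<And>i. small a N (\<lambda>x. f x $ i)" shows "small a N f"
proof -
 have "small a N (\<lambda>x. \<Sum>i\<in>UNIV. norm (f x $ i))" by (intro small_sum small_norm assms)
 thus ?thesis
 proof (rule small_dominated[OF _ zero_less_one])
  show "norm (f x) \<le> norm (\<Sum>i\<in>UNIV. norm (f x $ i))" for x using norm_le_l1_cart[of "f x"] by simp
 qed
qed

lemma small_bound:
 assumes "small a (Suc N) f"
 obtains \<delta> where "\<delta> > 0" "\<And>x. norm (x - a) < \<delta> \<Longrightarrow> norm (f x) \<le> 1"
proof -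
 obtain C \<epsilon> where 1: "C \<ge> 0" "\<epsilon> > 0" "\<And>x. norm (x - a) < \<epsilon> \<Longrightarrow> norm (f x) \<le> C * norm (x - a) ^ 1"
  by (rule smallE[OF small_mono[OF assms, of 1]]) auto
 have "norm (f x) \<le> 1" if "norm (x - a) < min \<epsilon> (1 / (C + 1))" for x
 proof -
  have "norm (f x) \<le> C * norm (x - a)" using 1 that by auto
  also have "\<dots> \<le> C * (1 / (C + 1))" using that 1 by (intro mult_left_mono) auto
  also have "\<dots> \<le> 1" using 1 by simp
  finally show ?thesis .
 qed
 thus ?thesis using 1 by (intro that[of "min \<epsilon> (1 / (C + 1))"]) auto
qed

text \<open>First-order expansion whose error is controlled for differences, not only at the base point.\<close>

definition strong_diff :: "real^'n \<Rightarrow> (real^'n \<Rightarrow> real) \<Rightarrow> bool" where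
 "strong_diff a p \<longleftrightarrow> (\<exists>g C. C \<ge> 0 \<and> (\<forall>x y. norm (x - a) \<le> 1 \<longrightarrow> norm (y - a) \<le> 1 \<longrightarrow>
   \<bar>p x - p y - g \<bullet> (x - y)\<bar> \<le> C * (norm (x - a) + norm (y - a)) * norm (x - y)))"

lemma strong_diff_const: "strong_diff a (\<lambda>x. c)"
 unfolding strong_diff_def by (intro exI[of _ 0]) simp

lemma strong_diff_var: "strong_diff a (\<lambda>x. x $ i)"
 unfolding strong_diff_def by (rule exI[of _ "axis i 1"], rule exI[of _ 0]) (simp add: inner_axis')

lemma strong_diff_add: assumes "strong_diff a p" "strong_diff a q" shows "strong_diff a (\<lambda>x. p x + q x)"
proof -
 obtain g C where 1: "C \<ge> 0" "\<And>x y. norm (x - a) \<le> 1 \<Longrightarrow> norm (y - a) \<le> 1 \<Longrightarrow>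
   \<bar>p x - p y - g \<bullet> (x - y)\<bar> \<le> C * (norm (x - a) + norm (y - a)) * norm (x - y)"
  using assms(1) unfolding strong_diff_def by auto
 obtain h D where 2: "D \<ge> 0" "\<And>x y. norm (x - a) \<le> 1 \<Longrightarrow> norm (y - a) \<le> 1 \<Longrightarrow>
   \<bar>q x - q y - h \<bullet> (x - y)\<bar> \<le> D * (norm (x - a) + norm (y - a)) * norm (x - y)"
  using assms(2) unfolding strong_diff_def by auto
 have "\<bar>(p x + q x) - (p y + q y) - (g + h) \<bullet> (x - y)\<bar> \<le> (C + D) * (norm (x - a) + norm (y - a)) * norm (x - y)"
  if "norm (x - a) \<le> 1" "norm (y - a) \<le> 1" for x y
  using 1(2)[OF that] 2(2)[OF that] unfolding inner_add_left distrib_right[of C D] distrib_right[of "C * _"] by linarith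
 thus ?thesis unfolding strong_diff_def using 1(1) 2(1) by (intro exI[of _ "g + h"] exI[of _ "C + D"]) auto
qed

lemma strong_diff_mult:
 fixes p q :: "real^'n \<Rightarrow> real"
 assumes "strong_diff a p" "strong_diff a q" shows "strong_diff a (\<lambda>x. p x * q x)"
proof -
 obtain g C where 1: "C \<ge> 0" "\<And>x y. norm (x - a) \<le> 1 \<Longrightarrow> norm (y - a) \<le> 1 \<Longrightarrow>
   \<bar>p x - p y - g \<bullet> (x - y)\<bar> \<le> C * (norm (x - a) + norm (y - a)) * norm (x - y)"
  using assms(1) unfolding strong_diff_def by auto
 obtain h D where 2: "D \<ge> 0" "\<And>x y. norm (x - a) \<le> 1 \<Longrightarrow> norm (y - a) \<le> 1 \<Longrightarrow>
   \<bar>q x - q y - h \<bullet> (x - y)\<bar> \<le> D * (norm (x - a) + norm (y - a)) * norm (x - y)"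
  using assms(2) unfolding strong_diff_def by auto
 have lip: "\<bar>p x - p a\<bar> \<le> (norm g + C) * norm (x - a)"
  if "\<forall>x y. norm (x - a) \<le> 1 \<longrightarrow> norm (y - a) \<le> 1 \<longrightarrow>
   \<bar>p x - p y - g \<bullet> (x - y)\<bar> \<le> C * (norm (x - a) + norm (y - a)) * norm (x - y)" "C \<ge> 0" "norm (x - a) \<le> 1"
  for p :: "real^'n \<Rightarrow> real" and g C x
 proof -
  have "C * norm (x - a) * norm (x - a) \<le> C * 1 * norm (x - a)" using that by (intro mult_mono) auto
  thus ?thesis using that(1)[rule_format, of x a] that(3) Cauchy_Schwarz_ineq2[of g "x - a"] by (simp add: distrib_right)
 qed
 define M where "M = \<bar>p a\<bar> + norm g + C"
 define N where "N = \<bar>q a\<bar> + norm h + D"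
 define E where "E = M * D + (norm g + C) * norm h + N * C + (norm h + D) * norm g"
 have MN: "M \<ge> 0" "N \<ge> 0" using 1(1) 2(1) by (auto simp: M_def N_def)
 have "\<bar>p x * q x - p y * q y - (p a *\<^sub>R h + q a *\<^sub>R g) \<bullet> (x - y)\<bar> \<le> E * (norm (x - a) + norm (y - a)) * norm (x - y)"
  if xy: "norm (x - a) \<le> 1" "norm (y - a) \<le> 1" for x y
 proof -
  define e where "e = norm (x - a) + norm (y - a)"
  define n where "n = norm (x - y)"
  have e: "e \<ge> 0" "n \<ge> 0" "norm (x - a) \<le> e" "norm (y - a) \<le> e" by (auto simp: e_def n_def)
  have lp: "\<bar>p x - p a\<bar> \<le> (norm g + C) * norm (x - a)" by (rule lip) (use 1 xy in auto)
  have lq: "\<bar>q y - q a\<bar> \<le> (norm h + D) * norm (y - a)" by (rule lip) (use 2 xy in auto)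
  have px: "\<bar>p x\<bar> \<le> M"
  proof -
   have "(norm g + C) * norm (x - a) \<le> (norm g + C) * 1" using 1(1) xy by (intro mult_left_mono) auto
   thus ?thesis using lp abs_triangle_ineq[of "p a" "p x - p a"] unfolding M_def by simp
  qed
  have qy: "\<bar>q y\<bar> \<le> N"
  proof -
   have "(norm h + D) * norm (y - a) \<le> (norm h + D) * 1" using 2(1) xy by (intro mult_left_mono) auto
   thus ?thesis using lq abs_triangle_ineq[of "q a" "q y - q a"] unfolding N_def by simp
  qed
  have lp': "\<bar>p x - p a\<bar> \<le> (norm g + C) * e"
   by (rule order_trans[OF lp mult_left_mono[OF e(3)]]) (use 1(1) in simp)
  have lq': "\<bar>q y - q a\<bar> \<le> (norm h + D) * e"
   by (rule order_trans[OF lq mult_left_mono[OF e(4)]]) (use 2(1) in simp)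
  have cs: "\<bar>g \<bullet> (x - y)\<bar> \<le> norm g * n" "\<bar>h \<bullet> (x - y)\<bar> \<le> norm h * n"
   unfolding n_def by (rule Cauchy_Schwarz_ineq2)+
  \<comment> \<open>Each summand is a bounded factor times either a first-order error or a deviation
    from the value at \<open>a\<close> times a linear term, hence of size
    \<open>e * n\<close>.\<close>
  have "p x * q x - p y * q y - (p a *\<^sub>R h + q a *\<^sub>R g) \<bullet> (x - y) =
    p x * (q x - q y - h \<bullet> (x - y)) + (p x - p a) * (h \<bullet> (x - y)) + q y * (p x - p y - g \<bullet> (x - y)) + (q y - q a) * (g \<bullet> (x - y))"
   by (simp add: inner_add_left algebra_simps)
  also have "\<bar>\<dots>\<bar> \<le> \<bar>p x * (q x - q y - h \<bullet> (x - y))\<bar> + \<bar>(p x - p a) * (h \<bullet> (x - y))\<bar> + \<bar>q y * (p x - p y - g \<bullet> (x - y))\<bar> + \<bar>(q y - q a) * (g \<bullet> (x - y))\<bar>"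
   by linarith
  also have "\<dots> \<le> M * (D * e * n) + ((norm g + C) * e) * (norm h * n) + N * (C * e * n) + ((norm h + D) * e) * (norm g * n)"
   unfolding abs_mult
   using MN 1(1) 2(1) e
   by (intro add_mono mult_mono px qy lp' lq' cs 1(2)[OF xy, folded e_def n_def] 2(2)[OF xy, folded e_def n_def]) auto
  also have "\<dots> = E * e * n" by (simp add: E_def algebra_simps)
  finally show ?thesis by (simp add: e_def n_def)
 qed
 moreover have "E \<ge> 0" unfolding E_def using MN 1(1) 2(1) by (intro add_nonneg_nonneg mult_nonneg_nonneg) auto
 ultimately show ?thesis unfolding strong_diff_def by blast
qed

lemma strong_diff_pfun: assumes "pfun I k p" shows "strong_diff a p"
proof -
 have pw: "strong_diff a (\<lambda>x. x $ i ^ n)" for i n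
  by (induction n) (auto intro: strong_diff_const strong_diff_mult strong_diff_var)
 have pr: "strong_diff a (\<lambda>x. \<Prod>i\<in>A. x $ i ^ \<alpha> i)" for A :: "'a set" and \<alpha>
  by (induction A rule: infinite_finite_induct) (auto intro: strong_diff_const strong_diff_mult pw)
 have sm: "strong_diff a (\<lambda>x. \<Sum>i\<in>A. f i x)" if "\<And>i. i \<in> A \<Longrightarrow> strong_diff a (f i)" for A :: "'b set" and f
  using that by (induction A rule: infinite_finite_induct) (auto intro: strong_diff_const strong_diff_add)
 obtain c where "p = (\<lambda>x. \<Sum>\<alpha>\<in>mons I k. c \<alpha> * mon \<alpha> x)" using assms by (auto simp: pfun_def)
 thus ?thesis unfolding mon_def by (auto intro!: sm strong_diff_mult strong_diff_const pr)
qed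

lemma has_derivative_of_small:
 assumes l: "bounded_linear l" and s: "small a 2 (\<lambda>x. f x - f a - l (x - a))"
 shows "(f has_derivative l) (at a)"
proof -
 obtain C \<delta> where C: "C \<ge> 0" "\<delta> > 0" "\<And>x. norm (x - a) < \<delta> \<Longrightarrow> norm (f x - f a - l (x - a)) \<le> C * norm (x - a) ^ 2"
  by (rule smallE[OF s]) blast
 have "((\<lambda>y. norm ((f y - f a) - l (y - a)) / norm (y - a)) \<longlongrightarrow> 0) (at a)"
 proof (rule Lim_null_comparison)
  show "\<forall>\<^sub>F x in at a. norm (norm (f x - f a - l (x - a)) / norm (x - a)) \<le> C * norm (x - a)"
   unfolding eventually_at
  proof (intro exI[of _ \<delta>] conjI ballI impI C(2))
   fix x assume x: "x \<noteq> a \<and> dist x a < \<delta>"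
   hence "norm (f x - f a - l (x - a)) \<le> C * norm (x - a) * norm (x - a)"
    using C(3)[of x] by (simp add: dist_norm power2_eq_square mult.assoc)
   thus "norm (norm (f x - f a - l (x - a)) / norm (x - a)) \<le> C * norm (x - a)"
    using x by (simp add: divide_le_eq)
  qed
  show "((\<lambda>x. C * norm (x - a)) \<longlongrightarrow> 0) (at a)"
   by (auto intro!: tendsto_eq_intros)
 qed
 thus ?thesis using l by (simp add: has_derivative_iff_norm)
qed

text \<open>Newton iteration on the polynomial approximations: each step gains one order.\<close>

lemma peano_inverse:
 fixes \<Xi> \<Psi> :: "real^'n \<Rightarrow> real^'n"
 assumes \<Xi>: "\<And>i. peano (\<lambda>x. \<Xi> x $ i) a" and der: "(\<Xi> has_derivative A) (at a)"
  and B: "linear B" "\<And>v. B (A v) = v"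
  and r: "r > 0" and \<Psi>: "\<And>z. norm (z - b) < r \<Longrightarrow> \<Xi> (\<Psi> z) = z \<and> norm (\<Psi> z - a) \<le> C * norm (z - b)"
 shows "peano (\<lambda>z. \<Psi> z $ i) b"
proof -
 have \<Psi>1: "small b 1 (\<lambda>z. \<Psi> z - a)" unfolding small_def using r \<Psi> by (intro exI[of _ C] exI[of _ r]) auto
 have blB: "bounded_linear B" using B(1) linear_conv_bounded_linear by blast
 have "\<exists>\<sigma> k. (\<forall>i. pfun UNIV k (\<lambda>z. \<sigma> z $ i)) \<and> small b (Suc N) (\<lambda>z. \<Psi> z - \<sigma> z)" for N
 proof (induction N)
  case 0
  show ?case by (rule exI[of _ "\<lambda>_. a"], rule exI[of _ 0]) (use \<Psi>1 in auto)
 next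
  case (Suc N)
  then obtain \<sigma> k where \<sigma>: "\<And>i. pfun UNIV k (\<lambda>z. \<sigma> z $ i)" "small b (Suc N) (\<lambda>z. \<Psi> z - \<sigma> z)" by blast
  have "\<forall>i. \<exists>kT. pfun UNIV (fst kT) (snd kT) \<and> small a (N + 2) (\<lambda>x. \<Xi> x $ i - snd kT x)"
   using \<Xi> unfolding peano_def by (auto simp: split_paired_Ex)
  from choice[OF this] obtain kT where kT: "\<forall>i. pfun UNIV (fst (kT i)) (snd (kT i)) \<and> small a (N + 2) (\<lambda>x. \<Xi> x $ i - snd (kT i) x)" ..
  define l where "l = (\<Sum>i\<in>UNIV. fst (kT i))"
  define S where "S x = (\<chi> i. snd (kT i) x)" for x
  have S: "pfun UNIV l (\<lambda>x. S x $ i)" "small a (N + 2) (\<lambda>x. \<Xi> x $ i - S x $ i)" for i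
  proof -
   have "fst (kT i) \<le> l" unfolding l_def by (rule member_le_sum) auto
   thus "pfun UNIV l (\<lambda>x. S x $ i)" using kT unfolding S_def by (auto intro: pfun_mono)
   show "small a (N + 2) (\<lambda>x. \<Xi> x $ i - S x $ i)" using kT by (simp add: S_def)
  qed
  have S': "small a (N + 2) (\<lambda>x. \<Xi> x - S x)" by (rule small_vec) (use S(2) in simp)
  \<comment> \<open>A Newton step with the derivative frozen at \<open>a\<close>; \<open>B\<close>
    is its left inverse.\<close>
  define \<sigma>' where "\<sigma>' z = \<sigma> z - B (S (\<sigma> z) - z)" for z
  have poly: "pfun UNIV (k + (l * k + 1)) (\<lambda>z. \<sigma>' z $ i)" for i
  proof -
   have "pfun UNIV (l * k + 1) (\<lambda>z. (S (\<sigma> z) - z) $ j)" for j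
    unfolding vector_minus_component
    by (intro pfun_diff pfun_mono[OF pfun_comp[OF S(1) \<sigma>(1)]] pfun_mono[OF pfun_var]) auto
   hence "pfun UNIV (l * k + 1) (\<lambda>z. B (S (\<sigma> z) - z) $ i)"
    unfolding linear_component[OF B(1), of "S _ - _"] by (intro pfun_sum pfun_cmult) auto
   thus ?thesis unfolding \<sigma>'_def vector_minus_component
    by (intro pfun_diff) (auto intro: pfun_mono \<sigma>(1))
  qed
  have \<sigma>1: "small b 1 (\<lambda>z. \<sigma> z - a)"
   using small_diff[OF \<Psi>1 small_mono[OF \<sigma>(2), of 1]] by simp
  \<comment> \<open>At the exact inverse only the remainder of the expansion \<open>S\<close> is
    left; the linear bound on \<open>\<Psi> z - a\<close> turns smallness at \<open>a\<close> into
    smallness at \<open>b\<close>.\<close>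
  have E1: "small b (Suc (Suc N)) (\<lambda>z. S (\<Psi> z) - z)"
  proof -
   obtain C1 \<delta> where C1: "C1 \<ge> 0" "\<delta> > 0" "\<And>x. norm (x - a) < \<delta> \<Longrightarrow> norm (\<Xi> x - S x) \<le> C1 * norm (x - a) ^ (N + 2)"
    by (rule smallE[OF S']) blast
   have "norm (S (\<Psi> z) - z) \<le> (C1 * \<bar>C\<bar> ^ (N + 2)) * norm (z - b) ^ Suc (Suc N)" if z: "norm (z - b) < min r (\<delta> / (\<bar>C\<bar> + 1))" for z
   proof -
    have C: "norm (\<Psi> z - a) \<le> \<bar>C\<bar> * norm (z - b)"
     using \<Psi>[of z] z mult_right_mono[OF abs_ge_self[of C] norm_ge_zero[of "z - b"]] by simp
    have "\<bar>C\<bar> * norm (z - b) \<le> (\<bar>C\<bar> + 1) * norm (z - b)" by (intro mult_right_mono) auto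
    also have "\<dots> < \<delta>" using z by (simp add: field_simps)
    finally have "norm (\<Psi> z - a) < \<delta>" using C by simp
    from C1(3)[OF this] have "norm (S (\<Psi> z) - z) \<le> C1 * norm (\<Psi> z - a) ^ (N + 2)" using \<Psi>[of z] z by (simp add: norm_minus_commute)
    also have "\<dots> \<le> C1 * (\<bar>C\<bar> * norm (z - b)) ^ (N + 2)" using C C1(1) by (intro mult_left_mono power_mono) auto
    finally show ?thesis by (simp only: power_mult_distrib mult.assoc add_2_eq_Suc')
   qed
   moreover have "min r (\<delta> / (\<bar>C\<bar> + 1)) > 0" using r C1(2) by simp
   ultimately show ?thesis unfolding small_def by blast
  qed
  have E2: "small b (Suc (Suc N)) (\<lambda>z. (S (\<Psi> z) - S (\<sigma> z) - A (\<Psi> z - \<sigma> z)) $ i)" for i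
  proof -
   obtain g D where D: "D \<ge> 0" "\<And>x y. norm (x - a) \<le> 1 \<Longrightarrow> norm (y - a) \<le> 1 \<Longrightarrow>
     \<bar>S x $ i - S y $ i - g \<bullet> (x - y)\<bar> \<le> D * (norm (x - a) + norm (y - a)) * norm (x - y)"
    using strong_diff_pfun[OF S(1), of a i] unfolding strong_diff_def by auto
   have "small a 2 (\<lambda>x. S x $ i - S a $ i - g \<bullet> (x - a))" unfolding small_def
   proof (rule exI[of _ D], rule exI[of _ 1], intro conjI allI impI)
    fix x assume "norm (x - a) < 1"
    thus "norm (S x $ i - S a $ i - g \<bullet> (x - a)) \<le> D * norm (x - a) ^ 2"
     using D(2)[of x a] by (simp add: power2_eq_square mult.assoc)
   qed simp
   hence dS: "((\<lambda>x. S x $ i) has_derivative (\<lambda>v. g \<bullet> v)) (at a)"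
    by (rule has_derivative_of_small[OF bounded_linear_inner_right])
   have e0: "\<Xi> a $ i - S a $ i = 0"
   proof -
    obtain C \<delta> where "\<delta> > 0" "\<And>x. norm (x - a) < \<delta> \<Longrightarrow> norm (\<Xi> x $ i - S x $ i) \<le> C * norm (x - a) ^ (N + 2)"
     by (rule smallE[OF S(2)]) blast
    from this(2)[of a] this(1) show ?thesis by simp
   qed
   have "((\<lambda>x. \<Xi> x $ i - S x $ i) has_derivative (\<lambda>v. 0)) (at a)"
   proof (rule has_derivative_of_small[OF bounded_linear_zero])
    show "small a 2 (\<lambda>x. \<Xi> x $ i - S x $ i - (\<Xi> a $ i - S a $ i) - 0)" unfolding e0 using small_mono[OF S(2), of 2] by simp
   qed
   \<comment> \<open>\<open>\<Xi>\<close> and \<open>S\<close> agree to second order at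
     \<open>a\<close>, so they have the same derivative there and \<open>g\<close> represents a
     component of \<open>A\<close>.\<close>
   from has_derivative_add[OF this dS] have "((\<lambda>x. \<Xi> x $ i) has_derivative (\<lambda>v. g \<bullet> v)) (at a)" by simp
   moreover have "((\<lambda>x. \<Xi> x $ i) has_derivative (\<lambda>v. A v $ i)) (at a)"
    by (rule bounded_linear.has_derivative[OF bounded_linear_vec_nth der])
   ultimately have "(\<lambda>v. g \<bullet> v) = (\<lambda>v. A v $ i)" by (rule has_derivative_unique)
   hence gA: "A v $ i = g \<bullet> v" for v by metis
   obtain \<delta>1 where d1: "\<delta>1 > 0" "\<And>z. norm (z - b) < \<delta>1 \<Longrightarrow> norm (\<Psi> z - a) \<le> 1"
    using small_bound[OF \<Psi>1[unfolded One_nat_def]] by blast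
   obtain \<delta>2 where d2: "\<delta>2 > 0" "\<And>z. norm (z - b) < \<delta>2 \<Longrightarrow> norm (\<sigma> z - a) \<le> 1"
    using small_bound[OF \<sigma>1[unfolded One_nat_def]] by blast
   have "small b (1 + Suc N) (\<lambda>z. D * (norm (\<Psi> z - a) + norm (\<sigma> z - a)) * norm (\<Psi> z - \<sigma> z))"
    by (intro small_mult small_cmult small_add small_norm \<Psi>1 \<sigma>1 \<sigma>(2))
   hence "small b (Suc (Suc N)) (\<lambda>z. D * (norm (\<Psi> z - a) + norm (\<sigma> z - a)) * norm (\<Psi> z - \<sigma> z))" by simp
   thus ?thesis
   proof (rule small_dominated)
    show "min \<delta>1 \<delta>2 > 0" using d1 d2 by simp
    fix z assume "norm (z - b) < min \<delta>1 \<delta>2"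
    hence "norm (\<Psi> z - a) \<le> 1" "norm (\<sigma> z - a) \<le> 1" using d1 d2 by auto
    from D(2)[OF this] show "norm ((S (\<Psi> z) - S (\<sigma> z) - A (\<Psi> z - \<sigma> z)) $ i) \<le> norm (D * (norm (\<Psi> z - a) + norm (\<sigma> z - a)) * norm (\<Psi> z - \<sigma> z))"
     by (simp add: gA)
   qed
  qed
  have "small b (Suc (Suc N)) (\<lambda>z. B (S (\<Psi> z) - z) - B (S (\<Psi> z) - S (\<sigma> z) - A (\<Psi> z - \<sigma> z)))"
   by (intro small_diff small_linear[OF _ blB] E1 small_vec E2)
  \<comment> \<open>By \<open>B (A v) = v\<close> the two terms combine to the error of the Newton
    step.\<close>
  also have "(\<lambda>z. B (S (\<Psi> z) - z) - B (S (\<Psi> z) - S (\<sigma> z) - A (\<Psi> z - \<sigma> z))) = (\<lambda>z. \<Psi> z - \<sigma>' z)"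
   by (simp add: fun_eq_iff \<sigma>'_def linear_diff[OF B(1)] B(2))
  finally show ?case using poly by blast
 qed
 note * = this
 have "\<exists>k T. pfun UNIV k T \<and> small b N (\<lambda>z. \<Psi> z $ i - T z)" for N
 proof -
  obtain \<sigma> k where \<sigma>: "\<And>i. pfun UNIV k (\<lambda>z. \<sigma> z $ i)" "small b (Suc N) (\<lambda>z. \<Psi> z - \<sigma> z)" using * by blast
  have "small b N (\<lambda>z. (\<Psi> z - \<sigma> z) $ i)"
   by (rule small_dominated[OF small_mono[OF \<sigma>(2)] zero_less_one]) (auto simp: component_le_norm_cart simp del: vector_minus_component)
  thus ?thesis using \<sigma>(1)[of i] by auto
 qed
 thus ?thesis by (simp add: peano_def)
qed

lemma coordinate_complement:
 fixes T :: "(real^'n) set"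
 assumes T: "subspace T"
 obtains J K where "card J = dim T" "linear K" "\<And>v. v \<in> T \<Longrightarrow> K v = 0" "\<And>v. v - K v \<in> T"
  "\<And>v. pj J v = 0 \<Longrightarrow> K v = v" "\<And>v. pj J (K v) = 0"
proof -
 obtain BT where BT: "BT \<subseteq> T" "independent BT" "T \<subseteq> span BT" "card BT = dim T" using basis_exists[of T] by blast
 define ax where "ax i = (axis i 1 :: real^'n)" for i
 have expand: "v = (\<Sum>i\<in>UNIV. v $ i *\<^sub>R ax i)" for v
  unfolding ax_def using basis_expansion[of v] by (simp add: scalar_mult_eq_scaleR)
 obtain B where B: "BT \<subseteq> B" "B \<subseteq> BT \<union> range ax" "independent B" "BT \<union> range ax \<subseteq> span B"
  using maximal_independent_subset_extend[of BT "BT \<union> range ax"] BT(2) by blast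
 have spB: "span B = UNIV"
 proof -
  have "v \<in> span B" for v
   by (subst expand) (intro span_sum span_scale, use B(4) in blast)
  thus ?thesis by blast
 qed
 have cB: "card B = CARD('n)"
  using dim_eq_card[of B UNIV] B(3) spB by simp
 have fB: "finite B" using B(3) by (rule independent_imp_finite)
 define J' where "J' = {i. ax i \<in> B - BT}"
 have "inj ax" by (auto simp: inj_on_def ax_def axis_eq_axis)
 moreover have "B - BT = ax ` J'" unfolding J'_def using B(2) by auto
 ultimately have "card (B - BT) = card J'" by (simp add: card_image inj_on_subset)
 moreover have "card (B - BT) = card B - card BT" using fB B(1) by (intro card_Diff_subset) (auto intro: finite_subset)
 moreover have "card BT \<le> card B" using fB B(1) by (intro card_mono)
 moreover have "card (- J') = CARD('n) - card J'" by (simp add: Compl_eq_Diff_UNIV card_Diff_subset)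
 ultimately have cJ: "card (- J') = dim T" using cB BT(4) by simp
 obtain K where K: "linear K" "\<And>b. b \<in> B \<Longrightarrow> K b = (if b \<in> BT then 0 else b)"
  using linear_independent_extend[OF B(3), of "\<lambda>b. if b \<in> BT then 0 else b"] by blast
 show ?thesis
 proof (rule that[of "- J'" K, OF cJ K(1)])
  show "K v = 0" if "v \<in> T" for v
   by (rule linear_eq_0_on_span[OF K(1), of BT]) (use K(2) B(1) BT(3) that in auto)
  have sub: "subspace {v. v - K v \<in> T}"
  proof -
   have "linear (\<lambda>v. v - K v)" by (intro linear_compose_sub linear_ident K(1))
   thus ?thesis using linear_subspace_vimage[OF _ T] by (simp add: vimage_def)
  qed
  show "v - K v \<in> T" for v
   by (rule span_induct[of v B "\<lambda>v. v - K v \<in> T"]) (use spB sub K(2) BT(1) subspace_0[OF T] in auto)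
  show "pj (- J') (K v) = 0" for v
  proof (rule linear_eq_0_on_span[of "\<lambda>v. pj (- J') (K v)" B])
   show "linear (\<lambda>v. pj (- J') (K v))" using linear_compose[OF K(1) pj_linear[of "- J'"]] by (simp add: o_def)
   fix b assume b: "b \<in> B"
   show "pj (- J') (K b) = 0"
   proof (cases "b \<in> BT")
    case False
    with b B(2) obtain i where i: "b = ax i" by blast
    have "pj (- J') b $ j = 0" for j
     using b False unfolding i by (auto simp: J'_def ax_def axis_def)
    hence "pj (- J') b = 0" by (simp add: vec_eq_iff del: pj_nth)
    thus ?thesis using K(2)[OF b] False by simp
   qed (use K(2)[OF b] in simp)
  qed (use spB in simp)
  show "K v = v" if v: "pj (- J') v = 0" for v
  proof -
   have v0: "v $ i = 0" if "i \<notin> J'" for i using arg_cong[OF v, of "\<lambda>w. w $ i"] that by simp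
   have "K v = (\<Sum>i\<in>UNIV. v $ i *\<^sub>R K (ax i))"
    by (subst expand) (simp add: linear_sum[OF K(1)] linear_scale[OF K(1)])
   also have "\<dots> = (\<Sum>i\<in>UNIV. v $ i *\<^sub>R ax i)"
   proof (intro sum.cong refl)
    fix i
    show "v $ i *\<^sub>R K (ax i) = v $ i *\<^sub>R ax i"
    proof (cases "i \<in> J'")
     case True
     hence "K (ax i) = ax i" using K(2)[of "ax i"] by (simp add: J'_def)
     thus ?thesis by simp
    qed (simp add: v0)
   qed
   finally show ?thesis using expand[of v] by simp
  qed
 qed
qed

section \<open>Smooth submanifolds as graphs over coordinates\<close>

lemma peano_cong: assumes "peano f a" "\<delta> > 0" "\<And>x. norm (x - a) < \<delta> \<Longrightarrow> g x = f x" shows "peano g a"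
 unfolding peano_def
proof
 fix N
 obtain k T where T: "pfun UNIV k T" "small a N (\<lambda>x. f x - T x)" using assms(1) unfolding peano_def by blast
 from small_cong[OF T(2) assms(2), of "\<lambda>x. g x - T x"] assms(3) T(1)
 show "\<exists>k T. pfun UNIV k T \<and> small a N (\<lambda>x. g x - T x)" by auto
qed

lemma peano_pj: assumes "peano f (pj J a)" shows "peano (\<lambda>z. f (pj J z)) a"
 unfolding peano_def
proof
 fix N
 obtain k T where T: "pfun UNIV k T" "small (pj J a) N (\<lambda>x. f x - T x)" using assms unfolding peano_def by blast
 obtain C \<delta> where C: "C \<ge> 0" "\<delta> > 0" "\<And>x. norm (x - pj J a) < \<delta> \<Longrightarrow> norm (f x - T x) \<le> C * norm (x - pj J a) ^ N"
  by (rule smallE[OF T(2)]) blast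
 have "pfun UNIV 1 (\<lambda>z. pj J z $ i)" for i
  using pfun_var[of i UNIV] pfun_const by (cases "i \<in> J") auto
 from pfun_comp[OF T(1) this] have "pfun UNIV (k * 1) (\<lambda>z. T (pj J z))" .
 moreover have "small a N (\<lambda>z. f (pj J z) - T (pj J z))"
  unfolding small_def
 proof (rule exI[of _ C], rule exI[of _ \<delta>], intro conjI allI impI C(2))
  fix x assume x: "norm (x - a) < \<delta>"
  have le: "norm (pj J x - pj J a) \<le> norm (x - a)" using norm_pj_le[of J "x - a"] by simp
  hence "norm (f (pj J x) - T (pj J x)) \<le> C * norm (pj J x - pj J a) ^ N" using x by (intro C(3)) simp
  also have "\<dots> \<le> C * norm (x - a) ^ N" using C(1) le by (intro mult_left_mono power_mono) auto
  finally show "norm (f (pj J x) - T (pj J x)) \<le> C * norm (x - a) ^ N" .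
 qed
 ultimately show "\<exists>k T. pfun UNIV k T \<and> small a N (\<lambda>z. f (pj J z) - T z)" by blast
qed

text \<open>The parametrisation is defined on the whole space; by the Lipschitz clause it depends,
  over the domain, only on the coordinates in \<open>J\<close>. The last clause says that near
  \<open>x0\<close> every point of \<open>V\<close> is on the graph. Borel measurability is for
  integrals of functions composed with \<open>\<Phi>\<close>.\<close>

definition graph_chart :: "(real^'n) set \<Rightarrow> real^'n \<Rightarrow> 'n set \<Rightarrow> (real^'n \<Rightarrow> real^'n) \<Rightarrow> real \<Rightarrow> real \<Rightarrow> bool" where
 "graph_chart V x0 J \<Phi> r M \<longleftrightarrow> r > 0 \<and> M > 0 \<and> \<Phi> \<in> borel_measurable borel \<and>
   (\<forall>z. norm (pj J (z - x0)) < r \<longrightarrow> \<Phi> z \<in> V \<and> pj J (\<Phi> z) = pj J z \<and> (\<forall>i. peano (\<lambda>z. \<Phi> z $ i) z)) \<and>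
   (\<forall>z z'. norm (pj J (z - x0)) < r \<longrightarrow> norm (pj J (z' - x0)) < r \<longrightarrow> norm (\<Phi> z - \<Phi> z') \<le> M * norm (pj J (z - z'))) \<and>
   (\<exists>\<rho>. 0 < \<rho> \<and> \<rho> \<le> r \<and> (\<forall>y\<in>V. norm (y - x0) < \<rho> \<longrightarrow> \<Phi> y = y))"

theorem smooth_submanifold_graph_chart:
 fixes V :: "(real^'n) set"
 assumes V: "smooth_submanifold d V" and x0: "x0 \<in> V"
 obtains J \<Phi> r M where "card J = d" "graph_chart V x0 J \<Phi> r M"
proof -
 obtain U W and \<phi> :: "real^'n \<Rightarrow> real^'n" and \<psi> :: "real^'n \<Rightarrow> real^'n" and L where
  U: "x0 \<in> U" "open U" "open W" "C_inf_on U \<phi>" "C_inf_on W \<psi>"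
  "\<phi> ` U = W" "\<And>y. y \<in> U \<Longrightarrow> \<psi> (\<phi> y) = y" "\<And>z. z \<in> W \<Longrightarrow> \<phi> (\<psi> z) = z"
  "subspace L" "dim L = d" "\<phi> ` (U \<inter> V) = W \<inter> L"
  using V x0 unfolding smooth_submanifold_def by metis
 define D where "D x = frechet_derivative \<phi> (at x)" for x
 define Q where "Q = frechet_derivative \<psi> (at (\<phi> x0))"
 have D: "(\<phi> has_derivative D x) (at x)" if "x \<in> U" for x unfolding D_def by (rule C_inf_on_differentiable[OF U(4) that])
 have dQ: "(\<psi> has_derivative Q) (at (\<phi> x0))" unfolding Q_def by (rule C_inf_on_differentiable[OF U(5)]) (use U in blast)
 have linD: "linear (D x)" if "x \<in> U" for x using D[OF that] by (rule has_derivative_linear)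
 have linQ: "linear Q" using dQ by (rule has_derivative_linear)
 have QD: "Q (D x0 v) = v" for v
 proof -
  have "((\<lambda>x. \<psi> (\<phi> x)) has_derivative (\<lambda>v. Q (D x0 v))) (at x0)" by (rule has_derivative_compose[OF D[OF U(1)] dQ])
  hence "((\<lambda>x. x) has_derivative (\<lambda>v. Q (D x0 v))) (at x0)"
   by (rule has_derivative_transform_within_open[OF _ U(2,1)]) (use U(7) in auto)
  from has_derivative_unique[OF this has_derivative_ident] show ?thesis by (rule fun_cong)
 qed
 have "Q \<circ> D x0 = id" using QD by (auto simp: fun_eq_iff)
 hence DQ: "D x0 (Q v) = v" for v using linear_inverse_left[OF linQ linD[OF U(1)]] by (metis comp_apply id_apply)
 have injQ: "inj Q" using DQ by (metis injI)
 \<comment> \<open>The tangent space of \<open>V\<close> at \<open>x0\<close>.\<close>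
 define T where "T = Q ` L"
 have T: "subspace T" unfolding T_def by (rule linear_subspace_image[OF linQ U(9)])
 have dT: "dim T = d" unfolding T_def using dim_image_eq[OF linQ, of L] injQ U(10) by (auto intro: inj_on_subset)
 obtain J K where JK: "card J = dim T" "linear K" "\<And>v. v \<in> T \<Longrightarrow> K v = 0" "\<And>v. v - K v \<in> T"
  "\<And>v. pj J v = 0 \<Longrightarrow> K v = v" "\<And>v. pj J (K v) = 0"
  by (rule coordinate_complement[OF T]) blast
 \<comment> \<open>On \<open>V\<close> the second summand vanishes, since
   \<open>Q (\<phi> x)\<close> lies in the tangent space; so \<open>\<Xi>\<close> flattens
   \<open>V\<close> and is the coordinate projection there. Its derivative at \<open>x0\<close> is
   \<open>pj J + K\<close>, injective by the choice of \<open>J\<close>.\<close>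
 define \<Xi> where "\<Xi> x = pj J x + K (Q (\<phi> x))" for x
 define f' where "f' x = Blinfun (\<lambda>v. pj J v + K (Q (D x v)))" for x
 have blpj: "bounded_linear (pj J)" using pj_linear linear_conv_bounded_linear by blast
 have linKQ: "linear (\<lambda>v. K (Q v))" using linear_compose[OF linQ JK(2)] by (simp add: o_def)
 have blKQ: "bounded_linear (\<lambda>v. K (Q v))" using linKQ linear_conv_bounded_linear by blast
 have f'_apply: "blinfun_apply (f' x) = (\<lambda>v. pj J v + K (Q (D x v)))" if "x \<in> U" for x
 proof -
  have "linear (\<lambda>v. K (Q (D x v)))" using linear_compose[OF linD[OF that] linKQ] by (simp add: o_def)
  hence "bounded_linear (\<lambda>v. pj J v + K (Q (D x v)))"
   by (intro bounded_linear_add blpj) (simp add: linear_conv_bounded_linear)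
  thus ?thesis unfolding f'_def by (rule bounded_linear_Blinfun_apply)
 qed
 have der: "(\<Xi> has_derivative blinfun_apply (f' x)) (at x)" if "x \<in> U" for x
  unfolding f'_apply[OF that] \<Xi>_def[abs_def]
  by (intro has_derivative_add bounded_linear.has_derivative[OF blpj] bounded_linear.has_derivative[OF blKQ] D that has_derivative_ident)
 have cont: "continuous_on U f'"
 proof (rule continuous_on_blinfun_componentwise)
  fix i :: "real^'n" assume "i \<in> Basis"
  have "continuous_on U (\<lambda>x. pj J i + K (Q (D x i)))"
   unfolding D_def
   by (intro continuous_intros bounded_linear.continuous_on[OF blKQ] C_inf_on_continuous C_inf_on_derivative U(4))
  thus "continuous_on U (\<lambda>x. blinfun_apply (f' x) i)"
   by (rule continuous_on_eq) (simp add: f'_apply)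
 qed
 have "inj (blinfun_apply (f' x0))"
 proof (rule linear_injective_0[THEN iffD2, rule_format])
  show "linear (blinfun_apply (f' x0))" by (rule bounded_linear.linear[OF blinfun.bounded_linear_right])
  fix v assume "blinfun_apply (f' x0) v = 0"
  hence 0: "pj J v + K v = 0" by (simp add: f'_apply[OF U(1)] QD)
  from arg_cong[OF this, of "pj J"] have 1: "pj J v = 0" by (simp add: JK(6))
  with 0 JK(5)[OF 1] show "v = 0" by simp
 qed
 then obtain Bi where Bi: "linear Bi" "Bi \<circ> blinfun_apply (f' x0) = id"
  using linear_injective_left_inverse[OF bounded_linear.linear[OF blinfun.bounded_linear_right]] by blast
 have blBi: "bounded_linear Bi" using Bi(1) linear_conv_bounded_linear by blast
 have inv: "Blinfun Bi o\<^sub>L f' x0 = id_blinfun"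
  using Bi(2) by (intro blinfun_eqI) (simp add: bounded_linear_Blinfun_apply[OF blBi] fun_eq_iff)
 obtain U' V' g g' where U': "open U'" "U' \<subseteq> U" "x0 \<in> U'" "open V'" "\<Xi> x0 \<in> V'" "homeomorphism U' V' \<Xi> g"
    "\<And>y. y \<in> V' \<Longrightarrow> (g has_derivative (g' y)) (at y)"
    "\<And>y. y \<in> V' \<Longrightarrow> bij (blinfun_apply (f'(g y)))"
  by (rule inverse_function_theorem[OF U(2) der cont U(1) inv]) blast+
 obtain KB where KB: "KB > 0" "\<And>v. norm (Bi v) \<le> norm v * KB" using bounded_linear.pos_bounded[OF blBi] by blast
 obtain e where e: "e > 0" "ball x0 e \<subseteq> U" "\<And>x. x \<in> ball x0 e \<Longrightarrow> norm (f' x - f' x0) \<le> 1 / (2 * KB)"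
 proof -
  have "isCont f' x0" using cont U(1,2) by (simp add: continuous_on_eq_continuous_at)
  then obtain e1 where e1: "e1 > 0" "\<And>x. dist x x0 < e1 \<Longrightarrow> dist (f' x) (f' x0) < 1 / (2 * KB)"
   unfolding continuous_at_eps_delta using KB(1) by (metis divide_pos_pos mult_pos_pos zero_less_numeral zero_less_one)
  obtain e2 where e2: "e2 > 0" "ball x0 e2 \<subseteq> U" using U(1,2) by (meson open_contains_ball)
  show ?thesis
  proof (rule that[of "min e1 e2"])
   show "ball x0 (min e1 e2) \<subseteq> U" using e2 by auto
   fix x assume "x \<in> ball x0 (min e1 e2)"
   hence "dist x x0 < e1" by (simp add: dist_commute)
   from e1(2)[OF this] show "norm (f' x - f' x0) \<le> 1 / (2 * KB)" by (simp add: dist_norm)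
  qed (use e1 e2 in simp)
 qed
 \<comment> \<open>Quantitative injectivity, which makes the inverse Lipschitz: \<open>Bi\<close>
   composed with \<open>\<Xi>\<close> differs from the identity by a map with Lipschitz constant
   1/2.\<close>
 have low: "norm (x - y) \<le> 2 * KB * norm (\<Xi> x - \<Xi> y)" if xy: "x \<in> ball x0 e" "y \<in> ball x0 e" for x y
 proof -
  have "norm ((Bi (\<Xi> x) - x) - (Bi (\<Xi> y) - y)) \<le> 1/2 * norm (x - y)"
  proof (rule differentiable_bound[OF convex_ball _ _ xy])
   fix z assume z: "z \<in> ball x0 e"
   hence zU: "z \<in> U" using e by blast
   show "((\<lambda>x. Bi (\<Xi> x) - x) has_derivative (\<lambda>v. Bi (blinfun_apply (f' z) v) - v)) (at z within ball x0 e)"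
    by (intro has_derivative_diff has_derivative_ident bounded_linear.has_derivative[OF blBi] has_derivative_at_withinI[OF der[OF zU]])
   show "onorm (\<lambda>v. Bi (blinfun_apply (f' z) v) - v) \<le> 1/2"
   proof (rule onorm_le)
    fix v
    have "Bi (blinfun_apply (f' x0) v) = v" using Bi(2) by (simp add: fun_eq_iff)
    hence "Bi (blinfun_apply (f' z) v) - v = Bi (blinfun_apply (f' z - f' x0) v)"
     by (simp add: blinfun.diff_left linear_diff[OF Bi(1)])
    also have "norm \<dots> \<le> norm (blinfun_apply (f' z - f' x0) v) * KB" by (rule KB)
    also have "\<dots> \<le> ((1 / (2 * KB)) * norm v) * KB"
     using KB(1) norm_blinfun[of "f' z - f' x0" v] mult_right_mono[OF e(3)[OF z], of "norm v"]
     by (intro mult_right_mono) auto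
    finally show "norm (Bi (blinfun_apply (f' z) v) - v) \<le> 1/2 * norm v" using KB(1) by simp
   qed
  qed
  hence "norm (x - y) \<le> 2 * norm (Bi (\<Xi> x) - Bi (\<Xi> y))"
   using norm_triangle_ineq2[of "x - y" "Bi (\<Xi> x) - Bi (\<Xi> y)"]
   by (simp add: algebra_simps norm_minus_commute)
  also have "\<dots> \<le> 2 * (norm (\<Xi> x - \<Xi> y) * KB)" using KB(2)[of "\<Xi> x - \<Xi> y"] by (simp add: linear_diff[OF Bi(1)])
  finally show ?thesis by (simp add: mult_ac)
 qed
 have \<Xi>V: "\<Xi> x = pj J x" if "x \<in> U" "x \<in> V" for x
 proof -
  have "\<phi> x \<in> L" using U(11) that by blast
  hence "K (Q (\<phi> x)) = 0" unfolding T_def[symmetric] by (intro JK(3)) (simp add: T_def)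
  thus ?thesis by (simp add: \<Xi>_def)
 qed
 \<comment> \<open>The converse: \<open>K\<close> vanishes only on the tangent space, so a point
   whose image lies in the coordinate subspace has \<open>\<phi> x\<close> in
   \<open>L\<close>.\<close>
 have V\<Xi>: "x \<in> V" if "x \<in> U" "pj J (\<Xi> x) = \<Xi> x" for x
 proof -
  have "K (Q (\<phi> x)) = 0" using that(2) by (simp add: \<Xi>_def JK(6))
  hence "Q (\<phi> x) \<in> Q ` L" using JK(4)[of "Q (\<phi> x)"] by (simp add: T_def)
  hence "\<phi> x \<in> L" using injQ by (metis inj_image_mem_iff)
  hence "\<phi> x \<in> \<phi> ` (U \<inter> V)" using U(6,11) that(1) by blast
  thus "x \<in> V" using U(7) that(1) by (metis IntD1 IntD2 imageE)
 qed
 define b0 where "b0 = pj J x0"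
 have b0: "\<Xi> x0 = b0" unfolding b0_def by (rule \<Xi>V[OF U(1) x0])
 have gh: "\<And>z. z \<in> V' \<Longrightarrow> g z \<in> U' \<and> \<Xi> (g z) = z" "\<And>x. x \<in> U' \<Longrightarrow> g (\<Xi> x) = x" "continuous_on V' g"
  using U'(6) unfolding homeomorphism_def by auto
 obtain r where r: "r > 0" "ball b0 r \<subseteq> V'" "\<And>z. z \<in> ball b0 r \<Longrightarrow> g z \<in> ball x0 e"
 proof -
  have "isCont g b0" using gh(3) U'(4,5) b0 by (simp add: continuous_on_eq_continuous_at)
  moreover have "g b0 = x0" using gh(2)[OF U'(3)] b0 by simp
  ultimately obtain r1 where r1: "r1 > 0" "\<And>z. dist z b0 < r1 \<Longrightarrow> dist (g z) x0 < e"
   unfolding continuous_at_eps_delta using e(1) by metis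
  obtain r2 where r2: "r2 > 0" "ball b0 r2 \<subseteq> V'" using U'(4,5) b0 by (metis open_contains_ball)
  show ?thesis by (rule that[of "min r1 r2"]) (use r1 r2 in \<open>auto simp: dist_commute\<close>)
 qed
 obtain \<rho> where \<rho>: "\<rho> > 0" "\<rho> \<le> r" "ball x0 \<rho> \<subseteq> U'"
 proof -
  obtain r2 where r2: "r2 > 0" "ball x0 r2 \<subseteq> U'" using U'(1,3) by (meson open_contains_ball)
  show ?thesis by (rule that[of "min r2 r"]) (use r2 r in auto)
 qed
 have dom: "norm (pj J (z - x0)) < r \<longleftrightarrow> pj J z \<in> ball b0 r" for z
  by (simp add: b0_def dist_norm norm_minus_commute)
 \<comment> \<open>Outside the domain the value is arbitrary; a constant keeps \<open>\<Phi>\<close>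
   Borel.\<close>
 define \<Phi> where "\<Phi> z = (if pj J z \<in> ball b0 r then g (pj J z) else x0)" for z
 have cg: "continuous_on (ball b0 r) g" using gh(3) r(2) continuous_on_subset by blast
 have glip: "norm (g z - g z') \<le> 2 * KB * norm (z - z')" if "z \<in> ball b0 r" "z' \<in> ball b0 r" for z z'
  using low[OF r(3)[OF that(1)] r(3)[OF that(2)]] gh(1) r(2) that by (metis subsetD)
 have op: "open (pj J -` ball b0 r)"
  by (intro open_vimage open_ball linear_continuous_on blpj)
 have "graph_chart V x0 J \<Phi> r (2 * KB)"
  unfolding graph_chart_def
 proof (intro conjI allI impI)
  show "\<Phi> \<in> borel_measurable borel"
  proof -
   have "continuous_on (pj J -` ball b0 r) (\<lambda>z. g (pj J z))"
    by (rule continuous_on_compose2[OF cg]) (auto intro!: continuous_intros)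
   from borel_measurable_continuous_on_if[OF _ this continuous_on_const[of _ x0]] op
   show ?thesis unfolding \<Phi>_def[abs_def] by (simp add: borel_open)
  qed
  show "\<exists>\<rho>. 0 < \<rho> \<and> \<rho> \<le> r \<and> (\<forall>y\<in>V. norm (y - x0) < \<rho> \<longrightarrow> \<Phi> y = y)"
  proof (intro exI[of _ \<rho>] conjI ballI impI \<rho>(1,2))
   fix y assume y: "y \<in> V" "norm (y - x0) < \<rho>"
   hence yU: "y \<in> U'" using \<rho>(3) by (auto simp: dist_norm norm_minus_commute)
   have "norm (pj J (y - x0)) < r" using norm_pj_le[of J "y - x0"] y(2) \<rho>(2) by linarith
   hence "pj J y \<in> ball b0 r" by (simp only: dom)
   thus "\<Phi> y = y" using gh(2)[OF yU] \<Xi>V[of y] y(1) yU U'(2) by (auto simp: \<Phi>_def)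
  qed
 next
  fix z z' assume "norm (pj J (z - x0)) < r" "norm (pj J (z' - x0)) < r"
  hence "pj J z \<in> ball b0 r" "pj J z' \<in> ball b0 r" by (simp_all only: dom)
  with glip[OF this] show "norm (\<Phi> z - \<Phi> z') \<le> 2 * KB * norm (pj J (z - z'))" by (simp add: \<Phi>_def)
 next
  fix z assume "norm (pj J (z - x0)) < r"
  hence z: "pj J z \<in> ball b0 r" by (simp only: dom)
  have \<Phi>z: "\<Phi> z = g (pj J z)" using z by (simp add: \<Phi>_def)
  have zV: "pj J z \<in> V'" using z r(2) by blast
  from gh(1)[OF zV] have gz: "g (pj J z) \<in> U'" "\<Xi> (g (pj J z)) = pj J z" by auto
  hence gU: "g (pj J z) \<in> U" using U'(2) by blast
  show \<Phi>V: "\<Phi> z \<in> V" unfolding \<Phi>z by (rule V\<Xi>[OF gU]) (simp add: gz(2))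
  show "pj J (\<Phi> z) = pj J z" using \<Xi>V[OF gU] gz(2) \<Phi>V unfolding \<Phi>z by simp
  fix i
  obtain r' where r': "r' > 0" "ball (pj J z) r' \<subseteq> ball b0 r" using z by (metis open_ball open_contains_ball)
  have "inj (blinfun_apply (f' (g (pj J z))))" using U'(8)[OF zV] by (rule bij_is_inj)
  then obtain B where B: "linear B" "B \<circ> blinfun_apply (f' (g (pj J z))) = id"
   using linear_injective_left_inverse[OF bounded_linear.linear[OF blinfun.bounded_linear_right]] by blast
  have "peano (\<lambda>z. g z $ i) (pj J z)"
  proof (rule peano_inverse[OF _ der[OF gU] B(1) _ r'(1)])
   show "peano (\<lambda>x. \<Xi> x $ i) (g (pj J z))" for i
   proof -
    have "pfun UNIV 1 (\<lambda>x. pj J x $ i)"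
     using pfun_var[of i UNIV] pfun_const by (cases "i \<in> J") auto
    moreover have "K (Q (\<phi> x)) $ i = (\<Sum>j\<in>UNIV. (K (Q (axis j 1)) $ i) * \<phi> x $ j)" for x
     by (rule linear_component[OF linKQ])
    ultimately show ?thesis
     unfolding \<Xi>_def vector_add_component
     by (simp only:) (intro peano_add peano_pfun[of 1] peano_sum peano_cmult C_inf_on_peano[OF U(4) gU])
   qed
   show "B (blinfun_apply (f' (g (pj J z))) v) = v" for v using B(2) by (simp add: fun_eq_iff)
   fix w assume "norm (w - pj J z) < r'"
   hence w: "w \<in> ball b0 r" using r'(2) by (auto simp: dist_norm norm_minus_commute)
   show "\<Xi> (g w) = w \<and> norm (g w - g (pj J z)) \<le> 2 * KB * norm (w - pj J z)"
    using glip[OF w z] gh(1)[of w] r(2) w by blast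
  qed
  from peano_pj[OF this] have p: "peano (\<lambda>z. g (pj J z) $ i) z" .
  show "peano (\<lambda>z. \<Phi> z $ i) z"
  proof (rule peano_cong[OF p r'(1)])
   fix x assume "norm (x - z) < r'"
   hence "norm (pj J x - pj J z) < r'" using norm_pj_le[of J "x - z"] by simp
   hence "pj J x \<in> ball b0 r" using r'(2) by (auto simp: dist_norm norm_minus_commute)
   thus "\<Phi> x $ i = g (pj J x) $ i" by (simp add: \<Phi>_def)
  qed
 qed (use r KB in auto)
 with JK(1) dT show ?thesis using that by simp
qed

text \<open>The set is a cylinder over the image of a piece of \<open>V\<close> in the coordinates
  \<open>I\<close>. It is a Lipschitz image of the coordinates in \<open>J\<close> together with
  those outside \<open>I\<close>; these are too few to fill the space, so they fit into a coordinate
  hyperplane, which is null.\<close>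

lemma graph_chart_projection_negligible:
 fixes V :: "(real^'n) set"
 assumes ch: "graph_chart V x0 J \<Phi> r M" and cI: "card I > card J"
 obtains \<rho> where "\<rho> > 0" "negligible {u. \<exists>y\<in>V. norm (y - x0) < \<rho> \<and> (\<forall>i\<in>I. y $ i = u $ i)}"
proof -
 have M: "M > 0" and
  lip: "\<And>z z'. norm (pj J (z - x0)) < r \<Longrightarrow> norm (pj J (z' - x0)) < r \<Longrightarrow> norm (\<Phi> z - \<Phi> z') \<le> M * norm (pj J (z - z'))"
  using ch unfolding graph_chart_def by blast+
 obtain \<rho> where \<rho>: "0 < \<rho>" "\<rho> \<le> r" "\<And>y. y \<in> V \<Longrightarrow> norm (y - x0) < \<rho> \<Longrightarrow> \<Phi> y = y"
  using ch unfolding graph_chart_def by blast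
 have cc: "card (- I) < card (- J)"
 proof -
  have "card I \<le> CARD('n)" by (rule card_mono) auto
  thus ?thesis using cI by (simp add: Compl_eq_Diff_UNIV card_Diff_subset)
 qed
 then obtain \<beta> where \<beta>: "inj_on \<beta> (- I)" "\<beta> ` (- I) \<subseteq> - J"
  using card_le_inj[of "- I" "- J"] by auto
 have "card (\<beta> ` (- I)) < card (- J)" using cc card_image[OF \<beta>(1)] by simp
 \<comment> \<open>A coordinate that carries no parameter: it is neither in \<open>J\<close> nor
   used to store a coordinate outside \<open>I\<close>.\<close>
 then obtain j' where j': "j' \<notin> J" "j' \<notin> \<beta> ` (- I)" using \<beta>(2) by (metis ComplI Compl_iff card_mono finite not_le subsetI)
 define S where "S = {z :: real^'n. z $ j' = 0 \<and> norm (pj J (z - x0)) < r}"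
 define h where "h z = (\<chi> i. if i \<in> I then \<Phi> z $ i else z $ \<beta> i)" for z
 have "negligible {x :: real^'n. x \<bullet> axis j' 1 = 0}" by (rule negligible_standard_hyperplane) simp
 hence nS: "negligible S" by (rule negligible_subset) (auto simp: S_def inner_axis)
 have hlip: "norm (h z - h z') \<le> (real CARD('n) * (M + 1)) * norm (z - z')" if "z \<in> S" "z' \<in> S" for z z'
 proof -
  have "norm ((h z - h z') $ i) \<le> (M + 1) * norm (z - z')" for i
  proof (cases "i \<in> I")
   case True
   have "norm ((h z - h z') $ i) \<le> norm (\<Phi> z - \<Phi> z')"
    using True component_le_norm_cart[of "\<Phi> z - \<Phi> z'" i] by (simp add: h_def)
   also have "\<dots> \<le> M * norm (pj J (z - z'))" using lip[of z z'] that by (simp add: S_def)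
   also have "\<dots> \<le> (M + 1) * norm (z - z')" using M norm_pj_le[of J "z - z'"] by (intro mult_mono) auto
   finally show ?thesis .
  next
   case False
   have "norm ((h z - h z') $ i) \<le> 1 * norm (z - z')"
    using False component_le_norm_cart[of "z - z'" "\<beta> i"] by (simp add: h_def)
   also have "\<dots> \<le> (M + 1) * norm (z - z')" using M by (intro mult_right_mono) auto
   finally show ?thesis .
  qed
  hence "(\<Sum>i\<in>UNIV. norm ((h z - h z') $ i)) \<le> (\<Sum>i\<in>(UNIV::'n set). (M + 1) * norm (z - z'))" by (intro sum_mono)
  thus ?thesis using norm_le_l1_cart[of "h z - h z'"] by simp
 qed
 have "negligible (h ` S)"
 proof (rule negligible_locally_Lipschitz_image[OF order_refl nS])
  fix x assume "x \<in> S"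
  thus "\<exists>T B. open T \<and> x \<in> T \<and> (\<forall>y\<in>S \<inter> T. norm (h y - h x) \<le> B * norm (y - x))"
   using hlip by (intro exI[of _ UNIV] exI[of _ "real CARD('n) * (M + 1)"]) auto
 qed
 moreover have "{u. \<exists>y\<in>V. norm (y - x0) < \<rho> \<and> (\<forall>i\<in>I. y $ i = u $ i)} \<subseteq> h ` S"
 proof
  fix u assume "u \<in> {u. \<exists>y\<in>V. norm (y - x0) < \<rho> \<and> (\<forall>i\<in>I. y $ i = u $ i)}"
  then obtain y where y: "y \<in> V" "norm (y - x0) < \<rho>" "\<And>i. i \<in> I \<Longrightarrow> y $ i = u $ i" by blast
  \<comment> \<open>The coordinates in \<open>J\<close> of the point of \<open>V\<close>, the
    coordinates of \<open>u\<close> outside \<open>I\<close> stored at the places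
    \<open>\<beta> i\<close>, and 0 in the spare places.\<close>
  define z where "z = (\<chi> l. if l \<in> J then y $ l else if l \<in> \<beta> ` (- I) then u $ (inv_into (- I) \<beta> l) else 0)"
  have pz: "pj J z = pj J y" by (simp add: vec_eq_iff z_def)
  have yr: "norm (pj J (y - x0)) < r" using norm_pj_le[of J "y - x0"] y(2) \<rho>(2) by linarith
  hence zr: "norm (pj J (z - x0)) < r" using pz by simp
  have "\<Phi> z = y" using lip[OF zr yr] \<rho>(3)[OF y(1,2)] pz by simp
  moreover have "z $ \<beta> i = u $ i" if "i \<notin> I" for i
   using that \<beta> by (auto simp: z_def inv_into_f_f)
  ultimately have "h z = u" using y(3) by (auto simp: vec_eq_iff h_def)
  moreover have "z \<in> S" using zr j' by (simp add: S_def z_def)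
  ultimately show "u \<in> h ` S" by blast
 qed
 ultimately show ?thesis using that \<rho>(1) negligible_subset by blast
qed

lemma submanifold_projection_negligible:
 fixes V :: "(real^'n) set"
 assumes V: "compact V" "smooth_submanifold d V" and cI: "card I > d"
 shows "negligible {u. \<exists>y\<in>V. \<forall>i\<in>I. y $ i = u $ i}"
proof -
 define N where "N x \<rho> = {u. \<exists>y\<in>V. norm (y - x) < \<rho> \<and> (\<forall>i\<in>I. y $ i = u $ i)}" for x \<rho>
 have "\<exists>\<rho>. \<rho> > 0 \<and> negligible (N x \<rho>)" if x: "x \<in> V" for x
 proof -
  obtain J \<Phi> r M where "card J = d" "graph_chart V x J \<Phi> r M"
   by (rule smooth_submanifold_graph_chart[OF V(2) x])
  moreover from this have "card J < card I" using cI by simp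
  ultimately obtain \<rho> where "\<rho> > 0" "negligible {u. \<exists>y\<in>V. norm (y - x) < \<rho> \<and> (\<forall>i\<in>I. y $ i = u $ i)}"
   by (auto elim: graph_chart_projection_negligible)
  thus ?thesis unfolding N_def by blast
 qed
 then obtain \<rho> where \<rho>: "\<And>x. x \<in> V \<Longrightarrow> \<rho> x > 0" "\<And>x. x \<in> V \<Longrightarrow> negligible (N x (\<rho> x))" by metis
 have "V \<subseteq> (\<Union>x\<in>V. ball x (\<rho> x))" using \<rho>(1) by force
 then obtain F where F: "F \<subseteq> V" "finite F" "V \<subseteq> (\<Union>x\<in>F. ball x (\<rho> x))"
  by (rule compactE_image[OF V(1), of V "\<lambda>x. ball x (\<rho> x)", rotated]) auto
 have "{u. \<exists>y\<in>V. \<forall>i\<in>I. y $ i = u $ i} \<subseteq> (\<Union>x\<in>F. N x (\<rho> x))"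
 proof
  fix u assume "u \<in> {u. \<exists>y\<in>V. \<forall>i\<in>I. y $ i = u $ i}"
  then obtain y where y: "y \<in> V" "\<forall>i\<in>I. y $ i = u $ i" by blast
  then obtain x where "x \<in> F" "y \<in> ball x (\<rho> x)" using F(3) by blast
  thus "u \<in> (\<Union>x\<in>F. N x (\<rho> x))" using y unfolding N_def by (auto simp: dist_norm norm_minus_commute)
 qed
 moreover have "negligible (\<Union>x\<in>F. N x (\<rho> x))" using F(1,2) \<rho>(2) by (intro negligible_Union) auto
 ultimately show ?thesis by (rule negligible_subset[rotated])
qed

text \<open>The sum of squares makes \<open>V\<close> the set of minima of one polynomial, as the
  variational elimination requires.\<close>

lemma algebraic_set_single_equation:
 assumes "algebraic_set V"
 obtains g q where "pfun UNIV g q" "\<And>x. q x \<ge> (0::real)" "V = {x. q x = 0}"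
proof -
 obtain Q where Q: "finite Q" "\<And>q. q \<in> Q \<Longrightarrow> is_polynomial q" "V = {x. \<forall>q\<in>Q. q x = 0}"
  using assms unfolding algebraic_set_def by blast
 have "\<exists>g. pfun UNIV g (\<lambda>x. \<Sum>q\<in>Q. (q x)\<^sup>2)"
  using Q(1,2)
 proof (induction Q)
  case empty
  show ?case using pfun_const[of UNIV 0 0] by auto
 next
  case (insert q Q)
  then obtain g where g: "pfun UNIV g (\<lambda>x. \<Sum>q\<in>Q. (q x)\<^sup>2)" by auto
  obtain k where "pfun UNIV k q" using insert.prems[of q] unfolding is_polynomial_def poly_fun_pfun by auto
  from pfun_power[OF this, of 2] have q2: "pfun UNIV (2 * k) (\<lambda>x. (q x)\<^sup>2)" .
  have "pfun UNIV (max g (2 * k)) (\<lambda>x. (q x)\<^sup>2 + (\<Sum>q\<in>Q. (q x)\<^sup>2))"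
   by (rule pfun_add; (rule pfun_mono[OF g] pfun_mono[OF q2]); simp)
  thus ?case using insert.hyps by auto
 qed
 then obtain g where "pfun UNIV g (\<lambda>x. \<Sum>q\<in>Q. (q x)\<^sup>2)" by blast
 thus ?thesis
  by (rule that) (use Q in \<open>auto intro!: sum_nonneg simp: sum_nonneg_eq_0_iff\<close>)
qed

text \<open>A null set contains no ball, so points off the projection come arbitrarily close to
  every point of \<open>V\<close>. This permits elimination for \<open>J\<close> and any one further
  coordinate.\<close>

lemma algebraic_submanifold_relation:
 fixes V :: "(real^'n) set"
 assumes V: "compact V" "algebraic_submanifold d V" and J: "card J = d"
 obtains D C :: nat where "\<And>k p. k \<ge> 1 \<Longrightarrow> pfun UNIV k p \<Longrightarrow>
   \<exists>b. (\<forall>i. pfun J (C * k) (b i)) \<and> (\<exists>i\<le>D. \<exists>x. b i x \<noteq> 0) \<and> (\<forall>x\<in>V. (\<Sum>i\<le>D. b i x * p x ^ i) = 0)"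
proof -
 obtain g q where q: "pfun UNIV g q" "\<And>x. q x \<ge> (0::real)" "V = {x. q x = 0}"
  using V(2) unfolding algebraic_submanifold_def by (auto elim: algebraic_set_single_equation)
 have sm: "smooth_submanifold d V" using V(2) by (simp add: algebraic_submanifold_def)
 have "\<exists>K a. pfun (insert j J) K a \<and> (\<exists>x. a x \<noteq> (0::real)) \<and> (\<forall>x\<in>V. a x = 0)" if j: "j \<notin> J" for j
 proof -
  have thin: "\<exists>u. dist u x < \<delta> \<and> (\<forall>y\<in>V. \<exists>i\<in>insert j J. y $ i \<noteq> u $ i)" if "\<delta> > 0" for x \<delta>
  proof (rule ccontr)
   assume n: "\<not> ?thesis"
   have "ball x \<delta> \<subseteq> {u. \<exists>y\<in>V. \<forall>i\<in>insert j J. y $ i = u $ i}"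
    using n by (auto simp: dist_commute)
   moreover have "negligible {u. \<exists>y\<in>V. \<forall>i\<in>insert j J. y $ i = u $ i}"
    by (rule submanifold_projection_negligible[OF V(1) sm]) (use j J in simp)
   ultimately have "negligible (ball x \<delta>)" by (rule negligible_subset[rotated])
   thus False using that open_not_negligible[of "ball x \<delta>"] by simp
  qed
  obtain K a where "pfun (insert j J) K a" "\<exists>x. a x \<noteq> (0::real)" "\<And>x. x \<in> V \<Longrightarrow> a x = 0"
   by (rule algebraic_relation_on_projection[OF q V(1) thin]) auto
  thus ?thesis by blast
 qed
 thus ?thesis by (rule uniform_algebraic_relation[OF _ that])
qed

text \<open>Each coordinate is a polynomial of degree 1, so on \<open>V\<close> it is algebraic over
  the coordinates in \<open>J\<close>; composed with the chart it is a function to which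
  \<open>analytic_extension\<close> applies.\<close>

lemma algebraic_chart:
 fixes V :: "(real^'n) set"
 assumes V: "compact V" "algebraic_submanifold d V" and ch: "graph_chart V x0 J \<Phi> r M" and J: "card J = d"
 obtains \<rho> where "\<rho> > 0" "\<And>a v. norm a \<le> \<rho> \<Longrightarrow> norm v \<le> \<rho> \<Longrightarrow>
   \<exists>W. (\<forall>i. (\<lambda>s. W s i) holomorphic_on ball 0 2) \<and>
    (\<forall>s::real. \<bar>s\<bar> \<le> 1 \<longrightarrow> W (complex_of_real s) = (\<lambda>i. complex_of_real (\<Phi> (pj J x0 + a + s *\<^sub>R v) $ i)))"
proof -
 obtain D C where DC: "\<And>k p. k \<ge> 1 \<Longrightarrow> pfun UNIV k p \<Longrightarrow>
   \<exists>b. (\<forall>i. pfun J (C * k) (b i)) \<and> (\<exists>i\<le>D. \<exists>x. b i x \<noteq> 0) \<and> (\<forall>x\<in>V. (\<Sum>i\<le>D. b i x * p x ^ i) = 0)"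
  by (rule algebraic_submanifold_relation[OF V J]) blast
 have r: "r > 0" and \<Phi>: "\<And>z. norm (pj J (z - x0)) < r \<Longrightarrow> \<Phi> z \<in> V \<and> pj J (\<Phi> z) = pj J z \<and> (\<forall>i. peano (\<lambda>z. \<Phi> z $ i) z)"
  using ch unfolding graph_chart_def by blast+
 have dom: "norm (pj J (pj J x0 + z - x0)) < r" if "norm z < r" for z
  using norm_pj_le[of J z] that by (simp add: pj_pj)
 define ext where "ext i a v \<longleftrightarrow> (\<exists>W. W holomorphic_on ball 0 2 \<and> (\<forall>s::real. \<bar>s\<bar> \<le> 1 \<longrightarrow> W (complex_of_real s) = complex_of_real (\<Phi> (pj J x0 + (a + s *\<^sub>R v)) $ i)))" for i a v
 have "\<exists>\<rho>. \<rho> > 0 \<and> (\<forall>a v. norm a \<le> \<rho> \<longrightarrow> norm v \<le> \<rho> \<longrightarrow> ext i a v)" for i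
 proof -
  obtain b where b: "\<And>l. pfun J (C * 1) (b l)" "\<exists>l\<le>D. \<exists>x. b l x \<noteq> 0" "\<And>x. x \<in> V \<Longrightarrow> (\<Sum>l\<le>D. b l x * (x $ i) ^ l) = 0"
   using DC[OF order_refl pfun_var[OF UNIV_I], of i] by blast
  define B where "B l z = b l (pj J x0 + z)" for l z
  have vshift: "pfun UNIV 1 (\<lambda>x. (c + x) $ l)" for l and c :: "real^'n"
   unfolding vector_add_component by (intro pfun_add pfun_const pfun_var) simp
  have Bp: "pfun UNIV (C * 1 * 1) (B l)" for l
   unfolding B_def[abs_def] by (rule pfun_comp[OF b(1) vshift])
  have Bnz: "\<exists>l\<le>D. \<exists>x. B l x \<noteq> 0"
  proof -
   obtain l x where "l \<le> D" "b l x \<noteq> 0" using b(2) by blast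
   thus ?thesis by (intro exI[of _ l] conjI exI[of _ "x - pj J x0"]) (auto simp: B_def)
  qed
  have tay: "\<exists>k T. pfun UNIV k T \<and> small a N (\<lambda>x. \<Phi> (pj J x0 + x) $ i - T x)" if "norm a < r" for a N
  proof -
   have "peano (\<lambda>z. \<Phi> z $ i) (pj J x0 + a)" using \<Phi>[OF dom[OF that]] by blast
   then obtain k T where T: "pfun UNIV k T" "small (pj J x0 + a) N (\<lambda>x. \<Phi> x $ i - T x)" unfolding peano_def by blast
   have "small a N (\<lambda>x. \<Phi> (pj J x0 + x) $ i - T (pj J x0 + x))"
   proof -
    obtain C \<delta> where C: "C \<ge> 0" "\<delta> > 0" "\<And>x. norm (x - (pj J x0 + a)) < \<delta> \<Longrightarrow> norm (\<Phi> x $ i - T x) \<le> C * norm (x - (pj J x0 + a)) ^ N"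
     by (rule smallE[OF T(2)]) blast
    show ?thesis unfolding small_def
     by (rule exI[of _ C], rule exI[of _ \<delta>]) (use C(2) C(3)[of "pj J x0 + _"] in auto)
   qed
   with pfun_comp[OF T(1) vshift] show ?thesis by blast
  qed
  have rel: "(\<Sum>l\<le>D. B l z * (\<Phi> (pj J x0 + z) $ i) ^ l) = 0" if "norm z < r" for z
  proof -
   note P = \<Phi>[OF dom[OF that]]
   have "b l (pj J x0 + z) = b l (\<Phi> (pj J x0 + z))" for l
   proof (rule pfun_cong[OF b(1)])
    fix j assume "j \<in> J"
    thus "(pj J x0 + z) $ j = \<Phi> (pj J x0 + z) $ j"
     using arg_cong[OF conjunct1[OF conjunct2[OF P]], of "\<lambda>w. w $ j"] by simp
   qed
   thus ?thesis using b(3) P by (simp add: B_def)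
  qed
  show ?thesis
  proof (rule analytic_extension[where f = "\<lambda>z. \<Phi> (pj J x0 + z) $ i", OF r tay Bp Bnz rel])
   fix \<rho> :: real
   assume *: "\<rho> > 0" "\<And>a v. norm a \<le> \<rho> \<Longrightarrow> norm v \<le> \<rho> \<Longrightarrow>
    \<exists>W. W holomorphic_on ball 0 2 \<and> (\<forall>s::real. \<bar>s\<bar> \<le> 1 \<longrightarrow> W (complex_of_real s) = complex_of_real (\<Phi> (pj J x0 + (a + s *\<^sub>R v)) $ i))"
   show ?thesis unfolding ext_def by (intro exI[of _ \<rho>] conjI allI impI *)
  qed
 qed
 hence "\<forall>i. \<exists>\<rho>. \<rho> > 0 \<and> (\<forall>a v. norm a \<le> \<rho> \<longrightarrow> norm v \<le> \<rho> \<longrightarrow> ext i a v)" ..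
 from choice[OF this] obtain \<rho> where "\<forall>i. \<rho> i > 0 \<and> (\<forall>a v. norm a \<le> \<rho> i \<longrightarrow> norm v \<le> \<rho> i \<longrightarrow> ext i a v)" ..
 hence \<rho>: "\<rho> i > 0" "norm a \<le> \<rho> i \<Longrightarrow> norm v \<le> \<rho> i \<Longrightarrow> ext i a v" for i a v by simp_all
 define \<rho>m where "\<rho>m = Min (range \<rho>)"
 have m: "\<rho>m > 0" "\<rho>m \<le> \<rho> i" for i unfolding \<rho>m_def using \<rho>(1) by auto
 show ?thesis
 proof (rule that[OF m(1)])
  fix a v :: "real^'n" assume av: "norm a \<le> \<rho>m" "norm v \<le> \<rho>m"
  have "\<forall>i. ext i a v" using \<rho>(2) m(2) av by (meson order_trans)
  from choice[OF this[unfolded ext_def]] obtain W where W: "\<forall>i. W i holomorphic_on ball 0 2 \<and> (\<forall>s::real. \<bar>s\<bar> \<le> 1 \<longrightarrow> W i (complex_of_real s) = complex_of_real (\<Phi> (pj J x0 + (a + s *\<^sub>R v)) $ i))" ..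
  show "\<exists>W. (\<forall>i. (\<lambda>s. W s i) holomorphic_on ball 0 2) \<and>
    (\<forall>s::real. \<bar>s\<bar> \<le> 1 \<longrightarrow> W (complex_of_real s) = (\<lambda>i. complex_of_real (\<Phi> (pj J x0 + a + s *\<^sub>R v) $ i)))"
   by (rule exI[of _ "\<lambda>s i. W i s"]) (use W in \<open>auto simp: add.assoc\<close>)
 qed
qed

section \<open>Logarithmic bounds on balls\<close>

text \<open>The value infinity on the zero set corrects the junk value of \<^term>\<open>ln (0::real)\<close>.\<close>

definition log_gap :: "real \<Rightarrow> (real^'n \<Rightarrow> real) \<Rightarrow> real^'n \<Rightarrow> ennreal" where
 "log_gap a p y = (if p y = 0 then \<infinity> else ennreal (a - ln \<bar>p y\<bar>))"

lemma log_gap_measurable: "pfun UNIV k p \<Longrightarrow> log_gap a p \<in> borel_measurable borel"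
 unfolding log_gap_def[abs_def] by (intro measurable_If) (auto intro: pfun_borel pred_eq_const1)

lemma ball_in_borel: "closed V \<Longrightarrow> ball_in V y r \<in> sets borel"
proof -
 assume "closed V"
 moreover have "ball_in V y r = V \<inter> ball y r" by (auto simp: ball_in_def)
 ultimately show ?thesis by auto
qed

text \<open>The relation is known on a real segment. All its terms extend holomorphically, so the
  identity theorem gives it on the disc, where the one-variable estimate applies.\<close>

lemma polynomial_log_integral_along_curve:
 fixes F :: "real \<Rightarrow> real^'n" and P :: "nat \<Rightarrow> real poly"
 assumes W: "\<And>i. (\<lambda>s. W s i) holomorphic_on ball 0 2"
  "\<And>s. \<bar>s\<bar> \<le> 1 \<Longrightarrow> W (complex_of_real s) = (\<lambda>i. complex_of_real (F s $ i))"
  and p: "pfun UNIV k p" "p (F 0) \<noteq> 0"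
  and P: "\<And>i. degree (P i) \<le> K" "i0 \<le> D" "P i0 \<noteq> 0" "\<And>s. \<bar>s\<bar> \<le> 1 \<Longrightarrow> (\<Sum>i\<le>D. poly (P i) s * p (F s) ^ i) = 0"
 shows "(\<integral>\<^sup>+t. log_gap (ln \<bar>p (F 0)\<bar>) p (F t) * indicator {1/2..1} t \<partial>lborel) \<le> ennreal (osc_bound D K)"
proof -
 obtain pc :: "('n \<Rightarrow> complex) \<Rightarrow> complex" where
  pc: "\<And>x::real^'n. pc (\<lambda>i. complex_of_real (x $ i)) = complex_of_real (p x)"
  "\<And>W S. (\<And>i. (\<lambda>s. W s i) holomorphic_on S) \<Longrightarrow> (\<lambda>s. pc (W s)) holomorphic_on S"
  by (rule pfun_complexify[OF p(1)]) blast
 define w where "w s = pc (W s)" for s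
 have w: "w holomorphic_on ball 0 2" unfolding w_def[abs_def] by (rule pc(2)[OF W(1)])
 have ws: "w (complex_of_real s) = complex_of_real (p (F s))" if "\<bar>s\<bar> \<le> 1" for s
  unfolding w_def W(2)[OF that] by (rule pc(1))
 have w0: "w 0 = complex_of_real (p (F 0))" using ws[of 0] by simp
 have "(\<Sum>i\<le>D. poly (cpoly (P i)) z * w z ^ i) = 0" if "z \<in> ball 0 2" for z
 proof (rule analytic_continuation[of "\<lambda>z. \<Sum>i\<le>D. poly (cpoly (P i)) z * w z ^ i" "ball 0 2" "complex_of_real ` {-1..1}" 0])
  show "0 islimpt complex_of_real ` {-1..1}"
   unfolding islimpt_approachable
  proof (intro allI impI)
   fix e :: real assume "e > 0"
   thus "\<exists>x'\<in>complex_of_real ` {-1..1}. x' \<noteq> 0 \<and> dist x' 0 < e"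
    by (intro bexI[of _ "complex_of_real (min 1 (e / 2))"]) auto
  qed
  show "(\<Sum>i\<le>D. poly (cpoly (P i)) z * w z ^ i) = 0" if z: "z \<in> complex_of_real ` {-1..1}" for z
  proof -
   obtain s where s: "z = complex_of_real s" "\<bar>s\<bar> \<le> 1" using z by (auto simp: abs_le_iff)
   have "(\<Sum>i\<le>D. poly (cpoly (P i)) z * w z ^ i) = complex_of_real (\<Sum>i\<le>D. poly (P i) s * p (F s) ^ i)"
    unfolding s(1) ws[OF s(2)] by simp
   thus ?thesis using P(4)[OF s(2)] by simp
  qed
 qed (use that w in \<open>auto intro!: holomorphic_intros\<close>)
 from algebraic_function_log_integral[OF w _ _ _ this, of K] p(2) P(1-3) w0
 have "(\<integral>\<^sup>+t. (if w (complex_of_real t) = 0 then \<infinity> else ennreal (ln (norm (w 0)) - ln (norm (w (complex_of_real t)))))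
   * indicator {1/2..1} t \<partial>lborel) \<le> ennreal (osc_bound D K)" by auto
 also have "(\<integral>\<^sup>+t. (if w (complex_of_real t) = 0 then \<infinity> else ennreal (ln (norm (w 0)) - ln (norm (w (complex_of_real t)))))
   * indicator {1/2..1} t \<partial>lborel) = (\<integral>\<^sup>+t. log_gap (ln \<bar>p (F 0)\<bar>) p (F t) * indicator {1/2..1} t \<partial>lborel)"
 proof (rule nn_integral_cong)
  fix t :: real
  show "(if w (complex_of_real t) = 0 then \<infinity> else ennreal (ln (norm (w 0)) - ln (norm (w (complex_of_real t))))) * indicator {1/2..1} t
    = log_gap (ln \<bar>p (F 0)\<bar>) p (F t) * indicator {1/2..1} t"
   by (cases "t \<in> {1/2..1}") (auto simp: log_gap_def w0 ws)
 qed
 finally show ?thesis .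
qed

lemma hausdorff_outer_translate_le:
 fixes c :: "'a::real_normed_vector"
 assumes "A \<subseteq> (\<lambda>v. c + v) ` B"
 shows "hausdorff_outer d A \<le> hausdorff_outer d B"
proof -
 have "hausdorff_outer d A \<le> hausdorff_outer d ((\<lambda>v. c + v) ` B)" by (rule hausdorff_outer_mono[OF assms])
 also have "\<dots> \<le> ennreal (1 ^ d) * hausdorff_outer d B" by (rule hausdorff_outer_lipschitz_image) auto
 finally show ?thesis by simp
qed

text \<open>From a point where \<open>q\<close> is nonzero every ray meets the zero set finitely
  often, and the dilation average sees only rays. The centre is projected to the subspace of
  \<open>J\<close>, which does not change the value of \<open>q\<close>.\<close>

lemma polynomial_zeros_hausdorff_null:
 fixes q :: "real^'n \<Rightarrow> real"
 assumes q: "pfun J K q" "q x \<noteq> 0"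
 shows "hausdorff_outer (card J) {v \<in> jball J R. q v = 0} = 0"
proof -
 define c where "c = pj J x"
 have qc: "q c \<noteq> 0" using q(2) pfun_cong[OF q(1), of x c] by (simp add: c_def)
 \<comment> \<open>Large enough to contain the given ball after the shift to the new centre.\<close>
 define R' where "R' = \<bar>R\<bar> + norm c + 1"
 define g where "g v = (if q (c + v) = 0 then 1 else 0 :: ennreal)" for v
 have vshift: "pfun J 1 (\<lambda>x. (c + x) $ l)" if "l \<in> J" for l
  unfolding vector_add_component by (intro pfun_add pfun_const pfun_var that)
 have qs: "pfun J (K * 1) (\<lambda>v. q (c + v))" by (rule pfun_comp[OF q(1) vshift])
 have g[measurable]: "g \<in> borel_measurable borel"
  unfolding g_def[abs_def] using pfun_borel[OF qs] by measurable
 have S: "{v \<in> jball J R'. q (c + v) = 0} \<in> sets borel"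
  using pfun_borel[OF qs] by measurable
 have inner: "(\<integral>\<^sup>+t. g (t *\<^sub>R v) * indicator {1/2..1} t \<partial>lborel) = 0" for v
 proof -
  obtain P :: "real poly" where P: "\<And>s. poly P s = q (c + s *\<^sub>R v)" by (rule pfun_line[OF q(1)]) blast
  have "P \<noteq> 0" using P[of 0] qc by auto
  hence "finite {s. poly P s = 0}" by (rule poly_roots_finite)
  hence "{s. poly P s = 0} \<in> null_sets lborel" by (rule finite_imp_null_set_lborel)
  hence "AE s in lborel. s \<notin> {s. poly P s = 0}" by (rule AE_not_in)
  hence "AE s in lborel. g (s *\<^sub>R v) * indicator {1/2..1} s = 0" by eventually_elim (auto simp: g_def P)
  hence "(\<integral>\<^sup>+t. g (t *\<^sub>R v) * indicator {1/2..1} t \<partial>lborel) = (\<integral>\<^sup>+t. 0 \<partial>(lborel :: real measure))" by (rule nn_integral_cong_AE)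
  thus ?thesis by simp
 qed
 have "{v \<in> jball J R. q v = 0} \<subseteq> (\<lambda>v. c + v) ` {v \<in> jball J R'. q (c + v) = 0}"
 proof
  fix v assume v: "v \<in> {v \<in> jball J R. q v = 0}"
  have "norm (v - c) < R'" using v norm_triangle_ineq4[of v c] by (auto simp: R'_def jball_def)
  hence "v - c \<in> {v \<in> jball J R'. q (c + v) = 0}" using v by (auto simp: jball_def c_def)
  thus "v \<in> (\<lambda>v. c + v) ` {v \<in> jball J R'. q (c + v) = 0}" by (rule rev_image_eqI) simp
 qed
 hence "hausdorff_outer (card J) {v \<in> jball J R. q v = 0} \<le> hausdorff_outer (card J) {v \<in> jball J R'. q (c + v) = 0}"
  by (rule hausdorff_outer_translate_le)
 also have "\<dots> = (\<integral>\<^sup>+v. indicator {v \<in> jball J R'. q (c + v) = 0} v \<partial>hausdorff_measure (card J))"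
  using S by (simp add: emeasure_hausdorff[symmetric])
 also have "\<dots> = (\<integral>\<^sup>+v. g v * indicator (jball J R') v \<partial>hausdorff_measure (card J))"
  by (intro nn_integral_cong) (auto simp: g_def split: split_indicator)
 also have "\<dots> \<le> 2 * (\<integral>\<^sup>+v. (\<integral>\<^sup>+t. g (t *\<^sub>R v) * indicator {1/2..1} t \<partial>lborel) * indicator (jball J (2 * R')) v \<partial>hausdorff_measure (card J))"
  by (rule nn_integral_dilation_average[OF g]) (simp add: R'_def add_nonneg_pos)
 also have "\<dots> = 0" unfolding inner by simp
 finally show ?thesis by simp
qed

text \<open>One-sided control: \<open>a\<close> is an upper bound of the logarithm, and the integral
  of the distance below it is estimated. Unlike mean oscillation this is inherited by subsets with
  the same \<open>a\<close>.\<close>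

definition log_controlled :: "nat \<Rightarrow> (real^'n) set \<Rightarrow> real \<Rightarrow> (real^'n \<Rightarrow> real) \<Rightarrow> bool" where
 "log_controlled d B c p \<longleftrightarrow> (\<exists>a. (\<forall>y\<in>B. p y \<noteq> 0 \<longrightarrow> ln \<bar>p y\<bar> \<le> a) \<and>
   (\<integral>\<^sup>+y. log_gap a p y * indicator B y \<partial>hausdorff_measure d) \<le> ennreal c)"

lemma log_controlled_mono: "log_controlled d B c p \<Longrightarrow> c \<le> c' \<Longrightarrow> log_controlled d B c' p"
 unfolding log_controlled_def by (meson ennreal_leI order_trans)

text \<open>One constant serves as scale, as regularity constant of the measure and as logarithmic
  bound, so that uniformity over a compact set only asks for a larger \<open>E\<close>.\<close>

definition local_log_bound :: "nat \<Rightarrow> (real^'n) set \<Rightarrow> real \<Rightarrow> real^'n \<Rightarrow> bool" where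
 "local_log_bound d V E y0 \<longleftrightarrow> (\<forall>r. 0 < r \<longrightarrow> r \<le> 1 / E \<longrightarrow>
   ennreal (r ^ d / E) \<le> emeasure (hausdorff_measure d) (ball_in V y0 r) \<and>
   emeasure (hausdorff_measure d) (ball_in V y0 r) \<le> ennreal (E * r ^ d) \<and>
   (\<forall>k p. k \<ge> 1 \<longrightarrow> pfun UNIV k p \<longrightarrow> (\<exists>y\<in>ball_in V y0 r. p y \<noteq> 0) \<longrightarrow>
    log_controlled d (ball_in V y0 r) (E * real k * r ^ d) p))"

lemma local_log_bound_mono:
 assumes "local_log_bound d V E y" "0 < E" "E \<le> E'" shows "local_log_bound d V E' y"
 unfolding local_log_bound_def
proof (intro allI impI)
 fix r :: real assume r: "0 < r" "r \<le> 1 / E'"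
 have "1 / E' \<le> 1 / E" using assms by (intro divide_left_mono) auto
 hence r': "r \<le> 1 / E" using r by simp
 note * = assms(1)[unfolded local_log_bound_def, rule_format, OF r(1) r']
 have 1: "r ^ d / E' \<le> r ^ d / E" using assms r by (intro divide_left_mono) auto
 have 2: "E * r ^ d \<le> E' * r ^ d" using assms r by (intro mult_right_mono) auto
 have 3: "E * real k * r ^ d \<le> E' * real k * r ^ d" for k using assms r by (intro mult_right_mono) auto
 show "ennreal (r ^ d / E') \<le> emeasure (hausdorff_measure d) (ball_in V y r) \<and>
   emeasure (hausdorff_measure d) (ball_in V y r) \<le> ennreal (E' * r ^ d) \<and>
   (\<forall>k p. k \<ge> 1 \<longrightarrow> pfun UNIV k p \<longrightarrow> (\<exists>y\<in>ball_in V y r. p y \<noteq> 0) \<longrightarrow>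
    log_controlled d (ball_in V y r) (E' * real k * r ^ d) p)"
  using * ennreal_leI[OF 1] ennreal_leI[OF 2] log_controlled_mono[OF _ 3] by (meson order_trans)
qed

text \<open>The summand \<open>ln (D + 1)\<close> is absorbed by \<open>k \<ge> 1\<close>; for
  constants \<open>p\<close> another argument is required.\<close>

lemma osc_bound_linear:
 assumes "k \<ge> 1"
 shows "osc_bound D (C * k) \<le> (2 * (7 * real C * (real D + 1) + ln (real D + 1)) * (real D + 1)^2) * real k"
proof -
 have "ln (real D + 1) * 1 \<le> ln (real D + 1) * real k" using assms by (intro mult_left_mono) auto
 hence "7 * real (C * k) * (real D + 1) + ln (real D + 1) \<le> (7 * real C * (real D + 1) + ln (real D + 1)) * real k"
  by (simp add: algebra_simps)
 hence "2 * (7 * real (C * k) * (real D + 1) + ln (real D + 1)) * (real D + 1)^2 \<le> 2 * ((7 * real C * (real D + 1) + ln (real D + 1)) * real k) * (real D + 1)^2"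
  by (intro mult_right_mono mult_left_mono) auto
 thus ?thesis by (simp only: osc_bound_def mult_ac)
qed

text \<open>The maximum of \<open>|p|\<close> over a closed ball of chart parameters is attained at
  some \<open>tm\<close>. The rays from \<open>tm\<close> sweep out the parameters of the ball in
  \<open>V\<close>, and along almost every ray the one-variable estimate applies. The Lipschitz
  bounds for chart and projection transport integrals to \<open>V\<close> and also give the two
  bounds on the measure.\<close>

lemma local_log_bound_near:
 fixes V :: "(real^'n) set"
 assumes V: "compact V" "algebraic_submanifold d V" and x0: "x0 \<in> V"
 obtains E where "E > 0" "\<And>y0. y0 \<in> V \<Longrightarrow> norm (y0 - x0) < 1 / E \<Longrightarrow> local_log_bound d V E y0"
proof -
 have sm: "smooth_submanifold d V" using V(2) by (simp add: algebraic_submanifold_def)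
 obtain J \<Phi> r M where J: "card J = d" and ch: "graph_chart V x0 J \<Phi> r M"
  by (rule smooth_submanifold_graph_chart[OF sm x0])
 have r: "r > 0" and M: "M > 0" and \<Phi>b[measurable]: "\<Phi> \<in> borel_measurable borel"
  and \<Phi>V: "\<And>z. norm (pj J (z - x0)) < r \<Longrightarrow> \<Phi> z \<in> V" "\<And>z. norm (pj J (z - x0)) < r \<Longrightarrow> pj J (\<Phi> z) = pj J z"
  and lip: "\<And>z z'. norm (pj J (z - x0)) < r \<Longrightarrow> norm (pj J (z' - x0)) < r \<Longrightarrow> norm (\<Phi> z - \<Phi> z') \<le> M * norm (pj J (z - z'))"
  using ch unfolding graph_chart_def by blast+
 obtain \<rho>0 where \<rho>0: "0 < \<rho>0" "\<rho>0 \<le> r" "\<And>y. y \<in> V \<Longrightarrow> norm (y - x0) < \<rho>0 \<Longrightarrow> \<Phi> y = y"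
  using ch unfolding graph_chart_def by blast
 have same: "\<Phi> z = \<Phi> z'" if "pj J z = pj J z'" "norm (pj J (z - x0)) < r" for z z'
  using lip[of z z'] that by simp
 obtain \<rho>a where \<rho>a: "\<rho>a > 0" "\<And>a v. norm a \<le> \<rho>a \<Longrightarrow> norm v \<le> \<rho>a \<Longrightarrow>
   \<exists>W. (\<forall>i. (\<lambda>s. W s i) holomorphic_on ball 0 2) \<and>
    (\<forall>s::real. \<bar>s\<bar> \<le> 1 \<longrightarrow> W (complex_of_real s) = (\<lambda>i. complex_of_real (\<Phi> (pj J x0 + a + s *\<^sub>R v) $ i)))"
  by (rule algebraic_chart[OF V ch J]) blast
 obtain D C where DC: "\<And>k p. k \<ge> 1 \<Longrightarrow> pfun UNIV k p \<Longrightarrow>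
   \<exists>b. (\<forall>i. pfun J (C * k) (b i)) \<and> (\<exists>i\<le>D. \<exists>x. b i x \<noteq> 0) \<and> (\<forall>x\<in>V. (\<Sum>i\<le>D. b i x * p x ^ i) = 0)"
  by (rule algebraic_submanifold_relation[OF V J]) blast
 \<comment> \<open>Keeps the parameters met below, within \<open>6 * \<epsilon>\<close> of the
   centre, in the domain of the chart, and the segments in the range of the holomorphic
   extension.\<close>
 define \<epsilon> where "\<epsilon> = min (\<rho>0 / 2) (min (r / 6) (\<rho>a / 4))"
 have \<epsilon>: "\<epsilon> > 0" "2 * \<epsilon> \<le> \<rho>0" "6 * \<epsilon> \<le> r" "4 * \<epsilon> \<le> \<rho>a" using r \<rho>0 \<rho>a by (auto simp: \<epsilon>_def)
 define h where "h = hball J"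
 have h: "h > 0" unfolding h_def by (rule hball_pos)
 define c1 where "c1 = 2 * (7 * real C * (real D + 1) + ln (real D + 1)) * (real D + 1)^2"
 have c1: "c1 \<ge> 0" unfolding c1_def by (intro mult_nonneg_nonneg add_nonneg_nonneg) auto
 define Q where "Q = M ^ d * (2 * (c1 * (4 ^ d * h)))"
 define E where "E = 1 / \<epsilon> + (M + 1) ^ d / h + M ^ d * h + Q"
 have Q: "Q \<ge> 0" unfolding Q_def using M h c1 by simp
 have E: "E > 0" "1 / \<epsilon> \<le> E" "(M + 1) ^ d / h \<le> E" "M ^ d * h \<le> E" "Q \<le> E"
 proof -
  have "1 / \<epsilon> > 0" "(M + 1) ^ d / h > 0" "M ^ d * h > 0" using \<epsilon>(1) M h by auto
  thus "E > 0" "1 / \<epsilon> \<le> E" "(M + 1) ^ d / h \<le> E" "M ^ d * h \<le> E" "Q \<le> E" using Q unfolding E_def by linarith+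
 qed
 have E\<epsilon>: "1 / E \<le> \<epsilon>" using E(1,2) \<epsilon>(1) by (simp add: field_simps)
 define b0 where "b0 = pj J x0"
 have "local_log_bound d V E y0" if y0: "y0 \<in> V" "norm (y0 - x0) < 1 / E" for y0
  unfolding local_log_bound_def
 proof (intro allI impI)
  fix r0 :: real assume r0: "0 < r0" "r0 \<le> 1 / E"
  have r0\<epsilon>: "r0 \<le> \<epsilon>" and y0\<epsilon>: "norm (y0 - x0) < \<epsilon>" using r0 y0 E\<epsilon> by linarith+
  define \<tau> where "\<tau> = pj J y0"
  define B where "B = ball_in V y0 r0"
  have Bb[measurable]: "B \<in> sets borel" unfolding B_def by (rule ball_in_borel[OF compact_imp_closed[OF V(1)]])
  have \<tau>b0: "norm (\<tau> - b0) < \<epsilon>" using norm_pj_le[of J "y0 - x0"] y0\<epsilon> by (simp add: \<tau>_def b0_def)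
  have BV: "y \<in> V" "norm (y - y0) < r0" "norm (y - x0) < 2 * \<epsilon>" "\<Phi> y = y" "norm (pj J y - \<tau>) < r0" if "y \<in> B" for y
  proof -
   show 1: "y \<in> V" "norm (y - y0) < r0" using that by (auto simp: B_def ball_in_def dist_norm norm_minus_commute)
   show 2: "norm (y - x0) < 2 * \<epsilon>" using 1(2) y0\<epsilon> r0\<epsilon> norm_triangle_ineq[of "y - y0" "y0 - x0"] by simp
   show "\<Phi> y = y" using \<rho>0(3)[OF 1(1)] 2 \<epsilon>(2) by simp
   show "norm (pj J y - \<tau>) < r0" using norm_pj_le[of J "y - y0"] 1(2) by (simp add: \<tau>_def)
  qed
  have dom: "norm (pj J (z - x0)) < r" if "norm (pj J z - b0) < 6 * \<epsilon>" for z using that \<epsilon>(3) by (simp add: b0_def)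
  have y0B: "y0 \<in> B" using y0 r0 by (simp add: B_def ball_in_def)
  have \<Phi>p: "\<Phi> (pj J y) = y" if "y \<in> B" for y
  proof -
   have "norm (pj J (y - x0)) < r" using norm_pj_le[of J "y - x0"] BV(3)[OF that] \<epsilon>(1,3) by linarith
   hence "\<Phi> y = \<Phi> (pj J y)" by (intro same) simp_all
   thus ?thesis using BV(4)[OF that] by simp
  qed
  have \<Phi>lip: "dist (\<Phi> (c + v)) (\<Phi> (c + v')) \<le> M * dist v v'"
   if "norm (pj J (c + v) - b0) < 6 * \<epsilon>" "norm (pj J (c + v') - b0) < 6 * \<epsilon>" for c v v'
  proof -
   have "norm (\<Phi> (c + v) - \<Phi> (c + v')) \<le> M * norm (pj J (v - v'))" using lip[OF dom[OF that(1)] dom[OF that(2)]] by simp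
   also have "\<dots> \<le> M * norm (v - v')" using M norm_pj_le[of J "v - v'"] by (intro mult_left_mono) auto
   finally show ?thesis by (simp add: dist_norm)
  qed
  have upper: "emeasure (hausdorff_measure d) B \<le> ennreal (E * r0 ^ d)"
  proof -
   have "B \<subseteq> (\<lambda>v. \<Phi> (\<tau> + v)) ` jball J r0"
   proof
    fix y assume y: "y \<in> B"
    have "pj J y - \<tau> \<in> jball J r0" using BV(5)[OF y] by (simp add: jball_def \<tau>_def)
    thus "y \<in> (\<lambda>v. \<Phi> (\<tau> + v)) ` jball J r0" by (rule rev_image_eqI) (simp add: \<Phi>p[OF y])
   qed
   hence "hausdorff_outer d B \<le> hausdorff_outer d ((\<lambda>v. \<Phi> (\<tau> + v)) ` jball J r0)" by (rule hausdorff_outer_mono)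
   also have "\<dots> \<le> ennreal (M ^ d) * hausdorff_outer d (jball J r0)"
   proof (rule hausdorff_outer_lipschitz_image[OF M \<Phi>lip])
    show "norm (pj J (\<tau> + v) - b0) < 6 * \<epsilon>" if "v \<in> jball J r0" for v
    proof -
     have eq: "pj J (\<tau> + v) - b0 = (\<tau> - b0) + v" and "norm v < r0" using that by (simp_all add: \<tau>_def jball_def)
     thus ?thesis unfolding eq using norm_triangle_ineq[of "\<tau> - b0" v] \<tau>b0 r0\<epsilon> \<epsilon>(1) by linarith
    qed
    thus "norm (pj J (\<tau> + v) - b0) < 6 * \<epsilon>" if "v \<in> jball J r0" for v using that .
   qed
   also have "\<dots> = ennreal (M ^ d * h * r0 ^ d)"
    using r0 M h by (simp add: hausdorff_jball[OF r0(1), of J, unfolded J] h_def[symmetric] ennreal_mult[symmetric] mult_ac)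
   also have "\<dots> \<le> ennreal (E * r0 ^ d)" using E(4) r0 by (intro ennreal_leI mult_right_mono) auto
   finally show ?thesis by (simp add: emeasure_hausdorff)
  qed
  have lower: "ennreal (r0 ^ d / E) \<le> emeasure (hausdorff_measure d) B"
  proof -
   \<comment> \<open>The chart stretches by at most \<open>M\<close>, so parameters within
     \<open>s\<close> of the centre land in the ball of radius \<open>r0\<close>.\<close>
   define s where "s = r0 / (M + 1)"
   have s: "s > 0" "M * s < r0" "s \<le> r0" using r0 M by (auto simp: s_def field_simps)
   have "r0 ^ d / E \<le> s ^ d * h"
   proof -
    have "(M + 1) ^ d \<le> E * h" using E(3) h by (simp add: field_simps)
    hence "r0 ^ d * (M + 1) ^ d \<le> r0 ^ d * (E * h)" using r0 by (intro mult_left_mono) auto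
    thus ?thesis using E(1) M unfolding s_def power_divide by (simp add: field_simps)
   qed
   hence "ennreal (r0 ^ d / E) \<le> hausdorff_outer d (jball J s)"
    by (simp add: hausdorff_jball[OF s(1), of J, unfolded J] h_def[symmetric] ennreal_leI)
   also have "jball J s \<subseteq> (\<lambda>y. pj J y - \<tau>) ` B"
   proof
    fix v assume v: "v \<in> jball J s"
    hence pv: "pj J v = v" "norm v < s" by (auto simp: jball_def)
    have z: "norm (pj J (\<tau> + v) - b0) < 6 * \<epsilon>"
    proof -
     have eq: "pj J (\<tau> + v) - b0 = (\<tau> - b0) + v" using pv by (simp add: \<tau>_def)
     show ?thesis unfolding eq using norm_triangle_ineq[of "\<tau> - b0" v] \<tau>b0 pv s r0\<epsilon> \<epsilon>(1) by linarith
    qed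
    have z0: "norm (pj J (\<tau> + 0) - b0) < 6 * \<epsilon>" using \<tau>b0 \<epsilon>(1) by (simp add: \<tau>_def)
    have "dist (\<Phi> (\<tau> + v)) y0 \<le> M * dist v 0" using \<Phi>lip[OF z z0] \<Phi>p[OF y0B] by (simp add: \<tau>_def)
    also have "\<dots> \<le> M * s" using pv M by (intro mult_left_mono) auto
    finally have "\<Phi> (\<tau> + v) \<in> B" using s \<Phi>V(1)[OF dom[OF z]] by (simp add: B_def ball_in_def dist_commute)
    moreover have "pj J (\<Phi> (\<tau> + v)) - \<tau> = v" unfolding \<Phi>V(2)[OF dom[OF z]] using pv by (simp add: \<tau>_def)
    ultimately show "v \<in> (\<lambda>y. pj J y - \<tau>) ` B" by (metis image_eqI)
   qed
   hence "hausdorff_outer d (jball J s) \<le> hausdorff_outer d ((\<lambda>y. pj J y - \<tau>) ` B)" by (rule hausdorff_outer_mono)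
   also have "\<dots> \<le> ennreal (1 ^ d) * hausdorff_outer d B"
   proof (rule hausdorff_outer_lipschitz_image)
    fix x y :: "real^'n"
    show "dist (pj J x - \<tau>) (pj J y - \<tau>) \<le> 1 * dist x y"
     using norm_pj_le[of J "x - y"] by (simp add: dist_norm)
   qed simp
   finally show ?thesis by (simp add: emeasure_hausdorff)
  qed
  have int: "log_controlled d B (E * real k * r0 ^ d) p"
   if k: "k \<ge> 1" and p: "pfun UNIV k p" and nz: "\<exists>y\<in>B. p y \<noteq> 0" for k p
  proof -
   \<comment> \<open>A compact set containing the parameters of \<open>B\<close>. The maximum point
     found in it need not come from \<open>B\<close>, which is harmless for an upper bound.\<close>
   define DD where "DD = {z. pj J z = z} \<inter> cball \<tau> r0"
   have DDn: "norm (pj J z - b0) < 2 * \<epsilon>" "pj J z = z" "norm (z - b0) < 2 * \<epsilon>" "norm (z - \<tau>) \<le> r0" if "z \<in> DD" for z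
   proof -
    show 1: "pj J z = z" "norm (z - \<tau>) \<le> r0" using that by (auto simp: DD_def dist_norm norm_minus_commute)
    show "norm (z - b0) < 2 * \<epsilon>" using norm_triangle_ineq[of "z - \<tau>" "\<tau> - b0"] 1(2) \<tau>b0 r0\<epsilon> by simp
    thus "norm (pj J z - b0) < 2 * \<epsilon>" using 1(1) by simp
   qed
   have cDD: "compact DD" unfolding DD_def by (intro closed_Int_compact closed_Collect_eq continuous_intros compact_cball)
   have "M-lipschitz_on DD \<Phi>"
   proof (rule lipschitz_onI)
    fix x y assume "x \<in> DD" "y \<in> DD"
    thus "dist (\<Phi> x) (\<Phi> y) \<le> M * dist x y" using \<Phi>lip[of 0 x y] DDn(1)[of x] DDn(1)[of y] \<epsilon>(1) by simp
   qed (use M in simp)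
   hence cont: "continuous_on DD (\<lambda>z. \<bar>p (\<Phi> z)\<bar>)"
    by (intro continuous_intros continuous_on_compose2[OF pfun_continuous[OF p, of UNIV]] lipschitz_on_continuous_on) auto
   have "\<tau> \<in> DD" using r0 by (simp add: DD_def \<tau>_def)
   then obtain tm where tm: "tm \<in> DD" "\<And>z. z \<in> DD \<Longrightarrow> \<bar>p (\<Phi> z)\<bar> \<le> \<bar>p (\<Phi> tm)\<bar>"
    using continuous_attains_sup[OF cDD _ cont] by blast
   have BD: "pj J y \<in> DD" if "y \<in> B" for y using BV(5)[OF that] by (simp add: DD_def dist_norm norm_minus_commute)
   have le: "\<bar>p y\<bar> \<le> \<bar>p (\<Phi> tm)\<bar>" if "y \<in> B" for y using tm(2)[OF BD[OF that]] \<Phi>p[OF that] by simp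
   have ptm: "p (\<Phi> tm) \<noteq> 0" using nz le by fastforce
   define a where "a = ln \<bar>p (\<Phi> tm)\<bar>"
   have a: "\<forall>y\<in>B. p y \<noteq> 0 \<longrightarrow> ln \<bar>p y\<bar> \<le> a" unfolding a_def using le ptm by (intro ballI impI) (subst ln_le_cancel_iff, auto)
   define f where "f v = \<Phi> (tm + v)" for v
   have f[measurable]: "f \<in> borel_measurable borel" unfolding f_def[abs_def] by measurable
   have G[measurable]: "log_gap a p \<in> borel_measurable borel" by (rule log_gap_measurable[OF p])
   have tmv: "norm (pj J (tm + v) - b0) < 2 * \<epsilon> + norm v" "pj J v = v \<Longrightarrow> pj J (tm + v) = tm + v" for v
   proof -
    have eq: "pj J (tm + v) - b0 = (tm - b0) + pj J v" using DDn(2)[OF tm(1)] by simp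
    show "norm (pj J (tm + v) - b0) < 2 * \<epsilon> + norm v"
     unfolding eq using norm_triangle_ineq[of "tm - b0" "pj J v"] DDn(3)[OF tm(1)] norm_pj_le[of J v] by linarith
   qed (simp add: DDn(2)[OF tm(1)])
   \<comment> \<open>Seen from \<open>tm\<close> the parameters of \<open>B\<close> lie within
     \<open>2 * r0\<close>; the dilation average doubles this to \<open>4 * r0\<close>.\<close>
   have sub: "B \<subseteq> f ` jball J (2 * r0)"
   proof
    fix y assume y: "y \<in> B"
    have "norm (pj J y - tm) < 2 * r0"
     using norm_triangle_ineq4[of "pj J y - \<tau>" "tm - \<tau>"] BV(5)[OF y] DDn(4)[OF tm(1)] by simp
    hence "pj J y - tm \<in> jball J (2 * r0)" using DDn(2)[OF tm(1)] by (simp add: jball_def)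
    thus "y \<in> f ` jball J (2 * r0)" by (rule rev_image_eqI) (simp add: f_def \<Phi>p[OF y])
   qed
   obtain b where b: "\<And>i. pfun J (C * k) (b i)" "\<exists>i\<le>D. \<exists>x. b i x \<noteq> 0" "\<And>x. x \<in> V \<Longrightarrow> (\<Sum>i\<le>D. b i x * p x ^ i) = 0"
    using DC[OF k p] by blast
   \<comment> \<open>A direction \<open>v\<close> is good if the nonzero polynomial
     \<open>b i0\<close> does not vanish at \<open>tm + v\<close>, for then the relation on that ray
     is not trivial. The other directions form a null set.\<close>
   obtain i0 xb where i0: "i0 \<le> D" "b i0 xb \<noteq> 0" using b(2) by blast
   have inner: "(\<integral>\<^sup>+t. log_gap a p (f (t *\<^sub>R v)) * indicator {1/2..1} t \<partial>lborel) \<le> ennreal (osc_bound D (C * k))"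
    if v: "v \<in> jball J (4 * r0)" and bv: "b i0 (tm + v) \<noteq> 0" for v
   proof -
    have v': "pj J v = v" "norm v < 4 * \<epsilon>" using v r0\<epsilon> by (auto simp: jball_def)
    have "norm (tm - b0) \<le> \<rho>a" using DDn(3)[OF tm(1)] \<epsilon>(1,4) by linarith
    moreover have "norm v \<le> \<rho>a" using v'(2) \<epsilon>(4) by linarith
    ultimately obtain W where W: "\<And>i. (\<lambda>s. W s i) holomorphic_on ball 0 2"
     "\<And>s::real. \<bar>s\<bar> \<le> 1 \<Longrightarrow> W (complex_of_real s) = (\<lambda>i. complex_of_real (f (s *\<^sub>R v) $ i))"
     using \<rho>a(2)[of "tm - b0" v] by (auto simp: b0_def f_def)
    have "\<forall>i. \<exists>P :: real poly. degree P \<le> C * k \<and> (\<forall>s. poly P s = b i (tm + s *\<^sub>R v))"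
    proof
     fix i
     obtain P :: "real poly" where "degree P \<le> C * k" "\<And>s. poly P s = b i (tm + s *\<^sub>R v)"
      by (rule pfun_line[OF b(1)]) blast
     thus "\<exists>P :: real poly. degree P \<le> C * k \<and> (\<forall>s. poly P s = b i (tm + s *\<^sub>R v))" by blast
    qed
    from choice[OF this] obtain P :: "nat \<Rightarrow> real poly" where
     P: "\<And>i. degree (P i) \<le> C * k" "\<And>i s. poly (P i) s = b i (tm + s *\<^sub>R v)" by blast
    have P0: "P i0 \<noteq> 0" using P(2)[of i0 1] bv by auto
    have rel: "(\<Sum>i\<le>D. poly (P i) s * p (f (s *\<^sub>R v)) ^ i) = 0" if s: "\<bar>s\<bar> \<le> 1" for s
    proof -
     have "\<bar>s\<bar> * norm v \<le> 1 * norm v" using s by (intro mult_right_mono) auto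
     hence "norm (pj J (tm + s *\<^sub>R v) - b0) < 6 * \<epsilon>" using tmv(1)[of "s *\<^sub>R v"] v'(2) by simp
     note z = dom[OF this]
     have "b i (tm + s *\<^sub>R v) = b i (f (s *\<^sub>R v))" for i
     proof (rule pfun_cong[OF b(1)])
      fix j assume "j \<in> J"
      thus "(tm + s *\<^sub>R v) $ j = f (s *\<^sub>R v) $ j"
       using arg_cong[OF \<Phi>V(2)[OF z], of "\<lambda>w. w $ j"] by (simp add: f_def)
     qed
     thus ?thesis using b(3)[OF \<Phi>V(1)[OF z]] by (simp add: P(2) f_def)
    qed
    have "(\<integral>\<^sup>+t. log_gap (ln \<bar>p (f (0 *\<^sub>R v))\<bar>) p (f (t *\<^sub>R v)) * indicator {1/2..1} t \<partial>lborel) \<le> ennreal (osc_bound D (C * k))"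
     by (rule polynomial_log_integral_along_curve[OF W p _ P(1) i0(1) P0 rel]) (use ptm in \<open>simp_all add: f_def\<close>)
    thus ?thesis by (simp add: f_def a_def)
   qed
   define N where "N = {v \<in> jball J (4 * r0). b i0 (tm + v) = 0}"
   have AE: "AE v in hausdorff_measure d. v \<notin> N"
   proof -
    have vshift: "pfun J 1 (\<lambda>x. (tm + x) $ l)" if "l \<in> J" for l
     unfolding vector_add_component by (intro pfun_add pfun_const pfun_var that)
    have q: "pfun J (C * k * 1) (\<lambda>v. b i0 (tm + v))" by (rule pfun_comp[OF b(1) vshift])
    have "hausdorff_outer (card J) N = 0"
     unfolding N_def by (rule polynomial_zeros_hausdorff_null[OF q, of "xb - tm"]) (use i0(2) in simp)
    moreover have "N \<in> sets borel" unfolding N_def using pfun_borel[OF q] by measurable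
    ultimately have "N \<in> null_sets (hausdorff_measure d)" using J by (simp add: null_sets_def emeasure_hausdorff)
    thus ?thesis by (rule AE_not_in)
   qed
   have "(\<integral>\<^sup>+y. log_gap a p y * indicator B y \<partial>hausdorff_measure d)
    \<le> ennreal (M ^ d) * (\<integral>\<^sup>+v. log_gap a p (f v) * indicator (jball J (2 * r0)) v \<partial>hausdorff_measure d)"
   proof (rule nn_integral_hausdorff_transport[OF Bb jball_borel f G M _ sub])
    fix x y assume xy: "x \<in> jball J (2 * r0)" "y \<in> jball J (2 * r0)"
    have "norm (pj J (tm + x) - b0) < 6 * \<epsilon>" "norm (pj J (tm + y) - b0) < 6 * \<epsilon>"
     using tmv(1)[of x] tmv(1)[of y] xy r0\<epsilon> \<epsilon>(1) by (auto simp: jball_def)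
    from \<Phi>lip[OF this] show "dist (f x) (f y) \<le> M * dist x y" by (simp add: f_def)
   qed
   also have "(\<integral>\<^sup>+v. log_gap a p (f v) * indicator (jball J (2 * r0)) v \<partial>hausdorff_measure d)
    \<le> 2 * (\<integral>\<^sup>+v. (\<integral>\<^sup>+t. log_gap a p (f (t *\<^sub>R v)) * indicator {1/2..1} t \<partial>lborel) * indicator (jball J (2 * (2 * r0))) v \<partial>hausdorff_measure d)"
    using nn_integral_dilation_average[of "\<lambda>v. log_gap a p (f v)" "2 * r0" J] r0 J by simp
   also have "(\<integral>\<^sup>+v. (\<integral>\<^sup>+t. log_gap a p (f (t *\<^sub>R v)) * indicator {1/2..1} t \<partial>lborel) * indicator (jball J (2 * (2 * r0))) v \<partial>hausdorff_measure d)
    \<le> (\<integral>\<^sup>+v. ennreal (osc_bound D (C * k)) * indicator (jball J (4 * r0)) v \<partial>hausdorff_measure d)"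
   proof (rule nn_integral_mono_AE)
    from AE show "AE v in hausdorff_measure d. (\<integral>\<^sup>+t. log_gap a p (f (t *\<^sub>R v)) * indicator {1/2..1} t \<partial>lborel) * indicator (jball J (2 * (2 * r0))) v
      \<le> ennreal (osc_bound D (C * k)) * indicator (jball J (4 * r0)) v"
    proof eventually_elim
     case (elim v)
     thus ?case using inner[of v] by (cases "v \<in> jball J (4 * r0)") (auto simp: N_def)
    qed
   qed
   also have "\<dots> = ennreal (osc_bound D (C * k)) * ennreal ((4 * r0) ^ d * h)"
    using r0 hausdorff_jball[of "4 * r0" J] J by (simp add: nn_integral_cmult_indicator emeasure_hausdorff h_def)
   also have "ennreal (osc_bound D (C * k)) \<le> ennreal (c1 * real k)"
    unfolding c1_def by (intro ennreal_leI osc_bound_linear k)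
   finally have "(\<integral>\<^sup>+y. log_gap a p y * indicator B y \<partial>hausdorff_measure d)
    \<le> ennreal (M ^ d) * (2 * (ennreal (c1 * real k) * ennreal ((4 * r0) ^ d * h)))"
    by (simp add: mult_left_mono mult_right_mono)
   also have "\<dots> = ennreal (Q * real k * r0 ^ d)"
   proof -
    have "2 * (ennreal (c1 * real k) * ennreal ((4 * r0) ^ d * h)) = ennreal (2 * (c1 * real k * ((4 * r0) ^ d * h)))"
     using c1 h r0 by (simp add: ennreal_mult')
    hence "ennreal (M ^ d) * (2 * (ennreal (c1 * real k) * ennreal ((4 * r0) ^ d * h))) = ennreal (M ^ d * (2 * (c1 * real k * ((4 * r0) ^ d * h))))"
     using M by (simp only: ennreal_mult'[symmetric] zero_le_power less_imp_le)
    also have "M ^ d * (2 * (c1 * real k * ((4 * r0) ^ d * h))) = Q * real k * r0 ^ d"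
     unfolding Q_def by (simp only: power_mult_distrib mult_ac)
    finally show ?thesis .
   qed
   also have "\<dots> \<le> ennreal (E * real k * r0 ^ d)" using E(5) r0 by (intro ennreal_leI mult_right_mono) auto
   finally show ?thesis unfolding log_controlled_def using a by blast
  qed
  show "ennreal (r0 ^ d / E) \<le> emeasure (hausdorff_measure d) (ball_in V y0 r0) \<and>
   emeasure (hausdorff_measure d) (ball_in V y0 r0) \<le> ennreal (E * r0 ^ d) \<and>
   (\<forall>k p. k \<ge> 1 \<longrightarrow> pfun UNIV k p \<longrightarrow> (\<exists>y\<in>ball_in V y0 r0. p y \<noteq> 0) \<longrightarrow>
    log_controlled d (ball_in V y0 r0) (E * real k * r0 ^ d) p)"
   using lower upper int unfolding B_def by blast
 qed
 with E(1) that show ?thesis by blast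
qed

section \<open>From local to global bounds\<close>

lemma local_log_bound_uniform:
 fixes V :: "(real^'n) set"
 assumes V: "compact V" "algebraic_submanifold d V"
 obtains E where "E > 0" "\<And>y. y \<in> V \<Longrightarrow> local_log_bound d V E y"
proof -
 have "\<forall>x\<in>V. \<exists>E. E > 0 \<and> (\<forall>y\<in>V. norm (y - x) < 1 / E \<longrightarrow> local_log_bound d V E y)"
 proof
  fix x assume x: "x \<in> V"
  obtain E where "E > 0" "\<And>y. y \<in> V \<Longrightarrow> norm (y - x) < 1 / E \<Longrightarrow> local_log_bound d V E y"
   by (rule local_log_bound_near[OF V x]) blast
  thus "\<exists>E. E > 0 \<and> (\<forall>y\<in>V. norm (y - x) < 1 / E \<longrightarrow> local_log_bound d V E y)" by blast
 qed
 from bchoice[OF this] obtain E where E: "\<And>x. x \<in> V \<Longrightarrow> E x > 0"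
  "\<And>x y. x \<in> V \<Longrightarrow> y \<in> V \<Longrightarrow> norm (y - x) < 1 / E x \<Longrightarrow> local_log_bound d V (E x) y" by blast
 have "V \<subseteq> (\<Union>x\<in>V. ball x (1 / E x))" using E(1) by force
 then obtain F where F: "F \<subseteq> V" "finite F" "V \<subseteq> (\<Union>x\<in>F. ball x (1 / E x))"
  by (rule compactE_image[OF V(1), of V "\<lambda>x. ball x (1 / E x)", rotated]) auto
 define E0 where "E0 = (\<Sum>x\<in>F. E x) + 1"
 have Epos: "0 \<le> E x" if "x \<in> F" for x using E(1) F(1) that by (meson less_imp_le subsetD)
 have le: "E x \<le> E0" if "x \<in> F" for x
  using member_le_sum[of x F E] that F(2) Epos by (simp add: E0_def)
 have "E0 > 0" unfolding E0_def using Epos by (intro add_nonneg_pos sum_nonneg) auto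
 thus ?thesis
 proof (rule that)
  fix y assume y: "y \<in> V"
  then obtain x where x: "x \<in> F" "y \<in> ball x (1 / E x)" using F(3) by blast
  hence "local_log_bound d V (E x) y" using E(2)[of x y] F(1) y by (auto simp: dist_norm norm_minus_commute)
  thus "local_log_bound d V E0 y" by (rule local_log_bound_mono) (use x E(1) F(1) le in auto)
 qed
qed

lemma log_gap_mono: "A \<le> a \<Longrightarrow> log_gap A p y \<le> log_gap a p y"
 by (simp add: log_gap_def ennreal_leI)

lemma log_gap_shift: "log_gap A p y \<le> log_gap a p y + ennreal (max 0 (A - a))"
proof (cases "p y = 0")
 case False
 have "ennreal (A - ln \<bar>p y\<bar>) \<le> ennreal (max 0 (a - ln \<bar>p y\<bar>) + max 0 (A - a))" by (intro ennreal_leI) auto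
 also have "\<dots> = ennreal (a - ln \<bar>p y\<bar>) + ennreal (max 0 (A - a))" by (simp add: ennreal_plus max_def ennreal_neg)
 finally show ?thesis using False by (simp add: log_gap_def)
qed (simp add: log_gap_def)

text \<open>On the overlap of two balls the constants \<^term>\<open>A\<close> and \<^term>\<open>a\<close> are compared, so an integral bound passes
 from one ball to the other.\<close>

lemma log_gap_integral_transfer:
 fixes V :: "(real^'n) set"
 assumes cl: "closed V" and E: "E > 0" and loc: "local_log_bound d V E y" "local_log_bound d V E y'"
  and yy': "dist y y' < 1 / (2 * E)"
  and k: "k \<ge> 1" and p: "pfun UNIV k p" and Q: "Q \<ge> 0"
  and I: "(\<integral>\<^sup>+x. log_gap A p x * indicator (ball_in V y (1/E)) x \<partial>hausdorff_measure d) \<le> ennreal (Q * real k)"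
 shows "(\<integral>\<^sup>+x. log_gap A p x * indicator (ball_in V y' (1/E)) x \<partial>hausdorff_measure d)
  \<le> ennreal ((E * (1/E)^d + E^2 * 2^d) * (Q + 1) * real k)"
proof -
 let ?H = "hausdorff_measure d :: (real^'n) measure"
 define \<epsilon> where "\<epsilon> = 1 / E"
 have \<epsilon>: "\<epsilon> > 0" "\<epsilon> / 2 \<le> 1 / E" "1 / (2 * E) = \<epsilon> / 2" using E by (auto simp: \<epsilon>_def field_simps)
 \<comment> \<open>The half ball around \<open>y\<close> lies in both balls, and its measure is at
   least \<open>m\<close>.\<close>
 define D0 where "D0 = ball_in V y (\<epsilon> / 2)"
 define m where "m = (\<epsilon> / 2) ^ d / E"
 have m: "m > 0" using E \<epsilon> by (simp add: m_def)
 have [measurable]: "ball_in V z s \<in> sets borel" for z s by (rule ball_in_borel[OF cl])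
 have [measurable]: "log_gap a p \<in> borel_measurable borel" for a by (rule log_gap_measurable[OF p])
 have mD: "ennreal m \<le> emeasure ?H D0"
  using loc(1) \<epsilon> unfolding local_log_bound_def D0_def m_def by (metis half_gt_zero)
 have sub: "D0 \<subseteq> ball_in V y \<epsilon>" "D0 \<subseteq> ball_in V y' \<epsilon>"
 proof -
  show "D0 \<subseteq> ball_in V y \<epsilon>" using \<epsilon>(1) by (auto simp: D0_def ball_in_def)
  show "D0 \<subseteq> ball_in V y' \<epsilon>"
  proof
   fix z assume "z \<in> D0"
   thus "z \<in> ball_in V y' \<epsilon>" using yy' \<epsilon>(3) dist_triangle[of y' z y] by (simp add: D0_def ball_in_def dist_commute)
  qed
 qed
 have low: "c * emeasure ?H D0 \<le> ennreal (Q * real k)" if "\<And>z. z \<in> D0 \<Longrightarrow> c \<le> log_gap A p z" for c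
 proof -
  have "c * emeasure ?H D0 = (\<integral>\<^sup>+x. c * indicator D0 x \<partial>?H)" by (simp add: D0_def nn_integral_cmult_indicator)
  also have "\<dots> \<le> (\<integral>\<^sup>+x. log_gap A p x * indicator (ball_in V y (1/E)) x \<partial>?H)"
   using that sub(1) by (intro nn_integral_mono) (auto simp: \<epsilon>_def split: split_indicator)
  finally show ?thesis using I by (rule order_trans)
 qed
 \<comment> \<open>If \<open>p\<close> vanished on \<open>D0\<close>, the given integral would be
   infinite.\<close>
 have nz: "\<exists>z\<in>D0. p z \<noteq> 0"
 proof (rule ccontr)
  assume "\<not> ?thesis"
  hence "\<infinity> * emeasure ?H D0 \<le> ennreal (Q * real k)" by (intro low) (auto simp: log_gap_def)
  moreover have "emeasure ?H D0 \<noteq> 0" using mD m by auto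
  ultimately show False by (simp add: ennreal_top_mult top_unique)
 qed
 hence "\<exists>z\<in>ball_in V y' \<epsilon>. p z \<noteq> 0" using sub(2) by blast
 then obtain a where a: "\<And>z. z \<in> ball_in V y' \<epsilon> \<Longrightarrow> p z \<noteq> 0 \<Longrightarrow> ln \<bar>p z\<bar> \<le> a"
  "(\<integral>\<^sup>+x. log_gap a p x * indicator (ball_in V y' \<epsilon>) x \<partial>?H) \<le> ennreal (E * real k * \<epsilon> ^ d)"
  using loc(2) \<epsilon>(1) k p unfolding local_log_bound_def log_controlled_def \<epsilon>_def by blast
 have up: "emeasure ?H (ball_in V y' \<epsilon>) \<le> ennreal (E * \<epsilon> ^ d)"
  using loc(2) \<epsilon>(1) unfolding local_log_bound_def \<epsilon>_def by blast
 define t where "t = max 0 (A - a)"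
 have t0: "t \<ge> 0" by (simp add: t_def)
 \<comment> \<open>On \<open>D0\<close> the logarithm is at most \<open>a\<close>, so the gap to
   \<open>A\<close> is at least \<open>t\<close> there and the given integral bounds
   \<open>t\<close>.\<close>
 have "ennreal t * emeasure ?H D0 \<le> ennreal (Q * real k)"
 proof (rule low)
  fix z assume "z \<in> D0"
  hence "p z \<noteq> 0 \<Longrightarrow> ln \<bar>p z\<bar> \<le> a" using a(1) sub(2) by blast
  thus "ennreal t \<le> log_gap A p z" by (cases "A \<le> a") (auto simp: log_gap_def t_def intro!: ennreal_leI)
 qed
 hence "ennreal t * ennreal m \<le> ennreal (Q * real k)" using mult_left_mono[OF mD, of "ennreal t"] by (meson order_trans zero_le)
 hence "t * m \<le> Q * real k" using t0 m Q by (simp add: ennreal_mult[symmetric])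
 hence tb: "t \<le> Q * real k / m" using m by (simp add: pos_le_divide_eq)
 have "(\<integral>\<^sup>+x. log_gap A p x * indicator (ball_in V y' \<epsilon>) x \<partial>?H)
   \<le> (\<integral>\<^sup>+x. log_gap a p x * indicator (ball_in V y' \<epsilon>) x + ennreal t * indicator (ball_in V y' \<epsilon>) x \<partial>?H)"
  unfolding t_def by (intro nn_integral_mono) (auto simp: log_gap_shift split: split_indicator)
 also have "\<dots> = (\<integral>\<^sup>+x. log_gap a p x * indicator (ball_in V y' \<epsilon>) x \<partial>?H) + ennreal t * emeasure ?H (ball_in V y' \<epsilon>)"
  by (subst nn_integral_add) (simp_all add: nn_integral_cmult_indicator)
 also have "\<dots> \<le> ennreal (E * real k * \<epsilon> ^ d) + ennreal (Q * real k / m) * ennreal (E * \<epsilon> ^ d)"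
  by (intro add_mono mult_mono a(2) up ennreal_leI tb) auto
 also have "\<dots> = ennreal (E * real k * \<epsilon> ^ d + Q * real k / m * (E * \<epsilon> ^ d))"
  using E \<epsilon>(1) Q m by (simp add: ennreal_mult'[symmetric] ennreal_plus[symmetric] del: ennreal_plus)
 also have "\<dots> \<le> ennreal ((E * (1/E)^d + E^2 * 2^d) * (Q + 1) * real k)"
 proof (rule ennreal_leI)
  have "Q * real k / m * (E * \<epsilon> ^ d) = E^2 * 2^d * Q * real k"
   using E \<epsilon>(1) by (simp add: m_def power_divide power2_eq_square field_simps)
  moreover have "E * \<epsilon> ^ d * (Q * real k) \<ge> 0" "E^2 * 2^d * real k \<ge> 0" using E \<epsilon>(1) Q by auto
  moreover have "(E * (1/E)^d + E^2 * 2^d) * (Q + 1) * real k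
    = E * real k * \<epsilon> ^ d + E^2 * 2^d * Q * real k + E * \<epsilon> ^ d * (Q * real k) + E^2 * 2^d * real k"
   unfolding \<epsilon>_def by (simp add: algebra_simps)
  ultimately show "E * real k * \<epsilon> ^ d + Q * real k / m * (E * \<epsilon> ^ d) \<le> (E * (1/E)^d + E^2 * 2^d) * (Q + 1) * real k"
   by linarith
 qed
 finally show ?thesis by (simp add: \<epsilon>_def)
qed

text \<open>At a maximum point of \<open>|p|\<close> on \<open>V\<close> the local bound holds with
  the global upper bound \<open>A\<close>, and the integral bound is transferred from ball to ball.
  The number of transfers is not made explicit: existence of a transfer constant is an equivalence
  relation with open classes, so by connectedness it holds for all pairs of points. A finite set of
  centres, chosen before \<open>p\<close>, makes the constant uniform.\<close>

lemma global_log_bound: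
 fixes V :: "(real^'n) set"
 assumes V: "compact V" "connected V" and E: "E > 0" and loc: "\<And>y. y \<in> V \<Longrightarrow> local_log_bound d V E y"
 obtains C where "C \<ge> 0" "emeasure (hausdorff_measure d) V < \<infinity>"
  "\<forall>k p. k \<ge> 1 \<longrightarrow> pfun UNIV k p \<longrightarrow> (\<exists>x\<in>V. p x \<noteq> 0) \<longrightarrow> log_controlled d V (C * real k) p"
proof -
 let ?H = "hausdorff_measure d :: (real^'n) measure"
 have cl: "closed V" by (rule compact_imp_closed[OF V(1)])
 define I where "I A p y = (\<integral>\<^sup>+x. log_gap A p x * indicator (ball_in V y (1/E)) x \<partial>?H)" for A p y
 define \<delta> where "\<delta> = 1 / (2 * E)"
 have \<delta>: "\<delta> > 0" using E by (simp add: \<delta>_def)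
 \<comment> \<open>\<open>K\<close> may not depend on \<open>p\<close>, \<open>A\<close> or
   \<open>Q\<close>; the form \<open>K * (Q + 1)\<close> is stable under composition.\<close>
 define trans_at where "trans_at K y y' \<longleftrightarrow> (\<forall>k p A Q. k \<ge> 1 \<longrightarrow> pfun UNIV k p \<longrightarrow> Q \<ge> 0 \<longrightarrow>
   I A p y \<le> ennreal (Q * real k) \<longrightarrow> I A p y' \<le> ennreal (K * (Q + 1) * real k))" for K y y'
 define K0 where "K0 = E * (1/E)^d + E^2 * 2^d"
 have K0: "K0 \<ge> 0" using E by (simp add: K0_def)
 have near: "trans_at K0 y y'" if "y \<in> V" "y' \<in> V" "dist y y' < \<delta>" for y y'
  unfolding trans_at_def I_def K0_def
  using log_gap_integral_transfer[OF cl E loc[OF that(1)] loc[OF that(2)] that(3)[unfolded \<delta>_def]] by blast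
 have comp: "trans_at (K' * (K + 1)) x z" if "K \<ge> 0" "K' \<ge> 0" "trans_at K x y" "trans_at K' y z" for K K' x y z
  unfolding trans_at_def
 proof (intro allI impI)
  fix k :: nat and p A and Q :: real
  assume k: "1 \<le> k" "pfun UNIV k p" "0 \<le> Q" "I A p x \<le> ennreal (Q * real k)"
  hence "I A p y \<le> ennreal (K * (Q + 1) * real k)" using that(3) unfolding trans_at_def by blast
  moreover have "K * (Q + 1) \<ge> 0" using that k by simp
  ultimately have "I A p z \<le> ennreal (K' * (K * (Q + 1) + 1) * real k)" using that(4) k unfolding trans_at_def by blast
  also have "\<dots> \<le> ennreal (K' * (K + 1) * (Q + 1) * real k)"
  proof (rule ennreal_leI)
   have "K * (Q + 1) + 1 \<le> (K + 1) * (Q + 1)" using k by (simp add: algebra_simps)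
   hence "K' * (K * (Q + 1) + 1) \<le> K' * ((K + 1) * (Q + 1))" using that by (intro mult_left_mono) auto
   thus "K' * (K * (Q + 1) + 1) * real k \<le> K' * (K + 1) * (Q + 1) * real k"
    by (intro mult_right_mono) (auto simp: mult.assoc)
  qed
  finally show "I A p z \<le> ennreal (K' * (K + 1) * (Q + 1) * real k)" .
 qed
 define R where "R y y' \<longleftrightarrow> (\<exists>K\<ge>0. trans_at K y y') \<and> (\<exists>K\<ge>0. trans_at K y' y)" for y y'
 have R: "R x y" if "x \<in> V" "y \<in> V" for x y
 proof (rule connected_equivalence_relation[OF V(2) that])
  show "R y x" if "R x y" for x y using that by (auto simp: R_def)
  show "R x z" if xyz: "R x y" "R y z" for x y z
  proof -
   obtain K1 K2 K3 K4 where K: "K1 \<ge> 0" "trans_at K1 x y" "K2 \<ge> 0" "trans_at K2 y x"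
    "K3 \<ge> 0" "trans_at K3 y z" "K4 \<ge> 0" "trans_at K4 z y" using xyz unfolding R_def by blast
   have "0 \<le> K3 * (K1 + 1)" "0 \<le> K2 * (K4 + 1)" using K by auto
   thus ?thesis unfolding R_def using comp[OF K(1,5,2,6)] comp[OF K(7,3,8,4)] by blast
  qed
  fix a assume a: "a \<in> V"
  show "\<exists>T. openin (top_of_set V) T \<and> a \<in> T \<and> (\<forall>x\<in>T. R a x)"
  proof (intro exI[of _ "V \<inter> ball a \<delta>"] conjI ballI)
   show "openin (top_of_set V) (V \<inter> ball a \<delta>)" by (rule openin_open_Int) simp
   show "a \<in> V \<inter> ball a \<delta>" using a \<delta> by simp
   fix x assume "x \<in> V \<inter> ball a \<delta>"
   thus "R a x" using near[of a x] near[of x a] a K0 unfolding R_def by (auto simp: dist_commute)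
  qed
 qed
 obtain F where F: "F \<subseteq> V" "finite F" "V \<subseteq> (\<Union>x\<in>F. ball x \<delta>)"
 proof -
  have "V \<subseteq> (\<Union>x\<in>V. ball x \<delta>)" using \<delta> by force
  thus ?thesis by (rule compactE_image[OF V(1), of V "\<lambda>x. ball x \<delta>", rotated]) (use that in auto)
 qed
 have cov: "V \<subseteq> (\<Union>x\<in>F. ball_in V x (1/E))"
 proof
  fix y assume y: "y \<in> V"
  then obtain x where "x \<in> F" "dist x y < \<delta>" using F(3) by auto
  thus "y \<in> (\<Union>x\<in>F. ball_in V x (1/E))" using y E by (auto simp: ball_in_def \<delta>_def field_simps intro!: bexI[of _ x])
 qed
 have [measurable]: "ball_in V z s \<in> sets borel" for z s by (rule ball_in_borel[OF cl])
 have Vb[measurable]: "V \<in> sets borel" using cl by simp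
 have fin: "emeasure ?H V < \<infinity>"
 proof -
  have "emeasure ?H V \<le> emeasure ?H (\<Union>x\<in>F. ball_in V x (1/E))" by (rule emeasure_mono[OF cov]) (use F(2) in auto)
  also have "\<dots> \<le> (\<Sum>x\<in>F. emeasure ?H (ball_in V x (1/E)))" by (rule emeasure_subadditive_finite) (use F(2) in auto)
  also have "\<dots> \<le> (\<Sum>x\<in>F. ennreal (E * (1/E)^d))"
   using loc F(1) E unfolding local_log_bound_def by (intro sum_mono) (meson order_refl subsetD zero_less_divide_1_iff)
  also have "\<dots> < \<infinity>" using E by (subst sum_ennreal) auto
  finally show ?thesis .
 qed
 have "\<forall>c. \<exists>K. K \<ge> 0 \<and> (fst c \<in> F \<longrightarrow> snd c \<in> F \<longrightarrow> trans_at K (fst c) (snd c))"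
  using R F(1) unfolding R_def by (metis order_refl subsetD)
 from choice[OF this] obtain K where K': "\<forall>c. K c \<ge> 0 \<and> (fst c \<in> F \<longrightarrow> snd c \<in> F \<longrightarrow> trans_at (K c) (fst c) (snd c))" ..
 have K: "K c \<ge> 0" "c1 \<in> F \<Longrightarrow> c2 \<in> F \<Longrightarrow> trans_at (K (c1, c2)) c1 c2" for c c1 c2
  using K'[THEN spec, of c] K'[THEN spec, of "(c1, c2)"] by (simp_all only: fst_conv snd_conv)
 define Km where "Km = (\<Sum>c\<in>F \<times> F. K c)"
 have Km: "K c \<le> Km" if "c \<in> F \<times> F" for c unfolding Km_def using that F(2) K(1) by (intro member_le_sum) auto
 have Km0: "Km \<ge> 0" unfolding Km_def by (intro sum_nonneg K(1))
 define Q0 where "Q0 = E * (1/E)^d"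
 have Q0: "Q0 \<ge> 0" using E by (simp add: Q0_def)
 define Q1 where "Q1 = K0 * (Q0 + 1)"
 have Q1: "Q1 \<ge> 0" using K0 Q0 by (simp add: Q1_def)
 define C where "C = real (card F) * (Km * (Q1 + 1))"
 have bound: "log_controlled d V (C * real k) p"
  if k: "k \<ge> 1" and p: "pfun UNIV k p" and nz: "\<exists>x\<in>V. p x \<noteq> 0" for k p
 proof -
  have [measurable]: "log_gap a p \<in> borel_measurable borel" for a by (rule log_gap_measurable[OF p])
  have "continuous_on V (\<lambda>x. \<bar>p x\<bar>)" by (intro continuous_intros pfun_continuous[OF p])
  then obtain ys where ys: "ys \<in> V" "\<And>y. y \<in> V \<Longrightarrow> \<bar>p y\<bar> \<le> \<bar>p ys\<bar>"
   using continuous_attains_sup[OF V(1)] nz by blast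
  have pys: "p ys \<noteq> 0" using nz ys(2) by fastforce
  define A where "A = ln \<bar>p ys\<bar>"
  have A: "ln \<bar>p y\<bar> \<le> A" if "y \<in> V" "p y \<noteq> 0" for y
   unfolding A_def using ys(2)[OF that(1)] that(2) pys by (subst ln_le_cancel_iff) auto
  have yB: "ys \<in> ball_in V ys (1/E)" using ys(1) E by (simp add: ball_in_def)
  then obtain a where a: "\<And>z. z \<in> ball_in V ys (1/E) \<Longrightarrow> p z \<noteq> 0 \<Longrightarrow> ln \<bar>p z\<bar> \<le> a"
   "(\<integral>\<^sup>+x. log_gap a p x * indicator (ball_in V ys (1/E)) x \<partial>?H) \<le> ennreal (E * real k * (1/E) ^ d)"
   using loc[OF ys(1)] E k p pys unfolding local_log_bound_def log_controlled_def by (meson order_refl zero_less_divide_1_iff)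
  \<comment> \<open>The maximum point lies in its own ball, so the local constant is at least
    \<open>A\<close>; lowering it to \<open>A\<close> reduces the integral.\<close>
  have "A \<le> a" using a(1)[OF yB pys] by (simp add: A_def)
  hence "I A p ys \<le> (\<integral>\<^sup>+x. log_gap a p x * indicator (ball_in V ys (1/E)) x \<partial>?H)"
   unfolding I_def by (intro nn_integral_mono mult_right_mono log_gap_mono) auto
  also note a(2)
  finally have "I A p ys \<le> ennreal (Q0 * real k)" by (simp add: Q0_def mult_ac)
  moreover obtain c where c: "c \<in> F" "dist c ys < \<delta>" using F(3) ys(1) by auto
  ultimately have Ic: "I A p c \<le> ennreal (Q1 * real k)"
   using near[of ys c] ys(1) F(1) k p Q0 unfolding trans_at_def Q1_def by (auto simp: dist_commute subset_iff)
  have Ic': "I A p c' \<le> ennreal (Km * (Q1 + 1) * real k)" if c': "c' \<in> F" for c'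
  proof -
   have "I A p c' \<le> ennreal (K (c, c') * (Q1 + 1) * real k)"
    using K(2)[OF c(1) c'] k p Q1 Ic unfolding trans_at_def by blast
   also have "\<dots> \<le> ennreal (Km * (Q1 + 1) * real k)"
    using Km[of "(c, c')"] c(1) c' Q1 by (intro ennreal_leI mult_right_mono) auto
   finally show ?thesis .
  qed
  have "(\<integral>\<^sup>+x. log_gap A p x * indicator V x \<partial>?H) \<le> (\<integral>\<^sup>+x. (\<Sum>c'\<in>F. log_gap A p x * indicator (ball_in V c' (1/E)) x) \<partial>?H)"
  proof (rule nn_integral_mono)
   fix x :: "real^'n"
   show "log_gap A p x * indicator V x \<le> (\<Sum>c'\<in>F. log_gap A p x * indicator (ball_in V c' (1/E)) x)"
   proof (cases "x \<in> V")
    case True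
    then obtain c' where c': "c' \<in> F" "x \<in> ball_in V c' (1/E)" using cov by blast
    hence "log_gap A p x * indicator V x = log_gap A p x * indicator (ball_in V c' (1/E)) x" using True by simp
    also have "\<dots> \<le> (\<Sum>c'\<in>F. log_gap A p x * indicator (ball_in V c' (1/E)) x)"
     using c'(1) F(2) by (intro member_le_sum) auto
    finally show ?thesis .
   qed simp
  qed
  also have "\<dots> = (\<Sum>c'\<in>F. I A p c')" unfolding I_def by (rule nn_integral_sum) measurable
  also have "\<dots> \<le> (\<Sum>c'\<in>F. ennreal (Km * (Q1 + 1) * real k))" by (intro sum_mono Ic')
  also have "\<dots> = ennreal (C * real k)"
   using Km0 Q1 by (simp add: C_def ennreal_of_nat_eq_real_of_nat ennreal_mult'[symmetric] mult_ac)
  finally show ?thesis unfolding log_controlled_def using A by blast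
 qed
 have "C \<ge> 0" using Km0 Q1 by (simp add: C_def)
 from that[OF this fin] bound show ?thesis by blast
qed

text \<open>With \<open>g = a - f \<ge> 0\<close> almost everywhere, the deviation of
  \<open>f\<close> from its mean is that of \<open>g\<close> from its mean, whose integral is at
  most twice that of \<open>g\<close>. \<open>G\<close> may be infinite where \<open>f\<close>
  carries a default value; finiteness of its integral makes such points a null set.\<close>

lemma mean_osc_le_of_one_sided:
 fixes f :: "'a \<Rightarrow> real" and G :: "'a \<Rightarrow> ennreal"
 assumes B[measurable]: "B \<in> sets M" and pos: "0 < emeasure M B" and fin: "emeasure M B < \<infinity>"
  and f[measurable]: "f \<in> borel_measurable M" and G[measurable]: "G \<in> borel_measurable M"
  and fG: "\<And>y. y \<in> B \<Longrightarrow> G y = \<infinity> \<or> (f y \<le> a \<and> G y = ennreal (a - f y))"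
  and Q: "Q \<ge> 0" "(\<integral>\<^sup>+y. G y * indicator B y \<partial>M) \<le> ennreal Q"
 shows "set_integrable M B f" "mean_osc M B f \<le> 2 * Q / measure M B"
proof -
 define g where "g y = (a - f y) * indicator B y" for y
 have g[measurable]: "g \<in> borel_measurable M" unfolding g_def[abs_def] by measurable
 have "(\<integral>\<^sup>+y. G y * indicator B y \<partial>M) \<noteq> \<infinity>" using Q(2) by (auto simp: top_unique)
 hence "AE y in M. G y * indicator B y \<noteq> \<infinity>" by (intro nn_integral_PInf_AE) auto
 hence ae: "AE y in M. (y \<in> B \<longrightarrow> f y \<le> a) \<and> ennreal (g y) = G y * indicator B y"
 proof eventually_elim
  case (elim y)
  thus ?case using fG[of y] by (cases "y \<in> B") (auto simp: g_def)
 qed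
 have g0: "AE y in M. 0 \<le> g y" using ae by eventually_elim (auto simp: g_def split: split_indicator)
 have ng: "(\<integral>\<^sup>+y. ennreal (g y) \<partial>M) \<le> ennreal Q"
  using Q(2) nn_integral_cong_AE[of "\<lambda>y. ennreal (g y)" "\<lambda>y. G y * indicator B y" M] ae by (auto simp: eventually_mono)
 have ig: "integrable M g" by (rule integrableI_nonneg[OF g g0]) (use ng in \<open>auto simp: le_less_trans\<close>)
 define g1 where "g1 = (LINT y|M. g y)"
 have g1: "0 \<le> g1" "g1 \<le> Q"
 proof -
  show "0 \<le> g1" unfolding g1_def by (rule integral_nonneg_AE[OF g0])
  show "g1 \<le> Q" using ng nn_integral_eq_integral[OF ig g0] Q(1) by (simp add: g1_def)
 qed
 define \<mu> where "\<mu> = measure M B"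
 have \<mu>: "\<mu> > 0" unfolding \<mu>_def using pos fin by (simp add: measure_def enn2real_positive_iff)
 have iB: "integrable M (indicator B :: 'a \<Rightarrow> real)" using fin by (intro integrable_real_indicator) auto
 have LB: "(LINT y|M. indicator B y :: real) = \<mu>" using fin by (simp add: \<mu>_def)
 have feq: "indicator B y *\<^sub>R f y = a * indicator B y - g y" for y by (simp add: g_def split: split_indicator)
 show si: "set_integrable M B f" unfolding set_integrable_def feq by (intro Bochner_Integration.integrable_diff integrable_mult_right iB ig)
 have mean: "mean_on M B f = a - g1 / \<mu>"
 proof -
  have "(LINT y:B|M. f y) = a * \<mu> - g1"
   unfolding set_lebesgue_integral_def feq g1_def LB[symmetric]
   by (subst Bochner_Integration.integral_diff) (auto intro: iB ig)
  thus ?thesis using \<mu> by (simp add: mean_on_def \<mu>_def[symmetric] diff_divide_distrib)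
 qed
 have aeq: "indicator B y *\<^sub>R \<bar>f y - (a - g1 / \<mu>)\<bar> = \<bar>(g1 / \<mu>) * indicator B y - g y\<bar>" for y
  by (cases "y \<in> B") (simp_all add: g_def algebra_simps)
 have "(LINT y:B|M. \<bar>f y - mean_on M B f\<bar>) \<le> (LINT y|M. g y + (g1 / \<mu>) * indicator B y)"
  unfolding set_lebesgue_integral_def mean aeq
 proof (rule integral_mono_AE)
  show "integrable M (\<lambda>y. \<bar>(g1 / \<mu>) * indicator B y - g y\<bar>)"
   by (intro integrable_abs Bochner_Integration.integrable_diff integrable_mult_right iB ig)
  show "integrable M (\<lambda>y. g y + (g1 / \<mu>) * indicator B y)"
   by (intro Bochner_Integration.integrable_add integrable_mult_right iB ig)
  show "AE y in M. \<bar>(g1 / \<mu>) * indicator B y - g y\<bar> \<le> g y + (g1 / \<mu>) * indicator B y"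
   using g0
  proof eventually_elim
   case (elim y)
   have "\<bar>u - v\<bar> \<le> v + u" if "u \<ge> 0" "v \<ge> 0" for u v :: real using that by linarith
   moreover have "(g1 / \<mu>) * indicator B y \<ge> 0" using g1(1) \<mu> by simp
   ultimately show ?case using elim by blast
  qed
 qed
 also have "\<dots> = g1 + (g1 / \<mu>) * (LINT y|M. indicator B y)"
  by (subst Bochner_Integration.integral_add[OF ig integrable_mult_right[OF iB]])
   (simp only: g1_def integral_mult_right_zero)
 also have "\<dots> = 2 * g1" unfolding LB using \<mu> by simp
 also have "\<dots> \<le> 2 * Q" using g1(2) by simp
 finally show "mean_osc M B f \<le> 2 * Q / measure M B"
  unfolding mean_osc_def using \<mu> by (simp add: \<mu>_def divide_right_mono)
qed

section \<open>Mean oscillation over balls of all radii\<close>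

lemma pfun_degree_0: "pfun I 0 p \<Longrightarrow> p x = p y"
 by (auto simp: pfun_def mons_def mon_def intro!: sum.cong prod.cong)

text \<open>Radii up to \<open>1 / E\<close> are covered by the local bounds. Larger balls have
  measure bounded below, so the integral bound on all of \<open>V\<close> is also one relative to
  their measure.\<close>

lemma log_bound_on_balls:
 fixes V :: "(real^'n) set"
 assumes V: "compact V" "connected V" "algebraic_submanifold d V"
 obtains C where "C \<ge> 0"
  "\<And>B. B \<in> balls_in V \<Longrightarrow> 0 < emeasure (hausdorff_measure d) B \<and> emeasure (hausdorff_measure d) B < \<infinity>"
  "\<forall>k p B. pfun UNIV k p \<longrightarrow> (\<exists>x\<in>V. p x \<noteq> 0) \<longrightarrow> B \<in> balls_in V \<longrightarrow>
    log_controlled d B (C * real k * measure (hausdorff_measure d) B) p"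
proof -
 let ?H = "hausdorff_measure d :: (real^'n) measure"
 have cl: "closed V" by (rule compact_imp_closed[OF V(1)])
 have bb[measurable]: "ball_in V z s \<in> sets borel" for z s by (rule ball_in_borel[OF cl])
 have Vb[measurable]: "V \<in> sets borel" using cl by simp
 obtain E where E: "E > 0" "\<And>y. y \<in> V \<Longrightarrow> local_log_bound d V E y" by (rule local_log_bound_uniform[OF V(1,3)]) blast
 obtain C where C: "C \<ge> 0" "emeasure ?H V < \<infinity>"
  "\<forall>k p. k \<ge> 1 \<longrightarrow> pfun UNIV k p \<longrightarrow> (\<exists>x\<in>V. p x \<noteq> 0) \<longrightarrow> log_controlled d V (C * real k) p"
  by (rule global_log_bound[OF V(1,2) E]) blast
 have low: "ennreal (min r (1/E) ^ d / E) \<le> emeasure ?H (ball_in V y r)" if "y \<in> V" "r > 0" for y r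
 proof -
  have "ennreal (min r (1/E) ^ d / E) \<le> emeasure ?H (ball_in V y (min r (1/E)))"
   using E(2)[OF that(1)] that(2) E(1) unfolding local_log_bound_def by simp
  also have "\<dots> \<le> emeasure ?H (ball_in V y r)"
   by (rule emeasure_mono) (auto simp: ball_in_def)
  finally show ?thesis .
 qed
 have fin: "emeasure ?H (ball_in V y r) < \<infinity>" for y r
  using emeasure_mono[of "ball_in V y r" V ?H] C(2) by (auto simp: ball_in_def intro: le_less_trans)
 have pos: "0 < emeasure ?H (ball_in V y r)" if "y \<in> V" "r > 0" for y r
 proof -
  have "0 < ennreal (min r (1/E) ^ d / E)" using that E(1) by simp
  thus ?thesis using low[OF that] by (rule less_le_trans)
 qed
 have mlow: "min r (1/E) ^ d / E \<le> measure ?H (ball_in V y r)" if "y \<in> V" "r > 0" for y r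
  using low[OF that] fin[of y r] that E(1) by (simp add: emeasure_eq_ennreal_measure less_top)
 \<comment> \<open>The first summand serves the small balls, the second the large ones.\<close>
 define CC where "CC = E^2 + C * E / (1/E)^d"
 show ?thesis
 proof (rule that[of CC])
  show "CC \<ge> 0" using C(1) E(1) by (simp add: CC_def)
  show "0 < emeasure ?H B \<and> emeasure ?H B < \<infinity>" if "B \<in> balls_in V" for B
   using that pos fin by (auto simp: balls_in_def)
  show "\<forall>k p B. pfun UNIV k p \<longrightarrow> (\<exists>x\<in>V. p x \<noteq> 0) \<longrightarrow> B \<in> balls_in V \<longrightarrow>
    log_controlled d B (CC * real k * measure ?H B) p"
  proof (intro allI impI)
  fix k p B assume p: "pfun UNIV k p" and nz: "\<exists>x\<in>V. p x \<noteq> 0" and "B \<in> balls_in V"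
  then obtain y r where y: "B = ball_in V y r" "y \<in> V" "r > 0" by (auto simp: balls_in_def)
  show "log_controlled d B (CC * real k * measure ?H B) p"
  proof (cases "k = 0")
   \<comment> \<open>The required bound is 0 here; a nonzero constant has no gap.\<close>
   case True
   obtain x0 where x0: "p x0 \<noteq> 0" using nz by blast
   have const: "p x = p x0" for x using pfun_degree_0[of UNIV p x x0] p True by simp
   have "log_gap (ln \<bar>p x0\<bar>) p x = 0" for x using const[of x] x0 by (simp add: log_gap_def)
   moreover have "ln \<bar>p x\<bar> \<le> ln \<bar>p x0\<bar>" for x using const[of x] by simp
   ultimately show ?thesis unfolding log_controlled_def by (intro exI[of _ "ln \<bar>p x0\<bar>"]) simp
  next
   case False
   hence k: "k \<ge> 1" by simp
   obtain A where A: "\<forall>y\<in>V. p y \<noteq> 0 \<longrightarrow> ln \<bar>p y\<bar> \<le> A" "(\<integral>\<^sup>+x. log_gap A p x * indicator V x \<partial>?H) \<le> ennreal (C * real k)"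
    using C(3) k p nz unfolding log_controlled_def by blast
   have AB: "(\<integral>\<^sup>+x. log_gap A p x * indicator B x \<partial>?H) \<le> ennreal (C * real k)"
    using A(2) by (rule order_trans[rotated]) (auto intro!: nn_integral_mono simp: y ball_in_def split: split_indicator)
   show ?thesis
   proof (cases "r \<le> 1 / E")
    case True
    \<comment> \<open>\<open>p\<close> is only known to be nonzero somewhere on \<open>V\<close>;
      the finite integral over \<open>V\<close> excludes that it vanishes on a whole ball.\<close>
    have "\<exists>x\<in>B. p x \<noteq> 0"
    proof (rule ccontr)
     assume "\<not> ?thesis"
     hence "(\<integral>\<^sup>+x. log_gap A p x * indicator B x \<partial>?H) = (\<integral>\<^sup>+x. \<infinity> * indicator B x \<partial>?H)"
      by (intro nn_integral_cong) (auto simp: log_gap_def split: split_indicator)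
     also have "\<dots> = \<infinity> * emeasure ?H B" unfolding y(1) by (rule nn_integral_cmult_indicator) simp
     also have "\<dots> = \<infinity>" using pos[OF y(2,3)] y(1) by (simp add: ennreal_top_mult)
     finally show False using AB by (simp add: top_unique)
    qed
    hence a: "log_controlled d B (E * real k * r ^ d) p"
     using E(2)[OF y(2)] True y k p unfolding local_log_bound_def by blast
    have "E * real k * r ^ d \<le> CC * real k * measure ?H B"
    proof -
     have "r ^ d / E \<le> measure ?H B" using mlow[OF y(2,3)] True y(1) by simp
     hence "E^2 * real k * (r ^ d / E) \<le> CC * real k * measure ?H B"
      using E(1) C(1) y(3) by (intro mult_mono) (auto simp: CC_def)
     thus ?thesis using E(1) by (simp add: power2_eq_square mult_ac)
    qed
    with a show ?thesis by (rule log_controlled_mono)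
   next
    case False
    have "C * real k \<le> CC * real k * measure ?H B"
    proof -
     have "(1/E) ^ d / E \<le> measure ?H B" using mlow[OF y(2,3)] False y(1) by simp
     hence "(C * E / (1/E)^d) * real k * ((1/E) ^ d / E) \<le> CC * real k * measure ?H B"
      using E(1) C(1) by (intro mult_mono) (auto simp: CC_def)
     moreover have "(C * E / (1/E)^d) * real k * ((1/E) ^ d / E) = C * real k" using E(1) by (simp add: field_simps)
     ultimately show ?thesis by simp
    qed
    moreover have "log_controlled d B (C * real k) p"
     unfolding log_controlled_def using A(1) AB y(1) by (auto simp: ball_in_def)
    ultimately show ?thesis by (rule log_controlled_mono[rotated])
   qed
  qed
  qed
 qed
qed

theorem theorem1p5:
 fixes V :: "(real^'n) set" and d :: nat
 assumes "compact V" and "connected V"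
  and "algebraic_submanifold d V"
 shows "\<exists>C::real. \<forall>(k::nat) (p :: real^'n \<Rightarrow> real).
      poly_fun k p \<and> (\<exists>x\<in>V. p x \<noteq> 0) \<longrightarrow>
       in_BMO (submanifold_measure d V) V (\<lambda>x. ln \<bar>p x\<bar>) \<and>
       bmo_norm (submanifold_measure d V) V (\<lambda>x. ln \<bar>p x\<bar>) \<le> C * real k"
proof -
 let ?H = "hausdorff_measure d :: (real^'n) measure"
 let ?M = "submanifold_measure d V"
 obtain C where C: "C \<ge> 0"
  "\<And>B. B \<in> balls_in V \<Longrightarrow> 0 < emeasure ?H B \<and> emeasure ?H B < \<infinity>"
  "\<forall>k p B. pfun UNIV k p \<longrightarrow> (\<exists>x\<in>V. p x \<noteq> 0) \<longrightarrow> B \<in> balls_in V \<longrightarrow>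
    log_controlled d B (C * real k * measure ?H B) p"
  by (rule log_bound_on_balls[OF assms]) blast
 have cl: "closed V" by (rule compact_imp_closed[OF assms(1)])
 have Vs: "V \<inter> space ?H \<in> sets ?H" using cl by simp
 have sM: "space ?M = V" by (simp add: submanifold_measure_def space_restrict_space)
 show ?thesis
 \<comment> \<open>The factor 2 comes from passing from the one-sided bound to the mean
   oscillation.\<close>
 proof (intro exI[of _ "2 * C"] allI impI)
  fix k and p :: "real^'n \<Rightarrow> real"
  assume "poly_fun k p \<and> (\<exists>x\<in>V. p x \<noteq> 0)"
  hence p: "pfun UNIV k p" and nz: "\<exists>x\<in>V. p x \<noteq> 0" by (auto simp: poly_fun_pfun)
  define f where "f x = ln \<bar>p x\<bar>" for x
  note [measurable] = pfun_borel[OF p]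
  have f[measurable]: "f \<in> borel_measurable ?M"
   unfolding f_def[abs_def] submanifold_measure_def by (intro measurable_restrict_space1) measurable
  have ball: "set_integrable ?M B f \<and> mean_osc ?M B f \<le> 2 * C * real k" if B: "B \<in> balls_in V" for B
  proof -
   obtain a where a: "\<forall>y\<in>B. p y \<noteq> 0 \<longrightarrow> ln \<bar>p y\<bar> \<le> a"
    "(\<integral>\<^sup>+x. log_gap a p x * indicator B x \<partial>?H) \<le> ennreal (C * real k * measure ?H B)"
    using C(3) p nz B unfolding log_controlled_def by blast
   have BV: "B \<subseteq> V" "B \<in> sets borel" using B ball_in_borel[OF cl] by (auto simp: balls_in_def ball_in_def)
   have Bs: "B \<in> sets ?M" using BV by (auto simp: submanifold_measure_def sets_restrict_space image_iff intro!: bexI[of _ B])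
   have eB: "emeasure ?M B = emeasure ?H B"
    unfolding submanifold_measure_def by (rule emeasure_restrict_space[OF Vs BV(1)])
   have mB: "measure ?M B = measure ?H B" using eB by (simp add: measure_def)
   have G: "log_gap a p \<in> borel_measurable ?M"
    unfolding submanifold_measure_def using log_gap_measurable[OF p] by (intro measurable_restrict_space1) simp
   have "(\<integral>\<^sup>+x. log_gap a p x * indicator B x \<partial>?M) = (\<integral>\<^sup>+x. log_gap a p x * indicator B x * indicator V x \<partial>?H)"
    unfolding submanifold_measure_def by (rule nn_integral_restrict_space[OF Vs])
   also have "\<dots> = (\<integral>\<^sup>+x. log_gap a p x * indicator B x \<partial>?H)"
    using BV(1) by (intro nn_integral_cong) (auto split: split_indicator)
   finally have I: "(\<integral>\<^sup>+x. log_gap a p x * indicator B x \<partial>?M) \<le> ennreal (C * real k * measure ?H B)" using a(2) by simp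
   have lg: "log_gap a p y = \<infinity> \<or> (f y \<le> a \<and> log_gap a p y = ennreal (a - f y))" if "y \<in> B" for y
    using a(1) that by (auto simp: log_gap_def f_def)
   have Q: "0 \<le> C * real k * measure ?H B" using C(1) by simp
   note * = mean_osc_le_of_one_sided[OF Bs _ _ f G lg Q I, unfolded eB, OF conjunct1[OF C(2)[OF B]] conjunct2[OF C(2)[OF B]]]
   have "measure ?H B > 0" using C(2)[OF B] by (simp add: measure_def enn2real_positive_iff)
   hence "2 * (C * real k * measure ?H B) / measure ?M B = 2 * C * real k" by (simp add: mB)
   with * show ?thesis by simp
  qed
  obtain y0 where y0: "y0 \<in> V" using nz by blast
  have "integrable ?M f"
  proof -
   obtain R where R: "\<And>x. x \<in> V \<Longrightarrow> dist y0 x \<le> R" using bounded_any_center[of V y0] compact_imp_bounded[OF assms(1)] by auto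
   have "R \<ge> 0" using R[OF y0] by simp
   \<comment> \<open>A large enough ball is \<open>V\<close> itself, so integrability on
     \<open>V\<close> is a case of integrability on balls.\<close>
   hence "ball_in V y0 (R + 1) \<in> balls_in V" using y0 by (auto simp: balls_in_def intro!: exI[of _ y0] exI[of _ "R + 1"])
   moreover have "ball_in V y0 (R + 1) = V" using R by (force simp: ball_in_def)
   ultimately have "set_integrable ?M V f" using ball by metis
   thus ?thesis unfolding set_integrable_def
    by (rule Bochner_Integration.integrable_cong[THEN iffD1, rotated -1]) (auto simp: sM)
  qed
  moreover have "bdd_above ((\<lambda>B. mean_osc ?M B f) ` balls_in V)"
   using ball by (intro bdd_aboveI[of _ "2 * C * real k"]) auto
  moreover have "bmo_norm ?M V f \<le> 2 * C * real k"
   unfolding bmo_norm_def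
  proof (rule cSUP_least)
   show "balls_in V \<noteq> {}" using y0 zero_less_one unfolding balls_in_def by blast
  qed (use ball in blast)
  ultimately show "in_BMO ?M V (\<lambda>x. ln \<bar>p x\<bar>) \<and> bmo_norm ?M V (\<lambda>x. ln \<bar>p x\<bar>) \<le> 2 * C * real k"
   unfolding in_BMO_def f_def[abs_def] by blast
 qed
qed

end
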